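(* Let $\Omega=\mathbb{R}^3\setminus\overline{\mathcal O}$ be the exterior of a uniformly convex bounded obstacle as described in the context. Let $0<\vartheta_0<\frac14$, and assume that $f_0$ satisfies the compatibility condition $f_0(x,v)=f_0(x,R_xv)$ for $x\in\partial\Omega$, that $\|w_0f_0\|_\infty:=\|e^{\vartheta_0|v|^2}f_0\|_\infty<\infty$, and that $$\mathbf{A}_{\frac12}(f_0):=\sup_{\substack{(x,\bar x,v)\in\overline\Omega\times\overline\Omega\times\mathbb{R}^3\\ |x-\bar x|\le 1}}\langle v\rangle\frac{|f_0(x,v)-f_0(\bar x,v)|}{|x-\bar x|}+\sup_{\substack{(x,v,\bar v)\in\overline\Omega\times\mathbb{R}^3\times\mathbb{R}^3\\ |v-\bar v|\le 1}}\langle v\rangle^2\frac{|f_0(x,v)-f_0(x,\bar v)|}{|v-\bar v|}<\infty .$$ Let $f$ be the local-in-time mild solution of the scaled Boltzmann equation with specular reflection boundary condition and initial datum $f_0$. For $0<\delta<1$ and $0<\epsilon<1$ define $$W((x,v),(\bar x,\bar v);\epsilon,\delta):=\frac{1}{|v|^{\delta}}\mathbf 1_{\{d(x,\partial\Omega)\le\epsilon\}}+\frac{1}{|\bar v|^{\delta}}\mathbf 1_{\{d(\bar x,\partial\Omega)\le\epsilon\}}+1 .$$ Then there exist $T>0$ and a constant $C>0$, depending on $\delta,\epsilon$ and $\vartheta_0$, such that $$\sup_{0\le t\le T}\ \sup_{\substack{(x,\bar x,v,\bar v)\in\overline\Omega\times\overline\Omega\times\mathbb{R}^3\times\mathbb{R}^3\\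 0<|(x,v)-(\bar x,\bar v)|\le1}}\left(W^{-1}\langle v\rangle^{-1}e^{-\varpi\langle v\rangle^2t}\,\frac{|f(t,x,v)-f(t,\bar x,\bar v)|}{|(x,v)-(\bar x,\bar v)|^{\frac12}}\right)\le C\,\mathcal P_3(\|w_0f_0\|_\infty)\left(\mathbf A_{\frac12}(f_0)+1\right),$$ where $W=W((x,v),(\bar x,\bar v);\epsilon,\delta)$ and $\varpi$ is a large constant depending on $\vartheta_0,f_0,\epsilon$.
   Context: Domain. $\mathcal O\subset\mathbb{R}^3$ is a bounded open set, $\mathcal O=\{x\in\mathbb{R}^3:\xi(x)>0\}$ for a sufficiently smooth function $\xi$, and there is $\theta_\Omega>0$ with $\sum_{i,j=1}^3(-\partial_{ij}\xi(x))\zeta_i\zeta_j\ge\theta_\Omega|\zeta|^2$ for all $\zeta\in\mathbb{R}^3$. Put $\Omega=\mathbb{R}^3\setminus\overline{\mathcal O}=\{\xi<0\}$, $\partial\Omega=\{\xi=0\}$, $\overline\Omega=\Omega\cup\partial\Omega$, $n(x)=\nabla\xi(x)/|\nabla\xi(x)|$ for $x\in\partial\Omega$, $R_xv=(I-2n(x)\otimes n(x))v$, and $d(x,\partial\Omega)=\min_{y\in\partial\Omega}|x-y|$. Characteristics. $t_{\mathbf b}(x,v)=\sup\{s\ge0: x-\tau v\in\Omega\text{ for all }\tau\in(0,s)\}$, with $t_{\mathbf b}=\infty$ if the backward trajectory never meets $\partial\Omega$; $x_{\mathbf b}(x,v)=x-t_{\mathbf b}(x,v)v$. If $t_{\mathbf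 b}(x,v)<\infty$: $(X,V)(s;t,x,v)=(x-(t-s)v,v)$ for $s\in(t-t_{\mathbf b}(x,v),t]$ and $(X,V)(s;t,x,v)=(x_{\mathbf b}-(t-t_{\mathbf b}-s)R_{x_{\mathbf b}}v,\ R_{x_{\mathbf b}}v)$ for $s\in[0,t-t_{\mathbf b}]$. If $t_{\mathbf b}(x,v)=\infty$: $(X,V)(s;t,x,v)=(x-(t-s)v,v)$ for all $s$. Equation. $\mu(v)=e^{-|v|^2/2}$. Hard-sphere kernel: with $u'=u+((v-u)\cdot\omega)\omega$, $v'=v-((v-u)\cdot\omega)\omega$ and $\mathbb S^2_+=\{\omega\in\mathbb S^2:(v-u)\cdot\omega\ge0\}$, $$\Gamma_{\rm gain}(f,f)(t,x,v)=\frac1{\sqrt{\mu(v)}}\int_{\mathbb{R}^3}\int_{\mathbb S^2_+}|(v-u)\cdot\omega|\sqrt{\mu(u')}f(t,x,u')\sqrt{\mu(v')}f(t,x,v')\,d\omega du,$$ $$\nu(f)(t,x,v)=\int_{\mathbb{R}^3}\int_{\mathbb S^2_+}|(v-u)\cdot\omega|\sqrt{\mu(u)}f(t,x,u)\,d\omega du.$$ The equation is $\partial_tf+v\cdot\nabla_xf=\Gamma_{\rm gain}(f,f)-\nu(f)f$, $f|_{t=0}=f_0$, with $f(t,x,v)=f(t,x,R_xv)$ for $x\in\partial\Omega$ (here $F=\sqrt\mu f\ge0$ solves the Boltzmann equation). A mild solution satisfies, with $X(s)=X(s;t,x,v)$, $V(s)=V(s;t,x,v)$, $$f(t,x,v)=e^{-\int_0^t\nu(f)(\tau,X(\tau),V(\tau))d\tau}f_0(X(0),V(0))+\int_0^te^{-\int_s^t\nu(f)(\tau,X(\tau),V(\tau))d\tau}\,\Gamma_{\rm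 gain}(f,f)(s,X(s),V(s))\,ds.$$ It is known that if $\|e^{\vartheta_0|v|^2}f_0\|_\infty<\infty$ with $0<\vartheta_0<\frac14$ and $f_0$ is compatible, there is a unique mild solution on some interval $[0,T^*]$, $T^*>0$, with $\sup_{0\le s\le T^*}\|e^{\vartheta|v|^2}f(s)\|_\infty\lesssim\|e^{\vartheta_0|v|^2}f_0\|_\infty$ for some $0<\vartheta<\vartheta_0$. The function $f$ in the claim is this solution. Notation. $\|f(t)\|_\infty$ is the essential supremum over $\overline\Omega\times\mathbb{R}^3$; $\langle v\rangle=\sqrt{1+|v|^2}$; $\mathcal P_n(x)=\sum_{i=0}^nx^i$. Constants may also depend on $\Omega$. When $W=+\infty$ (a zero velocity at a point within $\epsilon$ of $\partial\Omega$), $W^{-1}$ is read as $0$. *)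

theory Defs
  imports "HOL-Probability.Essential_Supremum"
begin

section \<open>The domain\<close>

definition partial :: "3 \<Rightarrow> (real^3 \<Rightarrow> real) \<Rightarrow> real^3 \<Rightarrow> real" where
  "partial i g x = frechet_derivative g (at x) (axis i 1)"

definition grad :: "(real^3 \<Rightarrow> real) \<Rightarrow> real^3 \<Rightarrow> real^3" where
  "grad g x = (\<chi> i. partial i g x)"

primrec Ck :: "nat \<Rightarrow> (real^3 \<Rightarrow> real) \<Rightarrow> bool" where
  "Ck 0 g \<longleftrightarrow> continuous_on UNIV g"
| "Ck (Suc k) g \<longleftrightarrow> g differentiable_on UNIV \<and> (\<forall>i. Ck k (partial i g))"

definition obstacle :: "(real^3 \<Rightarrow> real) \<Rightarrow> (real^3) set" where
  "obstacle \<xi> = {x. 0 < \<xi> x}"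

text \<open>
  The Hessian bound is required on all of \<open>\<real>\<^sup>3\<close>. Required only on the closure of \<open>{\<xi> > 0}\<close>, it
  would admit disconnected, hence non-convex, obstacles.
  Since \<open>\<xi>\<close> is then strictly concave and the obstacle is nonempty, \<open>Om \<xi> = {\<xi> < 0}\<close>,
  \<open>bd \<xi> = {\<xi> = 0}\<close> and \<open>grad \<xi> \<noteq> 0\<close> on \<open>bd \<xi>\<close>.
\<close>

definition uniformly_convex_obstacle :: "nat \<Rightarrow> (real^3 \<Rightarrow> real) \<Rightarrow> bool" where
  "uniformly_convex_obstacle m \<xi> \<longleftrightarrow>
     Ck m \<xi> \<and> obstacle \<xi> \<noteq> {} \<and> open (obstacle \<xi>) \<and> bounded (obstacle \<xi>) \<and>
     (\<exists>\<theta>>0. \<forall>x. \<forall>\<zeta>::real^3.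
        (\<Sum>i\<in>UNIV. \<Sum>j\<in>UNIV. - partial i (partial j \<xi>) x * \<zeta> $ i * \<zeta> $ j) \<ge> \<theta> * (norm \<zeta>)\<^sup>2)"

definition Om :: "(real^3 \<Rightarrow> real) \<Rightarrow> (real^3) set" where
  "Om \<xi> = - closure (obstacle \<xi>)"

definition bd :: "(real^3 \<Rightarrow> real) \<Rightarrow> (real^3) set" where
  "bd \<xi> = frontier (Om \<xi>)"

definition Om_bar :: "(real^3 \<Rightarrow> real) \<Rightarrow> (real^3) set" where
  "Om_bar \<xi> = Om \<xi> \<union> bd \<xi>"

definition normal_vec :: "(real^3 \<Rightarrow> real) \<Rightarrow> real^3 \<Rightarrow> real^3" where
  "normal_vec \<xi> x = grad \<xi> x /\<^sub>R norm (grad \<xi> x)"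

definition refl_vel :: "(real^3 \<Rightarrow> real) \<Rightarrow> real^3 \<Rightarrow> real^3 \<Rightarrow> real^3" where
  "refl_vel \<xi> x v = v - (2 * (normal_vec \<xi> x \<bullet> v)) *\<^sub>R normal_vec \<xi> x"


section \<open>Characteristics\<close>

definition t_b :: "(real^3 \<Rightarrow> real) \<Rightarrow> real^3 \<Rightarrow> real^3 \<Rightarrow> ereal" where
  "t_b \<xi> x v = (SUP s\<in>{s. 0 \<le> s \<and> (\<forall>\<tau>\<in>{0<..<s}. x - \<tau> *\<^sub>R v \<in> Om \<xi>)}. ereal s)"

text \<open>Meaningful only when \<open>t_b \<xi> x v < \<infinity>\<close>.\<close>

definition x_b :: "(real^3 \<Rightarrow> real) \<Rightarrow> real^3 \<Rightarrow> real^3 \<Rightarrow> real^3" where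
  "x_b \<xi> x v = x - real_of_ereal (t_b \<xi> x v) *\<^sub>R v"

definition Xc :: "(real^3 \<Rightarrow> real) \<Rightarrow> real \<Rightarrow> real \<Rightarrow> real^3 \<Rightarrow> real^3 \<Rightarrow> real^3" where
  "Xc \<xi> s t x v =
     (if ereal (t - s) < t_b \<xi> x v then x - (t - s) *\<^sub>R v
      else x_b \<xi> x v
        - (t - real_of_ereal (t_b \<xi> x v) - s) *\<^sub>R refl_vel \<xi> (x_b \<xi> x v) v)"

definition Vc :: "(real^3 \<Rightarrow> real) \<Rightarrow> real \<Rightarrow> real \<Rightarrow> real^3 \<Rightarrow> real^3 \<Rightarrow> real^3" where
  "Vc \<xi> s t x v =
     (if ereal (t - s) < t_b \<xi> x v then v else refl_vel \<xi> (x_b \<xi> x v) v)"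


section \<open>The collision operator\<close>

text \<open>
  Surface measure on the unit sphere, as a Borel measure on \<open>\<real>\<^sup>3\<close>: the measure of \<open>A\<close> is
  \<open>3\<close> times the volume of the cone \<open>{r \<omega> | 0 < r < 1, \<omega> \<in> A, |\<omega>| = 1}\<close>,
  because \<open>\<integral>\<^sub>0\<^sup>1 r\<^sup>2 dr = 1/3\<close>. On vectors, \<open>sgn x = x / |x|\<close>.
\<close>

definition sphere_measure :: "(real^3) measure" where
  "sphere_measure = scale_measure 3 (distr (restrict_space lborel (ball 0 1)) borel sgn)"

definition S_plus :: "real^3 \<Rightarrow> (real^3) set" where
  "S_plus w = {\<omega> \<in> sphere 0 1. 0 \<le> w \<bullet> \<omega>}"

definition \<mu> :: "real^3 \<Rightarrow> real" where
  "\<mu> v = exp (- (norm v)\<^sup>2 / 2)"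

definition post_u :: "real^3 \<Rightarrow> real^3 \<Rightarrow> real^3 \<Rightarrow> real^3" where
  "post_u v u \<omega> = u + ((v - u) \<bullet> \<omega>) *\<^sub>R \<omega>"

definition post_v :: "real^3 \<Rightarrow> real^3 \<Rightarrow> real^3 \<Rightarrow> real^3" where
  "post_v v u \<omega> = v - ((v - u) \<bullet> \<omega>) *\<^sub>R \<omega>"

definition Gamma_gain ::
  "(real \<Rightarrow> real^3 \<Rightarrow> real^3 \<Rightarrow> real) \<Rightarrow> (real \<Rightarrow> real^3 \<Rightarrow> real^3 \<Rightarrow> real) \<Rightarrow>
   real \<Rightarrow> real^3 \<Rightarrow> real^3 \<Rightarrow> real" where
  "Gamma_gain f g t x v = 1 / sqrt (\<mu> v) *
     (LINT u|lborel. (LINT \<omega>:S_plus (v - u)|sphere_measure.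
        \<bar>(v - u) \<bullet> \<omega>\<bar>
        * sqrt (\<mu> (post_u v u \<omega>)) * f t x (post_u v u \<omega>)
        * sqrt (\<mu> (post_v v u \<omega>)) * g t x (post_v v u \<omega>)))"

definition coll_freq ::
  "(real \<Rightarrow> real^3 \<Rightarrow> real^3 \<Rightarrow> real) \<Rightarrow> real \<Rightarrow> real^3 \<Rightarrow> real^3 \<Rightarrow> real" where
  "coll_freq f t x v =
     (LINT u|lborel. (LINT \<omega>:S_plus (v - u)|sphere_measure.
        \<bar>(v - u) \<bullet> \<omega>\<bar> * sqrt (\<mu> u) * f t x u))"


section \<open>Norms and mild solutions\<close>

definition norm_inf :: "(real^3 \<Rightarrow> real) \<Rightarrow> (real^3 \<Rightarrow> real^3 \<Rightarrow> real) \<Rightarrow> ereal" where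
  "norm_inf \<xi> g = esssup (lebesgue_on (Om_bar \<xi> \<times> UNIV)) (\<lambda>(x, v). ereal \<bar>g x v\<bar>)"

definition wnorm :: "(real^3 \<Rightarrow> real) \<Rightarrow> real \<Rightarrow> (real^3 \<Rightarrow> real^3 \<Rightarrow> real) \<Rightarrow> ereal" where
  "wnorm \<xi> \<theta> g = norm_inf \<xi> (\<lambda>x v. exp (\<theta> * (norm v)\<^sup>2) * g x v)"

definition specular :: "(real^3 \<Rightarrow> real) \<Rightarrow> (real^3 \<Rightarrow> real^3 \<Rightarrow> real) \<Rightarrow> bool" where
  "specular \<xi> g \<longleftrightarrow> (\<forall>x\<in>bd \<xi>. \<forall>v. g x v = g x (refl_vel \<xi> x v))"

definition mild_eq_at ::
  "(real^3 \<Rightarrow> real) \<Rightarrow> (real^3 \<Rightarrow> real^3 \<Rightarrow> real) \<Rightarrow>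
   (real \<Rightarrow> real^3 \<Rightarrow> real^3 \<Rightarrow> real) \<Rightarrow> real \<Rightarrow> real^3 \<Rightarrow> real^3 \<Rightarrow> bool" where
  "mild_eq_at \<xi> f\<^sub>0 f t x v \<longleftrightarrow>
     (let X = (\<lambda>s. Xc \<xi> s t x v); V = (\<lambda>s. Vc \<xi> s t x v) in
      f t x v =
        exp (- (LINT \<tau>:{0..t}|lborel. coll_freq f \<tau> (X \<tau>) (V \<tau>))) * f\<^sub>0 (X 0) (V 0)
        + (LINT s:{0..t}|lborel.
             exp (- (LINT \<tau>:{s..t}|lborel. coll_freq f \<tau> (X \<tau>) (V \<tau>)))
             * Gamma_gain f f s (X s) (V s)))"

text \<open>
  The mild equation involves values of \<open>f\<close> along individual trajectories, so a solution is an
  honest Borel function satisfying it at every point, not an almost-everywhere class. Only the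
  values of \<open>f\<close> on \<open>[0,T] \<times> Om_bar \<xi> \<times> \<real>\<^sup>3\<close> matter. Nonnegativity is that of the density
  \<open>F = sqrt \<mu> f\<close>.
\<close>

definition mild_solution ::
  "(real^3 \<Rightarrow> real) \<Rightarrow> real \<Rightarrow> (real^3 \<Rightarrow> real^3 \<Rightarrow> real) \<Rightarrow> real \<Rightarrow>
   (real \<Rightarrow> real^3 \<Rightarrow> real^3 \<Rightarrow> real) \<Rightarrow> bool" where
  "mild_solution \<xi> \<theta>\<^sub>0 f\<^sub>0 T f \<longleftrightarrow>
     0 < T \<and>
     (\<lambda>(t, x, v). f t x v) \<in> borel_measurable (restrict_space borel ({0..T} \<times> Om_bar \<xi> \<times> UNIV)) \<and>
     (\<forall>t\<in>{0..T}. \<forall>x\<in>Om_bar \<xi>. \<forall>v. 0 \<le> f t x v) \<and>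
     (\<forall>x\<in>Om_bar \<xi>. \<forall>v. f 0 x v = f\<^sub>0 x v) \<and>
     (\<forall>t\<in>{0..T}. specular \<xi> (f t)) \<and>
     (\<forall>t\<in>{0..T}. \<forall>x\<in>Om_bar \<xi>. \<forall>v. mild_eq_at \<xi> f\<^sub>0 f t x v) \<and>
     (\<exists>\<theta> K. 0 < \<theta> \<and> \<theta> < \<theta>\<^sub>0 \<and>
        (SUP s\<in>{0..T}. wnorm \<xi> \<theta> (f s)) \<le> ereal K * wnorm \<xi> \<theta>\<^sub>0 f\<^sub>0)"


section \<open>Hoelder quotients and weights\<close>

definition bracket :: "real^3 \<Rightarrow> real" where
  "bracket v = sqrt (1 + (norm v)\<^sup>2)"

definition poly_sum :: "nat \<Rightarrow> ereal \<Rightarrow> ereal" where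
  "poly_sum n y = (\<Sum>i=0..n. y ^ i)"

text \<open>The degenerate quotients \<open>0 / 0\<close> (equal points) are \<open>0\<close> and do not affect the suprema.\<close>

definition A_half :: "(real^3 \<Rightarrow> real) \<Rightarrow> (real^3 \<Rightarrow> real^3 \<Rightarrow> real) \<Rightarrow> ereal" where
  "A_half \<xi> f\<^sub>0 =
     (SUP (x, x', v)\<in>{(x, x', v). x \<in> Om_bar \<xi> \<and> x' \<in> Om_bar \<xi> \<and> norm (x - x') \<le> 1}.
        ereal (bracket v * (\<bar>f\<^sub>0 x v - f\<^sub>0 x' v\<bar> / norm (x - x'))))
     + (SUP (x, v, v')\<in>{(x, v, v'). x \<in> Om_bar \<xi> \<and> norm (v - v') \<le> 1}.
        ereal ((bracket v)\<^sup>2 * (\<bar>f\<^sub>0 x v - f\<^sub>0 x v'\<bar> / norm (v - v'))))"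

text \<open>In \<^typ>\<open>ereal\<close>, \<open>1 / 0 = \<infinity>\<close>, \<open>\<infinity> * 0 = 0\<close> and \<open>inverse \<infinity> = 0\<close>, and \<open>0 powr \<delta> = 0\<close>: so
  \<open>W = \<infinity>\<close>, with \<open>inverse W = 0\<close>, exactly for a zero velocity at a point within \<open>\<epsilon>\<close> of the boundary.\<close>

definition W :: "(real^3 \<Rightarrow> real) \<Rightarrow> (real^3) \<times> (real^3) \<Rightarrow> (real^3) \<times> (real^3) \<Rightarrow>
   real \<Rightarrow> real \<Rightarrow> ereal" where
  "W \<xi> = (\<lambda>(x, v) (x', v') \<epsilon> \<delta>.
     1 / ereal (norm v powr \<delta>) * indicator {y. infdist y (bd \<xi>) \<le> \<epsilon>} x
     + 1 / ereal (norm v' powr \<delta>) * indicator {y. infdist y (bd \<xi>) \<le> \<epsilon>} x'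
     + 1)"

definition Hoelder_sup :: "(real^3 \<Rightarrow> real) \<Rightarrow> real \<Rightarrow> real \<Rightarrow> real \<Rightarrow> real \<Rightarrow>
   (real \<Rightarrow> real^3 \<Rightarrow> real^3 \<Rightarrow> real) \<Rightarrow> ereal" where
  "Hoelder_sup \<xi> \<epsilon> \<delta> varpi T f =
     (SUP t\<in>{0..T}. SUP (x, x', v, v')\<in>{(x, x', v, v'). x \<in> Om_bar \<xi> \<and> x' \<in> Om_bar \<xi> \<and>
                        0 < norm ((x, v) - (x', v')) \<and> norm ((x, v) - (x', v')) \<le> 1}.
        inverse (W \<xi> (x, v) (x', v') \<epsilon> \<delta>) *
        ereal (inverse (bracket v) * exp (- varpi * (bracket v)\<^sup>2 * t) *
               (\<bar>f t x v - f t x' v'\<bar> / norm ((x, v) - (x', v')) powr (1 / 2))))"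

end

theory Submission
  imports Defs "HOL-Probability.Probability" "HOL-Real_Asymp.Real_Asymp"
begin

text \<open>
 Over a short time a trajectory is reflected at most once, at a speed of impact \<open>rate x v\<close>. Two
 trajectories with data at distance \<open>d\<close> deviate by \<open>O(sqrt d)\<close> always, and by \<open>O(d * norm v / rate x v)\<close>
 away from grazing, because the obstacle is uniformly convex. Inserted in the Duhamel formula, the
 first bound gives the exponent \<open>1/2\<close> once the differences of \<open>gain\<close> and \<open>freq\<close> are controlled.
 These are averages over velocities, hence better than \<open>f\<close>: the rays from \<open>x\<close> with velocities on a
 line through the obstacle direction graze at most once, and \<open>norm u / rate x u\<close> is dominated along
 that line by an integrable power of the distance to the grazing velocity, times a power \<open>zeta de x\<close>
 of the distance of \<open>x\<close> to the boundary. So \<open>gain\<close> and \<open>freq\<close> have a singular Lipschitz modulus,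
 obtained by halving the error term of an approximate modulus repeatedly, and \<open>zeta\<close> is integrable
 along trajectories, which costs the factor \<open>W\<close> for slow velocities near the boundary.

 Greek letters are transliterated by their first two letters.
\<close>

text \<open>Four obstacles shape the proof. No Lipschitz modulus of \<open>gain\<close> and
  \<open>freq\<close> is known to be finite beforehand, so a self-improving inequality cannot simply
  be absorbed; the iteration starts from mere boundedness, carried along as an error. In that
  inequality the velocity part of the modulus feeds the position part with a coefficient that does
  not shrink with time, because the velocities jump at impact and a position difference shifts the
  moment of the jump. Velocity differences therefore enter with a small weight \<open>et\<close>,
  chosen before \<open>L\<close>, and \<open>L\<close> before the time \<open>t0\<close>. At time
  zero the same jump is bridged by the compatibility condition. Finally, the hypothesis bounds
  \<open>f\<close> only almost everywhere, while the Duhamel formula uses it on single curves: for a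
  fixed starting point the flow expands velocities, by convexity, so that null sets pull back to
  null sets. The constant of the theorem must not contain \<open>L\<close>, which depends on the
  solution; the last time interval is shortened until the terms with \<open>L\<close> are
  absolute.\<close>

notation scaleR (infixr "*R" 75) and inner (infix "*." 70)

lemmas mono_l = mult_left_mono and mono_r = mult_right_mono and sq_eq = power2_eq_square

abbreviation nn_lborel (binder "NN " 10) where "nn_lborel f == nn_integral lborel f"
abbreviation nn_sphere (binder "NS " 10) where "nn_sphere f == nn_integral sphere_measure f"
abbreviation bm :: "('a::topological_space => 'b::topological_space) set" where "bm == borel_measurable borel"
abbreviation N2 :: "'a::real_normed_vector => real" where "N2 x == (norm x)^2"
abbreviation gs :: "real => 'a::real_normed_vector => real" where "gs a x == exp (- a * N2 x)"

section \<open>Geometry of the obstacle\<close>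

lemma has_derivative_grad:
 assumes "f differentiable (at x)"
 shows "(f has_derivative (%h. grad f x *. h)) (at x)"
proof -
 let ?D = "frechet_derivative f (at x)"
 have D: "(f has_derivative ?D) (at x)"
  using assms frechet_derivative_works by blast
 then have lin: "linear ?D"
  by (rule has_derivative_linear)
 have "?D h = grad f x *. h" for h
 proof -
  have "h = (\<Sum>i\<in>UNIV. h $ i *R axis i 1)"
   by (simp add: basis_expansion flip: scalar_mult_eq_scaleR)
  then have "?D h = ?D (\<Sum>i\<in>UNIV. h $ i *R axis i 1)"
   by simp
  also have "... = (\<Sum>i\<in>UNIV. h $ i * ?D (axis i 1))"
   by (simp only: linear_sum[OF lin] linear_cmul[OF lin] real_scaleR_def)
  also have "... = grad f x *. h"
   by (simp add: grad_def partial_def inner_vec_def mult.commute)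
  finally show ?thesis .
 qed
 then have "?D = (%h. grad f x *. h)" by auto
 with D show ?thesis by simp
qed

lemma has_real_derivative_line:
 assumes "f differentiable_on UNIV"
 shows "((%t. f (x + t *R e)) has_real_derivative (grad f (x + t *R e) *. e)) (at t)"
proof -
 have f: "(f has_derivative (%h. grad f (x + t *R e) *. h)) (at (x + t *R e))"
  using assms by (intro has_derivative_grad) (simp add: differentiable_on_def)
 have l: "((%t. x + t *R e) has_derivative (%h. h *R e)) (at t)"
  by (auto intro!: derivative_eq_intros)
 show ?thesis
  using has_derivative_compose[OF l f] by (simp add: has_field_derivative_def mult_commute_abs)
qed

definition hess_form :: "(real^3 => real) => real^3 => real^3 => real" where
 "hess_form f x e = (\<Sum>i\<in>UNIV. \<Sum>j\<in>UNIV. partial i (partial j f) x * e $ i * e $ j)"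

lemma taylor_line:
 assumes "Ck 2 f"
 obtains t where "0 < t" "t < 1"
  "f y = f x + grad f x *. (y - x) + hess_form f (x + t *R (y - x)) (y - x) / 2"
proof -
 let ?e = "y - x"
 have f: "f differentiable_on UNIV" and pf: "!!j. partial j f differentiable_on UNIV"
  using assms by (auto simp: numeral_2_eq_2)
 \<comment> \<open>The function along the segment together with its first two derivatives, indexed
   as \<open>Maclaurin\<close> expects them; only the indices 0, 1 and 2 occur.\<close>
 define dd where "dd = (%(m::nat) t. if m = 0 then f (x + t *R ?e) else if m = 1 then grad f (x + t *R ?e) *. ?e
  else hess_form f (x + t *R ?e) ?e :: real)"
 have d1: "((%t. grad f (x + t *R ?e) *. ?e) has_real_derivative hess_form f (x + t *R ?e) ?e) (at t)" for t
 proof -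
  have "((%t. \<Sum>j\<in>UNIV. partial j f (x + t *R ?e) * ?e $ j) has_real_derivative
    (\<Sum>j\<in>UNIV. (grad (partial j f) (x + t *R ?e) *. ?e) * ?e $ j)) (at t)"
   by (intro DERIV_sum DERIV_cmult_right has_real_derivative_line pf)
  moreover have "(\<Sum>j\<in>UNIV. (grad (partial j f) z *. ?e) * ?e $ j) = hess_form f z ?e" for z
   unfolding hess_form_def
   by (subst sum.swap) (simp add: grad_def inner_vec_def sum_distrib_right)
  moreover have "(\<Sum>j\<in>UNIV. partial j f z * ?e $ j) = grad f z *. ?e" for z
   by (simp add: grad_def inner_vec_def)
  ultimately show ?thesis by simp
 qed
 have "EX t. 0 < t & t < (1::real) \<and>
  dd 0 1 = (\<Sum>m<2. dd m 0 / fact m * 1 ^ m) + dd 2 t / fact 2 * 1 ^ 2"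
 proof (rule Maclaurin[where n = 2])
  have "DERIV (dd m) t :> dd (Suc m) t" if "m < 2" for m t
  proof -
   from that consider "m = 0" | "m = 1" by linarith
   then show ?thesis
    by cases (use d1 has_real_derivative_line[OF f] in \<open>simp_all add: dd_def\<close>)
  qed
  then show "ALL m t. m < 2 & 0 <= t & t <= 1 --> DERIV (dd m) t :> dd (Suc m) t"
   by blast
 qed auto
 then obtain t where "0 < t" "t < 1" "dd 0 1 = dd 0 0 + dd 1 0 + dd 2 t / 2"
  by (auto simp: numeral_2_eq_2)
 then show ?thesis
  by (intro that[of t]) (auto simp: dd_def)
qed

text \<open>All that is kept of \<open>xi\<close>: global strong concavity, and Taylor and gradient
  bounds on a ball, since second derivatives are bounded only on compact sets. The margin 4 leaves
  room for comparing points near the obstacle with points at distance 2 or 3 from them. The radius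
  \<open>2 * r0\<close> in \<open>center\<close> allows \<open>c0\<close> to be displaced by
  \<open>r0\<close>, so that one direction serves two positions at distance \<open>r0\<close>.
  Differentiability itself is not recorded: \<open>grad xi\<close> is known only through these
  inequalities.\<close>

locale convex_obstacle =
 fixes xi :: "real^3 => real" and th xi0 r0 R La :: real and c0 :: "real^3"
 assumes th_pos: "0 < th" and xi0_pos: "0 < xi0" and r0_pos: "0 < r0" and r0_le_1: "r0 <= 1"
  and R_ge_1: "1 <= R" and La_ge_1: "1 <= La"
  and cont: "continuous_on UNIV xi"
  and concave: "xi y <= xi x + grad xi x *. (y - x) - th / 2 * N2 (y - x)"
  and center: "norm (c - c0) <= 2 * r0 ==> xi0 <= xi c"
  and bounded: "0 <= xi x ==> norm x <= R"
  and quad_lower: "norm x <= R + 4 ==> norm y <= R + 4 ==>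
   xi x + grad xi x *. (y - x) - La / 2 * N2 (y - x) <= xi y"
  and grad_lip: "norm x <= R + 4 ==> norm y <= R + 4 ==> norm (grad xi x - grad xi y) <= La * norm (x - y)"
  and grad_bound: "norm x <= R + 4 ==> norm (grad xi x) <= La"

lemma convex_obstacleI:
 assumes "uniformly_convex_obstacle 2 xi"
 obtains th xi0 r0 R La c0 where "convex_obstacle xi th xi0 r0 R La c0"
proof -
 from assms obtain th where C2: "Ck 2 xi" and ne: "obstacle xi ~= {}" and op: "open (obstacle xi)"
  and bdd: "bounded (obstacle xi)" and th: "0 < th"
  and H: "!!x \<zeta>. (\<Sum>i\<in>UNIV. \<Sum>j\<in>UNIV. - partial i (partial j xi) x * \<zeta> $ i * \<zeta> $ j) >= th * N2 \<zeta>"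
  unfolding uniformly_convex_obstacle_def by blast
 have diff: "xi differentiable_on UNIV" and pdiff: "!!j. partial j xi differentiable_on UNIV"
  and ppcont: "!!i j. continuous_on UNIV (partial i (partial j xi))"
  using C2 by (auto simp: numeral_2_eq_2)
 have cont: "continuous_on UNIV xi"
  using diff by (rule differentiable_imp_continuous_on)
 have Hneg: "hess_form xi x e <= - th * N2 e" for x e
  using H[where x = x and \<zeta> = e] by (simp add: hess_form_def sum_negf)
 have concave: "xi y <= xi x + grad xi x *. (y - x) - th / 2 * N2 (y - x)" for x y
 proof -
  obtain t where "xi y = xi x + grad xi x *. (y - x) + hess_form xi (x + t *R (y - x)) (y - x) / 2"
   using taylor_line[OF C2] by metis
  then show ?thesis
   using Hneg[of "x + t *R (y - x)" "y - x"] by linarith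
 qed
 obtain c0 where c0: "xi c0 > 0"
  using ne by (auto simp: obstacle_def)
 have "isCont xi c0"
  using cont by (simp add: continuous_on_eq_continuous_at)
 then have "EX r>0. ALL x. dist x c0 < r --> dist (xi x) (xi c0) < xi c0 / 2"
  using c0 unfolding continuous_at_eps_delta by (metis half_gt_zero)
 then obtain r where r: "r > 0" "!!x. dist x c0 < r ==> abs (xi x - xi c0) < xi c0 / 2"
  by (auto simp: dist_real_def)
 define r0 where "r0 = min 1 (r / 3)"
 have r0: "0 < r0" "r0 <= 1" "2 * r0 < r"
  using r by (auto simp: r0_def min_def)
 have center: "xi c0 / 2 <= xi c" if "norm (c - c0) <= 2 * r0" for c
 proof -
  have "abs (xi c - xi c0) < xi c0 / 2"
   using r(2)[of c] that r0 by (simp add: dist_norm)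
  then show ?thesis by linarith
 qed
 obtain R1 where R1: "!!x. xi x > 0 ==> norm x <= R1"
  using bdd by (auto simp: bounded_iff obstacle_def)
 define R where "R = max 1 (R1 + 1)"
 \<comment> \<open>The hypothesis bounds only the set where \<open>xi\<close> is positive. A point
   with \<open>0 <= xi x\<close> is moved towards \<open>c0\<close> by at most 1, and concavity
   makes \<open>xi\<close> positive there; hence the \<open>+ 1\<close> in \<open>R\<close>.\<close>
 have bounded: "norm x <= R" if "0 <= xi x" for x
 proof (cases "x = c0")
  case True
  then show ?thesis using R1[of c0] c0 by (auto simp: R_def)
 next
  case False
  define l where "l = min 1 (1 / norm (c0 - x))"
  have l: "0 < l" "l <= 1" "l * norm (c0 - x) <= 1"
   using False by (auto simp: l_def min_def field_simps)
  define y where "y = x + l *R (c0 - x)"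
  have 1: "xi c0 <= xi y + grad xi y *. (c0 - y)" and 2: "xi x <= xi y + grad xi y *. (x - y)"
   using concave[of c0 y] concave[of x y] th by (smt (verit) zero_le_power2 mult_nonneg_nonneg divide_nonneg_nonneg)+
  have "l *R (c0 - y) + (1 - l) *R (x - y) = 0"
   by (simp add: y_def algebra_simps)
  then have "l * (grad xi y *. (c0 - y)) + (1 - l) * (grad xi y *. (x - y)) = 0"
   by (metis inner_add_right inner_scaleR_right inner_zero_right)
  moreover have "l * xi c0 <= l * (xi y + grad xi y *. (c0 - y))"
   using 1 l by simp
  moreover have "(1 - l) * xi x <= (1 - l) * (xi y + grad xi y *. (x - y))"
   using 2 l by (intro mono_l) auto
  ultimately have "l * xi c0 + (1 - l) * xi x <= xi y"
   by (simp add: algebra_simps)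
  moreover have "0 < l * xi c0" "0 <= (1 - l) * xi x"
   using l c0 that by auto
  ultimately have "xi y > 0" by linarith
  then have "norm y <= R1" by (rule R1)
  moreover have "norm (x - y) <= 1"
   using l by (simp add: y_def)
  ultimately show ?thesis
   using norm_triangle_sub[of x y] by (simp add: R_def)
 qed
 have R: "1 <= R" by (simp add: R_def)
 let ?K = "cball (0::real^3) (R + 4)"
 have "EX B. ALL x:?K. abs (partial i (partial j xi) x) <= B" for i j
 proof -
  have "compact (partial i (partial j xi) ` ?K)"
   by (intro compact_continuous_image continuous_on_subset[OF ppcont]) auto
  then have "bounded (partial i (partial j xi) ` ?K)" by (rule compact_imp_bounded)
  then show ?thesis by (auto simp: bounded_iff)
 qed
 then obtain B where B: "!!i j x. x \<in> ?K ==> abs (partial i (partial j xi) x) <= B i j"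
  by metis
 define B1 where "B1 = (\<Sum>i\<in>UNIV. \<Sum>j\<in>UNIV. abs (B i j))"
 have B1: "abs (partial i (partial j xi) x) <= B1" if "x \<in> ?K" for i j x
 proof -
  have "abs (partial i (partial j xi) x) <= abs (B i j)" using B[OF that, of i j] by linarith
  also have "... <= (\<Sum>j\<in>UNIV. abs (B i j))" by (intro member_le_sum) auto
  also have "... <= B1" unfolding B1_def by (rule member_le_sum[of i UNIV "%i. \<Sum>j\<in>UNIV. abs (B i j)"]) (auto intro: sum_nonneg)
  finally show ?thesis .
 qed
 have B1nn: "B1 >= 0" unfolding B1_def by (intro sum_nonneg) auto
 have gradcont: "continuous_on UNIV (grad xi)"
  unfolding grad_def using pdiff by (intro continuous_on_vec_lambda differentiable_imp_continuous_on)
 then have "bounded (grad xi ` ?K)"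
  by (intro compact_imp_bounded compact_continuous_image continuous_on_subset[OF gradcont]) auto
 then obtain G where G: "!!x. x \<in> ?K ==> norm (grad xi x) <= G"
  unfolding bounded_iff by blast
 define La where "La = max (max 1 G) (9 * B1)"
 have seg: "x + t *R (y - x) \<in> ?K" if "x \<in> ?K" "y \<in> ?K" "0 <= t" "t <= 1" for x y :: "real^3" and t
 proof -
  have "(1 - t) *R x + t *R y \<in> ?K"
   using convexD_alt[OF convex_cball that(1,2)] that by (auto simp: algebra_simps)
  then show ?thesis by (simp add: algebra_simps)
 qed
 have comp: "abs (e $ i) <= norm e" for e :: "real^3" and i
  by (rule component_le_norm_cart)
 have quad: "xi x + grad xi x *. (y - x) - La / 2 * N2 (y - x) <= xi y"
  if "norm x <= R + 4" "norm y <= R + 4" for x y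
 proof -
  obtain t where t: "0 < t" "t < 1"
   "xi y = xi x + grad xi x *. (y - x) + hess_form xi (x + t *R (y - x)) (y - x) / 2"
   using taylor_line[OF C2] by metis
  let ?z = "x + t *R (y - x)" and ?e = "y - x"
  have z: "?z \<in> ?K" using that t by (intro seg) auto
  have "- hess_form xi ?z ?e <= abs (hess_form xi ?z ?e)" by simp
  also have "... <= (\<Sum>i\<in>UNIV. \<Sum>j\<in>UNIV. abs (partial i (partial j xi) ?z * ?e $ i * ?e $ j))"
   unfolding hess_form_def by (rule order_trans[OF sum_abs]) (intro sum_mono sum_abs)
  also have "... <= (\<Sum>i\<in>(UNIV::3 set). \<Sum>j\<in>(UNIV::3 set). B1 * norm ?e * norm ?e)"
   unfolding abs_mult by (intro sum_mono mult_mono B1 z comp mult_nonneg_nonneg B1nn) auto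
  also have "... = 9 * B1 * N2 ?e" by (simp add: sq_eq)
  also have "... <= La * N2 ?e" by (intro mono_r) (auto simp: La_def)
  finally show ?thesis using t(3) by simp
 qed
 have glip: "norm (grad xi x - grad xi y) <= La * norm (x - y)"
  if xy: "norm x <= R + 4" "norm y <= R + 4" for x y
 proof -
  have c: "abs (partial j xi x - partial j xi y) <= 3 * B1 * norm (x - y)" for j
  proof -
   have "EX t. 0 < t & t < 1 & partial j xi (x + 1 *R (y - x)) - partial j xi (x + 0 *R (y - x))
     = (1 - 0) * (grad (partial j xi) (x + t *R (y - x)) *. (y - x))"
    by (rule MVT2[where f = "%t. partial j xi (x + t *R (y - x))"]) (auto intro: has_real_derivative_line pdiff)
   then obtain t where t: "0 < t" "t < 1"
    "partial j xi y - partial j xi x = grad (partial j xi) (x + t *R (y - x)) *. (y - x)" by auto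
   let ?z = "x + t *R (y - x)"
   have z: "?z \<in> ?K" using xy t by (intro seg) auto
   have "abs (grad (partial j xi) ?z *. (y - x)) <= (\<Sum>i\<in>UNIV. abs (partial i (partial j xi) ?z * (y - x) $ i))"
    by (simp add: inner_vec_def grad_def)
   also have "... <= (\<Sum>i\<in>(UNIV::3 set). B1 * norm (y - x))"
    unfolding abs_mult by (intro sum_mono mult_mono B1 z comp B1nn) auto
   finally show ?thesis using t(3) by (simp add: norm_minus_commute abs_minus_commute)
  qed
  have "norm (grad xi x - grad xi y) <= (\<Sum>j\<in>UNIV. abs ((grad xi x - grad xi y) $ j))"
   by (rule norm_le_l1_cart)
  also have "... <= (\<Sum>j\<in>(UNIV::3 set). 3 * B1 * norm (x - y))"
   using c by (intro sum_mono) (simp add: grad_def)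
  also have "... = 9 * B1 * norm (x - y)" by simp
  also have "... <= La * norm (x - y)" by (intro mono_r) (auto simp: La_def)
  finally show ?thesis .
 qed
 have gb: "norm (grad xi x) <= La" if "norm x <= R + 4" for x
  using G[of x] that by (simp add: La_def)
 have "convex_obstacle xi th (xi c0 / 2) r0 R La c0"
  using th c0 r0 R cont concave center bounded quad glip gb unfolding convex_obstacle_def by (simp add: La_def)
 then show ?thesis by (rule that)
qed

section \<open>Integrals in space and on the sphere\<close>

lemma nn_integral_lborel_pair:
 fixes g :: "'a::euclidean_space \<times> 'b::euclidean_space => ennreal"
 assumes "g \<in> bm"
 shows "(NN p. g p) = (NN a. NN b. g (a, b))"
proof -
 have "g \<in> borel_measurable (lborel \<Otimes>\<^sub>M lborel)"
  using assms by (simp add: lborel_prod)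
 from lborel.nn_integral_fst[OF this] show ?thesis
  by (simp add: lborel_prod)
qed

text \<open>Comparing boxes suffices; the preimage of a box is its image under the inverse rotation,
  which preserves Lebesgue measure.\<close>

lemma lborel_orthogonal:
 fixes Q :: "real^3 => real^3"
 assumes "orthogonal_transformation Q"
 shows "distr lborel borel Q = lborel"
proof (rule lborel_eqI[symmetric])
 have Q: "Q \<in> bm"
  using assms by (intro borel_measurable_continuous_onI linear_continuous_on)
   (simp add: orthogonal_transformation_def linear_conv_bounded_linear)
 have bij: "bij Q" and inv: "orthogonal_transformation (inv Q)"
  using assms by (simp_all add: orthogonal_transformation_bij orthogonal_transformation_inv)
 fix l u :: "real^3" assume lu: "!!b. b \<in> Basis ==> l *. b <= u *. b"
 let ?b = "Q -` box l u"
 let ?a = "emeasure (distr lborel borel Q) (box l u)"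
 have vim: "Q -` box l u = inv Q ` box l u"
  using bij by (simp add: bij_vimage_eq_inv_image)
 have fin: "Q -` box l u \<in> lmeasurable" and m: "measure lebesgue ?b = measure lebesgue (box l u)"
  unfolding vim using measurable_orthogonal_image[OF inv] measure_orthogonal_image[OF inv] by auto
 have b: "Q -` box l u \<in> sets borel"
  using measurable_sets[OF Q, of "box l u"] by simp
 have "?a = emeasure lborel ?b"
  using Q by (simp add: emeasure_distr)
 also have "... = emeasure lebesgue ?b"
  using b by simp
 also have "... = ennreal (measure lebesgue ?b)"
  by (rule emeasure_eq_measure2[OF fin])
 also have "... = emeasure lebesgue (box l u)"
  unfolding m by (rule emeasure_eq_measure2[symmetric]) simp
 also have "... = (\<Prod>b\<in>Basis. (u - l) *. b)"
  using lu by simp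
 finally show "?a = (\<Prod>b\<in>Basis. (u - l) *. b)" .
qed simp

lemma Basis_real3: "(Basis :: (real^3) set) = {axis 1 1, axis 2 1, axis 3 1}"
 by (auto simp: Basis_vec_def) (metis UNIV_3 UNIV_I insertE singletonD)

text \<open>The first coordinate is innermost. Rotated to a given direction in
  \<open>nn_integral_frame\<close> it becomes the variable along a line, and the estimates along
  lines come before the integration over the transversal plane.\<close>

lemma nn_integral_lborel_coords:
 fixes h :: "real^3 => ennreal"
 assumes [measurable]: "h \<in> bm"
 shows "(NN x. h x) = (NN a. NN b. NN s. h (s *R axis 1 1 + a *R axis 2 1 + b *R axis 3 1))"
proof -
 define F :: "real \<times> real \<times> real => real^3"
  where "F = (%(a, b, s). s *R axis 1 1 + a *R axis 2 1 + b *R axis 3 1)"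
 let ?a = "distr lborel borel F"
 have [measurable]: "F \<in> bm"
  unfolding F_def split_beta by (intro borel_measurable_continuous_onI continuous_intros)
 have d: "(axis 1 1 :: real^3) ~= axis 2 1" "(axis 1 1 :: real^3) ~= axis 3 1" "(axis 2 1 :: real^3) ~= axis 3 1"
  by (simp_all add: axis_eq_axis)
 have "lborel = ?a"
 proof (rule lborel_eqI)
  fix l u :: "real^3" assume lu: "!!b. b \<in> Basis ==> l *. b <= u *. b"
  have lu': "l $ i <= u $ i" for i
   using lu[of "axis i 1"] by (simp add: inner_axis axis_in_Basis_iff)
  have vim: "F -` box l u = {l $ 2 <..< u $ 2} \<times> {l $ 3 <..< u $ 3} \<times> {l $ 1 <..< u $ 1}"
   by (auto simp: F_def mem_box_cart forall_3 axis_def)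
  have "emeasure (?a) (box l u) = emeasure (lborel \<Otimes>\<^sub>M (lborel \<Otimes>\<^sub>M lborel)) (F -` box l u)"
   by (simp add: emeasure_distr lborel_prod)
  also have "... = (u $ 2 - l $ 2) * ((u $ 3 - l $ 3) * (u $ 1 - l $ 1))"
   unfolding vim using lu'
   by (subst lborel_pair.emeasure_pair_measure_Times sigma_finite_measure.emeasure_pair_measure_Times[OF sigma_finite_lborel]
     sigma_finite_measure.emeasure_pair_measure_Times[OF sigma_finite_lborel[where 'a = "real \<times> real", folded lborel_prod]]; simp add: ennreal_mult'')+
  also have "... = (\<Prod>b\<in>Basis. (u - l) *. b)"
   using d by (simp add: Basis_real3 inner_axis mult.assoc mult.commute mult.left_commute)
  finally show "emeasure (?a) (box l u) = (\<Prod>b\<in>Basis. (u - l) *. b)" .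
 qed simp
 then have "(NN x. h x) = (\<integral>\<^sup>+x. h x \<partial>?a)"
  by simp
 also have "... = (NN x. h (F x))"
  by (simp add: nn_integral_distr)
 also have "... = (NN a. NN y. h (F (a, y)))"
  by (intro nn_integral_lborel_pair) simp
 also have "... = (NN a. NN b. NN s. h (F (a, b, s)))"
  by (intro nn_integral_cong nn_integral_lborel_pair measurable_compose[OF _ assms]) simp
 finally show ?thesis by (simp add: F_def)
qed

lemma orthonormal_frame:
 fixes m :: "real^3"
 assumes "norm m = 1"
 obtains Q :: "real^3 => real^3" where "orthogonal_transformation Q" "Q (axis 1 1) = m"
proof -
 have "norm (axis 1 1 :: real^3) = 1" by simp
 from orthogonal_transformation_exists_1[OF this assms] show ?thesis
  using that by blast
qed

lemma nn_integral_lborel_rotate: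
 fixes h :: "real^3 => ennreal" and Q :: "real^3 => real^3"
 assumes "h \<in> bm" "orthogonal_transformation Q"
 shows "(NN x. h (Q x)) = (NN x. h x)"
proof -
 have [measurable]: "Q \<in> bm"
  using assms(2) by (intro borel_measurable_continuous_onI linear_continuous_on)
   (simp add: orthogonal_transformation_def linear_conv_bounded_linear)
 show ?thesis
  using assms(1) lborel_orthogonal[OF assms(2)] nn_integral_distr[of Q lborel borel h] by simp
qed

lemma nn_integral_frame:
 fixes h :: "real^3 => ennreal" and m :: "real^3"
 assumes h: "h \<in> bm" and m: "norm m = 1"
 obtains e2 e3 where "norm e2 = 1" "norm e3 = 1" "m *. e2 = 0" "m *. e3 = 0" "e2 *. e3 = 0"
  "(NN x. h x) = (NN a. NN b. NN s. h (s *R m + a *R e2 + b *R e3))"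
proof -
 obtain Q :: "real^3 => real^3" where Q: "orthogonal_transformation Q" "Q (axis 1 1) = m"
  using orthonormal_frame[OF m] .
 have lin: "linear Q" and ip: "!!x y. Q x *. Q y = x *. y" and nrm: "!!x. norm (Q x) = norm x"
  using Q(1) by (auto simp: orthogonal_transformation_def norm_eq_sqrt_inner)
 have [measurable]: "Q \<in> bm"
  using lin by (intro borel_measurable_continuous_onI linear_continuous_on) (simp add: linear_conv_bounded_linear)
 have "(NN x. h x) = (NN x. h (Q x))"
  using nn_integral_lborel_rotate[OF h Q(1)] by simp
 also have "... = (NN a. NN b. NN s. h (Q (s *R axis 1 1 + a *R axis 2 1 + b *R axis 3 1)))"
  using h by (intro nn_integral_lborel_coords) simp
 finally have "(NN x. h x) = (NN a. NN b. NN s. h (s *R m + a *R Q (axis 2 1) + b *R Q (axis 3 1)))"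
  by (simp add: linear_add[OF lin] linear_cmul[OF lin] Q(2))
 moreover have "m *. Q (axis 2 1) = 0" "m *. Q (axis 3 1) = 0" "Q (axis 2 1) *. Q (axis 3 1) = 0"
  unfolding Q(2)[symmetric] ip by (simp_all add: inner_axis_axis)
 ultimately show ?thesis
  by (intro that[of "Q (axis 2 1)" "Q (axis 3 1)"]) (simp_all add: nrm)
qed

section \<open>One-dimensional integrals of singular powers and Gaussians\<close>

lemma nn_integral_abs_powr_window:
 assumes "0 <= be" "be < 1" "0 <= l"
 shows "(NN x. ennreal (abs (x - a) powr - be) * indicator {x. abs (x - a) <= l} x) <= ennreal (2 * l powr (1 - be) / (1 - be))"
proof -
 let ?a = "NN x. ennreal (x powr - be) * indicator {0..l} x"
 have half: "?a = ennreal (l powr (1 - be) / (1 - be))"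
 proof (rule nn_integral_has_integral_lebesgue')
  show "((%x. x powr - be) has_integral l powr (1 - be) / (1 - be)) {0..l}"
   using has_integral_powr_from_0[of "- be" l] assms by simp
 qed auto
 let ?g = "%x. ennreal (abs x powr - be) * indicator {x. abs x <= l} x"
 have "(NN x. ennreal (abs (x - a) powr - be) * indicator {x. abs (x - a) <= l} x) = (NN x. ?g x)"
  by (subst (2) nn_integral_real_affine[where c = 1 and t = "- a"]) (auto intro!: nn_integral_cong split: split_indicator)
 also have "... <= (NN x. ennreal (x powr - be) * indicator {0..l} x + ennreal ((0 + (-1) * x) powr - be) * indicator {0..l} (0 + (-1) * x))"
  by (intro nn_integral_mono) (auto split: split_indicator)
 also have "... = ?a + ?a"
  by (subst (3) nn_integral_real_affine[where c = "-1" and t = 0]) (simp_all add: nn_integral_add)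
 also have "... = ennreal (2 * l powr (1 - be) / (1 - be))"
  unfolding half using assms by (subst ennreal_plus[symmetric]) auto
 finally show ?thesis .
qed

text \<open>The singularity may lie anywhere, also outside the interval, and the bound must not
  depend on it: at distance at most \<open>t\<close> the window estimate applies, further away the
  integrand is at most \<open>t powr - be\<close>.\<close>

lemma nn_integral_abs_powr_interval:
 assumes "0 <= be" "be < 1" "0 < t"
 shows "(NN x. ennreal (abs (x - a) powr - be) * indicator {0..t} x) <= ennreal (3 * t powr (1 - be) / (1 - be))"
proof -
 let ?a = "ennreal (t powr - be)"
 have "(NN x. ennreal (abs (x - a) powr - be) * indicator {0..t} x) <=
  (NN x. ennreal (abs (x - a) powr - be) * indicator {x. abs (x - a) <= t} x + ?a * indicator {0..t} x)"
 proof (intro nn_integral_mono)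
  fix x
  show "ennreal (abs (x - a) powr - be) * indicator {0..t} x <=
   ennreal (abs (x - a) powr - be) * indicator {x. abs (x - a) <= t} x + ?a * indicator {0..t} x"
  proof (cases "abs (x - a) <= t | x \<notin> {0..t}")
   case False
   then have "abs (x - a) powr - be <= t powr - be"
    using assms by (intro powr_mono2') auto
   with False show ?thesis by (auto intro: ennreal_leI)
  qed (auto split: split_indicator)
 qed
 also have "... = (NN x. ennreal (abs (x - a) powr - be) * indicator {x. abs (x - a) <= t} x) + ?a * t"
  using assms by (simp add: nn_integral_add nn_integral_cmult)
 also have "... <= ennreal (2 * t powr (1 - be) / (1 - be)) + ennreal (t powr (1 - be) / (1 - be))"
 proof (intro add_mono nn_integral_abs_powr_window)
  have "t powr - be * t = t powr (1 - be)"
   using assms by (cases "t = 0") (auto simp: powr_diff powr_minus field_simps)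
  also have "... <= t powr (1 - be) / (1 - be)"
   using assms by (simp add: field_simps mult_left_le)
  finally show "?a * ennreal t <= ennreal (t powr (1 - be) / (1 - be))"
   using assms by (simp add: ennreal_mult''[symmetric] ennreal_leI)
 qed (use assms in auto)
 also have "... = ennreal (3 * t powr (1 - be) / (1 - be))"
  using assms by (subst ennreal_plus[symmetric]) (auto simp: add_divide_distrib[symmetric])
 finally show ?thesis .
qed

lemma nn_integral_gauss:
 assumes "0 < c"
 shows "(NN x. ennreal (exp (- c * (x - b)^2))) = ennreal (sqrt (pi / c))"
proof -
 define si where "si = sqrt (1 / (2 * c))"
 let ?a = "NN x. ennreal (normal_density b si x)"
 have si: "si > 0" "si^2 = 1 / (2 * c)" using assms by (auto simp: si_def)
 have "exp (- c * (x - b)^2) = sqrt (pi / c) * normal_density b si x" for x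
  using assms by (simp add: normal_density_def si(2) real_sqrt_divide field_simps)
 then have "(NN x. ennreal (exp (- c * (x - b)^2))) = (NN x. ennreal (sqrt (pi / c)) * ennreal (normal_density b si x))"
  using assms by (simp add: ennreal_mult')
 also have "... = ennreal (sqrt (pi / c)) * ?a"
  by (rule nn_integral_cmult) simp
 also have "?a = 1"
  using prob_space.emeasure_space_1[OF prob_space_normal_density[OF si(1)], of b]
  by (simp add: emeasure_density)
 finally show ?thesis by simp
qed

text \<open>Splitting at distance 1 from the singularity makes the bound uniform in both centres
  \<open>a\<close> and \<open>b\<close>.\<close>

lemma nn_integral_gauss_powr:
 assumes "0 < c" "0 <= be" "be < 1"
 shows "(NN x. ennreal (exp (- c * (x - b)^2) * abs (x - a) powr - be)) <= ennreal (2 / (1 - be) + sqrt (pi / c))"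
proof -
 have "(NN x. ennreal (exp (- c * (x - b)^2) * abs (x - a) powr - be)) <=
  (NN x. ennreal (abs (x - a) powr - be) * indicator {x. abs (x - a) <= 1} x + ennreal (exp (- c * (x - b)^2)))"
 proof (intro nn_integral_mono)
  fix x
  have 1: "exp (- c * (x - b)^2) <= 1" using assms by simp
  let ?b = "exp (- c * (x - b)^2)"
  let ?a = "abs (x - a)"
  show "ennreal (exp (- c * (x - b)^2) * abs (x - a) powr - be) <=
   ennreal (abs (x - a) powr - be) * indicator {x. abs (x - a) <= 1} x + ennreal (exp (- c * (x - b)^2))"
  proof (cases "?a <= 1")
   case True
   have "?b * ?a powr - be <= ?a powr - be"
    using mono_r[OF 1, of "?a powr - be"] by simp
   with True show ?thesis
    by (auto intro: order_trans[OF ennreal_leI] simp: add_increasing2)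
  next
   case False
   then have "?a powr - be <= 1"
    using assms powr_mono2'[of "- be" 1 "?a"] by simp
   then have "?b * ?a powr - be <= ?b"
    by (simp add: mult_left_le)
   with False show ?thesis by (auto intro: ennreal_leI)
  qed
 qed
 also have "... = (NN x. ennreal (abs (x - a) powr - be) * indicator {x. abs (x - a) <= 1} x) + ennreal (sqrt (pi / c))"
  using assms by (subst nn_integral_add) (simp_all only: nn_integral_gauss, measurable)
 also have "... <= ennreal (2 / (1 - be)) + ennreal (sqrt (pi / c))"
  using nn_integral_abs_powr_window[of be 1 a] assms by (intro add_mono) auto
 also have "... = ennreal (2 / (1 - be) + sqrt (pi / c))"
  using assms by (subst ennreal_plus[symmetric]) auto
 finally show ?thesis .
qed

lemma ennreal_mult3:
 "0 <= a ==> 0 <= b ==> 0 <= c ==> ennreal a * ennreal b * ennreal c = ennreal (a * b * c)"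
 by (simp add: ennreal_mult)

lemma nn_integral_cong_off:
 assumes "!!x. x ~= c ==> f x = g x"
 shows "(\<integral>\<^sup>+x. f x \<partial>(lborel::'a::euclidean_space measure)) = (NN x. g x)"
 using AE_lborel_singleton[of c] assms by (intro nn_integral_cong_AE) (auto elim: eventually_mono)

lemma nn_integral_lborel_scaleR:
 fixes h :: "'a::euclidean_space => ennreal"
 assumes [measurable]: "h \<in> bm" and c: "c ~= 0"
 shows "(NN x. h x) = ennreal (abs c ^ DIM('a)) * (NN x. h (t + c *R x))"
proof -
 have "(NN x. h x) = (\<integral>\<^sup>+x. h x \<partial>density (distr lborel borel (%x. t + c *R x)) (%_. ennreal (abs c ^ DIM('a))))"
  using lborel_affine[OF c, of t] by simp
 also have "... = ennreal (abs c ^ DIM('a)) * (NN x. h (t + c *R x))"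
  by (simp add: nn_integral_density nn_integral_distr nn_integral_cmult)
 finally show ?thesis .
qed

lemma nn_integral_tail_power:
 assumes "0 < a" "0 < n"
 shows "(NN r. ennreal (1 / r ^ Suc n) * indicator {a..} r) = ennreal (1 / (real n * a ^ n))"
proof -
 have "(NN r. ennreal (1 / r ^ Suc n) * indicator {a..} r) = ennreal (0 - (- 1 / (real n * a ^ n)))"
 proof (intro nn_integral_FTC_atLeast)
  fix x assume x: "a <= x"
  then have "x > 0" using assms by simp
  with assms show "((%x. - 1 / (real n * x ^ n)) has_real_derivative 1 / x ^ Suc n) (at x)"
   by (auto intro!: derivative_eq_intros simp: field_simps power_diff sq_eq split: nat_diff_split)
  show "0 <= 1 / x ^ Suc n" using \<open>x > 0\<close> by simp
 next
  show "((%x. - 1 / (real n * x ^ n)) \<longlongrightarrow> 0) at_top"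
   using assms by real_asymp
 qed simp
 then show ?thesis by simp
qed

lemma borel_measurable_sgn_vec [measurable]:
 "(sgn :: 'a::euclidean_space => 'a) \<in> bm"
 unfolding sgn_div_norm by measurable

text \<open>A polar formula in which the sphere occurs only as an average over the unit ball of
  functions of \<open>sgn y\<close>, which is how \<open>sphere_measure\<close> is defined.
  Replacing \<open>r\<close> by \<open>norm y * r\<close> removes \<open>sgn\<close>, scaling by
  \<open>r\<close> turns \<open>r *R y\<close> into \<open>z\<close>, and the remaining integral
  over \<open>r > norm z\<close> gives the weight. In the plane the weight is \<open>1 / 2\<close>,
  in space \<open>1 / (3 * norm z)\<close>.\<close>

lemma nn_integral_polar:
 fixes F :: "'a::euclidean_space => ennreal"
 assumes [measurable]: "F \<in> bm"
 shows "(NN y. indicator (ball 0 1) y * (NN r. ennreal r * indicator {0<..} r * F (r *R sgn y))) =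
  (NN z. ennreal (N2 z / (real DIM('a) * norm z ^ DIM('a))) * F z)"
proof -
 let ?n = "DIM('a)"
 have [measurable]: "Measurable.pred borel (%y. y \<in> ball (0::'a) 1)"
  by (simp add: pred_def)
 have "(NN y. indicator (ball 0 1) y * (NN r. ennreal r * indicator {0<..} r * F (r *R sgn y)))
  = (NN y. (NN r. indicator (ball 0 1) y * ennreal (N2 y) * (ennreal r * indicator {0<..} r) * F (r *R y)))"
 proof (rule nn_integral_cong_off[of 0])
  fix y :: 'a assume y: "y ~= 0"
  let ?i = "NN r. ennreal r * indicator {0<..} r * F (r *R sgn y)"
  let ?h = "ennreal (norm y)"
  have "?i =
   ?h * (NN r. ennreal (norm y * r) * indicator {0<..} (norm y * r) * F ((norm y * r) *R sgn y))"
   using y by (subst nn_integral_real_affine[where c = "norm y" and t = 0]) simp_all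
  also have "... = ?h * (NN r. ?h * (ennreal r * indicator {0<..} r * F (r *R y)))"
  proof -
   have "ennreal (norm y * r) * indicator {0<..} (norm y * r) * F ((norm y * r) *R sgn y)
    = ?h * (ennreal r * indicator {0<..} r * F (r *R y))" for r
   proof (cases "0 < r")
    case True
    have "(norm y * r) *R sgn y = r *R y"
     using y by (simp add: sgn_div_norm)
    moreover have "ennreal (norm y * r) = ?h * ennreal r"
     by (rule ennreal_mult') simp
    ultimately show ?thesis
     using True y by (simp add: mult.assoc)
   next
    case False
    then have "~ 0 < norm y * r" using y by (simp add: zero_less_mult_iff)
    with False show ?thesis by simp
   qed
   then show ?thesis by (simp only:)
  qed
  also have "... = (NN r. ennreal (N2 y) * (ennreal r * indicator {0<..} r * F (r *R y)))"
   by (subst nn_integral_cmult, measurable, subst nn_integral_cmult, measurable) (simp add: sq_eq ennreal_mult mult.assoc)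
  finally show "indicator (ball 0 1) y * ?i =
   (NN r. indicator (ball 0 1) y * ennreal (N2 y) * (ennreal r * indicator {0<..} r) * F (r *R y))"
   by (subst (asm) nn_integral_cmult, measurable) (simp add: nn_integral_cmult mult.assoc)
 qed
 also have "... = (NN r. (NN y. indicator (ball 0 1) y * ennreal (N2 y) * (ennreal r * indicator {0<..} r) * F (r *R y)))"
  by (intro lborel_pair.Fubini') measurable
 also have "... = (NN r. (NN z. (ennreal (N2 z) * F z) * (ennreal (1 / r ^ Suc ?n) * indicator {0<..} (r - norm z))))"
 proof (rule nn_integral_cong)
  fix r :: real
  show "(NN y. indicator (ball 0 1) y * ennreal (N2 y) * (ennreal r * indicator {0<..} r) * F (r *R y))
   = (NN z. (ennreal (N2 z) * F z) * (ennreal (1 / r ^ Suc ?n) * indicator {0<..} (r - norm z)))"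
  proof (cases "r > 0")
   let ?g = "ennreal r * indicator {0<..} r"
   let ?c = "ennreal (r ^ ?n)"
   let ?a = "ennreal (1 / r ^ Suc ?n)"
   case True
   have "(NN z. (ennreal (N2 z) * F z) * (?a * indicator {0<..} (r - norm z))) =
    ?c * (NN y. (ennreal (N2 (r *R y)) * F (r *R y)) * (?a * indicator {0<..} (r - norm (r *R y))))"
    using True by (subst nn_integral_lborel_scaleR[where c = r and t = 0]) simp_all
   also have "... = (NN y. ?c * ((ennreal (N2 (r *R y)) * F (r *R y)) * (?a * indicator {0<..} (r - norm (r *R y)))))"
    by (rule nn_integral_cmult[symmetric]) measurable
   also have "... = (NN y. indicator (ball 0 1) y * ennreal (N2 y) * ?g * F (r *R y))"
   proof (intro nn_integral_cong)
    fix y :: 'a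
    have i: "indicator {0<..} (r - norm (r *R y)) = (indicator (ball 0 1) y :: ennreal)"
     using True by (auto simp: mult_less_cancel_left split: split_indicator)
    let ?j = "ennreal (N2 y)"
    let ?d = "ennreal (N2 (r *R y))"
    let ?b = "?c * ((?d * F (r *R y)) * (?a * indicator {0<..} (r - norm (r *R y))))"
    have "r ^ ?n * N2 (r *R y) * (1 / r ^ Suc ?n) = N2 y * r"
     using True by (simp add: power_mult_distrib sq_eq)
    moreover have "?c * ?d * ?a = ennreal (r ^ ?n * N2 (r *R y) * (1 / r ^ Suc ?n))"
     using True by (intro ennreal_mult3) auto
    moreover have "ennreal (N2 y * r) = ?j * ennreal r"
     using True by (intro ennreal_mult) auto
    ultimately have "?c * ?d * ?a = ?j * ennreal r"
     by (simp only:)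
    then have *: "?c * (?d * ?a) = ?j * ennreal r"
     by (simp only: mult.assoc)
    have "?b
     = (?c * (?d * ?a)) * F (r *R y) * indicator {0<..} (r - norm (r *R y))"
     by (simp only: ac_simps)
    also have "... = indicator (ball 0 1) y * ?j * ?g * F (r *R y)"
     unfolding * i using True by (simp add: ac_simps)
    finally show "?b
     = indicator (ball 0 1) y * ?j * ?g * F (r *R y)" .
   qed
   finally show ?thesis by simp
  next
   case False
   then have "indicator {0<..} (r - norm z) = (0::ennreal)" for z :: 'a
    by (auto split: split_indicator) (smt (verit) norm_ge_zero)
   with False show ?thesis by simp
  qed
 qed
 also have "... = (NN z. (NN r. (ennreal (N2 z) * F z) * (ennreal (1 / r ^ Suc ?n) * indicator {0<..} (r - norm z))))"
  by (intro lborel_pair.Fubini') measurable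
 also have "... = (NN z. ennreal (N2 z / (real ?n * norm z ^ ?n)) * F z)"
 proof (rule nn_integral_cong_off[of 0])
  fix z :: 'a assume z: "z ~= 0"
  let ?k = "ennreal (N2 z / (real ?n * norm z ^ ?n))"
  let ?f = "NN r. ennreal (1 / r ^ Suc ?n) * indicator {0<..} (r - norm z)"
  let ?e = "ennreal (1 / (real ?n * norm z ^ ?n))"
  have "?f
   = (NN r. ennreal (1 / r ^ Suc ?n) * indicator {norm z..} r)"
   by (rule nn_integral_cong_off[of "norm z"]) (auto split: split_indicator)
  also have "... = ?e"
   using z by (intro nn_integral_tail_power) auto
  finally have "?f = ?e" .
  moreover have "?k = ennreal (N2 z) * ?e"
   by (subst ennreal_mult[symmetric]) simp_all
  ultimately show "(NN r. (ennreal (N2 z) * F z) * (ennreal (1 / r ^ Suc ?n) * indicator {0<..} (r - norm z)))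
   = ?k * F z"
   by (subst nn_integral_cmult) (simp_all only: mult.assoc mult.commute[of "F z"], measurable)
 qed
 finally show ?thesis .
qed

section \<open>Surface measure on the sphere and the exchange of the outgoing velocities\<close>

lemma sets_sphere_measure [simp, measurable_cong]: "sets sphere_measure = sets borel"
 by (simp add: sphere_measure_def)

lemma space_sphere_measure [simp]: "space sphere_measure = UNIV"
 by (simp add: sphere_measure_def space_scale_measure)

lemma nn_integral_sphere:
 assumes [measurable]: "ph \<in> bm"
 shows "(NS om. ph om) = 3 * (NN y. indicator (ball 0 1) y * ph (sgn y))"
proof -
 have "(NS om. ph om) = 3 * (\<integral>\<^sup>+y. ph (sgn y) \<partial>restrict_space lborel (ball 0 1))"
  unfolding sphere_measure_def
  by (subst nn_integral_scale_measure, simp, subst nn_integral_distr) (simp_all add: measurable_restrict_space1)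
 also have "(\<integral>\<^sup>+y. ph (sgn y) \<partial>restrict_space lborel (ball 0 1)) = (NN y. indicator (ball 0 1) y * ph (sgn y))"
  by (subst nn_integral_restrict_space) (simp_all add: mult.commute)
 finally show ?thesis .
qed

lemma AE_sphere_norm: "AE om in sphere_measure. norm om = 1"
proof (rule AE_I)
 let ?N = "{om::real^3. norm om ~= 1}"
 show "{om \<in> space sphere_measure. norm om ~= 1} \<subseteq> ?N" by simp
 show N: "?N \<in> sets sphere_measure" by simp
 have "emeasure sphere_measure ?N = (NS om. indicator ?N om)"
  using N by simp
 also have "... = 3 * (NN y. indicator (ball 0 1) y * indicator ?N (sgn y))"
  by (rule nn_integral_sphere) simp
 also have "(\<integral>\<^sup>+y. indicator (ball 0 1) y * indicator ?N (sgn y) \<partial>(lborel::(real^3) measure)) = (\<integral>\<^sup>+y. 0 \<partial>(lborel::(real^3) measure))"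
  by (rule nn_integral_cong_off[of 0]) (auto simp: norm_sgn split: split_indicator)
 finally show "emeasure sphere_measure ?N = 0" by simp
qed

lemma finite_measure_sphere: "finite_measure sphere_measure"
proof
 have "emeasure sphere_measure UNIV = (NS om. 1)"
  by simp
 also have "... = 3 * (\<integral>\<^sup>+y. indicator (ball 0 1) y * 1 \<partial>(lborel :: (real^3) measure))"
  by (rule nn_integral_sphere) simp
 also have "... = 3 * emeasure lborel (ball (0::real^3) 1)"
  by simp
 also have "... < \<infinity>"
  using emeasure_lborel_ball_finite[of "0::real^3" 1] by (simp add: ennreal_mult_less_top less_top)
 finally show "emeasure sphere_measure (space sphere_measure) ~= \<infinity>" by simp
qed

interpretation sphere: finite_measure sphere_measure
 by (rule finite_measure_sphere)

interpretation lborel_sphere: pair_sigma_finite "lborel :: (real^3) measure" sphere_measure ..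

lemma nn_integral_sphere_rotate:
 assumes [measurable]: "ph \<in> bm" and Q: "orthogonal_transformation Q"
 shows "(NS om. ph (Q om)) = (NS om. ph om)"
proof -
 have lin: "linear Q" and nrm: "!!x. norm (Q x) = norm x"
  using Q by (auto simp: orthogonal_transformation_def norm_eq_sqrt_inner)
 have [measurable]: "Q \<in> bm"
  using lin by (intro borel_measurable_continuous_onI linear_continuous_on) (simp add: linear_conv_bounded_linear)
 have "sgn (Q y) = Q (sgn y)" for y
  by (simp add: sgn_div_norm nrm linear_cmul[OF lin])
 then show ?thesis
  using nn_integral_lborel_rotate[OF _ Q, of "%y. indicator (ball 0 1) y * ph (sgn y)"]
  by (simp add: nn_integral_sphere indicator_def nrm)
qed

text \<open>For a unit vector \<open>om\<close> in the plane of \<open>e0\<close> and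
  \<open>e\<close>, \<open>(om *. e0) *R om\<close> is the projection of \<open>e0\<close> to the
  line of \<open>om\<close>, and \<open>e0\<close> minus it is the projection to the perpendicular
  line; a quarter turn exchanges the two. In the coordinates \<open>s\<close>, \<open>r\<close> of
  the plane this is the exchange of \<open>s\<close> and \<open>r\<close>, under which the density
  \<open>k\<close>, the cosine times the distance from the axis, is symmetric. The sign that appears
  is absorbed by folding \<open>s\<close> to positive values.\<close>

lemma sphere_swap_plane:
 fixes et :: "real^3 => ennreal" and e0 e :: "real^3"
 assumes [measurable]: "et \<in> bm"
  and e: "norm e0 = 1" "norm e = 1" "e0 *. e = 0"
 defines "hL == %y. indicator (ball 0 1) y * ennreal \<bar>sgn y *. e0\<bar> * et ((sgn y *. e0) *R sgn y)"
  and "hR == %y. indicator (ball 0 1) y * ennreal \<bar>sgn y *. e0\<bar> * et (e0 - (sgn y *. e0) *R sgn y)"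
 shows "(NN r. ennreal r * indicator {0<..} r * (NN s. hL (s *R e0 + r *R e))) =
  (NN r. ennreal r * indicator {0<..} r * (NN s. hR (s *R e0 + r *R e)))"
proof -
 have ball [measurable]: "Measurable.pred borel (%y. y \<in> ball (0::real^3) 1)"
  by (simp add: pred_def)
 have [measurable]: "hL \<in> bm" "hR \<in> bm"
  unfolding hL_def hR_def by measurable
 define k where "k = (%s r::real. indicator {..<1} (s^2 + r^2) * ennreal (s * r / sqrt (s^2 + r^2)) * indicator {0<..} r * indicator {0<..} s :: ennreal)"
 define P where "P = (%a b. et (a *R e0 + b *R e))"
 define q where "q = (%s r::real. s^2 + r^2)"
 have [measurable]: "(%x. P (f x) (g x)) \<in> borel_measurable M" if [measurable]: "f \<in> borel_measurable M" "g \<in> borel_measurable M" for f g and M :: "'m measure"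
  unfolding P_def by measurable
 have split: "(NN s. h s) = (NN s. indicator {0<..} s * (h s + h (- s)))"
  if [measurable]: "h \<in> bm" for h :: "real => ennreal"
 proof -
  have "(NN s. h s) = (NN s. indicator {0<..} s * h s + indicator {..<0} s * h s)"
   by (rule nn_integral_cong_off[of 0]) (auto split: split_indicator)
  also have "... = (NN s. indicator {0<..} s * h s) + (NN s. indicator {..<0} s * h s)"
   by (rule nn_integral_add) measurable
  also have "(NN s. indicator {..<0} s * h s) = (NN s. indicator {0<..} s * h (- s))"
   by (subst nn_integral_real_affine[where c = "-1" and t = 0]) (auto intro!: nn_integral_cong split: split_indicator)
  also have "(NN s. indicator {0<..} s * h s) + ... = (NN s. indicator {0<..} s * h s + indicator {0<..} s * h (- s))"
   by (rule nn_integral_add[symmetric]) measurable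
  finally show ?thesis by (simp add: distrib_left)
 qed
 have nrm: "norm (s *R e0 + r *R e) = sqrt (q s r)" for s r
  using e by (simp add: norm_eq_sqrt_inner inner_simps q_def sq_eq inner_commute)
 have ip: "(s *R e0 + r *R e) *. e0 = s" for s r
  using e by (simp add: inner_simps inner_commute norm_eq_1)
 have q_pos: "q s r > 0" if "r > 0" for s r
  using that by (simp add: q_def add_nonneg_pos)
 have sg: "sgn (s *R e0 + r *R e) = (1 / sqrt (q s r)) *R (s *R e0 + r *R e)" for s r
  by (simp add: sgn_div_norm nrm divide_inverse)
 have sgip: "sgn (s *R e0 + r *R e) *. e0 = s / sqrt (q s r)" for s r
  unfolding sg by (simp add: ip)
 have bl: "indicator (ball 0 1) (s *R e0 + r *R e) = (indicator {..<1} (q s r) :: ennreal)" for s r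
  by (auto simp: nrm split: split_indicator)
 have vec: "(sgn (s *R e0 + r *R e) *. e0) *R sgn (s *R e0 + r *R e) = (s^2 / q s r) *R e0 + (s * r / q s r) *R e"
  if "r > 0" for s r
 proof -
  have "s / sqrt (q s r) * (1 / sqrt (q s r)) = s / q s r"
   using q_pos[OF that, of s] by simp
  then show ?thesis
   unfolding sgip by (simp only: sg scaleR_scaleR) (simp add: scaleR_add_right sq_eq)
 qed
 have L: "hL (s *R e0 + r *R e) = indicator {..<1} (q s r) * ennreal (abs s / sqrt (q s r)) * P (s^2 / q s r) (s * r / q s r)"
  if "r > 0" for s r
  unfolding hL_def vec[OF that] bl unfolding sgip P_def using q_pos[OF that, of s] by (simp add: abs_mult)
 have R: "hR (s *R e0 + r *R e) = indicator {..<1} (q s r) * ennreal (abs s / sqrt (q s r)) * P (r^2 / q s r) (- (s * r / q s r))"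
  if "r > 0" for s r
 proof -
  have "1 - s\<^sup>2 / q s r = r^2 / q s r"
   using q_pos[OF that, of s] by (auto simp: q_def divide_simps)
  then have v: "e0 - ((s^2 / q s r) *R e0 + (s * r / q s r) *R e) = (r^2 / q s r) *R e0 + (- (s * r / q s r)) *R e"
   by (metis (no_types, lifting) diff_diff_add scaleR_minus_left scaleR_left_diff_distrib scaleR_one uminus_add_conv_diff add.commute)
  show ?thesis
   unfolding hR_def vec[OF that] bl unfolding sgip P_def v using q_pos[OF that, of s] by (simp add: abs_mult)
 qed
 have qm: "q (- s) r = q s r" "q s r = q r s" for s r by (simp_all add: q_def)
 have kk: "ennreal r * indicator {0<..} r * (indicator {0<..} s * (indicator {..<1} (q s r) * ennreal (abs s / sqrt (q s r)) * A
  + indicator {..<1} (q s r) * ennreal (abs s / sqrt (q s r)) * B)) = k s r * (A + B)" for r s A B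
 proof (cases "r > 0 & s > 0")
  case True
  have "ennreal r * ennreal (s / sqrt (q s r)) = ennreal (s * r / sqrt (q s r))"
   using True q_pos[of r s] by (subst ennreal_mult[symmetric]) (auto simp: mult.commute)
  from this[symmetric] show ?thesis
   using True by (simp add: k_def q_def distrib_left distrib_right ac_simps)
 next
  case False
  then show ?thesis by (auto simp: k_def)
 qed
 have [measurable]: "(%x. k (f x) (g x)) \<in> borel_measurable M" if [measurable]: "f \<in> borel_measurable M" "g \<in> borel_measurable M" for f g and M :: "'m measure"
  unfolding k_def by measurable
 have [measurable]: "(%x. q (f x) (g x)) \<in> borel_measurable M" if [measurable]: "f \<in> borel_measurable M" "g \<in> borel_measurable M" for f g and M :: "'m measure"
  unfolding q_def by measurable
 have "(NN r. ennreal r * indicator {0<..} r * (NN s. hL (s *R e0 + r *R e)))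
  = (NN r. NN s. k s r * (P (s^2 / q s r) (s * r / q s r) + P (s^2 / q s r) (- (s * r / q s r))))"
 proof (intro nn_integral_cong)
  fix r :: real
  show "ennreal r * indicator {0<..} r * (NN s. hL (s *R e0 + r *R e))
   = (NN s. k s r * (P (s^2 / q s r) (s * r / q s r) + P (s^2 / q s r) (- (s * r / q s r))))"
  proof (cases "r > 0")
   case True
   show ?thesis
    by (subst split, measurable, subst nn_integral_cmult[symmetric], measurable)
     (simp only: L[OF True] kk[symmetric] qm(1) abs_minus_cancel power2_minus mult_minus_left divide_minus_left)
  next
   case False
   then show ?thesis by (simp add: k_def)
  qed
 qed
 also have "... = (NN s. NN r. k s r * (P (s^2 / q s r) (s * r / q s r) + P (s^2 / q s r) (- (s * r / q s r))))"
  by (intro lborel_pair.Fubini') measurable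
 also have "... = (NN r. NN s. k s r * (P (r^2 / q s r) (- (s * r / q s r)) + P (r^2 / q s r) (s * r / q s r)))"
 proof (intro nn_integral_cong)
  fix r s :: real
  have ks: "k r s = k s r"
   unfolding k_def by (simp add: ac_simps)
  show "k r s * (P (r^2 / q r s) (r * s / q r s) + P (r^2 / q r s) (- (r * s / q r s))) =
   k s r * (P (r^2 / q s r) (- (s * r / q s r)) + P (r^2 / q s r) (s * r / q s r))"
   unfolding ks qm(2)[of r s] by (simp only: add.commute mult.commute[of r s])
 qed
 also have "... = (NN r. ennreal r * indicator {0<..} r * (NN s. hR (s *R e0 + r *R e)))"
 proof (intro nn_integral_cong)
  fix r :: real
  show "(NN s. k s r * (P (r^2 / q s r) (- (s * r / q s r)) + P (r^2 / q s r) (s * r / q s r)))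
   = ennreal r * indicator {0<..} r * (NN s. hR (s *R e0 + r *R e))"
  proof (cases "r > 0")
   case True
   show ?thesis
    by (rule sym, subst split, measurable, subst nn_integral_cmult[symmetric], measurable)
     (simp only: R[OF True] kk[symmetric] qm(1) abs_minus_cancel power2_minus mult_minus_left divide_minus_left minus_minus)
  next
   case False
   then show ?thesis by (simp add: k_def)
  qed
 qed
 finally show ?thesis .
qed

text \<open>Cylindrical coordinates about \<open>e0\<close>: the integral over the ball is an
  average of integrals over half planes bounded by the axis, and \<open>sphere_swap_plane\<close>
  holds in each of them. The volume factor \<open>r\<close> is exactly what makes the density of the
  plane lemma symmetric.\<close>

lemma sphere_swap_axis:
 fixes et :: "real^3 => ennreal"
 assumes et [measurable]: "et \<in> bm"
 defines "e0 == axis 1 1 :: real^3"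
 shows "(NS om. ennreal \<bar>om *. e0\<bar> * et ((om *. e0) *R om)) =
  (NS om. ennreal \<bar>om *. e0\<bar> * et (e0 - (om *. e0) *R om))"
proof -
 let ?a = "DIM(real \<times> real)"
 have ball [measurable]: "Measurable.pred borel (%y. y \<in> ball (0::real^3) 1)"
  by (simp add: pred_def)
 define E where "E = (%p::real\<times>real. fst p *R axis 2 1 + snd p *R axis 3 1 :: real^3)"
 have [measurable]: "E \<in> bm"
  unfolding E_def by (intro borel_measurable_continuous_onI continuous_intros)
 have nE: "norm (E p) = norm p" "e0 *. E p = 0" for p
  by (simp_all add: E_def e0_def norm_eq_sqrt_inner inner_simps inner_axis_axis norm_prod_def inner_prod_def sq_eq)
 \<comment> \<open>The factor 2 compensates the constant weight \<open>1 / 2\<close> of the polar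
   formula in the plane.\<close>
 have eq: "(NN y. h y) = 2 * (NN p. indicator (ball 0 1) p * (NN r. ennreal r * indicator {0<..} r * (NN s. h (s *R e0 + r *R E (sgn p)))))"
  if [measurable]: "h \<in> bm" for h
 proof -
  have [measurable]: "(%p. NN s. h (s *R e0 + E p)) \<in> bm"
   by measurable
  have rE: "r *R E p = E (r *R p)" for r p
   by (simp add: E_def scaleR_add_right)
  have "(NN y. h y) = (NN p. NN s. h (s *R e0 + E p))"
   by (subst nn_integral_lborel_coords, measurable, subst nn_integral_lborel_pair, measurable)
    (simp add: E_def e0_def add.assoc)
  also have "... = (NN p. 2 * (ennreal (N2 p / (real DIM(real \<times> real) * norm p ^ ?a)) * (NN s. h (s *R e0 + E p))))"
  proof (rule nn_integral_cong_off[of 0])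
   fix p :: "real \<times> real" assume "p ~= 0"
   then have "ennreal (N2 p / (real DIM(real \<times> real) * norm p ^ ?a)) = ennreal (1 / 2)"
    by (simp add: numeral_2_eq_2[symmetric])
   moreover have "2 * ennreal (1 / 2) = 1"
    using ennreal_mult'[of 2 "1 / 2"] by simp
   ultimately have "2 * ennreal (N2 p / (real DIM(real \<times> real) * norm p ^ ?a)) = 1"
    by metis
   then show "(NN s. h (s *R e0 + E p)) = 2 * (ennreal (N2 p / (real DIM(real \<times> real) * norm p ^ ?a)) * (NN s. h (s *R e0 + E p)))"
    by (simp only: mult.assoc[symmetric]) simp
  qed
  also have "... = 2 * (NN p. ennreal (N2 p / (real DIM(real \<times> real) * norm p ^ ?a)) * (NN s. h (s *R e0 + E p)))"
   by (rule nn_integral_cmult) measurable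
  also have "... = 2 * (NN p. indicator (ball 0 1) p * (NN r. ennreal r * indicator {0<..} r * (NN s. h (s *R e0 + E (r *R sgn p)))))"
   by (subst nn_integral_polar) simp_all
  finally show ?thesis by (simp add: rE)
 qed
 have "(NN y. indicator (ball 0 1) y * (ennreal \<bar>sgn y *. e0\<bar> * et ((sgn y *. e0) *R sgn y)))
   = (NN y. indicator (ball 0 1) y * (ennreal \<bar>sgn y *. e0\<bar> * et (e0 - (sgn y *. e0) *R sgn y)))"
 proof (subst (1 2) eq)
  show "2 * (NN p. indicator (ball 0 1) p * (NN r. ennreal r * indicator {0<..} r * (NN s. indicator (ball 0 1) (s *R e0 + r *R E (sgn p)) *
      (ennreal \<bar>sgn (s *R e0 + r *R E (sgn p)) *. e0\<bar> * et ((sgn (s *R e0 + r *R E (sgn p)) *. e0) *R sgn (s *R e0 + r *R E (sgn p)))))))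
   = 2 * (NN p. indicator (ball 0 1) p * (NN r. ennreal r * indicator {0<..} r * (NN s. indicator (ball 0 1) (s *R e0 + r *R E (sgn p)) *
      (ennreal \<bar>sgn (s *R e0 + r *R E (sgn p)) *. e0\<bar> * et (e0 - (sgn (s *R e0 + r *R E (sgn p)) *. e0) *R sgn (s *R e0 + r *R E (sgn p)))))))"
  proof (rule arg_cong[where f = "%x. 2 * x"], rule nn_integral_cong_off[of 0])
   fix p :: "real \<times> real" assume p: "p ~= 0"
   let ?b = "E (sgn p)"
   have "norm e0 = 1" "norm (?b) = 1" "e0 *. ?b = 0"
    using p by (simp_all add: nE norm_sgn) (simp add: e0_def)
   from sphere_swap_plane[OF et this]
   show "indicator (ball 0 1) p * (NN r. ennreal r * indicator {0<..} r * (NN s. indicator (ball 0 1) (s *R e0 + r *R ?b) *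
      (ennreal \<bar>sgn (s *R e0 + r *R ?b) *. e0\<bar> * et ((sgn (s *R e0 + r *R ?b) *. e0) *R sgn (s *R e0 + r *R ?b)))))
    = indicator (ball 0 1) p * (NN r. ennreal r * indicator {0<..} r * (NN s. indicator (ball 0 1) (s *R e0 + r *R ?b) *
      (ennreal \<bar>sgn (s *R e0 + r *R ?b) *. e0\<bar> * et (e0 - (sgn (s *R e0 + r *R ?b) *. e0) *R sgn (s *R e0 + r *R ?b)))))"
    by (simp only: mult.assoc)
  qed
 qed measurable
 then show ?thesis
  by (simp add: nn_integral_sphere)
qed

text \<open>With \<open>w = v - u\<close> the two arguments of \<open>ph\<close> are
  \<open>post_u v u om - u\<close> and \<open>post_v v u om - u\<close>: exchanging the outgoing
  particles preserves the collision measure.\<close>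

lemma sphere_swap:
 fixes ph :: "real^3 => ennreal" and w :: "real^3"
 assumes [measurable]: "ph \<in> bm"
 shows "(NS om. ennreal \<bar>w *. om\<bar> * ph ((w *. om) *R om)) =
  (NS om. ennreal \<bar>w *. om\<bar> * ph (w - (w *. om) *R om))"
proof (cases "w = 0")
 case False
 define ka where "ka = norm w"
 have ka: "ka > 0" using False by (simp add: ka_def)
 obtain Q :: "real^3 => real^3" where Q: "orthogonal_transformation Q" "Q (axis 1 1) = w /\<^sub>R ka"
  using orthonormal_frame[of "w /\<^sub>R ka"] False by (auto simp: ka_def)
 have lin: "linear Q" and ip: "!!x y. Q x *. Q y = x *. y"
  using Q by (auto simp: orthogonal_transformation_def)
 have [measurable]: "Q \<in> bm"
  using lin by (intro borel_measurable_continuous_onI linear_continuous_on) (simp add: linear_conv_bounded_linear)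
 let ?e = "axis 1 1 :: real^3"
 define et where "et = (%y. ennreal ka * ph (Q (ka *R y)))"
 have et [measurable]: "et \<in> bm" unfolding et_def by measurable
 have w: "w = Q (ka *R ?e)" using ka Q by (simp add: linear_cmul[OF lin])
 have wip: "w *. Q om = ka * (om *. ?e)" for om
  unfolding w ip by (simp add: inner_commute)
 have 1: "ennreal \<bar>w *. Q om\<bar> * ph ((w *. Q om) *R Q om) = ennreal \<bar>om *. ?e\<bar> * et ((om *. ?e) *R om)" for om
  using ka by (simp add: wip et_def abs_mult ennreal_mult linear_cmul[OF lin] ac_simps)
 have 2: "ennreal \<bar>w *. Q om\<bar> * ph (w - (w *. Q om) *R Q om) = ennreal \<bar>om *. ?e\<bar> * et (?e - (om *. ?e) *R om)" for om
 proof -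
  have "w - (w *. Q om) *R Q om = Q (ka *R (?e - (om *. ?e) *R om))"
   unfolding wip by (subst w) (simp add: linear_cmul[OF lin] linear_diff[OF lin] scaleR_diff_right)
  then show ?thesis
   using ka by (simp add: et_def wip abs_mult ennreal_mult ac_simps)
 qed
 show ?thesis
  by (subst (1 2) nn_integral_sphere_rotate[OF _ Q(1), symmetric], measurable)
   (simp only: 1 2 sphere_swap_axis[OF et])
qed simp

section \<open>Kernel estimates for the collision integrals\<close>

text \<open>The integral over the plane orthogonal to \<open>om\<close> gives \<open>pi / c\<close>;
  the Gaussian factor along \<open>om\<close> is bounded by 1.\<close>

lemma gauss_slice:
 fixes om :: "real^3" and H :: "real => ennreal"
 assumes H [measurable]: "H \<in> bm" and om: "norm om = 1" and c: "0 < c"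
 shows "(NN u. ennreal (gs c u) * H (u *. om)) <= ennreal (pi / c) * (NN s. H s)"
proof -
 let ?h = "%u. ennreal (gs c u) * H (u *. om)"
 have h: "?h \<in> bm" by measurable
 obtain e2 e3 where e: "norm e2 = 1" "norm e3 = 1" "om *. e2 = 0" "om *. e3 = 0" "e2 *. e3 = 0"
  and eq: "(NN x. ?h x) = (NN a. NN b. NN s. ?h (s *R om + a *R e2 + b *R e3))"
  using nn_integral_frame[OF h om] .
 have n: "N2 (s *R om + a *R e2 + b *R e3) = s^2 + a^2 + b^2" for s a b
  unfolding power2_norm_eq_inner using e om by (simp add: inner_simps inner_commute norm_eq_1 sq_eq)
 have ip: "(s *R om + a *R e2 + b *R e3) *. om = s" for s a b
  using e om by (simp add: inner_simps inner_commute norm_eq_1)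
 have "(NN x. ?h x) <= (NN a. NN b. NN s. ennreal (exp (- c * a^2)) * (ennreal (exp (- c * b^2)) * H s))"
  unfolding eq ip n
 proof (intro nn_integral_mono)
  fix a b s :: real
  have "exp (- c * (s^2 + a^2 + b^2)) <= exp (- c * a^2) * exp (- c * b^2)"
   using c by (simp add: exp_add[symmetric] algebra_simps)
  then show "ennreal (exp (- c * (s^2 + a^2 + b^2))) * H s <= ennreal (exp (- c * a^2)) * (ennreal (exp (- c * b^2)) * H s)"
   by (simp add: mult.assoc[symmetric] ennreal_mult[symmetric]) (intro mono_r ennreal_leI, auto)
 qed
 also have "... = (NN a. ennreal (exp (- c * a^2))) * ((NN b. ennreal (exp (- c * b^2))) * (NN s. H s))"
  by (simp add: nn_integral_cmult nn_integral_multc)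
 also have "... = ennreal (sqrt (pi / c)) * (ennreal (sqrt (pi / c)) * (NN s. H s))"
  using nn_integral_gauss[OF c, of 0] by simp
 also have "... = ennreal (pi / c) * (NN s. H s)"
  using c by (simp add: mult.assoc[symmetric] ennreal_mult[symmetric])
 finally show ?thesis .
qed

text \<open>With \<open>r\<close> on the whole line every point is met twice; against the volume
  element with \<open>r^2\<close>, the factor \<open>abs r\<close> leaves
  \<open>1 / norm z\<close>.\<close>

lemma nn_integral_sphere_line:
 fixes G :: "real^3 => ennreal"
 assumes [measurable]: "G \<in> bm"
 shows "(NS om. NN r. ennreal \<bar>r\<bar> * G (r *R om)) = (NN z. ennreal (2 / norm z) * G z)"
proof -
 let ?c = "NN z. ennreal (1 / norm z) * G (- z)"
 let ?a = "NN z. ennreal (1 / norm z) * G z"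
 have half: "(NS om. NN r. ennreal r * indicator {0<..} r * K (r *R om)) = (NN z. ennreal (1 / norm z) * K z)"
  if [measurable]: "K \<in> bm" for K :: "real^3 => ennreal"
 proof -
  have "(NS om. NN r. ennreal r * indicator {0<..} r * K (r *R om))
   = 3 * (NN y. indicator (ball 0 1) y * (NN r. ennreal r * indicator {0<..} r * K (r *R sgn y)))"
   by (rule nn_integral_sphere) measurable
  also have "... = 3 * (NN z. ennreal (N2 z / (real DIM(real^3) * norm z ^ DIM(real^3))) * K z)"
   by (subst nn_integral_polar) simp_all
  also have "... = (NN z. 3 * (ennreal (N2 z / (real DIM(real^3) * norm z ^ DIM(real^3))) * K z))"
   by (rule nn_integral_cmult[symmetric]) measurable
  also have "... = (NN z. ennreal (1 / norm z) * K z)"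
  proof (rule nn_integral_cong_off[of 0])
   fix z :: "real^3" assume "z ~= 0"
   then have "3 * (N2 z / (real DIM(real^3) * norm z ^ DIM(real^3))) = 1 / norm z"
    by (simp add: sq_eq power3_eq_cube)
   then have "3 * ennreal (N2 z / (real DIM(real^3) * norm z ^ DIM(real^3))) = ennreal (1 / norm z)"
    using ennreal_mult[of 3 "N2 z / (real DIM(real^3) * norm z ^ DIM(real^3))"] by simp
   then show "3 * (ennreal (N2 z / (real DIM(real^3) * norm z ^ DIM(real^3))) * K z) = ennreal (1 / norm z) * K z"
    by (simp only: mult.assoc[symmetric])
  qed
  finally show ?thesis .
 qed
 have "(NN r. ennreal \<bar>r\<bar> * G (r *R om)) =
  (NN r. ennreal r * indicator {0<..} r * G (r *R om)) + (NN r. ennreal r * indicator {0<..} r * G (- (r *R om)))" for om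
 proof -
  let ?b = "NN r. ennreal r * indicator {0<..} r * G (- (r *R om))"
  have "?b = (NN r. ennreal (- r) * indicator {0<..} (- r) * G (r *R om))"
   by (subst nn_integral_real_affine[where c = "-1" and t = 0]) simp_all
  then have "(NN r. ennreal r * indicator {0<..} r * G (r *R om)) + ?b
   = (NN r. ennreal r * indicator {0<..} r * G (r *R om) + ennreal (- r) * indicator {0<..} (- r) * G (r *R om))"
   by (subst nn_integral_add) simp_all
  then show ?thesis
   by (auto intro!: nn_integral_cong split: split_indicator)
 qed
 then have "(NS om. NN r. ennreal \<bar>r\<bar> * G (r *R om)) =
  ?a + ?c"
  using half[of G] half[of "%z. G (- z)"] by (simp add: nn_integral_add)
 also have "?c = ?a"
  by (subst (2) nn_integral_lborel_scaleR[where c = "-1" and t = 0]) simp_all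
 also have "?a + ?a = (NN z. ennreal (2 / norm z) * G z)"
 proof -
  have "ennreal (2 / norm z) = ennreal (1 / norm z) + ennreal (1 / norm z)" for z :: "real^3"
   by (subst ennreal_plus[symmetric]) auto
  then show ?thesis by (simp add: nn_integral_add distrib_right)
 qed
 finally show ?thesis .
qed

lemma post_energy:
 assumes "norm om = 1"
 shows "N2 (post_u v u om) + N2 (post_v v u om) = N2 u + N2 v"
 unfolding power2_norm_eq_inner using assms
 by (simp add: post_u_def post_v_def inner_simps norm_eq_1 inner_commute algebra_simps)

lemma post_shift:
 assumes "norm om = 1"
 shows "norm (post_u v u om - u) = abs ((v - u) *. om)" "norm (v - post_v v u om) = abs ((v - u) *. om)"
 using assms by (simp_all add: post_u_def post_v_def)

lemma post_measurable [measurable]: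
 assumes [measurable]: "f \<in> borel_measurable M" "g \<in> borel_measurable M" "h \<in> borel_measurable M"
 shows "(%x. post_u (f x) (g x) (h x)) \<in> borel_measurable M" "(%x. post_v (f x) (g x) (h x)) \<in> borel_measurable M"
 unfolding post_u_def post_v_def by measurable

text \<open>A parametrization in the manner of Carleman. For fixed \<open>om\<close>,
  \<open>post_v v u om\<close> depends on \<open>u\<close> only through the component along
  \<open>om\<close>, and the transversal components are integrated out by
  \<open>gauss_slice\<close>. The rest are polar coordinates of \<open>v - post_v v u om\<close>,
  whence the kernel \<open>1 / norm (z - v)\<close>. It decays because \<open>v\<close> and
  \<open>u\<close> are displaced by the same length, which the Gaussians in \<open>u\<close> and
  \<open>post_u\<close> control. In \<open>ka\<close>, half of \<open>c\<close> is reserved for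
  \<open>gauss_slice\<close>, and the outer division by 2 pays for squaring a sum.\<close>

lemma gain_kernel_v:
 fixes g :: "real^3 => ennreal" and v :: "real^3"
 assumes g [measurable]: "g \<in> bm" and c: "0 < c" and d: "0 < d"
 defines "ka == min (c / 2) d / 2"
 shows "(NN u. NS om. ennreal (abs ((v - u) *. om) * gs c u * gs d (post_u v u om)) * g (post_v v u om))
  <= ennreal (4 * pi / c) * (NN z. ennreal (gs ka (z - v) / norm (z - v)) * g z)"
proof -
 let ?d = "NN z. ennreal 2 * (ennreal (gs ka (z - v) / norm (z - v)) * g z)"
 let ?c = "ennreal (2 * pi / c)"
 define G where "G = (%z. ennreal (gs ka z) * g (v - z))"
 let ?e = "NN z. ennreal (2 / norm z) * G z"
 have [measurable]: "G \<in> bm" unfolding G_def by measurable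
 have ka: "ka > 0" using c d by (simp add: ka_def)
 have "(NN u. NS om. ennreal (\<bar>(v - u) *. om\<bar> * gs c u * gs d (post_u v u om)) * g (post_v v u om))
  <= (NN u. NS om. ennreal (gs (c / 2) u) * (ennreal \<bar>v *. om - u *. om\<bar> * G ((v *. om - u *. om) *R om)))"
 proof (rule nn_integral_mono, rule nn_integral_mono_AE, rule AE_mp[OF AE_sphere_norm], rule AE_I2, rule impI)
  fix u om :: "real^3" assume om: "norm om = 1"
  let ?w = "v *. om - u *. om"
  let ?h = "?w *R om"
  have w: "(v - u) *. om = ?w" by (simp add: inner_diff_left)
  let ?a = "post_u v u om"
  have pv: "v - ?w *R om = post_v v u om" by (simp add: post_v_def w)
  have nw: "norm ?h = norm (?a - u)"
   using post_shift(1)[OF om, of v u] om by (simp add: w)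
  have "N2 (?a - u) <= (norm (?a) + norm u)^2"
   by (intro power_mono norm_triangle_ineq4) simp
  also have "... <= 2 * (N2 (?a) + N2 u)"
   using sum_squares_bound[of "norm (?a)" "norm u"] by (simp add: power2_sum)
  finally have "ka * N2 ?h <= 2 * ka * (N2 (?a) + N2 u)"
   unfolding nw using ka by simp
  also have "... = (2 * ka) * N2 (?a) + (2 * ka) * N2 u"
   by (simp add: algebra_simps)
  also have "... <= d * N2 (?a) + c / 2 * N2 u"
   by (intro add_mono mono_r) (auto simp: ka_def)
  finally have "gs c u * gs d (?a) <= gs (c / 2) u * gs ka ?h"
   by (simp add: exp_add[symmetric])
  then have "abs ?w * gs c u * gs d (?a) <= gs (c / 2) u * (abs ?w * gs ka ?h)"
   using mono_l[of _ _ "abs ?w"] by (fastforce simp: ac_simps)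
  then have "ennreal (abs ?w * gs c u * gs d (?a)) <= ennreal (gs (c / 2) u * (abs ?w * gs ka ?h))"
   by (rule ennreal_leI)
  from mono_r[OF this, of "g (post_v v u om)"]
  show "ennreal (\<bar>(v - u) *. om\<bar> * gs c u * gs d (?a)) * g (post_v v u om)
   <= ennreal (gs (c / 2) u) * (ennreal \<bar>?w\<bar> * G ?h)"
   by (simp only: G_def w pv ennreal_mult abs_ge_zero exp_ge_zero mult_nonneg_nonneg mult.assoc zero_le)
 qed
 also have "... = (NS om. NN u. ennreal (gs (c / 2) u) * (ennreal \<bar>v *. om - u *. om\<bar> * G ((v *. om - u *. om) *R om)))"
  by (intro lborel_sphere.Fubini'[symmetric]) measurable
 also have "... <= (NS om. ?c * (NN r. ennreal \<bar>r\<bar> * G (r *R om)))"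
 proof (rule nn_integral_mono_AE, rule AE_mp[OF AE_sphere_norm], rule AE_I2, rule impI)
  fix om :: "real^3" assume om: "norm om = 1"
  let ?g = "NN r. ennreal \<bar>r\<bar> * G (r *R om)"
  let ?f = "NN s. ennreal \<bar>v *. om - s\<bar> * G ((v *. om - s) *R om)"
  let ?b = "NN u. ennreal (gs (c / 2) u) * (ennreal \<bar>v *. om - u *. om\<bar> * G ((v *. om - u *. om) *R om))"
  have "?b
   <= ennreal (pi / (c / 2)) * ?f"
   using c by (intro gauss_slice[where H = "%s. ennreal \<bar>v *. om - s\<bar> * G ((v *. om - s) *R om)"] om) auto
  also have "?f = ?g"
   by (subst (2) nn_integral_real_affine[where c = "-1" and t = "v *. om"]) simp_all
  finally show "?b
   <= ?c * ?g"
   by (simp add: mult.commute)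
 qed
 also have "... = ?c * ?e"
  by (subst nn_integral_cmult) (measurable, simp add: nn_integral_sphere_line)
 also have "?e = ?d"
 proof -
  have "?d
   = (NN z. ennreal 2 * (ennreal (gs ka z / norm z) * g (v - z)))"
   by (subst nn_integral_lborel_scaleR[where c = "-1" and t = v]) simp_all
  also have "... = ?e"
  proof (intro nn_integral_cong)
   fix z :: "real^3"
   have "ennreal (2 / norm z) * ennreal (gs ka z) = ennreal 2 * ennreal (gs ka z / norm z)"
    by (subst (1 2) ennreal_mult[symmetric]) (auto simp: field_simps)
   then show "ennreal 2 * (ennreal (gs ka z / norm z) * g (v - z)) = ennreal (2 / norm z) * G z"
    by (simp only: G_def mult.assoc[symmetric])
  qed
  finally show ?thesis by simp
 qed
 also have "?c * ... = ennreal (4 * pi / c) * (NN z. ennreal (gs ka (z - v) / norm (z - v)) * g z)"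
 proof -
  have "?c * ennreal 2 = ennreal (4 * pi / c)"
   using c by (subst ennreal_mult[symmetric]) auto
  then show ?thesis
   by (subst nn_integral_cmult) (measurable, simp only: mult.assoc[symmetric])
 qed
 finally show ?thesis .
qed

text \<open>For fixed \<open>u\<close>, \<open>sphere_swap\<close> turns the inner integral into
  that of \<open>gain_kernel_v\<close>.\<close>

lemma gain_kernel_u:
 fixes g :: "real^3 => ennreal" and v :: "real^3"
 assumes g [measurable]: "g \<in> bm" and c: "0 < c" and d: "0 < d"
 defines "ka == min (c / 2) d / 2"
 shows "(NN u. NS om. ennreal (abs ((v - u) *. om) * gs c u * gs d (post_v v u om)) * g (post_u v u om))
  <= ennreal (4 * pi / c) * (NN z. ennreal (gs ka (z - v) / norm (z - v)) * g z)"
proof -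
 have "(NS om. ennreal (abs ((v - u) *. om) * gs c u * gs d (post_v v u om)) * g (post_u v u om))
  = (NS om. ennreal (abs ((v - u) *. om) * gs c u * gs d (post_u v u om)) * g (post_v v u om))" for u
 proof -
  define ph where "ph = (%a. ennreal (gs c u * gs d (v - a)) * g (u + a))"
  have ph: "ph \<in> bm" unfolding ph_def by measurable
  have 1: "ennreal (\<bar>(v - u) *. om\<bar> * gs c u * gs d (post_v v u om)) * g (post_u v u om) = ennreal \<bar>(v - u) *. om\<bar> * ph (((v - u) *. om) *R om)" for om
   unfolding ph_def post_u_def post_v_def by (simp add: ennreal_mult mult.assoc)
  have 2: "ennreal (\<bar>(v - u) *. om\<bar> * gs c u * gs d (post_u v u om)) * g (post_v v u om) = ennreal \<bar>(v - u) *. om\<bar> * ph ((v - u) - ((v - u) *. om) *R om)" for om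
  proof -
   have "v - ((v - u) - ((v - u) *. om) *R om) = post_u v u om" "u + ((v - u) - ((v - u) *. om) *R om) = post_v v u om"
    by (simp_all add: post_u_def post_v_def algebra_simps)
   then show ?thesis
    unfolding ph_def by (simp only: ennreal_mult abs_ge_zero exp_ge_zero mult_nonneg_nonneg mult.assoc)
  qed
  show ?thesis
   unfolding 1 2 by (rule sphere_swap[OF ph])
 qed
 then show ?thesis
  using gain_kernel_v[OF g c d, of v] by (simp add: ka_def)
qed

section \<open>Velocity averages of functions that are singular along lines\<close>

lemma powr_mult_le_sum:
 fixes A B r s :: real
 assumes "0 < A" "0 < B" "0 <= r" "0 <= s"
 shows "A powr - r * B powr - s <= A powr - (r + s) + B powr - (r + s)"
proof (cases "A <= B")
 case True
 then have "B powr - s <= A powr - s"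
  using assms by (intro powr_mono2') auto
 then have "A powr - r * B powr - s <= A powr - r * A powr - s"
  by (intro mono_l) auto
 also have "... = A powr - (r + s)"
  by (simp add: powr_add[symmetric])
 finally show ?thesis by (simp add: add_increasing2)
next
 case False
 then have "A powr - r <= B powr - r"
  using assms by (intro powr_mono2') auto
 then have "A powr - r * B powr - s <= B powr - r * B powr - s"
  by (intro mono_r) auto
 also have "... = B powr - (r + s)"
  by (simp add: powr_add[symmetric])
 finally show ?thesis by (simp add: add_increasing)
qed

text \<open>Exponents up to \<open>3 / 4\<close> stay away from 1; each of the two separated
  singularities then contributes at most \<open>2 / (1 - 3 / 4) = 8\<close>.\<close>

lemma nn_integral_gauss_powr_prod:
 assumes "0 < c" "0 <= r" "0 <= s" "r + s <= 3 / 4"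
 shows "(NN x. ennreal (exp (- c * (x - b)^2) * (abs (x - b) powr - r * abs (x - a) powr - s))) <= ennreal (16 + 2 * sqrt (pi / c))"
proof -
 let ?a = "sqrt (pi / c)"
 have "AE x in lborel. x ~= a & x ~= b"
  using AE_lborel_singleton[of a] AE_lborel_singleton[of b] by eventually_elim auto
 then have "(NN x. ennreal (exp (- c * (x - b)^2) * (abs (x - b) powr - r * abs (x - a) powr - s)))
  <= (NN x. ennreal (exp (- c * (x - b)^2) * abs (x - b) powr - (r + s)) + ennreal (exp (- c * (x - b)^2) * abs (x - a) powr - (r + s)))"
 proof (intro nn_integral_mono_AE, eventually_elim)
  fix x assume "x ~= a & x ~= b"
  then have "abs (x - b) powr - r * abs (x - a) powr - s <= abs (x - b) powr - (r + s) + abs (x - a) powr - (r + s)"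
   using assms by (intro powr_mult_le_sum) auto
  then have "exp (- c * (x - b)^2) * (abs (x - b) powr - r * abs (x - a) powr - s) <= exp (- c * (x - b)^2) * (abs (x - b) powr - (r + s) + abs (x - a) powr - (r + s))"
   by (intro mono_l) auto
  then show "ennreal (exp (- c * (x - b)^2) * (abs (x - b) powr - r * abs (x - a) powr - s)) <= ennreal (exp (- c * (x - b)^2) * abs (x - b) powr - (r + s)) + ennreal (exp (- c * (x - b)^2) * abs (x - a) powr - (r + s))"
   by (simp add: ennreal_plus[symmetric] distrib_left ennreal_leI del: ennreal_plus)
 qed
 also have "... = (NN x. ennreal (exp (- c * (x - b)^2) * abs (x - b) powr - (r + s))) + (NN x. ennreal (exp (- c * (x - b)^2) * abs (x - a) powr - (r + s)))"
  by (rule nn_integral_add) measurable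
 also have "... <= ennreal (2 / (1 - (r + s)) + ?a) + ennreal (2 / (1 - (r + s)) + ?a)"
  using assms by (intro add_mono nn_integral_gauss_powr) auto
 also have "... <= ennreal (8 + ?a) + ennreal (8 + ?a)"
  using assms by (intro add_mono ennreal_leI) (auto simp: field_simps)
 also have "... = ennreal (16 + 2 * ?a)"
  using assms by (subst ennreal_plus[symmetric]) auto
 finally show ?thesis .
qed

text \<open>
 The hypothesis is only imposed along each line in the direction \<open>m\<close>, where the positions \<open>a\<close>, \<open>b\<close>
 of the singularities may depend on the line in a non-measurable way.
\<close>

lemma kernel_average:
 assumes ka: "0 < ka" and de: "0 <= de" "de <= 1 / 4" and be: "0 <= be" "be < 1"
 obtains C where "0 < C"
  "!!(g :: real^3 => ennreal) m v h P. [|g \<in> bm; norm m = 1; 0 <= P;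
   !!q. EX a b. ALL s. s ~= a --> s ~= b --> q + s *R m ~= 0 --> q + s *R m + h ~= 0 -->
    g (q + s *R m) <= ennreal ((1 + norm (q + s *R m) powr - de + norm (q + s *R m + h) powr - de) *
      (P * (1 + abs (s - a) powr - be + abs (s - b) powr - be)))|] ==>
   (NN z. ennreal (gs ka (z - v) / norm (z - v)) * g z) <= ennreal (C * P)"
proof -
 let ?b = "sqrt (pi / ka)"
 let ?l = "ennreal (16 + 2 * ?b)"
 \<comment> \<open>\<open>K1\<close> bounds the integral along a line, \<open>K2\<close> each of the
   two transversal integrals.\<close>
 define K1 where "K1 = ?b + 2 * (2 / (1 - be) + ?b)"
 define K2 where "K2 = 3 * (16 + 2 * ?b)"
 have K1: "K1 > 0" using ka be by (simp add: K1_def add_pos_nonneg)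
 have K2: "K2 > 0" using ka by (simp add: K2_def add_pos_nonneg)
 show ?thesis
 proof (rule that[of "K1 * K2 * K2"])
  show "0 < K1 * K2 * K2" using K1 K2 by simp
  fix g :: "real^3 => ennreal" and m v h :: "real^3" and P :: real
  assume g [measurable]: "g \<in> bm" and m: "norm m = 1" and P: "0 <= P"
   and bnd: "!!q. EX a b. ALL s. s ~= a --> s ~= b --> q + s *R m ~= 0 --> q + s *R m + h ~= 0 -->
    g (q + s *R m) <= ennreal ((1 + norm (q + s *R m) powr - de + norm (q + s *R m + h) powr - de) *
      (P * (1 + abs (s - a) powr - be + abs (s - b) powr - be)))"
  let ?f = "ennreal (P * K1)"
  let ?F = "%z. ennreal (gs ka (z - v) / norm (z - v)) * g z"
  have F: "?F \<in> bm" by measurable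
  obtain e2 e3 where e: "norm e2 = 1" "norm e3 = 1" "m *. e2 = 0" "m *. e3 = 0" "e2 *. e3 = 0"
   and eq: "(NN x. ?F x) = (NN a. NN b. NN s. ?F (s *R m + a *R e2 + b *R e3))"
   using nn_integral_frame[OF F m] .
  \<comment> \<open>The factor of one transversal coordinate. The variable \<open>s\<close> must be
    left to the singularities at \<open>a\<close> and \<open>b\<close>, so
    \<open>1 / norm (z - v)\<close> and the powers of \<open>norm z\<close> and
    \<open>norm (z + h)\<close> are dominated by products of powers of the two transversal
    coordinates alone. In each of them the exponents add up to at most
    \<open>1 / 2 + de / 2\<close>, below \<open>3 / 4\<close>.\<close>
  define ph where "ph = (%x y a. exp (- ka * (a - x)^2) * abs (a - x) powr - (1 / 2) * (1 + abs a powr - (de / 2) + abs (a - y) powr - (de / 2)) :: real)"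
  let ?e = "- h *. e3"
  let ?d = "- h *. e2"
  have ph_nn: "ph x y a >= 0" for x y a by (simp add: ph_def)
  have ph_int: "(NN a. ennreal (ph x y a)) <= ennreal K2" for x y
  proof -
   have "ennreal (ph x y a) = ennreal (exp (- ka * (a - x)^2) * (abs (a - x) powr - (1 / 2) * abs (a - x) powr - 0))
    + ennreal (exp (- ka * (a - x)^2) * (abs (a - x) powr - (1 / 2) * abs (a - 0) powr - (de / 2)))
    + ennreal (exp (- ka * (a - x)^2) * (abs (a - x) powr - (1 / 2) * abs (a - y) powr - (de / 2)))" for a
    by (subst ennreal_plus[symmetric], simp, simp, subst ennreal_plus[symmetric]) (auto simp: ph_def algebra_simps intro!: arg_cong[where f = ennreal])
   then have "(NN a. ennreal (ph x y a)) =
    (NN a. ennreal (exp (- ka * (a - x)^2) * (abs (a - x) powr - (1 / 2) * abs (a - x) powr - 0)))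
    + (NN a. ennreal (exp (- ka * (a - x)^2) * (abs (a - x) powr - (1 / 2) * abs (a - 0) powr - (de / 2))))
    + (NN a. ennreal (exp (- ka * (a - x)^2) * (abs (a - x) powr - (1 / 2) * abs (a - y) powr - (de / 2))))"
    by (simp add: nn_integral_add)
   also have "... <= ?l + ?l + ?l"
    using ka de by (intro add_mono nn_integral_gauss_powr_prod) auto
   also have "... = ennreal K2"
    using ka by (simp add: K2_def ennreal_plus[symmetric] del: ennreal_plus)
   finally show ?thesis .
  qed
  have n: "N2 (s *R m + a *R e2 + b *R e3 - u) = (s - u *. m)^2 + (a - u *. e2)^2 + (b - u *. e3)^2 + N2 u - (u *. m)\<^sup>2 - (u *. e2)\<^sup>2 - (u *. e3)\<^sup>2" for s a b u
   unfolding power2_norm_eq_inner using e m by (simp add: inner_simps inner_commute norm_eq_1 sq_eq algebra_simps)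
  \<comment> \<open>In \<open>n\<close>, the coefficients of \<open>u\<close> itself leave only the
    remainder of the Bessel inequality.\<close>
  have bessel: "(u *. m)^2 + (u *. e2)^2 + (u *. e3)^2 <= N2 u" for u
  proof -
   have "0 <= N2 ((u *. m) *R m + (u *. e2) *R e2 + (u *. e3) *R e3 - u)" by simp
   then show ?thesis unfolding n by simp
  qed
  have low: "N2 (s *R m + a *R e2 + b *R e3 - u) >= (s - u *. m)^2 + (a - u *. e2)^2 + (b - u *. e3)^2" for s a b u
   using n[of s a b u] bessel[of u] by linarith
  have sing: "norm (s *R m + a *R e2 + b *R e3 - u) > 0 \<and>
    norm (s *R m + a *R e2 + b *R e3 - u) powr - r <= abs (a - u *. e2) powr - (r / 2) * abs (b - u *. e3) powr - (r / 2)"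
   if "a ~= u *. e2" "b ~= u *. e3" "0 <= r" for s a b u r
  proof -
   let ?z = "s *R m + a *R e2 + b *R e3 - u"
   have "(s - u *. m)^2 >= 0" "(a - u *. e2)^2 >= 0" "(b - u *. e3)^2 >= 0" by simp_all
   then have "abs (a - u *. e2)^2 <= N2 ?z" "abs (b - u *. e3)^2 <= N2 ?z"
    using low[where s = s and u = u and a = a and b = b] unfolding power2_abs by linarith+
   then have le: "abs (a - u *. e2) <= norm ?z" "abs (b - u *. e3) <= norm ?z"
    by (auto simp del: power2_abs intro: power2_le_imp_le)
   then have pos: "norm ?z > 0" using that by (smt (verit))
   have "norm ?z powr - r = norm ?z powr - (r / 2) * norm ?z powr - (r / 2)"
    by (simp add: powr_add[symmetric])
   also have "... <= abs (a - u *. e2) powr - (r / 2) * abs (b - u *. e3) powr - (r / 2)"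
    using that le by (intro mult_mono powr_mono2') auto
   finally show ?thesis using pos by simp
  qed
  have "(NN s. ?F (s *R m + a *R e2 + b *R e3)) <= ?f * (ennreal (ph (v *. e2) ?d a) * ennreal (ph (v *. e3) ?e b))"
   if ab: "a ~= 0" "b ~= 0" "a ~= v *. e2" "b ~= v *. e3" "a ~= - h *. e2" "b ~= - h *. e3" for a b
  proof -
   let ?n = "NN s. ?F (s *R m + a *R e2 + b *R e3)"
   let ?h = "1 + abs b powr - (de / 2) + abs (b - ?e) powr - (de / 2)"
   let ?g = "1 + abs a powr - (de / 2) + abs (a - ?d) powr - (de / 2)"
   let ?c = "a *R e2 + b *R e3"
   let ?a = "abs (a - v *. e2) powr - (1 / 2) * abs (b - v *. e3) powr - (1 / 2)"
   obtain a0 b0 where ab0: "ALL s. s ~= a0 --> s ~= b0 --> ?c + s *R m ~= 0 --> ?c + s *R m + h ~= 0 -->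
    g (?c + s *R m) <= ennreal ((1 + norm (?c + s *R m) powr - de + norm (?c + s *R m + h) powr - de) *
      (P * (1 + abs (s - a0) powr - be + abs (s - b0) powr - be)))"
    using bnd[of "a *R e2 + b *R e3"] by blast
   define M where "M = ph (v *. e2) ?d a * ph (v *. e3) ?e b"
   let ?j = "ennreal (P * M)"
   have M: "M >= 0" by (simp add: M_def ph_nn)
   define S where "S = (%s. exp (- ka * (s - v *. m)^2) * (1 + abs (s - a0) powr - be + abs (s - b0) powr - be))"
   let ?m = "NN s. ennreal (S s)"
   have "AE s in lborel. s ~= a0 & s ~= b0"
    using AE_lborel_singleton[of a0] AE_lborel_singleton[of b0] by eventually_elim auto
   then have "?n <= (NN s. ?j * ennreal (S s))"
   proof (intro nn_integral_mono_AE, eventually_elim)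
    fix s assume s: "s ~= a0 & s ~= b0"
    let ?i = "P * (1 + abs (s - a0) powr - be + abs (s - b0) powr - be)"
    let ?z = "s *R m + a *R e2 + b *R e3"
    let ?k = "norm (?z - v)"
    have z: "?c + s *R m = ?z" by simp
    have s1: "norm ?z > 0" "norm ?z powr - de <= abs a powr - (de / 2) * abs b powr - (de / 2)"
     using sing[of a 0 b de s] ab de by auto
    have s2: "norm (?z + h) > 0" "norm (?z + h) powr - de <= abs (a - ?d) powr - (de / 2) * abs (b - ?e) powr - (de / 2)"
     using sing[of a "- h" b de s] ab de by auto
    have s3: "?k > 0" "?k powr - 1 <= abs (a - v *. e2) powr - (1 / 2) * abs (b - v *. e3) powr - (1 / 2)"
     using sing[of a v b 1 s] ab by auto
    have gz: "g ?z <= ennreal ((1 + norm ?z powr - de + norm (?z + h) powr - de) * ?i)"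
     using ab0[rule_format, of s] s s1(1) s2(1) unfolding z by auto
    define X where "X = exp (- ka * (s - v *. m)^2) * exp (- ka * (a - v *. e2)^2) * exp (- ka * (b - v *. e3)^2)"
    have ex: "gs ka (?z - v) <= X"
     using mono_l[OF low[of s v a b], of ka] ka by (simp add: X_def exp_add[symmetric] algebra_simps)
    have k: "gs ka (?z - v) / ?k <= X * ?a"
    proof -
     have "gs ka (?z - v) / ?k = gs ka (?z - v) * ?k powr - 1"
      using s3(1) by (simp add: powr_minus_divide)
     also have "... <= X * ?a"
      using s3(2) by (intro mult_mono ex) (auto simp: X_def)
     finally show ?thesis .
    qed
    have sum: "1 + norm ?z powr - de + norm (?z + h) powr - de <= ?g * ?h"
    proof -
     have "1 + x * y + z * w <= (1 + x + z) * (1 + y + w)" if "x >= 0" "y >= 0" "z >= 0" "w >= 0" for x y z w :: real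
      using that by (simp add: algebra_simps)
     from this[of "abs a powr - (de / 2)" "abs b powr - (de / 2)" "abs (a - ?d) powr - (de / 2)" "abs (b - ?e) powr - (de / 2)"]
     show ?thesis using s1(2) s2(2) by (auto intro: order_trans[rotated])
    qed
    have "?F ?z <= ennreal (X * ?a) *
      ennreal ((?g * ?h) * ?i)"
     using P by (intro mult_mono ennreal_leI k order_trans[OF gz] mono_r sum) auto
    also have "... = ?j * ennreal (S s)"
     using P M by (subst (1 2) ennreal_mult[symmetric]) (auto simp: M_def S_def X_def ph_def ac_simps intro!: mult_nonneg_nonneg arg_cong[where f = ennreal])
    finally show "?F ?z <= ?j * ennreal (S s)" .
   qed
   also have "... = ?j * ?m"
    by (rule nn_integral_cmult) (simp add: S_def)
   also have "?m <= ennreal K1"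
   proof -
    have "ennreal (S s) = ennreal (exp (- ka * (s - v *. m)^2)) + (ennreal (exp (- ka * (s - v *. m)^2) * abs (s - a0) powr - be) + ennreal (exp (- ka * (s - v *. m)^2) * abs (s - b0) powr - be))" for s
     by (subst ennreal_plus[symmetric], simp, simp, subst ennreal_plus[symmetric]) (auto simp: S_def algebra_simps)
    then have "?m = (NN s. ennreal (exp (- ka * (s - v *. m)^2))) + ((NN s. ennreal (exp (- ka * (s - v *. m)^2) * abs (s - a0) powr - be)) + (NN s. ennreal (exp (- ka * (s - v *. m)^2) * abs (s - b0) powr - be)))"
     by (simp add: nn_integral_add)
    also have "... <= ennreal (?b) + (ennreal (2 / (1 - be) + ?b) + ennreal (2 / (1 - be) + ?b))"
     using ka be by (intro add_mono nn_integral_gauss_powr nn_integral_gauss[THEN eq_refl]) auto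
    also have "... = ennreal K1"
     using ka be by (simp add: K1_def ennreal_plus[symmetric] del: ennreal_plus)
    finally show ?thesis .
   qed
   finally have "?n <= ?j * ennreal K1"
    by (simp add: mono_l)
   also have "... = ?f * (ennreal (ph (v *. e2) ?d a) * ennreal (ph (v *. e3) ?e b))"
    using P M K1 ph_nn by (simp add: M_def ennreal_mult[symmetric] ac_simps)
   finally show ?thesis .
  qed note inner = this
  have "(NN x. ?F x) <= (NN a. NN b. ?f * (ennreal (ph (v *. e2) ?d a) * ennreal (ph (v *. e3) ?e b)))"
   unfolding eq
  proof (rule nn_integral_mono_AE)
   have "AE a in lborel. a ~= 0 & a ~= v *. e2 & a ~= - h *. e2"
    using AE_lborel_singleton[of 0] AE_lborel_singleton[of "v *. e2"] AE_lborel_singleton[of "- h *. e2"] by eventually_elim auto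
   then show "AE a in lborel. (NN b. NN s. ?F (s *R m + a *R e2 + b *R e3)) <=
    (NN b. ?f * (ennreal (ph (v *. e2) ?d a) * ennreal (ph (v *. e3) ?e b)))"
   proof eventually_elim
    case (elim a)
    have "AE b in lborel. b ~= 0 & b ~= v *. e3 & b ~= - h *. e3"
     using AE_lborel_singleton[of 0] AE_lborel_singleton[of "v *. e3"] AE_lborel_singleton[of "- h *. e3"] by eventually_elim auto
    then show ?case
     by (intro nn_integral_mono_AE, eventually_elim) (use elim inner in blast)
   qed
  qed
  also have "... = ?f * ((NN a. ennreal (ph (v *. e2) ?d a)) * (NN b. ennreal (ph (v *. e3) ?e b)))"
  proof -
   have [measurable]: "ph x y \<in> bm" for x y unfolding ph_def by measurable
   show ?thesis by (simp add: nn_integral_cmult nn_integral_multc)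
  qed
  also have "... <= ?f * (ennreal K2 * ennreal K2)"
   by (intro mono_l mult_mono ph_int) auto
  also have "... = ennreal (K1 * K2 * K2 * P)"
   using P K1 K2 by (simp add: ennreal_mult[symmetric] ac_simps)
  finally show "(NN z. ?F z) <= ennreal (K1 * K2 * K2 * P)" .
 qed
qed

section \<open>Characteristics outside the obstacle\<close>

context convex_obstacle
begin

lemma concave_comb:
 assumes "0 <= l" "l <= 1"
 shows "(1 - l) * xi x + l * xi y <= xi ((1 - l) *R x + l *R y)"
proof -
 let ?z = "(1 - l) *R x + l *R y"
 have 1: "xi w <= xi ?z + grad xi ?z *. (w - ?z)" for w
 proof -
  have "0 <= th / 2 * N2 (w - ?z)" using th_pos by simp
  then show ?thesis using concave[of w ?z] by linarith
 qed
 have "(1 - l) * xi x + l * xi y <= (1 - l) * (xi ?z + grad xi ?z *. (x - ?z)) + l * (xi ?z + grad xi ?z *. (y - ?z))"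
  using assms by (intro add_mono mono_l 1) auto
 also have "... = xi ?z + grad xi ?z *. ((1 - l) *R (x - ?z) + l *R (y - ?z))"
  by (simp only: inner_add_right inner_scaleR_right) (simp add: algebra_simps)
 also have "(1 - l) *R (x - ?z) + l *R (y - ?z) = 0"
  by (simp add: algebra_simps)
 finally show ?thesis by simp
qed

text \<open>The concavity inequalities at the midpoint are added for both ends; their linear terms
  cancel.\<close>

lemma strong_mid: "(xi x + xi y) / 2 + th / 8 * N2 (x - y) <= xi ((1 / 2) *R (x + y))"
proof -
 define z where "z = (1 / 2) *R (x + y)"
 have e: "x - z = (1 / 2) *R (x - y)" "y - z = - ((1 / 2) *R (x - y))"
  by (simp_all add: z_def vec_eq_iff field_simps)
 define E where "E = th / 8 * N2 (x - y)"
 have n: "th / 2 * N2 ((1 / 2) *R (x - y)) = E"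
  by (simp add: E_def power_divide)
 have "xi x + xi y <= 2 * xi z - 2 * E"
  using concave[of x z] concave[of y z] unfolding e norm_minus_cancel n inner_minus_right by linarith
 then show ?thesis unfolding E_def[symmetric] z_def[symmetric] by (simp add: field_simps)
qed

lemma c0_ge: "xi0 <= xi c0"
 using center[of c0] r0_pos by simp

lemma closure_obstacle: "closure (obstacle xi) = {x. 0 <= xi x}"
proof
 let ?a = "closure (obstacle xi)"
 have "closed {x. 0 <= xi x}"
  by (intro closed_Collect_le continuous_on_const cont)
 then show "?a \<subseteq> {x. 0 <= xi x}"
  by (intro closure_minimal) (auto simp: obstacle_def)
 show "{x. 0 <= xi x} \<subseteq> ?a"
 proof
  fix x assume "x \<in> {x. 0 <= xi x}"
  then have x: "0 <= xi x" by simp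
  have "(1 - 1 / real (Suc n)) *R x + (1 / real (Suc n)) *R c0 \<in> obstacle xi" for n
  proof -
   have "0 < (1 / real (Suc n)) * xi c0" using c0_ge xi0_pos by simp
   moreover have "0 <= (1 - 1 / real (Suc n)) * xi x" using x by simp
   ultimately show ?thesis
    using concave_comb[of "1 / real (Suc n)" x c0] by (simp add: obstacle_def)
  qed
  moreover have "(%n. (1 - 1 / real (Suc n)) *R x + (1 / real (Suc n)) *R c0) \<longlonglongrightarrow> (1 - 0) *R x + 0 *R c0"
   by (intro tendsto_intros LIMSEQ_Suc[OF lim_1_over_n])
  ultimately show "x \<in> ?a"
   unfolding closure_sequential by (intro exI conjI allI) (assumption, simp)
 qed
qed

lemma Om_eq: "Om xi = {x. xi x < 0}"
 by (auto simp: Om_def closure_obstacle)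

lemma bd_eq: "bd xi = {x. xi x = 0}"
proof -
 let ?b = "interior {x. 0 <= xi x}"
 have "x \<notin> ?b" if x: "xi x = 0" for x
 proof
  let ?c = "norm (c0 - x)"
  assume "x \<in> ?b"
  then obtain e where e: "0 < e" "ball x e \<subseteq> {x. 0 <= xi x}"
   by (meson mem_interior)
  \<comment> \<open>If \<open>x\<close> were interior to the set \<open>0 <= xi\<close>, the segment
    from \<open>c0\<close> could be prolonged beyond \<open>x\<close> by the fraction
    \<open>k\<close>. Then \<open>x\<close> would be a proper convex combination of
    \<open>c0\<close> and a point with \<open>0 <= xi\<close>, and \<open>xi x\<close> would be
    positive.\<close>
  define k where "k = e / (2 * (1 + ?c))"
  let ?a = "x - k *R (c0 - x)"
  let ?d = "(1 - k / (1 + k)) *R ?a + (k / (1 + k)) *R c0"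
  have k: "k > 0" using e by (simp add: k_def add_pos_nonneg)
  have "k * ?c <= k * (1 + ?c)"
   using k by simp
  also have "... = e / 2"
  proof -
   have "1 + ?c > 0" using norm_ge_zero[of "c0 - x"] by linarith
   then show ?thesis unfolding k_def by (simp add: divide_simps)
  qed
  finally have "k * ?c <= e / 2" .
  then have "x - k *R (c0 - x) \<in> ball x e" using e k by (simp add: dist_norm)
  with e(2) have y: "0 <= xi ?a" by blast
  have eq: "?d = x"
  proof -
   have "1 - k / (1 + k) = 1 / (1 + k)" using k by (simp add: field_simps)
   then have "?d
    = (1 / (1 + k)) *R (?a + k *R c0)"
    by (simp add: scaleR_add_right)
   also have "?a + k *R c0 = (1 + k) *R x" by (simp add: algebra_simps)
   finally show ?thesis using k by simp
  qed
  have "0 < k / (1 + k) * xi c0" using k c0_ge xi0_pos by simp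
  moreover have "0 <= (1 - k / (1 + k)) * xi ?a"
   using y k by (intro mult_nonneg_nonneg) auto
  ultimately have "0 < xi x"
   using concave_comb[of "k / (1 + k)" "x - k *R (c0 - x)" c0] k unfolding eq by auto
  with x show False by simp
 qed
 moreover have "x \<in> ?b" if "0 < xi x" for x
 proof (rule interiorI)
  show "open {x. 0 < xi x}" by (intro open_Collect_less continuous_on_const cont)
 qed (use that in auto)
 ultimately have "?b = {x. 0 < xi x}"
  using interior_subset[of "{x. 0 <= xi x}"] by (auto simp: order_less_le)
 moreover have "closed {x. 0 <= xi x}"
  by (intro closed_Collect_le continuous_on_const cont)
 moreover have "frontier (Om xi) = frontier {x. 0 <= xi x}"
  unfolding Om_def closure_obstacle by (rule frontier_complement)
 ultimately show ?thesis
  unfolding bd_def frontier_def by (auto simp: closure_closed)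
qed

lemma Om_bar_eq: "Om_bar xi = {x. xi x <= 0}"
 by (auto simp: Om_bar_def Om_eq bd_eq)

text \<open>Concavity makes \<open>xi\<close> climb from \<open>0\<close> at \<open>p\<close> to at
  least \<open>xi0\<close> at \<open>c0\<close> within the distance \<open>2 * R\<close>, at most at
  the initial slope.\<close>

lemma grad_lower:
 assumes "xi p = 0"
 shows "xi0 / (2 * R) <= norm (grad xi p)"
proof -
 have "0 <= th / 2 * N2 (c0 - p)" using th_pos by simp
 then have "xi0 <= grad xi p *. (c0 - p)"
  using concave[of c0 p] c0_ge assms by linarith
 also have "... <= norm (grad xi p) * norm (c0 - p)" by (rule norm_cauchy_schwarz)
 also have "... <= norm (grad xi p) * (2 * R)"
  using bounded[of p] bounded[of c0] assms c0_ge xi0_pos norm_triangle_ineq4[of c0 p]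
  by (intro mono_l) auto
 finally show ?thesis using R_ge_1 by (simp add: field_simps)
qed

lemma grad_pos: "xi p = 0 ==> 0 < norm (grad xi p)"
 using grad_lower[of p] xi0_pos R_ge_1 by (smt (verit) divide_pos_pos)

lemma norm_normal: "xi p = 0 ==> norm (normal_vec xi p) = 1"
 using grad_pos[of p] by (simp add: normal_vec_def)

lemma refl_linear: "linear (refl_vel xi p)"
 by (rule linearI) (simp_all add: refl_vel_def inner_simps algebra_simps)

lemma norm_refl:
 assumes "xi p = 0"
 shows "norm (refl_vel xi p v) = norm v"
proof -
 have "N2 (refl_vel xi p v) = N2 v"
  unfolding power2_norm_eq_inner using norm_normal[OF assms]
  by (simp add: refl_vel_def inner_simps norm_eq_1 inner_commute algebra_simps)
 then show ?thesis by simp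
qed

lemma normal_inner: "xi p = 0 ==> normal_vec xi p *. v = (grad xi p *. v) / norm (grad xi p)"
 by (simp add: normal_vec_def divide_inverse mult.commute)

lemma grad_refl: "xi p = 0 ==> grad xi p *. refl_vel xi p v = - (grad xi p *. v)"
proof -
 assume p: "xi p = 0"
 have "grad xi p = norm (grad xi p) *R normal_vec xi p"
  using grad_pos[OF p] by (simp add: normal_vec_def)
 moreover have "normal_vec xi p *. refl_vel xi p v = - (normal_vec xi p *. v)"
  using norm_normal[OF p] by (simp add: refl_vel_def inner_simps norm_eq_1)
 ultimately show ?thesis
  by (metis inner_scaleR_left mult_minus_right)
qed

section \<open>Hitting times and the reflected flow\<close>

lemma concave_line:
 "xi (x - ta *R v) <= xi (x - si *R v) - (ta - si) * (grad xi (x - si *R v) *. v) - th / 2 * ((ta - si)^2 * N2 v)"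
proof -
 have e: "(x - ta *R v) - (x - si *R v) = (- (ta - si)) *R v"
  by (simp add: algebra_simps)
 have n: "(norm ((- (ta - si)) *R v))^2 = (ta - si)^2 * N2 v"
  by (simp only: norm_scaleR power_mult_distrib power2_abs power2_minus)
 show ?thesis
  using concave[of "x - ta *R v" "x - si *R v"] unfolding e n inner_scaleR_right by linarith
qed

lemma cont_line: "continuous_on UNIV (%ta. xi (x - ta *R v))"
 by (intro continuous_on_compose2[OF cont] continuous_intros) auto

text \<open>The hit case includes grazing rays and, with \<open>ta = 0\<close>, boundary points from
  which the backward ray enters the obstacle at once. The sign of the gradient expresses that first
  contact is made from outside; otherwise the ray would have been inside the obstacle shortly
  before.\<close>

lemma t_b_cases:
 assumes x: "xi x <= 0"
 obtains (miss) "t_b xi x v = \<infinity>" "!!ta. 0 < ta ==> xi (x - ta *R v) < 0"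
 | (hit) ta where "t_b xi x v = ereal ta" "0 <= ta" "xi (x - ta *R v) = 0"
   "!!si. 0 < si ==> si < ta ==> xi (x - si *R v) < 0"
   "grad xi (x - ta *R v) *. v <= 0"
proof (cases "ALL ta>0. xi (x - ta *R v) < 0")
 case True
 have ge: "ereal (max B 0) <= t_b xi x v" for B
  unfolding t_b_def using True by (intro SUP_upper) (auto simp: Om_eq)
 have "ereal B <= t_b xi x v" for B
  by (rule order_trans[OF _ ge[of B]]) simp
 then have "t_b xi x v = \<infinity>"
  by (rule ereal_top)
 with True miss show ?thesis by blast
next
 let ?b = "La * N2 v"
 case False
 define Z where "Z = {ta. 0 < ta & 0 <= xi (x - ta *R v)}"
 obtain z where "0 < z" "0 <= xi (x - z *R v)" using False by (auto simp: not_less)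
 then have Zne: "Z ~= {}" by (auto simp: Z_def)
 have Zbd: "bdd_below Z" by (rule bdd_belowI[of _ 0]) (auto simp: Z_def)
 define ta where "ta = Inf Z"
 let ?c = "x - ta *R v"
 have ta0: "0 <= ta" unfolding ta_def by (rule cInf_greatest[OF Zne]) (auto simp: Z_def)
 have before: "xi (x - si *R v) < 0" if "0 < si" "si < ta" for si
  using cInf_lower[OF _ Zbd, of si] that unfolding ta_def by (force simp: Z_def)
 have after: "EX si:Z. si < s" if "ta < s" for s
  using that Zne Zbd unfolding ta_def by (simp add: cInf_less_iff)
 have t_b: "t_b xi x v = ereal ta"
  unfolding t_b_def
 proof (rule SUP_eqI)
  fix s assume "s \<in> {s. 0 <= s & (ALL ta:{0<..<s}. x - ta *R v \<in> Om xi)}"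
  then have s: "0 <= s" "!!si. 0 < si ==> si < s ==> xi (x - si *R v) < 0" by (auto simp: Om_eq)
  show "ereal s <= ereal ta"
  proof (rule ccontr)
   assume "~ ereal s <= ereal ta"
   then obtain si where "si \<in> Z" "si < s" using after[of s] by auto
   then show False using s(2)[of si] by (auto simp: Z_def)
  qed
 next
  fix y assume "!!s. s \<in> {s. 0 <= s & (ALL ta:{0<..<s}. x - ta *R v \<in> Om xi)} ==> ereal s <= y"
  then show "ereal ta <= y" using ta0 before by (auto simp: Om_eq)
 qed
 have cont_at: "isCont (%ta. xi (x - ta *R v)) ta"
  using cont_line by (simp add: continuous_on_eq_continuous_at)
 have ge: "0 <= xi ?c"
 proof (rule ccontr)
  assume "~ 0 <= xi ?c"
  then have "eventually (%si. xi (x - si *R v) < 0) (nhds ta)"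
   using cont_at by (intro order_tendstoD(2)[of "%ta. xi (x - ta *R v)" "xi ?c"]) (auto simp: isCont_def tendsto_at_iff_tendsto_nhds[of "%ta. xi (x - ta *R v)" ta])
  then obtain e where e: "0 < e" "!!si. dist si ta < e ==> xi (x - si *R v) < 0"
   by (auto simp: eventually_nhds_metric)
  obtain si where "si \<in> Z" "si < ta + e" using after[of "ta + e"] e by auto
  moreover have "ta <= si" using \<open>si \<in> Z\<close> Zbd by (simp add: ta_def cInf_lower)
  ultimately show False using e(2)[of si] by (auto simp: Z_def dist_real_def)
 qed
 have le: "xi ?c <= 0"
 proof (cases "ta = 0")
  case False
  then have ta: "0 < ta" using ta0 by simp
  show ?thesis
  proof (rule tendsto_upperbound[of "%ta. xi (x - ta *R v)" _ "at_left ta"])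
   show "((%ta. xi (x - ta *R v)) \<longlongrightarrow> xi (x - ta *R v)) (at_left ta)"
    using cont_at unfolding isCont_def by (rule tendsto_mono[OF at_le, rotated]) simp
   have "eventually (%si. si \<in> {0<..<ta}) (at_left ta)"
    using ta by (rule eventually_at_left_real)
   then show "eventually (%si. xi (x - si *R v) <= 0) (at_left ta)"
    by eventually_elim (auto dest!: before)
  qed simp
 qed (use x in simp)
 have "grad xi ?c *. v <= 0"
 proof (rule ccontr)
  let ?p = "x - ta *R v"
  let ?a = "grad xi ?p"
  assume "~ ?a *. v <= 0"
  then have G: "0 < ?a *. v" by simp
  have neg: "xi (x - si *R v) < 0" if "ta < si" for si
  proof -
   have "0 < (si - ta) * (?a *. v)" using G that by simp
   moreover have "0 <= th / 2 * ((si - ta)^2 * N2 v)" using th_pos by simp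
   ultimately show ?thesis
    using concave_line[of x si v ta] le by linarith
  qed
  obtain si where "si \<in> Z" using Zne by blast
  moreover from this have "ta <= si" using Zbd by (simp add: ta_def cInf_lower)
  ultimately have ta: "0 < ta"
   using neg[of si] ta0 by (cases "ta = si") (auto simp: Z_def)
  have v: "v ~= 0" using G by auto
  \<comment> \<open>Small enough that the quadratic term of \<open>quad_lower\<close> is at most
    half the linear one, that the point stays in the ball where it holds, and that the time remains
    positive.\<close>
  define e where "e = min (ta / 2) (min (1 / norm v) ((?a *. v) / ?b))"
  have e: "0 < e" "e < ta" "e * norm v <= 1" "e * ?b <= ?a *. v"
  proof -
   show "0 < e" using ta v G La_ge_1 by (auto simp: e_def)
   have "e <= ta / 2" unfolding e_def by (rule min.coboundedI1[OF order_refl])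
   then show "e < ta" using ta by simp
   have "e <= 1 / norm v" unfolding e_def by (rule min.coboundedI2[OF min.coboundedI1[OF order_refl]])
   then show "e * norm v <= 1" using v by (simp add: field_simps)
   have "e <= (?a *. v) / ?b" unfolding e_def by (rule min.coboundedI2[OF min.coboundedI2[OF order_refl]])
   then show "e * ?b <= ?a *. v" using v La_ge_1 by (simp add: pos_le_divide_eq)
  qed
  let ?y = "x - (ta - e) *R v"
  have y: "?y - ?p = e *R v" by (simp add: algebra_simps)
  have np: "norm ?p <= R" using ge by (rule bounded)
  have "norm ?y <= R + 4"
   using norm_triangle_ineq[of ?p "e *R v"] y np e by (auto simp: algebra_simps)
  then have "xi ?p + ?a *. (?y - ?p) - La / 2 * N2 (?y - ?p) <= xi ?y"
   using np by (intro quad_lower) auto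
  then have "e * (?a *. v) - (e * (e * ?b)) / 2 <= xi ?y"
   using ge le e unfolding y by (simp add: power_mult_distrib sq_eq algebra_simps)
  moreover have "e * (e * ?b) <= e * (?a *. v)"
   using e by (intro mono_l) auto
  moreover have "0 < e * (?a *. v)" using e G by simp
  ultimately have "0 < xi ?y" by linarith
  then show False using before[of "ta - e"] e by auto
 qed
 with t_b ta0 ge le before hit show ?thesis by (metis order_antisym)
qed

text \<open>The characteristics only depend on the elapsed time \<open>r = t - s\<close>.\<close>

definition flow :: "real => real^3 => real^3 => real^3" where "flow r x v = Xc xi 0 r x v"

definition vel :: "real => real^3 => real^3 => real^3" where "vel r x v = Vc xi 0 r x v"

lemma Xc_flow: "Xc xi s t x v = flow (t - s) x v"
 by (simp add: Xc_def flow_def algebra_simps)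

lemma Vc_vel: "Vc xi s t x v = vel (t - s) x v"
 by (simp add: Vc_def vel_def)

lemma flow_cases:
 assumes x: "xi x <= 0" and r: "0 <= r"
 obtains (free) "ereal r < t_b xi x v" "flow r x v = x - r *R v" "vel r x v = v" "!!si. 0 <= si ==> si <= r ==> xi (x - si *R v) <= 0"
 | (refl) ta where "t_b xi x v = ereal ta" "0 <= ta" "ta <= r" "xi (x - ta *R v) = 0"
  "!!si. 0 <= si ==> si <= ta ==> xi (x - si *R v) <= 0" "grad xi (x - ta *R v) *. v <= 0"
  "flow r x v = x - ta *R v - (r - ta) *R refl_vel xi (x - ta *R v) v" "vel r x v = refl_vel xi (x - ta *R v) v"
proof (cases rule: t_b_cases[OF x, of v, case_names miss hit])
 case miss
 show ?thesis
 proof (rule free)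
  show "xi (x - si *R v) <= 0" if "0 <= si" for si
   using miss(2)[of si] that x by (cases "si = 0") auto
 qed (use miss in \<open>auto simp: flow_def vel_def Xc_def Vc_def\<close>)
next
 case (hit ta)
 have le: "xi (x - si *R v) <= 0" if "0 <= si" "si <= ta" for si
  using hit(4)[of si] hit(3) x that by (cases "si = 0"; cases "si = ta") auto
 show ?thesis
 proof (cases "r < ta")
  case True
  then show ?thesis
   using hit(1) le by (intro free) (auto simp: flow_def vel_def Xc_def Vc_def)
 next
  case False
  then show ?thesis
   using hit le by (intro refl[of ta]) (auto simp: flow_def vel_def Xc_def Vc_def x_b_def algebra_simps)
 qed
qed

lemma norm_vel:
 assumes "xi x <= 0" "0 <= r"
 shows "norm (vel r x v) = norm v"
 using assms by (cases rule: flow_cases[of x r v]) (simp_all add: norm_refl)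

lemma refl_line_bound:
 assumes p: "xi p = 0" and A: "grad xi p *. v <= 0" and ro: "0 <= ro"
 shows "xi (p - ro *R refl_vel xi p v) <= - (th / 2 * (ro^2 * N2 v))"
proof -
 have "0 <= ro * - (grad xi p *. v)" using A ro by (intro mult_nonneg_nonneg) auto
 then show ?thesis
  using concave_line[of p ro "refl_vel xi p v" 0] p A by (simp add: grad_refl norm_refl)
qed

text \<open>Beyond \<open>q\<close> strong concavity has brought \<open>xi\<close> below its value
  at \<open>x\<close>, so that a compact interval of times decides.\<close>

lemma ray_max:
 assumes "v ~= 0"
 obtains m where "0 <= m" "!!si. 0 <= si ==> xi (x - si *R v) <= xi (x - m *R v)"
proof -
 let ?a = "grad xi x *. v"
 define q where "q = abs ?a / (th / 2 * N2 v)"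
 have q: "0 <= q" using th_pos by (simp add: q_def)
 obtain m where m: "m \<in> {0..q}" "!!si. si \<in> {0..q} ==> xi (x - si *R v) <= xi (x - m *R v)"
  using continuous_attains_sup[of "{0..q}" "%ta. xi (x - ta *R v)"] q continuous_on_subset[OF cont_line] by (metis atLeastatMost_empty_iff2 compact_Icc linorder_not_le subset_UNIV)
 have far: "xi (x - si *R v) <= xi x" if "q <= si" for si
 proof -
  have "si * abs ?a = si * (q * (th / 2 * N2 v))"
   using assms th_pos by (simp add: q_def)
  also have "... <= si * (si * (th / 2 * N2 v))"
   using that q th_pos by (intro mono_l mono_r) auto
  finally have "- si * ?a <= th / 2 * (si^2 * N2 v)"
   using that q abs_ge_minus_self[of "si * ?a"] by (simp add: abs_mult sq_eq ac_simps)
  then show ?thesis using concave_line[of x si v 0] by simp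
 qed
 have max: "xi (x - si *R v) <= xi (x - m *R v)" if "0 <= si" for si
  using m(2)[of si] far[of si] m(2)[of 0] that q by (cases "si <= q") auto
 show ?thesis using m(1) max by (intro that[of m]) auto
qed

text \<open>Whether or not there is a reflection, the distance from the obstacle in terms of
  \<open>xi\<close> grows quadratically from one instant \<open>r1\<close>; this is what makes
  negative powers of \<open>- xi\<close> integrable in time. For a reflected trajectory
  \<open>r1\<close> is the time of impact. Otherwise it is the time when \<open>xi\<close> is
  largest on the ray, and \<open>strong_mid\<close> takes the place of the vanishing derivative
  there.\<close>

lemma flow_depth:
 assumes x: "xi x <= 0"
 obtains r1 where "!!r. 0 <= r ==> xi (flow r x v) <= - (th / 4 * N2 v * (r - r1)^2)"
proof (cases rule: t_b_cases[OF x, of v, case_names miss hit])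
 case miss
 have "EX m. ALL r>=0. xi (x - r *R v) <= - (th / 4 * N2 v * (r - m)^2)"
 proof (cases "v = 0")
  case False
  obtain m where m: "0 <= m" and max: "!!si. 0 <= si ==> xi (x - si *R v) <= xi (x - m *R v)"
   using ray_max[OF False] by metis
  let ?a = "x - m *R v"
  have "xi (x - r *R v) <= - (th / 4 * N2 v * (r - m)^2)" if "0 <= r" for r
  proof -
   have mid: "(1 / 2) *R (?a + (x - r *R v)) = x - ((m + r) / 2) *R v"
    by (simp add: vec_eq_iff field_simps)
   have d: "?a - (x - r *R v) = (r - m) *R v"
    by (simp add: algebra_simps)
   have "xi (x - ((m + r) / 2) *R v) <= xi ?a"
    using that m by (intro max) auto
   then have "xi (x - r *R v) <= xi ?a - th / 4 * ((r - m)^2 * N2 v)"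
    using strong_mid[of "x - m *R v" "x - r *R v"] unfolding mid d norm_scaleR power_mult_distrib power2_abs
    by (simp add: field_simps)
   moreover have "xi ?a <= 0"
    using miss(2)[of m] m x by (cases "m = 0") auto
   ultimately show ?thesis by (simp add: mult_ac)
  qed
  then show ?thesis by blast
 qed (use x in auto)
 then obtain m where "ALL r>=0. xi (x - r *R v) <= - (th / 4 * N2 v * (r - m)^2)" by blast
 moreover have "flow r x v = x - r *R v" for r
  using miss(1) by (simp add: flow_def Xc_def)
 ultimately show ?thesis by (intro that[of m]) auto
next
 case (hit ta)
 let ?p = "x - ta *R v"
 have "xi (flow r x v) <= - (th / 4 * N2 v * (r - ta)^2)" if r: "0 <= r" for r
 proof -
  have w: "th / 4 * N2 v * (r - ta)^2 <= th / 2 * ((r - ta)^2 * N2 v)"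
   using th_pos by simp
  show ?thesis
  proof (cases "r < ta")
   case True
   then have "flow r x v = x - r *R v"
    using hit(1) by (simp add: flow_def Xc_def)
   moreover have "0 <= (r - ta) * (grad xi ?p *. v)"
    using True hit(5) by (intro mult_nonpos_nonpos) auto
   ultimately show ?thesis
    using concave_line[of x r v ta] hit(3) w by (simp only:)
  next
   case False
   then have "flow r x v = ?p - (r - ta) *R refl_vel xi ?p v"
    using hit(1) by (simp add: flow_def Xc_def x_b_def algebra_simps)
   moreover have "xi (?p - (r - ta) *R refl_vel xi ?p v) <= - (th / 2 * ((r - ta)^2 * N2 v))"
    using False by (intro refl_line_bound hit) simp
   ultimately show ?thesis using w by (simp only:)
  qed
 qed
 then show ?thesis by (intro that[of ta]) auto
qed

lemma flow_le_0:
 assumes "xi x <= 0" "0 <= r"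
 shows "xi (flow r x v) <= 0"
proof -
 have "- (th / 4 * N2 v * (r - q)^2) <= 0" for q using th_pos by simp
 then show ?thesis
  using flow_depth[OF assms(1), of v] assms(2) by (metis order_trans)
qed

lemma tangent_plane:
 assumes "xi p = 0" "0 <= xi q"
 shows "0 <= normal_vec xi p *. (q - p)"
proof -
 have "0 <= th / 2 * N2 (q - p)" using th_pos by simp
 then have "0 <= grad xi p *. (q - p)"
  using concave[of q p] assms by linarith
 then show ?thesis by (simp add: normal_inner assms)
qed

text \<open>
 Reflection at a convex obstacle is dispersing: with \<open>y = x - r v\<close> and \<open>X = y - 2 k n\<close>, the
 difference \<open>|X - X'|^2 - |y - y'|^2\<close> is bounded below by a perfect square.
\<close>

lemma reflected_flow_expands:
 assumes x: "xi x <= 0" and r: "0 <= r" and hits: "t_b xi x v <= ereal r" "t_b xi x v' <= ereal r"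
 shows "r * norm (v - v') <= norm (flow r x v - flow r x v')"
proof -
 let ?b = "flow r x v - flow r x v'"
 obtain ta where ta: "0 <= ta" "ta <= r" "xi (x - ta *R v) = 0" "grad xi (x - ta *R v) *. v <= 0"
  "flow r x v = x - ta *R v - (r - ta) *R refl_vel xi (x - ta *R v) v" "t_b xi x v = ereal ta"
  using hits(1) by (cases rule: flow_cases[OF x r, of v]) auto
 obtain ta' where ta': "0 <= ta'" "ta' <= r" "xi (x - ta' *R v') = 0" "grad xi (x - ta' *R v') *. v' <= 0"
  "flow r x v' = x - ta' *R v' - (r - ta') *R refl_vel xi (x - ta' *R v') v'" "t_b xi x v' = ereal ta'"
  using hits(2) by (cases rule: flow_cases[OF x r, of v']) auto
 let ?d = "r - ta'"
 show ?thesis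
 proof (cases "xi x = 0")
  \<comment> \<open>A trajectory that starts on the boundary and hits does so at time 0, and
    reflection is an isometry.\<close>
  case True
  have "ta = 0" if "t_b xi x v = ereal ta" "0 <= ta" "xi (x - ta *R v) = 0" for ta v
  proof (rule ccontr)
   assume "ta ~= 0"
   with that have ta: "0 < ta" by simp
   have mid: "(1 / 2) *R (x + (x - ta *R v)) = x - (ta / 2) *R v"
    by (simp add: vec_eq_iff field_simps)
   have "0 <= xi (x - (ta / 2) *R v)"
   proof -
    have "0 <= th / 8 * N2 (x - (x - ta *R v))" using th_pos by simp
    then show ?thesis
     using strong_mid[of x "x - ta *R v"] True that(3) unfolding mid by simp
   qed
   then show False
    using ta that(1) by (cases rule: t_b_cases[OF x, of v]) (auto simp: not_less[symmetric])
  qed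
  then have "ta = 0" "ta' = 0" using ta ta' by auto
  then have "flow r x v - flow r x v' = - (r *R (refl_vel xi x v - refl_vel xi x v'))"
   using ta(5) ta'(5) by (simp add: algebra_simps)
  also have "refl_vel xi x v - refl_vel xi x v' = refl_vel xi x (v - v')"
   by (simp add: linear_diff[OF refl_linear])
  finally show ?thesis using norm_refl[OF True] r by simp
 next
  case False
  have pos: "0 < ta" "0 < ta'"
   using False ta ta' by (auto simp: less_le)
  define p p' n n' where "p = x - ta *R v" and "p' = x - ta' *R v'" and "n = normal_vec xi p" and "n' = normal_vec xi p'"
  define al al' where "al = - (n *. v)" and "al' = - (n' *. v')"
  let ?c = "ta / ta' * al^2 + ta' / ta * al'^2 - 2 * (al * al')"
  define k k' where "k = (r - ta) * al" and "k' = ?d * al'"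
  define y y' where "y = x - r *R v" and "y' = x - r *R v'"
  let ?a = "k * (n *. (y' - p)) + k' * (n' *. (y - p')) - 2 * (k * k') * (n *. n')"
  have p0: "xi p = 0" "xi p' = 0" using ta ta' by (simp_all add: p_def p'_def)
  have nn: "n *. n = 1" "n' *. n' = 1"
   using norm_normal p0 by (simp_all add: n_def n'_def norm_eq_1[symmetric])
  have al: "0 <= al" "0 <= al'"
   using ta(4) ta'(4) p0 by (simp_all add: al_def al'_def n_def n'_def normal_inner p_def[symmetric] p'_def[symmetric] divide_le_0_iff)
  have k: "0 <= k" "0 <= k'" using al ta ta' by (simp_all add: k_def k'_def)
  have X: "flow r x v = y - (2 * k) *R n" "flow r x v' = y' - (2 * k') *R n'"
   unfolding ta(5) ta'(5) refl_vel_def p_def[symmetric] p'_def[symmetric] n_def[symmetric] n'_def[symmetric]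
   by (simp_all add: y_def y'_def p_def p'_def k_def k'_def al_def al'_def algebra_simps)
  have yn: "y *. n = p *. n + k" "y' *. n' = p' *. n' + k'"
   by (simp_all add: y_def y'_def p_def p'_def k_def k'_def al_def al'_def inner_simps inner_commute algebra_simps)
  have tp: "0 <= n *. (p' - p)" "0 <= n' *. (p - p')"
   using tangent_plane p0 by (simp_all add: n_def n'_def)
  \<comment> \<open>Relative to the tangent plane at \<open>p\<close>, \<open>x\<close> is at height
    \<open>- ta * al\<close> and \<open>p'\<close> at nonnegative height; the slope of the ray
    between them is continued to \<open>y'\<close>.\<close>
  have b: "?d * (ta / ta') * al <= n *. (y' - p)"
  proof -
   have "n *. (y' - p) = n *. (p' - p) + ?d * (n *. (- v'))"
    by (simp add: y'_def p'_def inner_simps algebra_simps)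
   moreover have "ta' * (n *. (- v')) = n *. (p' - p) + ta * al"
    by (simp add: p'_def p_def al_def inner_simps algebra_simps)
   then have "ta * al <= ta' * (n *. (- v'))" using tp by linarith
   then have "(ta / ta') * al <= n *. (- v')" using pos by (simp add: field_simps)
   then have "?d * ((ta / ta') * al) <= ?d * (n *. (- v'))"
    using ta' by (intro mono_l) auto
   ultimately show ?thesis using tp by (simp add: mult.assoc)
  qed
  have b': "(r - ta) * (ta' / ta) * al' <= n' *. (y - p')"
  proof -
   have "n' *. (y - p') = n' *. (p - p') + (r - ta) * (n' *. (- v))"
    by (simp add: y_def p_def inner_simps algebra_simps)
   moreover have "ta * (n' *. (- v)) = n' *. (p - p') + ta' * al'"
    by (simp add: p'_def p_def al'_def inner_simps algebra_simps)
   then have "ta' * al' <= ta * (n' *. (- v))" using tp by linarith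
   then have "(ta' / ta) * al' <= n' *. (- v)" using pos by (simp add: field_simps)
   then have "(r - ta) * ((ta' / ta) * al') <= (r - ta) * (n' *. (- v))"
    using ta by (intro mono_l) auto
   ultimately show ?thesis using tp by (simp add: mult.assoc)
  qed
  have nle: "n *. n' <= 1"
   using norm_cauchy_schwarz[of n n'] norm_normal p0 by (simp add: n_def n'_def)
  define Z where "Z = (r - ta) * ?d"
  have Z: "0 <= Z" using ta ta' by (simp add: Z_def)
  \<comment> \<open>Up to positive factors this is the square of
    \<open>ta * al - ta' * al'\<close>.\<close>
  have "0 <= Z * (ta / ta' * al^2 + ta' / ta * al'^2 - 2 * (al * al'))"
  proof (rule mult_nonneg_nonneg[OF Z])
   have "?c = (ta * al - ta' * al')^2 / (ta * ta')"
    using pos by (simp add: field_simps sq_eq)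
   then show "0 <= ?c"
    using pos by simp
  qed
  also have "... = k * (?d * (ta / ta') * al) + k' * ((r - ta) * (ta' / ta) * al') - 2 * (k * k')"
   by (simp only: Z_def k_def k'_def sq_eq ring_distribs) (simp add: mult_ac)
  also have "... <= ?a"
  proof -
   have "k * k' * (n *. n') <= k * k' * 1" using k nle by (intro mono_l) auto
   then show ?thesis
    using mono_l[OF b k(1)] mono_l[OF b' k(2)] by simp
  qed
  finally have main: "0 <= ?a" .
  have "N2 ?b - N2 (y - y')
    = 4 * (k * (n *. (y' - p)) + k' * (n' *. (y - p')) - 2 * (k * k') * (n *. n'))"
  proof -
   define d where "d = k *R n - k' *R n'"
   have X2: "flow r x v - flow r x v' = (y - y') - 2 *R d"
    unfolding X by (simp add: d_def algebra_simps)
   have "N2 ?b - N2 (y - y') = 4 * (d *. d - (y - y') *. d)"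
    unfolding X2 power2_norm_eq_inner by (simp add: inner_simps inner_commute algebra_simps)
   also have "d *. d = k^2 + k'^2 - 2 * (k * k') * (n *. n')"
    using nn by (simp add: d_def inner_simps inner_commute sq_eq algebra_simps)
   also have "(y - y') *. d = k * (y *. n - y' *. n) - k' * (y *. n' - y' *. n')"
    by (simp add: d_def inner_simps algebra_simps)
   also have "k^2 + k'^2 - 2 * (k * k') * (n *. n') - (k * (y *. n - y' *. n) - k' * (y *. n' - y' *. n'))
     = ?a"
    unfolding yn by (simp add: inner_simps inner_commute sq_eq algebra_simps)
   finally show ?thesis .
  qed
  with main have "N2 (y - y') <= N2 ?b"
   by (metis diff_ge_0_iff_ge mult_nonneg_nonneg zero_le_numeral)
  then have "norm (y - y') <= norm ?b"
   by (rule power2_le_imp_le) simp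
  moreover have "y - y' = - (r *R (v - v'))" by (simp add: y_def y'_def algebra_simps)
  ultimately show ?thesis using r by simp
 qed
qed

end

section \<open>Deviation of two characteristics\<close>

context convex_obstacle
begin

definition tau :: "real^3 => real^3 => real" where "tau x v = real_of_ereal (t_b xi x v)"

text \<open>The normal velocity at impact times the norm of \<open>grad xi\<close>, which lies
  between \<open>ga\<close> and \<open>La\<close> on the boundary. It has a meaning only for rays
  that hit: otherwise \<open>tau\<close> is the default value \<open>0\<close> of
  \<open>real_of_ereal\<close> at infinity.\<close>

definition rate :: "real^3 => real^3 => real" where
 "rate x v = - (grad xi (x - tau x v *R v) *. v)"

definition ga :: real where "ga = xi0 / (2 * R)"

lemma ga_pos: "0 < ga"
 using xi0_pos R_ge_1 by (simp add: ga_def)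

lemma rate_bound:
 assumes "xi (x - tau x v *R v) = 0"
 shows "rate x v <= La * norm v"
proof -
 let ?a = "x - tau x v *R v"
 have "norm ?a <= R" using assms by (intro bounded) simp
 then have "norm (grad xi ?a) <= La" by (intro grad_bound) simp
 then have "norm (grad xi ?a) * norm v <= La * norm v"
  by (intro mono_r) auto
 then show ?thesis
  using Cauchy_Schwarz_ineq2[of "grad xi ?a" v] unfolding rate_def by linarith
qed

lemma normal_lip:
 assumes "xi p = 0" "xi q = 0"
 shows "norm (normal_vec xi p - normal_vec xi q) <= 2 * La / ga * norm (p - q)"
proof -
 let ?a = "grad xi p" and ?b = "grad xi q"
 let ?e = "?a - ?b"
 let ?d = "1 / norm ?a"
 let ?c = "(norm ?b - norm ?a) / norm ?b"
 have a: "ga <= norm ?a" and b: "0 < norm ?b"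
  using grad_lower[OF assms(1)] grad_pos[OF assms(2)] by (simp_all add: ga_def)
 have a0: "0 < norm ?a" using a ga_pos by linarith
 have "norm p <= R" "norm q <= R" using assms bounded by simp_all
 then have lip: "norm ?e <= La * norm (p - q)" by (intro grad_lip) auto
 have "normal_vec xi p - normal_vec xi q = ?d *R (?e + ?c *R ?b)"
 proof -
  have "?d * ?c = 1 / norm ?a - 1 / norm ?b"
   using a0 b by (simp add: field_simps)
  then have "?d *R (?e + ?c *R ?b)
   = ?d *R ?e + (1 / norm ?a - 1 / norm ?b) *R ?b"
   by (simp only: scaleR_add_right scaleR_scaleR)
  also have "... = normal_vec xi p - normal_vec xi q"
   by (simp add: normal_vec_def scaleR_diff_right scaleR_left_diff_distrib inverse_eq_divide)
  finally show ?thesis by simp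
 qed
 then have "norm (normal_vec xi p - normal_vec xi q) = ?d * norm (?e + ?c *R ?b)"
  using a0 by simp
 also have "... <= ?d * (norm ?e + norm (?c *R ?b))"
  by (intro mono_l norm_triangle_ineq) simp
 also have "norm (?c *R ?b) = abs (norm ?b - norm ?a)"
  using b by simp
 also have "?d * (norm ?e + abs (norm ?b - norm ?a)) <= (1 / ga) * (La * norm (p - q) + La * norm (p - q))"
  using lip norm_triangle_ineq3[of ?a ?b] a ga_pos
  by (intro mult_mono add_mono) (auto simp: frac_le abs_minus_commute)
 finally show ?thesis by (simp add: field_simps)
qed

lemma refl_diff:
 assumes "xi p = 0" "xi q = 0"
 shows "norm (refl_vel xi p v - refl_vel xi q v') <= norm (v - v') + 8 * La / ga * norm (p - q) * norm v'"
proof -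
 let ?b = "refl_vel xi q v'"
 let ?n = "normal_vec xi p" and ?m = "normal_vec xi q"
 let ?a = "?n - ?m"
 let ?c = "(- (?a *. v')) *R ?n - (?m *. v') *R ?a"
 have n: "norm ?n = 1" "norm ?m = 1" using norm_normal assms by auto
 have e1: "refl_vel xi p v - ?b = refl_vel xi p (v - v') + (refl_vel xi p v' - ?b)"
  by (simp add: linear_diff[OF refl_linear])
 have "norm (refl_vel xi p v - ?b) <= norm (v - v') + norm (refl_vel xi p v' - ?b)"
  unfolding e1 by (rule order_trans[OF norm_triangle_ineq]) (simp add: norm_refl[OF assms(1)])
 also have "refl_vel xi p v' - ?b = 2 *R ?c"
  by (simp add: refl_vel_def inner_simps algebra_simps)
 also have "norm (2 *R ?c) <= 2 * (abs (?a *. v') + abs (?m *. v') * norm ?a)"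
  using norm_triangle_ineq4[of "(- (?a *. v')) *R ?n" "(?m *. v') *R ?a"] n by simp
 also have "... <= 2 * (norm ?a * norm v' + (1 * norm v') * norm ?a)"
  using Cauchy_Schwarz_ineq2[of "?n - ?m" v'] Cauchy_Schwarz_ineq2[of ?m v'] n
  by (intro mono_l add_mono mono_r) auto
 also have "... = 4 * norm ?a * norm v'" by simp
 also have "... <= 4 * (2 * La / ga * norm (p - q)) * norm v'"
  using normal_lip[OF assms] by (intro mono_r mono_l) auto
 finally show ?thesis by (simp add: field_simps)
qed

text \<open>The later of two reflections: \<open>(x', v')\<close> hits at time \<open>ta' >= ta\<close>.\<close>

lemma hit_times:
 assumes p: "xi (x - ta *R v) = 0" and p': "xi (x' - ta' *R v') = 0" and q: "xi (x' - ta *R v') <= 0"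
  and ta: "0 <= ta" "ta <= ta'" "ta <= 1" and D: "norm (x - x') <= 1" "norm (v - v') <= 1"
 shows "(ta' - ta) * - (grad xi (x' - ta' *R v') *. v') + th / 2 * ((ta' - ta)^2 * N2 v') <= La * (norm (x - x') + ta * norm (v - v'))"
proof -
 let ?a = "La * (norm (x - x') + ta * norm (v - v'))"
 let ?q = "x' - ta *R v'" and ?p = "x - ta *R v"
 have e1: "?p - ?q = (x - x') - ta *R (v - v')" by (simp add: algebra_simps)
 have pq: "norm (?p - ?q) <= norm (x - x') + ta * norm (v - v')"
  unfolding e1 by (rule order_trans[OF norm_triangle_ineq4]) (use ta in simp)
 have "ta * norm (v - v') <= 1" using ta D by (intro mult_le_one) auto
 then have "norm (?p - ?q) <= 2" using pq D by linarith
 moreover have "norm ?p <= R" using p by (intro bounded) simp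
 ultimately have "norm ?q <= R + 4" using norm_triangle_sub[of ?q ?p] by (simp add: norm_minus_commute)
 then have g: "norm (grad xi ?q) <= La" by (rule grad_bound)
 have "0 <= th / 2 * N2 (?p - ?q)" using th_pos by simp
 then have "- xi ?q <= grad xi ?q *. (?p - ?q)" using concave[of ?p ?q] p by linarith
 also have "... <= norm (grad xi ?q) * norm (?p - ?q)" by (rule norm_cauchy_schwarz)
 also have "... <= ?a"
  using g pq La_ge_1 by (intro mult_mono) auto
 finally have "- xi ?q <= ?a" .
 moreover have "xi ?q <= 0 - (ta - ta') * (grad xi (x' - ta' *R v') *. v') - th / 2 * ((ta - ta')^2 * N2 v')"
  using concave_line[of x' ta v' ta'] p' by simp
 ultimately show ?thesis by (simp add: power2_commute algebra_simps)
qed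

text \<open>One characteristic is reflected at time \<open>ta\<close> and the other stays free up to time \<open>r\<close>.\<close>

lemma hit_miss:
 assumes p: "xi (x - ta *R v) = 0" and A: "A = - (grad xi (x - ta *R v) *. v)" "0 <= A"
  and free: "!!si. 0 <= si ==> si <= r ==> xi (x' - si *R v') <= 0"
  and ta: "0 <= ta" "ta <= r" "r <= 1" and D: "norm (x - x') <= 1" "norm (v - v') <= 1"
 shows "((r - ta) * A <= 2 * La * (norm (x - x') + r * norm (v - v')) & (r - ta) * (La * N2 v) <= A) \<or>
  (A^2 <= 2 * La^2 * N2 v * (norm (x - x') + norm (v - v')) \<and>
  A^2 <= 2 * La^2 * N2 v * (norm (x - x') + ta * norm (v - v')) + 2 * La * A * norm (v - v'))"
proof (cases "v = 0")
 case True
 with A show ?thesis by simp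
next
 let ?e = "grad xi (x - ta *R v)"
 let ?d = "norm (x - x')"
 let ?c = "La * N2 v"
 let ?b = "norm (v - v')"
 case False
 \<comment> \<open>The ray of \<open>x\<close>, prolonged past its impact without reflection, is
   inside the obstacle by \<open>ro * A\<close> to first order, while the nearby free ray is still
   outside. The restriction \<open>ro * norm v <= 1\<close> keeps all points in the ball of the
   Taylor bounds.\<close>
 have key: "ro * A - La / 2 * (ro^2 * N2 v) <= La * (?d + (ta + ro) * ?b)"
  if ro: "0 <= ro" "ta + ro <= r" "ro * norm v <= 1" for ro
 proof -
  let ?p = "x - ta *R v" and ?q = "x - (ta + ro) *R v" and ?q' = "x' - (ta + ro) *R v'"
  have np: "norm ?p <= R" using p by (intro bounded) simp
  have qp: "?q - ?p = - (ro *R v)" by (simp add: algebra_simps)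
  then have nqp: "norm (?q - ?p) <= 1" using ro by simp
  have nq: "norm ?q <= R + 1"
   using norm_triangle_sub[of ?q ?p] nqp np by linarith
  have e1: "?q - ?q' = (x - x') - (ta + ro) *R (v - v')" by (simp add: algebra_simps)
  have d: "norm (?q - ?q') <= ?d + (ta + ro) * ?b"
   unfolding e1 by (rule order_trans[OF norm_triangle_ineq4]) (use ta ro in simp)
  have "(ta + ro) * ?b <= 1" using ta ro D by (intro mult_le_one) auto
  then have "norm (?q - ?q') <= 2" using d D by linarith
  then have "norm ?q' <= R + 4" using norm_triangle_sub[of ?q' ?q] nq by (simp add: norm_minus_commute)
  then have g: "norm (grad xi ?q') <= La" by (rule grad_bound)
  have "xi ?p + grad xi ?p *. (?q - ?p) - La / 2 * N2 (?q - ?p) <= xi ?q"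
   using np nq by (intro quad_lower) auto
  then have "ro * A - La / 2 * (ro^2 * N2 v) <= xi ?q"
   unfolding qp using p A by (simp add: power_mult_distrib)
  also have "... <= xi ?q' + grad xi ?q' *. (?q - ?q')"
  proof -
   have "0 <= th / 2 * N2 (?q - ?q')" using th_pos by simp
   then show ?thesis using concave[of ?q ?q'] by linarith
  qed
  also have "... <= 0 + norm (grad xi ?q') * norm (?q - ?q')"
   using free[of "ta + ro"] ta ro by (intro add_mono norm_cauchy_schwarz) auto
  also have "... <= 0 + La * (?d + (ta + ro) * ?b)"
   using g d La_ge_1 by (intro add_mono mult_mono) auto
  finally show ?thesis by simp
 qed
 \<comment> \<open>The time at which the parabola \<open>ro * A - La / 2 * (ro^2 * N2 v)\<close> is
   largest. If less time than this has elapsed since the impact, the first alternative results,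
   otherwise the bounds for \<open>A^2\<close>.\<close>
 define ro0 where "ro0 = A / ?c"
 let ?a = "?d + (ta + ro0) * ?b"
 have L: "0 < La * N2 v" using False La_ge_1 by simp
 have ro0: "0 <= ro0" "ro0 * ?c = A"
 proof -
  show "0 <= ro0" unfolding ro0_def using A(2) less_imp_le[OF L] by (rule divide_nonneg_nonneg)
  show "ro0 * ?c = A" unfolding ro0_def using L by (metis less_irrefl nonzero_eq_divide_eq)
 qed
 have "A <= La * norm v"
 proof -
  have "norm (x - ta *R v) <= R" using p by (intro bounded) simp
  then have "norm (?e) <= La" by (intro grad_bound) simp
  then have "norm (?e) * norm v <= La * norm v"
   by (intro mono_r) auto
  then show ?thesis
   using Cauchy_Schwarz_ineq2[of "?e" v] unfolding A(1) by linarith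
 qed
 then have ro0v: "ro0 * norm v <= 1"
  using False La_ge_1 by (simp add: ro0_def sq_eq field_simps)
 show ?thesis
 proof (cases "r - ta <= ro0")
  case True
  have h: "(r - ta) * ?c <= A"
   using mono_r[OF True, of "La * N2 v"] L ro0 by simp
  have "(r - ta) * norm v <= 1"
   using mono_r[OF True, of "norm v"] ro0v by simp
  then have "(r - ta) * A - La / 2 * ((r - ta)^2 * N2 v) <= La * (?d + r * ?b)"
   using key[of "r - ta"] ta by simp
  moreover have "(r - ta) * ((r - ta) * ?c) <= (r - ta) * A"
   using h ta by (intro mono_l) auto
  ultimately have "(r - ta) * A <= 2 * La * (?d + r * ?b)"
   by (simp add: sq_eq algebra_simps)
  with h show ?thesis by blast
 next
  case False
  have r0: "ta + ro0 <= r" using False by simp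
  have k: "ro0 * A - La / 2 * (ro0^2 * N2 v) <= La * ?a"
   using key[OF ro0(1) r0 ro0v] .
  have "La / 2 * (ro0^2 * N2 v) = ro0 * A / 2"
   using ro0(2) by (simp add: sq_eq algebra_simps)
  with k have "ro0 * A <= 2 * (La * ?a)"
   by (simp add: field_simps)
  then have "(ro0 * A) * ?c <= (2 * (La * ?a)) * ?c"
   using L by (intro mono_r) auto
  moreover have "(ro0 * A) * ?c = A * (ro0 * ?c)"
   by (simp only: mult_ac)
  then have "(ro0 * A) * ?c = A^2"
   unfolding ro0(2) by (simp only: sq_eq)
  moreover have "(2 * (La * Y)) * ?c = 2 * La^2 * N2 v * Y" for Y
   by (simp add: sq_eq)
  ultimately have A2: "A^2 <= 2 * La^2 * N2 v * ?a"
   by (simp only:)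
  have "(ta + ro0) * ?b <= 1 * ?b"
   using r0 ta by (intro mono_r) auto
  then have "2 * La^2 * N2 v * ?a <= 2 * La^2 * N2 v * (?d + ?b)"
   by (intro mono_l) auto
  moreover have "2 * La^2 * N2 v * ?a = 2 * La^2 * N2 v * (?d + ta * ?b) + 2 * La * (ro0 * ?c) * ?b"
   by (simp add: sq_eq algebra_simps)
  ultimately show ?thesis using A2 unfolding ro0(2) by simp
 qed
qed

section \<open>The square-root scale and the Lipschitz scale of deviation\<close>

definition sig :: "real => real^3 => real^3 => real" where
 "sig t x v = (if t_b xi x v <= ereal t then norm v / rate x v else 0)"

definition nongrazing :: "real => real^3 => real^3 => bool" where
 "nongrazing t x v \<longleftrightarrow> (t_b xi x v <= ereal t --> 0 < rate x v)"

definition lip_dev :: "real => real^3 => real^3 => real^3 => real^3 => real" where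
 "lip_dev t x v x' v' = (norm (x - x') + tau x v * norm (v - v')) * sig t x v +
  (norm (x - x') + tau x' v' * norm (v - v')) * sig t x' v'"

text \<open>While one trajectory is already reflected and the other still free, their velocities may
  differ by a multiple of \<open>rate x v\<close>. This is not small, but it lasts only as long as
  \<open>r - tau x v\<close> is at most \<open>D / rate x v\<close>, so that the time integral is at
  most \<open>D\<close>.\<close>

definition jump :: "real => real^3 => real^3 => real => real" where
 "jump D x v r = (if t_b xi x v <= ereal r & (r - tau x v) * rate x v <= D then rate x v else 0)"

text \<open>The admissible position errors: the square root always, the Lipschitz quantity away from
  grazing. With \<open>e\<close> abstract each deviation estimate is proved once for both purposes,
  the final Hoelder bound and the regularity of the averages.\<close>

definition dev_bound :: "real => real^3 => real^3 => real^3 => real^3 => real => bool" where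
 "dev_bound t x v x' v' e \<longleftrightarrow> e = sqrt (norm (x - x') + norm (v - v')) \<or>
  (nongrazing t x v & nongrazing t x' v' & e = lip_dev t x v x' v')"

lemma dev_bound_sym: "dev_bound t x v x' v' e ==> dev_bound t x' v' x v e"
 by (auto simp: dev_bound_def lip_dev_def norm_minus_commute add.commute)

definition BD :: real where "BD = 2 + 4 * La^2 + sqrt (2 * La / th)"

lemma BD_bounds: "1 <= BD" "2 <= BD" "La <= BD" "2 * La <= BD" "4 * La <= BD" "2 * La^2 <= BD" "sqrt (2 * La / th) <= BD"
proof -
 have l: "La <= La^2" using La_ge_1 self_le_power[of La 2] by simp
 have s: "0 <= sqrt (2 * La / th)" using La_ge_1 th_pos by simp
 show "1 <= BD" "2 <= BD" "La <= BD" "2 * La <= BD" "4 * La <= BD" "2 * La^2 <= BD" "sqrt (2 * La / th) <= BD"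
  using l s La_ge_1 unfolding BD_def by linarith+
qed

lemma hit_facts:
 assumes "t_b xi x v = ereal ta" "xi (x - ta *R v) = 0" "grad xi (x - ta *R v) *. v <= 0"
 shows "tau x v = ta" "rate x v = - (grad xi (x - ta *R v) *. v)" "0 <= rate x v" "rate x v <= La * norm v"
proof -
 show t: "tau x v = ta" using assms by (simp add: tau_def)
 show r: "rate x v = - (grad xi (x - ta *R v) *. v)" by (simp add: rate_def t)
 then show "0 <= rate x v" using assms by simp
 show "rate x v <= La * norm v" using rate_bound[of x v] assms by (simp add: t)
qed

lemma sig_nonneg:
 assumes "xi x <= 0"
 shows "0 <= sig t x v" "t_b xi x v <= ereal t ==> 0 <= tau x v & tau x v <= t" "0 <= tau x v"
proof -
 show "0 <= sig t x v"
 proof (cases "t_b xi x v <= ereal t")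
  case True
  then have "0 <= rate x v"
   by (cases rule: t_b_cases[OF assms, of v]) (auto simp: hit_facts)
  then show ?thesis by (simp add: sig_def)
 qed (simp add: sig_def)
 show "t_b xi x v <= ereal t ==> 0 <= tau x v & tau x v <= t"
  by (cases rule: t_b_cases[OF assms, of v]) (auto simp: tau_def)
 show "0 <= tau x v"
  by (cases rule: t_b_cases[OF assms, of v]) (auto simp: tau_def)
qed

lemma lip_dev_nonneg: "xi x <= 0 ==> xi x' <= 0 ==> 0 <= lip_dev t x v x' v'"
 unfolding lip_dev_def by (intro add_nonneg_nonneg mult_nonneg_nonneg sig_nonneg) auto

lemma dev_bound_nonneg: "xi x <= 0 ==> xi x' <= 0 ==> dev_bound t x v x' v' e ==> 0 <= e"
 by (auto simp: dev_bound_def lip_dev_nonneg)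

lemma lip_dev_ge:
 assumes "xi x <= 0" "xi x' <= 0" "t_b xi x v <= ereal t"
 shows "(norm (x - x') + tau x v * norm (v - v')) * (norm v / rate x v) <= lip_dev t x v x' v'"
proof -
 have "0 <= (norm (x - x') + tau x' v' * norm (v - v')) * sig t x' v'"
  using assms by (intro mult_nonneg_nonneg add_nonneg_nonneg sig_nonneg) auto
 then show ?thesis using assms(3) by (simp add: lip_dev_def sig_def)
qed

text \<open>Linear quantities are below \<open>e\<close> on both scales, up to a constant: the
  square root dominates because the distances are at most 1, and on a hit \<open>sig\<close> is at
  least \<open>1 / La\<close>.\<close>

lemma dev_bound_hit:
 assumes x: "xi x <= 0" "xi x' <= 0" and hit: "t_b xi x v = ereal ta" "xi (x - ta *R v) = 0" "grad xi (x - ta *R v) *. v <= 0"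
  and ta: "0 <= ta" "ta <= t" "t <= 1" and D: "norm (x - x') <= 1" "norm (v - v') <= 1" and e: "dev_bound t x v x' v' e"
 shows "norm (x - x') + ta * norm (v - v') <= BD * e"
 using e unfolding dev_bound_def
proof (elim disjE conjE)
 let ?a = "norm (v - v')"
 define s where "s = norm (x - x') + ?a"
 assume "e = sqrt (norm (x - x') + ?a)"
 then have es: "e = sqrt s" by (simp add: s_def)
 have s: "0 <= s" "s <= 2" using D by (simp_all add: s_def)
 have "ta * ?a <= 1 * ?a" using ta by (intro mono_r) auto
 then have "norm (x - x') + ta * ?a <= s" by (simp add: s_def)
 also have "s = sqrt s * sqrt s" using s by simp
 also have "... <= sqrt 4 * sqrt s" using s by (intro mono_r real_sqrt_le_mono) auto
 also have "... <= BD * e" using BD_bounds(2) s by (simp add: es mono_r)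
 finally show ?thesis .
next
 assume ng: "nongrazing t x v" and e: "e = lip_dev t x v x' v'"
 note h = hit_facts[OF hit]
 have le: "t_b xi x v <= ereal t" using hit ta by simp
 then have r: "0 < rate x v" using ng by (simp add: nongrazing_def)
 have 1: "1 <= La * (norm v / rate x v)" using h(4) r by (simp add: field_simps)
 have "norm (x - x') + ta * norm (v - v') <= (norm (x - x') + ta * norm (v - v')) * (La * (norm v / rate x v))"
  using mono_l[OF 1, of "norm (x - x') + ta * norm (v - v')"] ta by simp
 also have "... = La * ((norm (x - x') + tau x v * norm (v - v')) * (norm v / rate x v))"
  by (simp add: h(1))
 also have "... <= La * e"
  unfolding e using La_ge_1 by (intro mono_l lip_dev_ge x le) auto
 also have "... <= BD * e"
  using BD_bounds(3) lip_dev_nonneg[OF x] by (intro mono_r) (auto simp: e)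
 finally show ?thesis .
qed

text \<open>In \<open>hit_times\<close> the quadratic term, present by uniform convexity, yields the
  square root, and the linear term with the factor \<open>rate\<close> yields the Lipschitz
  bound.\<close>

lemma dev_bound_times:
 assumes x: "xi x <= 0" "xi x' <= 0"
  and hit: "t_b xi x v = ereal ta" "xi (x - ta *R v) = 0"
  and hit': "t_b xi x' v' = ereal ta'" "xi (x' - ta' *R v') = 0" "grad xi (x' - ta' *R v') *. v' <= 0" "xi (x' - ta *R v') <= 0"
  and ta: "0 <= ta" "ta <= ta'" "ta' <= t" "t <= 1" and D: "norm (x - x') <= 1" "norm (v - v') <= 1" and e: "dev_bound t x v x' v' e"
 shows "(ta' - ta) * norm v' <= BD * e"
proof -
 let ?d = "rate x' v'"
 let ?c = "norm (x - x')"
 let ?b = "ta' - ta"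
 let ?a = "norm (v - v')"
 note h = hit_facts[OF hit'(1-3)]
 have key: "?b * ?d + th / 2 * (?b^2 * N2 v') <= La * (?c + ta * ?a)"
  unfolding h(2) using ta D by (intro hit_times hit hit') auto
 have nn: "0 <= ?b * ?d" using h(3) ta by (intro mult_nonneg_nonneg) auto
 show ?thesis
  using e unfolding dev_bound_def
 proof (elim disjE conjE)
  assume e: "e = sqrt (?c + ?a)"
  define s where "s = ?c + ?a"
  have "ta * ?a <= 1 * ?a" using ta by (intro mono_r) auto
  then have "La * (?c + ta * ?a) <= La * s" using La_ge_1 by (intro mono_l) (auto simp: s_def)
  then have "th / 2 * ((?b * norm v')^2) <= La * s" using key nn by (simp add: power_mult_distrib)
  then have "(?b * norm v')^2 <= 2 * La / th * s" using th_pos by (simp add: field_simps)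
  then have "?b * norm v' <= sqrt (2 * La / th * s)" by (rule real_le_rsqrt)
  also have "... = sqrt (2 * La / th) * e" unfolding e s_def by (rule real_sqrt_mult)
  also have "... <= BD * e" using BD_bounds(7) by (intro mono_r) (auto simp: e)
  finally show ?thesis .
 next
  assume ng: "nongrazing t x' v'" and e: "e = lip_dev t x v x' v'"
  have le: "t_b xi x' v' <= ereal t" using hit' ta by simp
  then have r: "0 < ?d" using ng by (simp add: nongrazing_def)
  have "0 <= th / 2 * (?b^2 * N2 v')" using th_pos by simp
  then have "?b * ?d <= La * (?c + ta * ?a)" using key by linarith
  also have "... <= La * (?c + ta' * ?a)"
   using ta La_ge_1 by (intro mono_l add_mono mono_r) auto
  finally have "(?b * ?d) * (norm v' / ?d) <= (La * (?c + ta' * ?a)) * (norm v' / ?d)"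
   using r by (intro mono_r) auto
  then have "?b * norm v' <= La * ((norm (x' - x) + tau x' v' * norm (v' - v)) * (norm v' / ?d))"
   using r by (simp add: h(1) norm_minus_commute)
  also have "... <= La * lip_dev t x' v' x v"
   using La_ge_1 by (intro mono_l lip_dev_ge x le) auto
  also have "lip_dev t x' v' x v = e" by (simp add: e lip_dev_def norm_minus_commute add.commute)
  also have "La * e <= BD * e"
   using BD_bounds(3) lip_dev_nonneg[OF x] by (intro mono_r) (auto simp: e)
  finally show ?thesis .
 qed
qed

text \<open>The two hypotheses \<open>deep\<close> come from the second alternative of
  \<open>hit_miss\<close>, one for each scale: \<open>lip_dev\<close> weights
  \<open>norm (v - v')\<close> with the time of impact, and the discrepancy is the last term of the
  second hypothesis.\<close>

lemma dev_bound_deep: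
 assumes x: "xi x <= 0" "xi x' <= 0" and hit: "t_b xi x v = ereal ta" "xi (x - ta *R v) = 0" "grad xi (x - ta *R v) *. v <= 0"
  and ta: "0 <= ta" "ta <= t" and e: "dev_bound t x v x' v' e"
  and deep: "(rate x v)^2 <= 2 * La^2 * N2 v * (norm (x - x') + norm (v - v'))"
  "(rate x v)^2 <= 2 * La^2 * N2 v * (norm (x - x') + ta * norm (v - v')) + 2 * La * rate x v * norm (v - v')"
 shows "rate x v <= BD * (norm (v - v') + norm v * e)"
 using e unfolding dev_bound_def
proof (elim disjE conjE)
 let ?a = "norm (x - x') + norm (v - v')"
 assume e: "e = sqrt ?a"
 have "(rate x v)^2 <= (2 * La * norm v * e)^2"
 proof -
  have "2 * La^2 * N2 v * ?a <= 2 * (2 * La^2 * N2 v * ?a)"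
   by simp
  also have "... = (2 * La * norm v * e)^2" by (simp add: e power_mult_distrib)
  finally show ?thesis using deep(1) by (rule order_trans[rotated])
 qed
 then have "rate x v <= 2 * La * norm v * e"
  using La_ge_1 by (intro power2_le_imp_le[of "rate x v" "2 * La * norm v * e"]) (auto simp: e)
 also have "... = (2 * La) * (norm v * e)" by (simp only: mult.assoc)
 also have "... <= BD * (norm v * e)"
  using BD_bounds(4) by (intro mono_r) (simp_all add: e)
 also have "... <= BD * (norm (v - v') + norm v * e)"
  using BD_bounds(1) by (intro mono_l) auto
 finally show ?thesis .
next
 let ?b = "norm (v - v')"
 note h = hit_facts[OF hit]
 assume ng: "nongrazing t x v" and e: "e = lip_dev t x v x' v'"
 have le: "t_b xi x v <= ereal t" using hit ta by simp
 then have r: "0 < rate x v" using ng by (simp add: nongrazing_def)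
 have "(rate x v)^2 / rate x v <= (2 * La^2 * N2 v * (norm (x - x') + ta * ?b) + 2 * La * rate x v * ?b) / rate x v"
  using r deep(2) by (intro divide_right_mono) auto
 then have "rate x v <= 2 * La^2 * (norm v * ((norm (x - x') + tau x v * ?b) * (norm v / rate x v))) + 2 * La * ?b"
  using r by (simp add: h(1) sq_eq add_divide_distrib mult_ac)
 also have "... <= BD * (norm v * e) + BD * ?b"
  unfolding e using BD_bounds La_ge_1 r ta by (intro add_mono mult_mono lip_dev_ge x le mono_r) (auto simp: h(1))
 finally show ?thesis by (simp add: algebra_simps)
qed

end

section \<open>Comparison of a pair of trajectories\<close>

lemma norm_triangle3:
 fixes a b c :: "'a::real_normed_vector"
 shows "norm (a - b + c) <= norm a + norm b + norm c" "norm (a - b - c) <= norm a + norm b + norm c"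
 using norm_triangle_ineq[of "a - b" c] norm_triangle_ineq4[of "a - b" c] norm_triangle_ineq4[of a b] by linarith+

context convex_obstacle
begin

definition CD :: real where "CD = 1 + 3 * BD + 16 * La / ga * BD + 4 * La / ga + 2 * BD / ga + 2 / ga"

lemma CD_bounds: "1 <= CD" "3 * BD + 16 * La / ga * BD + 1 <= CD" "1 + 4 * La / ga <= CD" "1 + 2 * BD / ga <= CD" "2 / ga <= CD"
proof -
 have "0 <= 16 * La / ga * BD" "0 <= 4 * La / ga" "0 <= 2 * BD / ga" "0 <= 2 / ga"
  using La_ge_1 BD_bounds(1) ga_pos by simp_all
 then show "1 <= CD" "3 * BD + 16 * La / ga * BD + 1 <= CD" "1 + 4 * La / ga <= CD" "1 + 2 * BD / ga <= CD" "2 / ga <= CD"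
  using BD_bounds(1) unfolding CD_def by linarith+
qed

text \<open>The impact points are within a multiple of \<open>e\<close>: the rays are close at the
  earlier time \<open>ta\<close>, and the later one then travels only
  \<open>(ta' - ta) * norm v'\<close>. The reflected velocities differ accordingly by the Lipschitz
  bound for \<open>refl_vel\<close>, and the elapsed time multiplies only this difference.\<close>

lemma pair_refl_refl:
 assumes x: "xi x <= 0" "xi x' <= 0"
  and hit: "t_b xi x v = ereal ta" "xi (x - ta *R v) = 0" "grad xi (x - ta *R v) *. v <= 0"
  and hit': "t_b xi x' v' = ereal ta'" "xi (x' - ta' *R v') = 0" "grad xi (x' - ta' *R v') *. v' <= 0" "xi (x' - ta *R v') <= 0"
  and ta: "0 <= ta" "ta <= ta'" "ta' <= r" "r <= t" "t <= 1" and D: "norm (x - x') <= 1" "norm (v - v') <= 1" and e: "dev_bound t x v x' v' e"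
 defines "w == norm v + norm v'"
  and "V == refl_vel xi (x - ta *R v) v" and "V' == refl_vel xi (x' - ta' *R v') v'"
 shows "norm ((x - ta *R v - (r - ta) *R V) - (x' - ta' *R v' - (r - ta') *R V')) <= CD * (norm (x - x') + norm (v - v') + (1 + r * w) * e)"
  and "norm (V - V') <= CD * (norm (v - v') + w * e)"
proof -
 let ?f = "ta' - ta"
 let ?e = "norm (V - V')"
 let ?d = "16 * La / ga * BD"
 let ?b = "16 * La / ga * BD"
 let ?a = "norm (v - v')"
 let ?g = "CD * (norm (x - x') + ?a + (1 + r * w) * e)"
 let ?p = "x - ta *R v" and ?p' = "x' - ta' *R v'"
 let ?h = "norm (?p - ?p')"
 let ?c = "norm ((?p - (r - ta) *R V) - (?p' - (r - ta') *R V'))"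
 have e0: "0 <= e" using dev_bound_nonneg[OF x e] .
 have w: "0 <= w" "norm v' <= w" by (simp_all add: w_def)
 have h: "?f * norm v' <= BD * e"
  using dev_bound_times[OF x hit(1,2) hit' _ _ _ _ D e] ta by auto
 have k: "norm (x - x') + ta * ?a <= BD * e"
  using dev_bound_hit[OF x hit _ _ _ D e] ta by auto
 have e1: "?p - ?p' = (x - x') - ta *R (v - v') + ?f *R v'" by (simp add: algebra_simps)
 have pp: "?h <= 2 * (BD * e)"
 proof -
  have "?h <= norm (x - x') + ta * ?a + ?f * norm v'"
   unfolding e1 by (rule order_trans[OF norm_triangle3(1)]) (use ta in simp)
  then show ?thesis using h k by simp
 qed
 have "?e <= ?a + 8 * La / ga * ?h * norm v'"
  unfolding V_def V'_def using hit hit' by (intro refl_diff) auto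
 also have "... <= ?a + 8 * La / ga * (2 * (BD * e)) * w"
  using pp w La_ge_1 ga_pos BD_bounds(1) e0 by (intro add_mono mult_mono mono_l) auto
 also have "... = ?a + ?b * (w * e)" by simp
 finally have VV: "?e <= ?a + ?b * (w * e)" .
 have c: "?d <= CD" "0 <= ?d"
 proof -
  show "?d <= CD" using CD_bounds(2) BD_bounds(1) by linarith
  show "0 <= ?d" using BD_bounds(1) La_ge_1 ga_pos by simp
 qed
 have we: "0 <= w * e" using w e0 by simp
 have "?a + ?b * (w * e) <= CD * ?a + CD * (w * e)"
  using c CD_bounds(1) we mono_r[OF CD_bounds(1), of "?a"] by (intro add_mono mono_r) auto
 with VV show "?e <= CD * (?a + w * e)" by (simp add: distrib_left)
 have e2: "(?p - (r - ta) *R V) - (?p' - (r - ta') *R V') = (?p - ?p') - (r - ta) *R (V - V') - ?f *R V'"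
  by (simp add: algebra_simps)
 have "?c <= ?h + (r - ta) * ?e + ?f * norm V'"
  unfolding e2 by (rule order_trans[OF norm_triangle3(2)]) (use ta in simp)
 also have "... <= 2 * (BD * e) + r * (?a + ?b * (w * e)) + BD * e"
 proof (intro add_mono)
  show "(r - ta) * ?e <= r * (?a + ?b * (w * e))"
   using VV ta by (intro mult_mono) auto
  show "?f * norm V' <= BD * e"
   using h norm_refl[OF hit'(2), of v'] by (simp add: V'_def)
 qed (use pp in simp)
 also have "... <= 1 * ?a + (3 * BD + 16 * La / ga * BD) * ((1 + r * w) * e)"
 proof -
  have "r * ?a <= 1 * ?a" using ta by (intro mono_r) auto
  moreover have "0 <= 3 * BD * (r * w * e)" "0 <= 16 * La / ga * BD * e"
   using BD_bounds(1) ta w mult_nonneg_nonneg[OF c(2) e0] e0 by simp_all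
  ultimately show ?thesis by (simp add: distrib_right distrib_left) (simp add: mult_ac)
 qed
 also have "... <= CD * ?a + CD * ((1 + r * w) * e)"
  using CD_bounds w e0 ta by (intro add_mono mono_r) auto
 also have "... <= ?g"
  using CD_bounds(1) by (simp add: distrib_left)
 finally show "?c <= ?g" .
qed

lemma refl_rate:
 assumes hit: "t_b xi x v = ereal ta" "xi (x - ta *R v) = 0" "grad xi (x - ta *R v) *. v <= 0"
 shows "norm (refl_vel xi (x - ta *R v) v - v) <= 2 / ga * rate x v"
proof -
 note h = hit_facts[OF hit]
 let ?p = "x - ta *R v"
 have g: "ga <= norm (grad xi ?p)" using grad_lower[OF hit(2)] by (simp add: ga_def)
 have "norm (refl_vel xi ?p v - v) = 2 * abs (normal_vec xi ?p *. v)"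
  using norm_normal[OF hit(2)] by (simp add: refl_vel_def)
 also have "... = 2 * (rate x v / norm (grad xi ?p))"
  using hit(3) by (simp add: normal_inner[OF hit(2)] h(2))
 also have "... <= 2 * (rate x v / ga)"
  using g h(3) ga_pos by (intro mono_l divide_left_mono mult_pos_pos) auto
 finally show ?thesis by simp
qed

text \<open>In the shallow alternative of \<open>hit_miss\<close> the impact is recent: the
  positions are close, but the velocity has already changed by a multiple of \<open>rate\<close>. In
  the deep one the impact is so close to grazing that the change itself is of the order of the
  error.\<close>

lemma pair_refl_free:
 assumes x: "xi x <= 0" "xi x' <= 0"
  and hit: "t_b xi x v = ereal ta" "xi (x - ta *R v) = 0" "grad xi (x - ta *R v) *. v <= 0"
  and free: "!!si. 0 <= si ==> si <= r ==> xi (x' - si *R v') <= 0"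
  and ta: "0 <= ta" "ta <= r" "r <= t" "t <= 1" and D: "norm (x - x') <= 1" "norm (v - v') <= 1" and e: "dev_bound t x v x' v' e"
 defines "w == norm v + norm v'" and "V == refl_vel xi (x - ta *R v) v"
 shows "norm ((x - ta *R v - (r - ta) *R V) - (x' - r *R v')) <= CD * (norm (x - x') + norm (v - v') + (1 + r * w) * e)"
  and "norm (V - v') <= CD * (norm (v - v') + w * e) \<or>
   (norm (V - v') <= norm (v - v') + CD * rate x v & (r - ta) * rate x v <= 2 * La * (norm (x - x') + r * norm (v - v')) \<and>
   (r - ta) * (La * N2 v) <= rate x v)"
proof -
 let ?g = "2 / ga * rate x v"
 let ?f = "(r - ta) * (2 / ga * rate x v)"
 let ?d = "norm (V - v')"
 let ?a = "norm ((x - ta *R v - (r - ta) *R V) - (x' - r *R v'))"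
 note h = hit_facts[OF hit]
 let ?Dx = "norm (x - x')" and ?Dv = "norm (v - v')"
 let ?e = "?Dx + ?Dv"
 let ?c = "?Dv + w * e"
 let ?b = "?Dx + ?Dv + (1 + r * w) * e"
 have e0: "0 <= e" using dev_bound_nonneg[OF x e] .
 have w: "0 <= w" "norm v <= w" by (simp_all add: w_def)
 have Vv: "norm (V - v) <= ?g"
  unfolding V_def by (rule refl_rate[OF hit])
 have "V - v' = (V - v) + (v - v')" by simp
 then have VV: "?d <= ?Dv + 2 / ga * rate x v"
  using norm_triangle_ineq[of "V - v" "v - v'"] Vv by simp
 have e1: "(x - ta *R v - (r - ta) *R V) - (x' - r *R v') = (x - x') - r *R (v - v') - (r - ta) *R (V - v)"
  by (simp add: algebra_simps)
 have XX: "?a <= ?Dx + r * ?Dv + (r - ta) * (2 / ga * rate x v)"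
  unfolding e1 by (rule order_trans[OF norm_triangle3(2)]) (use ta mono_l[OF Vv, of "r - ta"] in simp)
 have rDv: "r * ?Dv <= 1 * ?Dv" using ta by (intro mono_r) auto
 have Ee: "0 <= (1 + r * w) * e" using ta w e0 by simp
 consider (shallow) "(r - ta) * rate x v <= 2 * La * (?Dx + r * ?Dv)" "(r - ta) * (La * N2 v) <= rate x v"
  | (deep) "rate x v <= BD * (?Dv + norm v * e)"
  using hit_miss[OF hit(2) h(2) h(3) free ta(1,2) _ D] ta dev_bound_deep[OF x hit _ _ e] by auto
 then have "?a <= CD * ?b \<and>
  (?d <= CD * ?c \<or>
   (?d <= ?Dv + CD * rate x v & (r - ta) * rate x v <= 2 * La * (?Dx + r * ?Dv) \<and>
   (r - ta) * (La * N2 v) <= rate x v))"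
 proof cases
  case shallow
  have "?f = 2 / ga * ((r - ta) * rate x v)" by simp
  also have "... <= 2 / ga * (2 * La * ?e)"
  proof (rule mono_l)
   have "2 * La * (?Dx + r * ?Dv) <= 2 * La * ?e"
    using rDv La_ge_1 by (intro mono_l) auto
   with shallow(1) show "(r - ta) * rate x v <= 2 * La * ?e" by linarith
  qed (use ga_pos in simp)
  finally have s: "?f <= 2 / ga * (2 * La * ?e)" .
  have "(1 + 4 * La / ga) * ?e = ?Dx + ?Dv + 2 / ga * (2 * La * ?e)"
   by (simp add: distrib_right)
  then have "?a <= (1 + 4 * La / ga) * ?e"
   using XX rDv s by linarith
  also have "... <= CD * ?e" using CD_bounds(3) by (intro mono_r) auto
  also have "... <= CD * ?b" using CD_bounds(1) Ee by (intro mono_l) auto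
  finally have 1: "?a <= CD * ?b" .
  have "?g <= CD * rate x v" using CD_bounds(5) h(3) by (rule mono_r)
  with VV 1 shallow show ?thesis by auto
 next
  case deep
  have d2: "?g <= 2 * BD / ga * ?c"
  proof -
   have "norm v * e <= w * e" using w e0 by (intro mono_r)
   then have "BD * (?Dv + norm v * e) <= BD * ?c" using BD_bounds(1) by (intro mono_l) auto
   with deep have "rate x v <= BD * ?c" by linarith
   then have "?g <= 2 / ga * (BD * ?c)" using ga_pos by (intro mono_l) auto
   then show ?thesis by simp
  qed
  have we: "0 <= w * e" using w e0 by simp
  have b0: "0 <= 2 * BD / ga" using BD_bounds(1) ga_pos by simp
  have "?d <= 1 * ?Dv + 2 * BD / ga * ?c" using VV d2 by simp
  also have "... <= 1 * ?c + 2 * BD / ga * ?c" using we by simp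
  also have "... = (1 + 2 * BD / ga) * ?c" by (simp only: distrib_right)
  also have "... <= CD * ?c" using CD_bounds(4) we by (intro mono_r) auto
  finally have 2: "?d <= CD * ?c" .
  have "?f <= r * (2 * BD / ga * ?c)"
   using ta h(3) ga_pos by (intro mult_mono[OF _ d2]) auto
  also have "... = 2 * BD / ga * (r * ?Dv + r * w * e)"
  proof -
   have "r * (K * ?c) = K * (r * ?Dv + r * w * e)" for K by (simp add: algebra_simps)
   then show ?thesis by blast
  qed
  also have "... <= 2 * BD / ga * ?b"
  proof (rule mono_l[OF _ b0])
   have "(1 + r * w) * e = e + r * w * e" by (simp add: distrib_right)
   then show "r * ?Dv + r * w * e <= ?Dx + ?Dv + (1 + r * w) * e"
    using rDv e0 norm_ge_zero[of "x - x'"] by linarith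
  qed
  finally have "?a <= 1 * ?b + 2 * BD / ga * ?b"
   using XX rDv Ee by simp
  also have "... = (1 + 2 * BD / ga) * ?b" by (simp only: distrib_right)
  also have "... <= CD * ?b" using CD_bounds(4) Ee by (intro mono_r) auto
  finally show ?thesis using 2 by blast
 qed
 then show "?a <= CD * ?b"
  and "?d <= CD * ?c \<or>
   (?d <= ?Dv + CD * rate x v & (r - ta) * rate x v <= 2 * La * (?Dx + r * ?Dv) \<and>
   (r - ta) * (La * N2 v) <= rate x v)" by auto
qed

lemma jump_nonneg:
 assumes "xi x <= 0"
 shows "0 <= jump D x v r"
proof (cases "t_b xi x v <= ereal r")
 case True
 then have "0 <= rate x v"
  by (cases rule: t_b_cases[OF assms, of v]) (auto simp: hit_facts)
 then show ?thesis by (simp add: jump_def)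
qed (simp add: jump_def)

text \<open>If the trajectory that hits later is already reflected, so is the other one; hence only
  three cases arise.\<close>

lemma flow_deviation_aux:
 assumes x: "xi x <= 0" "xi x' <= 0" and r: "0 <= r" "r <= t" "t <= 1"
  and D: "norm (x - x') <= 1" "norm (v - v') <= 1" and e: "dev_bound t x v x' v' e"
  and first: "t_b xi x v <= t_b xi x' v'"
 defines "w == norm v + norm v'"
 shows "norm (flow r x v - flow r x' v') <= CD * (norm (x - x') + norm (v - v') + (1 + r * w) * e)"
  and "norm (vel r x v - vel r x' v') <= CD * (norm (v - v') + w * e + jump (2 * La * (norm (x - x') + t * norm (v - v'))) x v r)"
proof -
 let ?g = "x' - r *R v'"
 let ?d = "norm (vel r x v - vel r x' v')"
 let ?Dx = "norm (x - x')" and ?Dv = "norm (v - v')"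
 let ?f = "2 * La * (?Dx + r * ?Dv)"
 let ?e = "CD * (?Dv + w * e)"
 let ?a = "?Dx + ?Dv + (1 + r * w) * e"
 let ?J = "jump (2 * La * (?Dx + t * ?Dv)) x v r"
 let ?b = "?Dv + w * e + ?J"
 have e0: "0 <= e" using dev_bound_nonneg[OF x e] .
 have w: "0 <= w" by (simp add: w_def)
 have J: "0 <= ?J" using jump_nonneg x by blast
 have "norm (flow r x v - flow r x' v') <= CD * ?a \<and>
  ?d <= CD * ?b"
 proof (cases rule: flow_cases[OF x(1) r(1), of v, case_names free refl])
  case free
  have "ereal r < t_b xi x' v'" using free(1) first by simp
  then have f: "flow r x' v' = x' - r *R v'" "vel r x' v' = v'"
   by (simp_all add: flow_def vel_def Xc_def Vc_def)
  have e1: "(x - r *R v) - ?g = (x - x') - r *R (v - v')" by (simp add: algebra_simps)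
  have "norm ((x - r *R v) - ?g) <= ?Dx + r * ?Dv"
   unfolding e1 by (rule order_trans[OF norm_triangle_ineq4]) (use r in simp)
  also have "... <= 1 * ?a"
  proof -
   have "r * ?Dv <= 1 * ?Dv" using r by (intro mono_r) auto
   moreover have "0 <= (1 + r * w) * e" using r w e0 by simp
   ultimately show ?thesis by simp
  qed
  also have "... <= CD * ?a"
   using CD_bounds(1) r w e0 by (intro mono_r) auto
  finally have 1: "norm ((x - r *R v) - ?g) <= CD * ?a" .
  have "1 * ?b <= CD * ?b"
   using CD_bounds(1) w e0 J by (intro mono_r) auto
  moreover have "?Dv <= 1 * ?b" using w e0 J by simp
  ultimately show ?thesis unfolding free(2,3) f using 1 by simp
 next
  case (refl ta)
  let ?c = "norm (refl_vel xi (x - ta *R v) v - v')"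
  note hit = refl(1,4,6)
  show ?thesis
  proof (cases rule: flow_cases[OF x(2) r(1), of v', case_names free' refl'])
   case free'
   note P = pair_refl_free[where x = x and v = v and x' = x' and v' = v' and r = r, OF x hit _ refl(2,3) r(2,3) D e, folded w_def]
   have P1: "norm ((x - ta *R v - (r - ta) *R refl_vel xi (x - ta *R v) v) - ?g) <= CD * ?a"
    using P(1) free'(4) by blast
   have P2: "?c <= ?e \<or>
    ?c <= ?Dv + CD * rate x v & (r - ta) * rate x v <= ?f"
    using P(2) free'(4) by blast
   have le: "?e <= CD * ?b"
    using CD_bounds(1) J by (intro mono_l) auto
   have "?d <= CD * ?b"
    using P2
   proof (elim disjE conjE)
    assume "?c <= ?e"
    then show ?thesis unfolding refl(8) free'(3) using le by linarith
   next
    assume a: "?c <= ?Dv + CD * rate x v" "(r - ta) * rate x v <= ?f"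
    have "?f <= 2 * La * (?Dx + t * ?Dv)"
     using r La_ge_1 by (intro mono_l add_mono mono_r) auto
    then have "?J = rate x v"
     using a(2) refl(3) hit_facts(1)[OF hit] refl(1) by (simp add: jump_def)
    moreover have "1 * ?Dv <= CD * ?Dv" using CD_bounds(1) by (intro mono_r) auto
    moreover have "0 <= CD * (w * e)" using CD_bounds(1) w e0 by simp
    ultimately show ?thesis unfolding refl(8) free'(3) using a(1) by (simp add: distrib_left)
   qed
   then show ?thesis
    using P1
    unfolding refl(7) free'(2) by blast
  next
   case (refl' ta')
   have tata: "ta <= ta'" using first refl(1) refl'(1) by simp
   have q: "xi (x' - ta *R v') <= 0" using refl'(5) refl(2) tata by simp
   note P = pair_refl_refl[OF x hit refl'(1,4,6) q refl(2) tata refl'(3) r(2,3) D e, folded w_def]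
   have "?e <= CD * ?b"
    using CD_bounds(1) J by (intro mono_l) auto
   then show ?thesis using P unfolding refl(7,8) refl'(7,8) by linarith
  qed
 qed
 then show "norm (flow r x v - flow r x' v') <= CD * ?a"
  and "?d <= CD * ?b" by auto
qed

lemma flow_deviation:
 assumes x: "xi x <= 0" "xi x' <= 0" and r: "0 <= r" "r <= t" "t <= 1"
  and D: "norm (x - x') <= 1" "norm (v - v') <= 1" and e: "dev_bound t x v x' v' e"
 defines "w == norm v + norm v'" and "d == 2 * La * (norm (x - x') + t * norm (v - v'))"
 shows "norm (flow r x v - flow r x' v') <= CD * (norm (x - x') + norm (v - v') + (1 + r * w) * e)"
  and "norm (vel r x v - vel r x' v') <= CD * (norm (v - v') + w * e + (jump d x v r + jump d x' v' r))"
proof -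
 let ?b = "CD * (norm (x - x') + norm (v - v') + (1 + r * w) * e)"
 let ?a = "CD * (norm (v - v') + w * e + (jump d x v r + jump d x' v' r))"
 have J: "0 <= jump d x v r" "0 <= jump d x' v' r" using jump_nonneg x by blast+
 have "norm (flow r x v - flow r x' v') <= ?b \<and>
  norm (vel r x v - vel r x' v') <= ?a"
 proof (cases "t_b xi x v <= t_b xi x' v'")
  case True
  have "CD * (norm (v - v') + w * e + jump d x v r) <= ?a"
   using J CD_bounds(1) by (intro mono_l) auto
  then show ?thesis
   using flow_deviation_aux[OF x r D e True] unfolding w_def d_def by linarith
 next
  case False
  then have "t_b xi x' v' <= t_b xi x v" by simp
  note P = flow_deviation_aux[OF x(2,1) r _ _ dev_bound_sym[OF e] this]
  have "CD * (norm (v - v') + w * e + jump d x' v' r) <= ?a"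
   using J CD_bounds(1) by (intro mono_l) auto
  then show ?thesis
   using P D unfolding w_def d_def by (simp add: norm_minus_commute add.commute)
 qed
 then show "norm (flow r x v - flow r x' v') <= ?b"
  and "norm (vel r x v - vel r x' v') <= ?a" by auto
qed

lemma jump_integral:
 assumes x: "xi x <= 0" and D: "0 <= D"
 shows "jump D x v \<in> bm" "(NN r. ennreal (jump D x v r)) <= ennreal D"
proof -
 let ?a = "NN r. ennreal (jump D x v r)"
 have "jump D x v \<in> bm & ?a <= ennreal D"
 proof (cases rule: t_b_cases[OF x, of v, case_names miss hit])
  case miss
  then have "jump D x v = (%_. 0)" by (auto simp: jump_def fun_eq_iff)
  then show ?thesis by simp
 next
  case (hit ta)
  note h = hit_facts[OF hit(1,3,5)]
  have j: "jump D x v = (%r. rate x v * indicator {r. ta <= r & (r - ta) * rate x v <= D} r)"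
   using hit(1) by (auto simp: jump_def fun_eq_iff h(1))
  have m: "jump D x v \<in> bm" unfolding j by measurable
  show ?thesis
  proof (cases "rate x v = 0")
   case True
   then show ?thesis using m by (simp add: j)
  next
   case False
   then have A: "0 < rate x v" using h(3) by simp
   then have "{r. ta <= r & (r - ta) * rate x v <= D} = {ta..ta + D / rate x v}"
    by (auto simp: field_simps)
   then have "?a = (NN r. ennreal (rate x v) * indicator {ta..ta + D / rate x v} r)"
    unfolding j using A by (intro nn_integral_cong) (auto split: split_indicator)
   also have "... = ennreal (rate x v) * ennreal (D / rate x v)"
    using A D by (simp add: nn_integral_cmult_indicator)
   also have "... = ennreal D" using A D by (simp add: ennreal_mult[symmetric])
   finally show ?thesis using m by simp
  qed
 qed
 then show "jump D x v \<in> bm" "?a <= ennreal D" by auto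
qed

end

context convex_obstacle
begin

section \<open>The initial datum at the ends of two trajectories\<close>

definition CF :: real where "CF = 2 * CD + 4 * (1 + 4 * La * CD) + 4 * BD"

text \<open>After a recent impact the two final velocities differ by an amount that is not small, so
  the Lipschitz bounds of \<open>f0\<close> do not apply directly. Compatibility bridges the jump:
  at the impact point \<open>f0\<close> has the same value before and after reflection, and the way
  from there to the end is short. In \<open>fv\<close> only the speeds are close, since velocities
  at equal speed may be far apart after a reflection.\<close>

lemma initial_deviation_aux:
 fixes f0 :: "real^3 => real^3 => real"
 assumes A1: "0 <= A1"
  and fx: "!!x x' v. xi x <= 0 ==> xi x' <= 0 ==> abs (f0 x v - f0 x' v) <= A1 / (1 + norm v) * norm (x - x')"
  and fv: "!!x v v'. xi x <= 0 ==> abs (norm v - norm v') <= 1 ==> abs (f0 x v - f0 x v') <= A1 / (1 + norm v)^2 * norm (v - v')"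
  and spec: "!!x v. xi x = 0 ==> f0 x v = f0 x (refl_vel xi x v)"
  and x: "xi x <= 0" "xi x' <= 0" and t: "0 <= t" "t <= 1"
  and D: "norm (x - x') <= 1" "norm (v - v') <= 1" and e: "dev_bound t x v x' v' e"
  and first: "t_b xi x v <= t_b xi x' v'"
 defines "w == norm v + norm v'"
 shows "abs (f0 (flow t x v) (vel t x v) - f0 (flow t x' v') (vel t x' v')) <=
  CF * A1 / (1 + w) * (norm (x - x') + norm (v - v') + (1 + t * w) * e)"
proof -
 let ?m = "2 / (1 + w)"
 let ?k = "vel t x' v'"
 let ?h = "flow t x v"
 let ?g = "A1 / (1 + w)"
 let ?f = "vel t x v"
 let ?e = "flow t x' v'"
 let ?c = "norm (?f - ?k)"
 let ?a = "1 + norm v"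
 let ?Dx = "norm (x - x')" and ?Dv = "norm (v - v')"
 let ?l = "?Dx + ?Dv"
 let ?j = "2 * La * (?Dx + t * ?Dv)"
 let ?d = "?Dv + w * e"
 let ?T = "?Dx + ?Dv + (1 + t * w) * e"
 have e0: "0 <= e" using dev_bound_nonneg[OF x e] .
 have w: "0 <= w" by (simp add: w_def)
 have dn: "abs (norm v - norm v') <= 1" using norm_triangle_ineq3[of v v'] D by linarith
 have T0: "0 <= (1 + t * w) * e" using t w e0 by simp
 have W: "1 / ?a <= 2 / (1 + w)"
 proof -
  have "1 + w <= 2 * ?a" using dn by (simp add: w_def)
  moreover have "0 < 1 + norm v" "0 < 1 + w" using w norm_ge_zero[of v] by linarith+
  ultimately show ?thesis by (simp add: field_simps)
 qed
 have w1: "0 < 1 + w" using w by linarith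
 have fl: "xi (?h) <= 0" "xi (?e) <= 0" using flow_le_0 x t by auto
 have vl: "norm (?f) = norm v" "norm (?k) = norm v'" using norm_vel x t by auto
 have generic: "abs (f0 (?h) (?f) - f0 (?e) (?k)) <= (2 * CD + 4 * K) * A1 / (1 + w) * ?T"
  if K: "0 <= K" "?c <= K * ?d" for K
 proof -
  have X: "norm (?h - ?e) <= CD * ?T"
   using flow_deviation_aux(1)[OF x t(1) order_refl t(2) D e first] by (simp add: w_def)
  have "abs (f0 (?h) (?f) - f0 (?e) (?f)) <= A1 / ?a * norm (?h - ?e)"
   using fx[OF fl, of "?f"] by (simp add: vl)
  also have "... <= (A1 * ?m) * (CD * ?T)"
   using mono_l[OF W A1] X A1 w1 by (intro mult_mono) auto
  also have "... = ?g * (2 * CD * ?T)"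
  proof -
   have "(A1 * ?m) * (CD * T) = ?g * (2 * CD * T)" for T by simp
   then show ?thesis .
  qed
  finally have 1: "abs (f0 (?h) (?f) - f0 (?e) (?f)) <= ?g * (2 * CD * ?T)" .
  have "abs (f0 (?e) (?f) - f0 (?e) (?k)) <= A1 * (1 / ?a)^2 * ?c"
   using fv[OF fl(2), of "?f" "?k"] dn by (simp add: vl power_divide)
  also have "... <= A1 * ?m^2 * (K * ?d)"
   using power_mono[OF W, of 2] A1 K by (intro mult_mono mono_l) auto
  also have "... = ?g * (4 * K * (?d / (1 + w)))"
   using w1 by (simp add: sq_eq)
  also have "... <= ?g * (4 * K * ?T)"
  proof (intro mono_l)
   have "?Dv + w * e <= (1 + w) * (?Dv + e)" using w e0 by (simp add: algebra_simps)
   then have "?d / (1 + w) <= ?Dv + e" using w1 by (simp add: pos_divide_le_eq mult.commute)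
   also have "... <= ?T" using t w e0 by (simp add: algebra_simps)
   finally show "?d / (1 + w) <= ?T" .
  qed (use A1 w1 K in auto)
  finally have "abs (f0 (?h) (?f) - f0 (?e) (?k)) <= ?g * (2 * CD * ?T) + ?g * (4 * K * ?T)"
   using 1 by linarith
  also have "... = (2 * CD + 4 * K) * A1 / (1 + w) * ?T" by (simp add: algebra_simps add_divide_distrib)
  finally show ?thesis .
 qed
 have mono: "a * A1 / (1 + w) * ?T <= CF * A1 / (1 + w) * ?T" if "a <= CF" for a
  using that A1 w1 T0 by (intro mono_r divide_right_mono) auto
 have cd: "1 <= CD" "CD <= 4 * La * CD" "0 <= BD"
 proof -
  show 1: "1 <= CD" using CD_bounds by simp
  have "1 * CD <= (4 * La) * CD" using 1 La_ge_1 by (intro mono_r) auto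
  then show "CD <= 4 * La * CD" by simp
 qed (use BD_bounds in linarith)
 have cd0: "0 <= CD" and cd1: "CD <= 1 + 4 * La * CD" using cd by linarith+
 have fin: ?thesis if "0 <= K" "K <= 1 + 4 * La * CD" "?c <= K * ?d" for K
  using order_trans[OF generic[OF that(1,3)] mono] that(2) cd by (simp add: CF_def)
 show ?thesis
 proof (cases rule: flow_cases[OF x(1) t(1), of v, case_names free refl])
  case free
  have "ereal t < t_b xi x' v'" using free(1) first by simp
  then have "?k = v'" by (simp add: vel_def Vc_def)
  then show ?thesis using free(3) w e0 La_ge_1 cd by (intro fin[of 1]) auto
 next
  case (refl ta)
  let ?b = "norm (refl_vel xi (x - ta *R v) v - v')"
  note hit = refl(1,4,6)
  note h = hit_facts[OF hit]
  show ?thesis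
  proof (cases rule: flow_cases[OF x(2) t(1), of v', case_names free' refl'])
   case free'
   have P: "?b <= CD * ?d \<or>
    ?b <= ?Dv + CD * rate x v & (t - ta) * rate x v <= ?j \<and>
    (t - ta) * (La * N2 v) <= rate x v"
    using pair_refl_free(2)[OF x hit _ refl(2,3) order_refl t(2) D e, folded w_def] free'(4) by blast
   show ?thesis
   proof (cases "?b <= CD * ?d")
    case True
    then have "?c <= CD * ?d"
     unfolding refl(8) free'(3) .
    then show ?thesis by (rule fin[OF cd0 cd1])
   next
    case False
    with P have s: "?b <= ?Dv + CD * rate x v"
     "(t - ta) * rate x v <= ?j" "(t - ta) * (La * N2 v) <= rate x v" by auto
    show ?thesis
    \<comment> \<open>If the rate is at most a multiple of \<open>norm (v - v')\<close>, so is the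
      jump. Otherwise \<open>?et * (4 * La * ?Dv)\<close> can be absorbed in
      \<open>?et * rate x v\<close>; this replaces \<open>t\<close> by \<open>ta\<close> in the
      shallow bound, which is the form of \<open>lip_dev\<close>.\<close>
    proof (cases "rate x v <= 4 * La * ?Dv")
     case True
     have "CD * rate x v <= CD * (4 * La * ?Dv)" using True cd by (intro mono_l) auto
     then have "?b <= (1 + 4 * La * CD) * ?Dv"
      using s(1) by (simp add: algebra_simps)
     also have "... <= (1 + 4 * La * CD) * ?d"
      using w e0 cd La_ge_1 by (intro mono_l) auto
     finally show ?thesis using cd La_ge_1 refl(8) free'(3) by (intro fin[of "1 + 4 * La * CD"]) auto
    next
     case False
     let ?et = "t - ta" and ?p = "x - ta *R v"
     let ?n = "?Dx + ?Dv + ?et * norm v"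
     let ?i = "?et * norm v"
     have et: "0 <= ?et" using refl by simp
     have tDv: "t * ?Dv <= 1 * ?Dv" using t by (intro mono_r) auto
     have he: "?et * norm v <= BD * e"
      using e unfolding dev_bound_def
     proof (elim disjE conjE)
      assume e: "e = sqrt ?l"
      have "?et * (?et * (La * N2 v)) <= ?et * rate x v" using s(3) et by (intro mono_l) auto
      also have "... <= 2 * La * ?l"
      proof -
       have "?j <= 2 * La * ?l" using tDv La_ge_1 by (intro mono_l) auto
       with s(2) show ?thesis by linarith
      qed
      finally have "La * ?i^2 <= La * (2 * ?l)" by (simp add: power_mult_distrib sq_eq mult_ac)
      then have "?i^2 <= 2 * ?l" using La_ge_1 by simp
      also have "... <= (2 * e)^2" by (simp add: e power_mult_distrib)
      finally have "?et * norm v <= 2 * e" using e0 by (intro power2_le_imp_le[of "?et * norm v" "2 * e"]) auto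
      also have "... <= BD * e" using BD_bounds(2) e0 by (intro mono_r) auto
      finally show ?thesis .
     next
      assume ng: "nongrazing t x v" and e: "e = lip_dev t x v x' v'"
      have le: "t_b xi x v <= ereal t" using refl by simp
      then have r: "0 < rate x v" using ng by (simp add: nongrazing_def)
      have "?et * (4 * La * ?Dv) <= ?et * rate x v" using False et by (intro mono_l) auto
      moreover define P Q where "P = ?j" and "Q = 4 * La * (?Dx + ta * ?Dv)"
      have "2 * P = Q + ?et * (4 * La * ?Dv)"
       by (simp add: P_def Q_def algebra_simps)
      ultimately have "?et * rate x v <= Q" using s(2)[folded P_def] by linarith
      then have "?et * rate x v <= 4 * La * (?Dx + ta * ?Dv)" by (simp only: Q_def)
      then have "(?et * rate x v) * (norm v / rate x v) <= (4 * La * (?Dx + ta * ?Dv)) * (norm v / rate x v)"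
       using r by (intro mono_r) auto
      then have "?et * norm v <= 4 * La * ((?Dx + tau x v * ?Dv) * (norm v / rate x v))"
       using r by (simp add: h(1))
      also have "... <= BD * e"
       unfolding e using BD_bounds(1,5) r refl(2) by (intro mult_mono lip_dev_ge x le) (auto simp: h(1))
      finally show ?thesis .
     qed
     let ?V = "refl_vel xi ?p v" and ?X' = "x' - t *R v'"
     have X: "?h = ?p - ?et *R ?V" "?f = ?V" "?e = ?X'" "?k = v'"
      using refl free' by auto
     have nV: "norm ?V = norm v" using norm_refl[OF refl(4)] .
     have p: "xi ?p <= 0" using refl(4) by simp
     \<comment> \<open>The path of comparison: to the impact point with the reflected velocity,
       across the reflection, to the other end with the incoming velocity, and last a change of
       velocity.\<close>
     have "abs (f0 (?h) ?V - f0 ?p ?V) <= A1 / ?a * ?i"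
      using fx[OF fl(1) p, of ?V] et unfolding X(1) nV by (simp add: nV)
     moreover have "f0 ?p ?V = f0 ?p v" using spec[OF refl(4), of v] by simp
     moreover have "abs (f0 ?p v - f0 ?X' v) <= A1 / ?a * ?n"
     proof -
      have e1: "?p - ?X' = (x - x') - t *R (v - v') + ?et *R v" by (simp add: algebra_simps)
      have "norm (?p - ?X') <= ?Dx + t * ?Dv + ?et * norm v"
       unfolding e1 by (rule order_trans[OF norm_triangle3(1)]) (use t et in simp)
      also have "... <= ?Dx + ?Dv + ?et * norm v" using tDv by simp
      finally have n: "norm (?p - ?X') <= ?Dx + ?Dv + ?et * norm v" .
      have "abs (f0 ?p v - f0 ?X' v) <= A1 / ?a * norm (?p - ?X')"
       using fx[OF p fl(2), of v] unfolding X(3) .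
      also have "... <= A1 / ?a * ?n"
       using n A1 by (intro mono_l) auto
      finally show ?thesis .
     qed
     moreover have "abs (f0 ?X' v - f0 ?X' v') <= A1 / ?a * ?Dv"
     proof -
      have "abs (f0 ?X' v - f0 ?X' v') <= A1 / ?a^2 * ?Dv"
       using fv[OF fl(2) dn] unfolding X(3) .
      also have "... <= A1 / ?a * ?Dv"
      proof (intro mono_r divide_left_mono A1)
       show "1 + norm v <= ?a^2" using self_le_power[of "1 + norm v" 2] by simp
      next
       have "0 < 1 + norm v" by (simp add: add_pos_nonneg)
       then show "0 < ?a^2 * ?a" by simp
      qed simp
      finally show ?thesis .
     qed
     ultimately have "abs (f0 (?h) ?V - f0 ?X' v') <= A1 / ?a * ?i + A1 / ?a * ?n + A1 / ?a * ?Dv"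
      by linarith
     also have "... = A1 / ?a * (?Dx + 2 * ?Dv + 2 * ?i)"
      by (simp only: distrib_left[symmetric]) simp
     also have "... <= (A1 * ?m) * (2 * (1 + BD) * ?T)"
     proof (intro mult_mono)
      show "A1 / ?a <= A1 * ?m" using mono_l[OF W A1] by simp
      have "?Dx + 2 * ?Dv + 2 * ?i <= 2 * ?l + 2 * (BD * e)"
       using he norm_ge_zero[of "x - x'"] unfolding distrib_left by linarith
      also have "... <= 2 * (1 + BD) * (?Dx + ?Dv + e)"
       using cd e0 by (simp add: algebra_simps)
      also have "... <= 2 * (1 + BD) * ?T" using cd t w e0 by (intro mono_l) (auto simp: algebra_simps)
      finally show "?Dx + 2 * ?Dv + 2 * ?i <= 2 * (1 + BD) * ?T" .
     qed (use A1 w1 et in auto)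
     also have "... = (4 * (1 + BD)) * A1 / (1 + w) * ?T" by simp
     also have "... <= CF * A1 / (1 + w) * ?T"
      using cd La_ge_1 by (intro mono) (simp add: CF_def)
     finally show ?thesis unfolding X(2,3,4) .
    qed
   qed
  next
   case (refl' ta')
   have tata: "ta <= ta'" using first refl(1) refl'(1) by simp
   have q: "xi (x' - ta *R v') <= 0" using refl'(5) refl(2) tata by simp
   have "?c <= CD * ?d"
    using pair_refl_refl(2)[OF x hit refl'(1,4,6) q refl(2) tata refl'(3) order_refl t(2) D e, folded w_def]
    unfolding refl(8) refl'(8) .
   then show ?thesis by (rule fin[OF cd0 cd1])
  qed
 qed
qed

lemma initial_deviation:
 fixes f0 :: "real^3 => real^3 => real"
 assumes "0 <= A1"
  and "!!x x' v. xi x <= 0 ==> xi x' <= 0 ==> abs (f0 x v - f0 x' v) <= A1 / (1 + norm v) * norm (x - x')"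
  and "!!x v v'. xi x <= 0 ==> abs (norm v - norm v') <= 1 ==> abs (f0 x v - f0 x v') <= A1 / (1 + norm v)^2 * norm (v - v')"
  and "!!x v. xi x = 0 ==> f0 x v = f0 x (refl_vel xi x v)"
  and x: "xi x <= 0" "xi x' <= 0" and t: "0 <= t" "t <= 1"
  and D: "norm (x - x') <= 1" "norm (v - v') <= 1" and e: "dev_bound t x v x' v' e"
 defines "w == norm v + norm v'"
 shows "abs (f0 (flow t x v) (vel t x v) - f0 (flow t x' v') (vel t x' v')) <=
  CF * A1 / (1 + w) * (norm (x - x') + norm (v - v') + (1 + t * w) * e)"
proof (cases "t_b xi x v <= t_b xi x' v'")
 case True
 then show ?thesis using initial_deviation_aux[OF assms(1-11)] by (simp add: w_def)
next
 case False
 then have "t_b xi x' v' <= t_b xi x v" by simp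
 then show ?thesis
  using initial_deviation_aux[OF assms(1-4) x(2,1) t _ _ dev_bound_sym[OF e]] D
  by (simp add: w_def norm_minus_commute abs_minus_commute add.commute)
qed

end

section \<open>Reflections along a line of velocities\<close>

lemma powr_add_le_sum:
 fixes a b p :: real
 assumes "0 <= a" "0 <= b" "0 <= p" "p <= 1"
 shows "(a + b) powr p <= 2 * (a powr p + b powr p)"
proof -
 have 2: "2 powr p <= (2::real)" using powr_mono[of p 1 2] assms by simp
 have le: "(x + y) powr p <= 2 * y powr p" if "0 <= x" "x <= y" for x y :: real
 proof -
  have "(x + y) powr p <= (2 * y) powr p" using that assms by (intro powr_mono2) auto
  also have "... = 2 powr p * y powr p" using that by (intro powr_mult)
  also have "... <= 2 * y powr p" using 2 by (intro mono_r) auto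
  finally show ?thesis .
 qed
 show ?thesis
 proof (cases "a <= b")
  case True
  have "0 <= a powr p" by simp
  with le[of a b] True assms show ?thesis unfolding distrib_left by linarith
 next
  case False
  have "0 <= b powr p" by simp
  with le[of b a] False assms show ?thesis unfolding distrib_left add.commute[of a b] by linarith
 qed
qed

context convex_obstacle
begin

text \<open>Since \<open>grad xi\<close> is known only through inequalities, the first-order
  condition at the deepest point is derived from \<open>quad_lower\<close>: a short step in the
  direction of increase would lead deeper. The hypothesis \<open>0 <= xi\<close> places the point in
  the ball where \<open>quad_lower\<close> holds.\<close>

lemma stationary:
 assumes m: "0 < m" "0 <= xi (x - m *R u)" and max: "!!si. 0 <= si ==> xi (x - si *R u) <= xi (x - m *R u)"
 shows "grad xi (x - m *R u) *. u = 0"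
proof (rule ccontr)
 let ?y = "x - m *R u"
 define b where "b = grad xi ?y *. u"
 assume "grad xi (x - m *R u) *. u ~= 0"
 then have b: "b ~= 0" and u: "u ~= 0" by (auto simp: b_def)
 define N where "N = La * N2 u"
 have N: "0 < N" using u La_ge_1 by (simp add: N_def)
 define k where "k = min m (min (1 / norm u) (abs b / N))"
 have k: "0 < k" "k <= m" "k * norm u <= 1" "k * N <= abs b"
 proof -
  show "0 < k" using m u b N by (simp add: k_def)
  show "k <= m" by (simp add: k_def)
  have "k <= 1 / norm u" unfolding k_def by (rule min.coboundedI2[OF min.coboundedI1[OF order_refl]])
  then show "k * norm u <= 1" using u by (simp add: field_simps)
  have "k <= abs b / N" unfolding k_def by (rule min.coboundedI2[OF min.coboundedI2[OF order_refl]])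
  then show "k * N <= abs b" using N by (simp add: pos_le_divide_eq)
 qed
 define z where "z = x - (m - sgn b * k) *R u"
 have zy: "z - ?y = (sgn b * k) *R u" by (simp add: z_def algebra_simps)
 have sk: "abs (sgn b * k) = k" using k b by (simp add: abs_mult abs_sgn_eq)
 have ny: "norm ?y <= R" using m by (intro bounded) simp
 have "norm (z - ?y) <= 1" unfolding zy using k sk by simp
 then have nz: "norm z <= R + 4" using norm_triangle_sub[of z ?y] ny by linarith
 have "xi ?y + grad xi ?y *. (z - ?y) - La / 2 * N2 (z - ?y) <= xi z"
  using ny nz by (intro quad_lower) auto
 moreover have "grad xi ?y *. (z - ?y) = k * abs b"
  unfolding zy by (simp add: b_def[symmetric] abs_sgn[of b] mult_ac)
 moreover have "La / 2 * N2 (z - ?y) = (k * (k * N)) / 2"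
  unfolding zy norm_scaleR sk by (simp add: N_def sq_eq)
 moreover have "k * (k * N) <= k * abs b" using k by (intro mono_l) auto
 moreover have "0 < k * abs b" using k b by simp
 ultimately have "xi ?y < xi z" by linarith
 moreover have "0 <= m - sgn b * k" using k sk by (cases "b > 0") (auto simp: sgn_if split: if_splits)
 then have "xi z <= xi ?y" unfolding z_def by (rule max)
 ultimately show False by simp
qed

text \<open>Along the ray, \<open>xi\<close> lies below the parabola through the impact point with
  slope \<open>rate x u\<close> and curvature \<open>th * N2 u\<close>, whose maximum is
  \<open>(rate x u)^2 / (2 * th * N2 u)\<close>. A ray that gets as deep as \<open>h\<close> is
  therefore far from grazing.\<close>

lemma rate_lower:
 assumes hit: "t_b xi x u = ereal ta" "xi (x - ta *R u) = 0" "grad xi (x - ta *R u) *. u <= 0"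
  and h: "0 < h" "h <= xi (x - ta1 *R u)" and u: "u ~= 0"
 shows "0 < rate x u" "norm u / rate x u <= 1 / sqrt (2 * th * h)"
proof -
 note hf = hit_facts[OF hit]
 let ?A = "rate x u" and ?n = "norm u"
 have n: "0 < ?n" using u by simp
 define s where "s = ta1 - ta"
 have "h <= s * ?A - th / 2 * (s^2 * ?n^2)"
  using concave_line[of x ta1 u ta] h hit by (simp add: s_def hf(2))
 then have "2 * th * ?n^2 * h <= 2 * th * ?n^2 * (s * ?A - th / 2 * (s^2 * ?n^2))"
  using th_pos by (intro mono_l) auto
 also have "... = ?A^2 - (?A - th * ?n^2 * s)\<^sup>2"
  by (simp add: sq_eq algebra_simps)
 also have "... <= ?A^2" by simp
 finally have key: "2 * th * ?n^2 * h <= ?A^2" .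
 have pos: "0 < 2 * th * h" using th_pos h by simp
 have "0 < 2 * th * ?n^2 * h" using th_pos h n by simp
 with key have "?A ~= 0" by auto
 then show A: "0 < ?A" using hf(3) by simp
 have "sqrt (2 * th * h) * ?n = sqrt (2 * th * ?n^2 * h)"
  using n by (simp add: real_sqrt_mult)
 also have "... <= ?A" using key A by (intro real_le_lsqrt) auto
 finally show "?n / ?A <= 1 / sqrt (2 * th * h)"
  using A pos by (simp add: field_simps)
qed

text \<open>Near the boundary \<open>- xi\<close> is comparable with the distance and easier to
  follow along a trajectory. The summand 1 lets \<open>zeta\<close> dominate terms without
  singularity.\<close>

definition zeta :: "real => real^3 => real" where
 "zeta de x = 1 + (- xi x) powr - (de / 2)"

text \<open>
 Turning the velocity towards an interior point \<open>c\<close> by \<open>k\<close> moves the ray into the obstacle: the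
 deepest point of the new ray lies below a convex combination of \<open>c\<close> and of the deepest point of
 the old ray.
\<close>

lemma deeper_ray:
 assumes x: "xi x < 0" and c: "xi0 <= xi c" and cx: "r0 <= norm (c - x)" and k: "0 < k"
  and old: "0 < ta0" "0 < xi (x - ta0 *R u)"
 defines "u' == u - k *R (c - x)" and "U == norm u + 2 * k * norm (c - x)" and "K == r0^2 * min 1 (xi0 / (2 * La))"
 shows "EX ta. t_b xi x u' = ereal ta & 0 < ta \<and>
  (EX ta1>=ta. xi0 * (ta * k) <= xi (x - ta1 *R u')) \<and>
  (norm x <= R + 4 -->
   (EX ta1. xi0 * K / 4 * (k / U)^2 <= xi (x - ta1 *R u')) \<and>
   (EX ta1. xi0 * r0 / (2 * La) * (sqrt (min 1 (- xi x)) * (k / U)) <= xi (x - ta1 *R u')))"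
proof -
 have u0: "u ~= 0" using old x by auto
 obtain m where m0: "0 <= m" and max: "!!si. 0 <= si ==> xi (x - si *R u) <= xi (x - m *R u)"
  using ray_max[OF u0] by metis
 let ?c = "m * norm u"
 let ?y = "x - m *R u"
 let ?b = "grad xi ?y"
 define L where "L = norm (c - x)"
 have L: "r0 <= L" "0 < L" using cx r0_pos unfolding L_def by linarith+
 have H: "0 < xi ?y" using max[of ta0] old by simp
 have m: "0 < m" using m0 H x by (cases "m = 0") auto
 have st: "?b *. u = 0" using m H max by (intro stationary) auto
 have U: "0 < U" "norm u <= U" "2 * k * L <= U"
  using u0 k L by (auto simp: U_def L_def intro: add_pos_nonneg)
 \<comment> \<open>With \<open>l = ta1 * k\<close> the combination
   \<open>(1 - l) *R ?y + l *R c\<close> is the point of the new ray at time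
   \<open>ta1\<close>.\<close>
 define ta1 where "ta1 = m / (1 + m * k)"
 let ?a = "xi (x - ta1 *R u')"
 define l where "l = ta1 * k"
 have mk: "0 < 1 + m * k" using m k by (simp add: add_pos_pos)
 have ta1: "0 < ta1" using m mk by (simp add: ta1_def)
 have l: "0 < l" "l < 1" "1 - l = 1 / (1 + m * k)" "l = m * k / (1 + m * k)"
  using ta1 k mk m by (simp_all add: l_def ta1_def field_simps)
 have pt: "(1 - l) *R ?y + l *R c = x - ta1 *R u'"
 proof -
  have e: "(1 - l) * m = ta1" using l(3) by (simp add: ta1_def)
  have "(1 - l) *R ?y + l *R c = x - ((1 - l) * m) *R u + l *R (c - x)"
   by (simp add: algebra_simps)
  also have "... = x - ta1 *R u'"
   unfolding e by (simp add: u'_def l_def scaleR_diff_right)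
  finally show ?thesis .
 qed
 have "(1 - l) * xi ?y + l * xi c <= ?a"
  using concave_comb[of l ?y c] l unfolding pt by simp
 moreover have "l * xi0 <= l * xi c" using c l(1) by (intro mono_l) auto
 ultimately have low: "(1 - l) * xi ?y + l * xi0 <= ?a" by linarith
 have "0 < (1 - l) * xi ?y" using l(2) H by (intro mult_pos_pos) auto
 then have low1: "l * xi0 <= ?a" using low by linarith
 moreover have "0 < l * xi0" using l(1) xi0_pos by (rule mult_pos_pos)
 ultimately have pos: "0 < ?a" by linarith
 obtain ta where ta: "t_b xi x u' = ereal ta" "0 < ta" "ta <= ta1"
 proof (cases rule: t_b_cases[OF less_imp_le[OF x], of u', case_names miss hit])
  case miss
  then show ?thesis using miss(2)[OF ta1] pos by simp
 next
  case (hit ta)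
  have "ta ~= 0" using hit(3) x by auto
  moreover have "ta <= ta1" using hit(4)[OF ta1] pos by force
  ultimately show ?thesis using hit that[of ta] by simp
 qed
 have first: "xi0 * (ta * k) <= ?a"
 proof -
  have "xi0 * (ta * k) <= xi0 * (ta1 * k)" using ta k xi0_pos by (intro mono_l mono_r) auto
  then show ?thesis using low1 by (simp add: l_def mult.commute)
 qed
 have kU: "k / U <= 1 / (2 * L)"
  using U L k by (simp add: field_simps)
 have kU0: "0 < k / U" using k U by simp
 have l_ge: "z / (1 + z) <= l" if "0 <= z" "z <= m * k" for z
  using that mk by (simp add: l(4) frac_le_eq divide_simps algebra_simps)
 have second: "EX ta1. xi0 * K / 4 * (k / U)^2 <= xi (x - ta1 *R u')"
 proof -
  define z where "z = K * (k / U)^2"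
  have K: "0 < K" "K <= r0^2" "K <= xi0 / (2 * La)"
  proof -
   show "0 < K" using r0_pos xi0_pos La_ge_1 by (simp add: K_def)
   have "K <= r0^2 * 1" unfolding K_def by (intro mono_l) auto
   then show "K <= r0^2" by simp
   have "r0^2 <= 1" using r0_pos r0_le_1 by (simp add: power_le_one)
   then have "K <= 1 * min 1 (xi0 / (2 * La))" unfolding K_def using xi0_pos La_ge_1 by (intro mono_r) auto
   then show "K <= xi0 / (2 * La)" by simp
  qed
  have kr: "k / U <= 1 / (2 * r0)"
   using kU L r0_pos by (smt (verit) frac_le)
  have z: "0 <= z" "z <= 1"
  proof -
   show "0 <= z" using K by (simp add: z_def)
   have "z <= r0^2 * (1 / (2 * r0))^2"
    unfolding z_def using K kr kU0 by (intro mult_mono power_mono) auto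
   also have "... <= 1" using r0_pos by (simp add: power_divide power_mult_distrib)
   finally show "z <= 1" .
  qed
  have goal: "xi0 * K / 4 * (k / U)^2 = xi0 * z / 4" by (simp add: z_def)
  have z4: "xi0 * z / 4 <= xi0 / 4" using z xi0_pos by simp
  consider (a) "xi0 / 2 <= xi ?y" | (b) "xi ?y < xi0 / 2" "z <= m * k" | (c) "xi ?y < xi0 / 2" "m * k < z" by linarith
  then show ?thesis
  proof cases
   case a
   have "(1 - l) * (xi0 / 2) <= (1 - l) * xi ?y" using a l(1,2) by (intro mono_l) auto
   moreover have "(1 - l) * (xi0 / 2) + l * xi0 = xi0 / 2 + l * xi0 / 2" by (simp add: field_simps)
   moreover have "0 < l * xi0 / 2" using l(1) xi0_pos by simp
   ultimately have "xi0 / 2 <= ?a" using low by linarith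
   then show ?thesis unfolding goal using z4 xi0_pos by (intro exI[of _ ta1]) linarith
  next
   case b
   have "z / 4 <= z / (1 + z)" using z by (intro divide_left_mono) auto
   then have "z / 4 <= l" using l_ge[OF z(1) b(2)] by linarith
   then have "z / 4 * xi0 <= l * xi0" using xi0_pos by (intro mono_r) auto
   then show ?thesis unfolding goal using low1 by (intro exI[of _ ta1]) (simp add: mult.commute)
  next
   case c
   \<comment> \<open>The deepest point of the old ray comes so early that the convex combination is
     not deep enough. The new ray is followed for a further time \<open>et\<close>: at
     \<open>?y\<close> the gradient is orthogonal to \<open>u\<close>, so only the turn contributes
     to first order, and \<open>et\<close> is chosen to make the quadratic loss half of this
     gain.\<close>
   define et where "et = K * k / U^2"
   have et: "0 < et" "et * k = z" "et * U = K * (k / U)"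
    using K k U by (simp_all add: et_def z_def sq_eq)
   have "m * k < et * k" using c et by simp
   then have meta: "m < et" using k by simp
   let ?P = "x - (m + et) *R u'"
   let ?d = "?P - ?y"
   have Py: "?P - ?y = (- et) *R u + ((m + et) * k) *R (c - x)"
    by (simp add: u'_def algebra_simps)
   have nPy: "norm ?d <= et * U"
   proof -
    have "norm ?d <= et * norm u + (m + et) * k * L"
     unfolding Py by (rule order_trans[OF norm_triangle_ineq]) (use et m k in \<open>simp add: L_def\<close>)
    also have "(m + et) * k * L <= (2 * et) * k * L" using meta k L by (intro mono_r) auto
    finally show ?thesis by (simp add: U_def L_def algebra_simps)
   qed
   have etU: "et * U <= 1"
   proof -
    have "et * U <= r0^2 * (1 / (2 * r0))" unfolding et using K kr kU0 by (intro mult_mono) auto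
    also have "... = r0 / 2" using r0_pos by (simp add: sq_eq)
    finally show ?thesis using r0_le_1 by simp
   qed
   have ny: "norm ?y <= R" using H by (intro bounded) simp
   have nP: "norm ?P <= R + 4" using norm_triangle_sub[of ?P ?y] nPy etU ny by linarith
   have "xi ?y + ?b *. ?d - La / 2 * N2 ?d <= xi ?P"
    using ny nP by (intro quad_lower) auto
   moreover have "et * k * (xi0 / 2) <= ?b *. ?d"
   proof -
    have "0 <= th / 2 * N2 (c - ?y)" using th_pos by simp
    then have "xi c - xi ?y <= ?b *. (c - ?y)" using concave[of c ?y] by linarith
    also have "... = ?b *. (c - x)"
     using st by (simp add: inner_simps)
    finally have g: "xi0 / 2 <= ?b *. (c - x)" using c(1) assms(2) by linarith
    have "et * k * (xi0 / 2) <= (m + et) * k * (?b *. (c - x))"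
     using g m k et xi0_pos by (intro mult_mono) auto
    then show ?thesis unfolding Py inner_add_right inner_scaleR_right st by simp
   qed
   moreover have "La / 2 * N2 ?d <= et * k * (xi0 / 4)"
   proof -
    have "La / 2 * N2 ?d <= La / 2 * (et * U)^2"
     using nPy La_ge_1 by (intro mono_l power_mono) auto
    also have "... = La / 2 * (et * k * K)" using U by (simp add: et_def sq_eq)
    also have "... <= La / 2 * (et * k * (xi0 / (2 * La)))"
     using K La_ge_1 et k by (intro mono_l) auto
    also have "... = et * k * (xi0 / 4)" using La_ge_1 by simp
    finally show ?thesis .
   qed
   ultimately have "et * k * (xi0 / 2) - et * k * (xi0 / 4) <= xi ?P" using H by linarith
   then show ?thesis unfolding goal et(2) by (intro exI[of _ "m + et"]) (simp add: mult.commute)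
  qed
 qed
 have third: "EX ta1. xi0 * r0 / (2 * La) * (sqrt (min 1 (- xi x)) * (k / U)) <= xi (x - ta1 *R u')" if nx: "norm x <= R + 4"
 proof -
  define q where "q = min 1 (- xi x)"
  have q: "0 < q" "q <= 1" "q <= - xi x" using x by (auto simp: q_def)
  have ny: "norm ?y <= R" using H by (intro bounded) simp
  have xy: "x - ?y = m *R u" by simp
  \<comment> \<open>The gradient along the ray vanishes at \<open>?y\<close>, so the way from
    \<open>x\<close> up to the obstacle is gained only quadratically. This bounds
    \<open>m * norm u\<close> from below by a multiple of \<open>sqrt q\<close>.\<close>
  have "xi ?y + ?b *. (x - ?y) - La / 2 * N2 (x - ?y) <= xi x"
   using ny nx by (intro quad_lower) auto
  then have "xi ?y - La / 2 * ?c^2 <= xi x"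
   unfolding xy using st m by simp
  then have "q <= La / 2 * ?c^2" using H q by linarith
  also have "... <= La^2 * ?c^2"
   using La_ge_1 self_le_power[of La 2] by (intro mono_r) auto
  finally have "q <= (La * ?c)^2" by (simp add: power_mult_distrib)
  then have sq: "sqrt q <= La * ?c"
   using m La_ge_1 by (intro real_le_lsqrt) auto
  define z where "z = sqrt q / La * (k / U)"
  have z0: "0 <= z" using q La_ge_1 kU0 unfolding z_def by (intro mult_nonneg_nonneg) auto
  have "sqrt q / La <= m * norm u" using sq La_ge_1 by (simp add: field_simps)
  also have "... <= m * U" using U m by (intro mono_l) auto
  finally have "z <= (m * U) * (k / U)" unfolding z_def using kU0 by (intro mono_r) auto
  then have zm: "z <= m * k" using U by simp
  have z1: "1 + z <= 2 / r0"
  proof -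
   have "sqrt q <= 1" using q by simp
   then have "sqrt q <= La" using La_ge_1 by linarith
   then have "sqrt q / La <= 1" using La_ge_1 by simp
   then have "z <= 1 * (1 / (2 * r0))"
    unfolding z_def
   proof (intro mult_mono)
    have "1 / (2 * L) <= 1 / (2 * r0)" using L r0_pos by (intro divide_left_mono) auto
    then show "k / U <= 1 / (2 * r0)" using kU by linarith
   qed (use kU0 in auto)
   moreover have "1 <= 1 / r0" using r0_pos r0_le_1 by simp
   ultimately show ?thesis by (simp add: field_simps)
  qed
  have "z * (r0 / 2) <= z * (1 / (1 + z))"
  proof (rule mono_l[OF _ z0])
   show "r0 / 2 <= 1 / (1 + z)" using z1 z0 r0_pos by (simp add: field_simps)
  qed
  then have "z * (r0 / 2) <= l" using l_ge[OF z0 zm] by (simp only: mult_1_right times_divide_eq_right)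
  then have "z * (r0 / 2) * xi0 <= l * xi0" using xi0_pos by (intro mono_r) auto
  moreover have "z * (r0 / 2) * xi0 = xi0 * r0 / (2 * La) * (sqrt q * (k / U))"
   by (simp add: z_def mult_ac)
  ultimately show ?thesis using low1 unfolding q_def by (intro exI[of _ ta1]) linarith
 qed
 show ?thesis using ta first second third by (intro exI[of _ ta]) blast
qed

text \<open>With \<open>y = k / U\<close> and \<open>q = min 1 (- xi x)\<close>, two of the depths
  in \<open>deeper_ray\<close> are of order \<open>y^2\<close> and \<open>sqrt q * y\<close>. The
  larger one exceeds their interpolation \<open>q powr de * y powr (2 - 2 * de)\<close>, which by
  \<open>rate_lower\<close> gives a singularity of exponent \<open>1 - de\<close>, integrable along
  the line, at the price \<open>q powr - (de / 2)\<close>, hence of \<open>zeta\<close>. The third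
  depth, proportional to the time of impact, serves for the quotient multiplied by
  \<open>tau\<close>: there the factor \<open>sqrt t\<close> takes the place of
  \<open>zeta\<close>.\<close>

lemma line_step:
 assumes de: "0 < de" "de <= 1 / 4"
 obtains C where "1 <= C"
  "!!x c k t ta0 u. [|xi x < 0; xi0 <= xi c; r0 <= norm (c - x); 0 < k; 0 < t; t <= 1; 0 < ta0; 0 < xi (x - ta0 *R u);
   t_b xi x (u - k *R (c - x)) <= ereal t|] ==>
  0 < rate x (u - k *R (c - x)) \<and>
  norm (u - k *R (c - x)) / rate x (u - k *R (c - x)) <=
   C * zeta de x * (1 + norm (u - k *R (c - x))) * (1 + (k * norm (c - x)) powr - (1 - de)) \<and>
  tau x (u - k *R (c - x)) * (norm (u - k *R (c - x)) / rate x (u - k *R (c - x))) <=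
   C * sqrt t * (1 + norm (u - k *R (c - x))) * (1 + (k * norm (c - x)) powr - (1 - de))"
proof -
 let ?f = "1 - 2 * de"
 let ?d = "2 * R + 1"
 let ?c = "2 - 2 * de"
 define K where "K = r0^2 * min 1 (xi0 / (2 * La))"
 define c1 where "c1 = min (xi0 * K / 4) (xi0 * r0 / (2 * La))"
 have c1: "0 < c1" using xi0_pos r0_pos La_ge_1 by (simp add: c1_def K_def)
 have c1_le: "c1 <= xi0 * K / 4" "c1 <= xi0 * r0 / (2 * La)" by (simp_all add: c1_def)
 define L1 where "L1 = 2 * R + 4"
 have L1: "1 <= L1" using R_ge_1 by (simp add: L1_def)
 define a1 where "a1 = 1 / sqrt (2 * th * c1)"
 define a2 where "a2 = 1 / sqrt (2 * th * xi0)"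
 have a: "0 < a1" "0 < a2" using c1 th_pos xi0_pos by (simp_all add: a1_def a2_def)
 define C where "C = 1 + 8 * a1 * L1 + a2 * (2 * (R + 2) + 4 * R)"
 have C: "1 <= C" "8 * a1 * L1 <= C" "a2 * (R + 2) <= C" "a2 * ?d <= C"
 proof -
  have "0 <= 8 * a1 * L1" "0 <= a2 * (2 * (R + 2) + 4 * R)" "0 <= a2 * R" using a L1 R_ge_1 by simp_all
  then show "1 <= C" "8 * a1 * L1 <= C" "a2 * (R + 2) <= C" "a2 * ?d <= C"
   using a unfolding C_def by (simp_all add: algebra_simps)
 qed
 show ?thesis
 proof (rule that[OF C(1)])
  fix x c :: "real^3" and k t ta0 u
  assume x: "xi x < 0" and c: "xi0 <= xi c" and cx: "r0 <= norm (c - x)" and k: "0 < k" and t: "0 < t" "t <= 1"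
   and old: "0 < ta0" "0 < xi (x - ta0 *R u)" and hits: "t_b xi x (u - k *R (c - x)) <= ereal t"
  let ?m = "1 + (k * norm (c - x)) powr - (1 - de)"
  let ?h = "zeta de x"
  let ?b = "u - k *R (c - x)"
  define u' L where "u' = u - k *R (c - x)" and "L = norm (c - x)"
  let ?g = "sqrt ((R + 2) * norm u')"
  let ?a = "1 + norm u'"
  define U where "U = norm u + 2 * k * L"
  define si where "si = k * L"
  let ?l = "si powr - (1 / 2)"
  let ?k = "(L * norm u') powr (1 - de) * si powr - (1 - de)"
  let ?j = "L1 * ?a * si powr - (1 - de)"
  have L: "r0 <= L" "0 < L" using cx r0_pos unfolding L_def by linarith+
  have si: "0 < si" using k L by (simp add: si_def)
  obtain ta where ta: "t_b xi x u' = ereal ta" "0 < ta" and d1: "EX ta1>=ta. xi0 * (ta * k) <= xi (x - ta1 *R u')"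
   and d2: "norm x <= R + 4 ==> (EX ta1. xi0 * K / 4 * (k / U)^2 <= xi (x - ta1 *R u'))"
   and d3: "norm x <= R + 4 ==> (EX ta1. xi0 * r0 / (2 * La) * (sqrt (min 1 (- xi x)) * (k / U)) <= xi (x - ta1 *R u'))"
   using deeper_ray[OF x c cx k old] unfolding u'_def U_def L_def K_def by blast
  let ?e = "sqrt (ta * k)"
  have tat: "ta <= t" using hits ta by (simp add: u'_def)
  obtain hit: "xi (x - ta *R u') = 0" "grad xi (x - ta *R u') *. u' <= 0"
   using ta(1) by (cases rule: t_b_cases[OF less_imp_le[OF x], of u']) auto
  note hf = hit_facts[OF ta(1) hit]
  have u'0: "u' ~= 0" using hit(1) x by auto
  let ?q = "norm u' / rate x u'"
  have low: "0 < rate x u' & ?q <= 1 / sqrt (2 * th * h)" if "0 < h" "EX ta1. h <= xi (x - ta1 *R u')" for h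
   using that rate_lower[OF ta(1) hit _ _ u'0, of h] by blast
  have h1: "0 < xi0 * (ta * k)" using xi0_pos ta k by simp
  have r: "0 < rate x u'" and q1: "?q <= 1 / sqrt (2 * th * (xi0 * (ta * k)))" using low[OF h1] d1 by blast+
  have q0: "0 <= ?q" using r by simp
  have q1': "?q <= a2 / ?e"
   using q1 th_pos xi0_pos ta k by (simp add: a2_def real_sqrt_mult mult.assoc)
  have half: "?l <= 1 + si powr - (1 - de)"
  proof (cases "si <= 1")
   case True
   have "?l <= si powr - (1 - de)"
    using True si de by (intro powr_mono') auto
   then show ?thesis by simp
  next
   case False
   then have "?l <= 1" using powr_mono[of "- (1 / 2)" 0 si] by simp
   then show ?thesis by (simp add: add_increasing2)
  qed
  have sq: "1 / sqrt si = ?l" using si by (simp add: powr_minus_divide powr_half_sqrt)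
  have nu: "0 <= norm u'" "sqrt (norm u') <= 1 + norm u'"
   using real_le_lsqrt[of "1 + norm u'" "norm u'"] by (simp_all add: sq_eq algebra_simps)
  define S where "S = 1 + si powr - (1 - de)"
  have S: "1 <= S" "0 <= S" by (simp_all add: S_def)
  have cR: "norm c <= R" using c xi0_pos by (intro bounded) simp
  have pR: "norm (x - ta *R u') <= R" using hit by (intro bounded) simp
  have xle: "norm x <= R + ta * norm u'"
   using norm_triangle_sub[of x "x - ta *R u'"] pR ta by simp
  have Lx: "L <= R + norm x" using norm_triangle_ineq4[of c x] cR by (simp add: L_def)
  have zeta: "1 <= ?h" by (simp add: zeta_def)
  have second: "ta * ?q <= C * sqrt t * ?a * S"
  proof -
   have Lu: "L <= 2 * R + norm u'"
   proof -
    have "ta * norm u' <= 1 * norm u'" using tat t by (intro mono_r) auto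
    then show ?thesis using Lx xle by linarith
   qed
   have "sqrt L <= sqrt (?d * ?a)"
   proof (intro real_sqrt_le_mono)
    have "0 <= R * norm u'" using R_ge_1 by simp
    then show "L <= ?d * ?a" using Lu by (simp add: algebra_simps)
   qed
   also have "... <= ?d * ?a"
   proof -
    have "1 <= ?d * ?a" using R_ge_1 mult_mono[of 1 "2 * R + 1" 1 "1 + norm u'"] by simp
    then show ?thesis using self_le_power[of "?d * ?a" 2] by (intro real_le_lsqrt) auto
   qed
   finally have sL: "sqrt L <= ?d * ?a" .
   have "ta * ?q <= ta * (a2 / ?e)" using q1' ta by (intro mono_l) auto
   also have "... = a2 * sqrt ta * sqrt L * (1 / sqrt si)"
   proof -
    have "ta / ?e = sqrt ta / sqrt k"
     using ta k by (simp add: real_sqrt_mult real_div_sqrt divide_divide_eq_left[symmetric])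
    moreover have "1 / sqrt k = sqrt L * (1 / sqrt si)"
     using k L by (simp add: si_def real_sqrt_mult)
    moreover have "ta * (a2 / ?e) = a2 * (ta / ?e)" by simp
    moreover have "sqrt ta / sqrt k = sqrt ta * (1 / sqrt k)" by simp
    ultimately show ?thesis by (simp only: mult.assoc)
   qed
   also have "... <= a2 * sqrt t * (?d * ?a) * S"
    unfolding sq S_def using a sL tat ta t L R_ge_1 by (intro mult_mono half) (auto intro!: mult_nonneg_nonneg)
   also have "... = (a2 * ?d) * (sqrt t * ?a * S)" by simp
   also have "... <= C * (sqrt t * ?a * S)"
    using C(4) S t by (intro mono_r) auto
   finally show ?thesis by (simp add: mult.assoc)
  qed
  have first: "?q <= C * ?h * ?a * S"
  proof (cases "norm x <= R + 4")
   case False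
   \<comment> \<open>Outside the ball of the Taylor bounds the ray must travel at least
     \<open>norm x - R\<close>, so \<open>ta * norm u'\<close> is comparable with the distance to
     \<open>c\<close>, and the depth proportional to \<open>ta\<close> suffices.\<close>
   have fx: "L <= (R + 2) * (ta * norm u')"
   proof -
    have "(norm x - R) * (R + 2) = (norm x + R) + (norm x - R) * (R + 1) - 2 * R" by (simp add: algebra_simps)
    moreover have "4 * (R + 1) <= (norm x - R) * (R + 1)" using False R_ge_1 by (intro mono_r) auto
    ultimately have "norm x + R <= (norm x - R) * (R + 2)" using R_ge_1 unfolding distrib_left[of 4] by linarith
    also have "... <= (ta * norm u') * (R + 2)" using xle R_ge_1 by (intro mono_r) auto
    finally show ?thesis using Lx by (simp add: mult.commute)
   qed
   have "si <= (R + 2) * norm u' * (ta * k)"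
    using mono_l[OF fx, of k] k by (simp add: si_def mult_ac)
   then have "sqrt si <= ?g * ?e"
    by (subst real_sqrt_mult[symmetric]) (rule real_sqrt_le_mono)
   then have "1 / ?e <= ?g * (1 / sqrt si)"
    using si ta k by (simp add: field_simps)
   also have "... <= ((R + 2) * ?a) * S"
   proof (rule mult_mono)
    have "?g <= sqrt ((R + 2) * (R + 2)) * sqrt (norm u')"
     using R_ge_1 by (subst real_sqrt_mult) (intro mono_r real_sqrt_le_mono, auto simp: mult_le_cancel_left1)
    also have "... <= (R + 2) * ?a"
     using nu R_ge_1 by (intro mult_mono) auto
    finally show "?g <= (R + 2) * ?a" .
    show "1 / sqrt si <= S" unfolding sq S_def by (rule half)
   qed (use R_ge_1 si in auto)
   finally have "a2 * (1 / ?e) <= a2 * (((R + 2) * ?a) * S)"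
    using a by (intro mono_l) auto
   then have "?q <= (a2 * (R + 2)) * (?a * S)" using q1' by (simp add: mult.assoc)
   also have "... <= (C * ?h) * (?a * S)"
   proof (intro mono_r)
    have "C * 1 <= C * ?h" using C(1) zeta by (intro mono_l) auto
    then show "a2 * (R + 2) <= C * ?h" using C(3) by linarith
   qed (use S in auto)
   finally show ?thesis by (simp add: mult.assoc)
  next
   case True
   define q where "q = min 1 (- xi x)"
   have q: "0 < q" "q <= 1" using x by (auto simp: q_def)
   have u0: "u ~= 0" using old x by auto
   have U: "0 < U" using u0 k L by (simp add: U_def add_pos_pos)
   define y where "y = k / U"
   let ?i = "q powr de * y powr ?c"
   have y: "0 < y" using k U by (simp add: y_def)
   obtain ta1 ta2 where t12: "xi0 * K / 4 * y^2 <= xi (x - ta1 *R u')" "xi0 * r0 / (2 * La) * (sqrt q * y) <= xi (x - ta2 *R u')"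
    using d2[OF True] d3[OF True] unfolding q_def y_def by blast
   define h where "h = c1 * (q powr de * y powr ?c)"
   have h: "0 < h" using c1 q y by (simp add: h_def)
   have "EX ta1. h <= xi (x - ta1 *R u')"
   proof (cases "y <= sqrt q")
    case True
    have "?i <= sqrt q * y"
    proof -
     have "y powr ?c = y * y powr ?f"
      using y powr_add[of y 1 "1 - 2 * de"] by simp
     also have "... <= y * (sqrt q) powr ?f"
      using True y de by (intro mono_l powr_mono2) auto
     also have "(sqrt q) powr ?f = q powr (?f / 2)"
      using q by (simp add: powr_half_sqrt[symmetric] powr_powr)
     finally have "?i <= q powr de * (y * q powr (?f / 2))"
      using q by (intro mono_l) auto
     also have "... = y * (q powr de * q powr (?f / 2))" by simp
     also have "q powr de * q powr (?f / 2) = sqrt q"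
     proof -
      have "de + ?f / 2 = 1 / 2" by (simp add: field_simps)
      then show ?thesis unfolding powr_add[symmetric] using q by (simp only: powr_half_sqrt less_imp_le)
     qed
     finally show ?thesis by (simp add: mult.commute)
    qed
    then have "h <= xi0 * r0 / (2 * La) * (sqrt q * y)"
     unfolding h_def using c1 c1_le(2) q y by (rule_tac mult_mono) auto
    then show ?thesis using t12(2) by (intro exI[of _ ta2]) linarith
   next
    case False
    have "?i <= y^2"
    proof -
     have "q powr de = (sqrt q) powr (2 * de)"
      using q by (simp add: powr_half_sqrt[symmetric] powr_powr)
     also have "... <= y powr (2 * de)" using False q de by (intro powr_mono2) auto
     finally have "?i <= y powr (2 * de) * y powr ?c"
      by (intro mono_r) auto
     also have "... = y^2" using y by (simp add: powr_add[symmetric])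
     finally show ?thesis .
    qed
    then have "h <= xi0 * K / 4 * y^2"
     unfolding h_def using c1 c1_le(1) q y by (rule_tac mult_mono) auto
    then show ?thesis using t12(1) by (intro exI[of _ ta1]) linarith
   qed
   from low[OF h this] have "?q <= 1 / sqrt (2 * th * h)" by simp
   also have "... = a1 * (q powr - (de / 2) * (1 / y) powr (1 - de))"
   proof -
    have "sqrt h = sqrt c1 * (q powr (de / 2) * y powr (1 - de))"
    proof -
     have "sqrt (q powr de * y powr ?c) = (q powr de) powr (1 / 2) * (y powr ?c) powr (1 / 2)"
      by (simp add: real_sqrt_mult powr_half_sqrt)
     also have "... = q powr (de / 2) * y powr (1 - de)"
     proof -
      have "?c * (1 / 2) = 1 - de" by (simp add: field_simps)
      then show ?thesis unfolding powr_powr by (simp only: mult_1_right times_divide_eq_right)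
     qed
     finally show ?thesis by (simp add: h_def real_sqrt_mult)
    qed
    then have e: "sqrt (2 * th * h) = sqrt (2 * th * c1) * (q powr (de / 2) * y powr (1 - de))"
     by (simp add: real_sqrt_mult)
    show ?thesis unfolding e a1_def using y q
     by (simp add: powr_minus_divide powr_divide)
   qed
   also have "... <= a1 * (?h * (8 * L1 * ?a * S))"
   proof (intro mono_l mult_mono)
    show "q powr - (de / 2) <= ?h"
    proof (cases "1 <= - xi x")
     case True
     then have "q = 1" by (simp add: q_def)
     then show ?thesis using zeta by simp
    next
     case False
     then have "q = - xi x" by (simp add: q_def)
     then show ?thesis by (simp add: zeta_def)
    qed
    have LL: "L <= L1" using Lx True by (simp add: L1_def)
    \<comment> \<open>\<open>U\<close> is expressed by the new velocity \<open>u'\<close>, which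
      differs from \<open>u\<close> by \<open>k * L\<close> only.\<close>
    have "1 / y = U / k" by (simp add: y_def)
    also have "... <= norm u' / k + 3 * L"
    proof -
     have "norm u <= norm u' + k * L"
      using norm_triangle_ineq[of u' "k *R (c - x)"] k by (simp add: u'_def L_def)
     then have "U <= norm u' + 3 * L * k" by (simp add: U_def algebra_simps)
     then show ?thesis using k by (simp add: field_simps)
    qed
    also have "norm u' / k = L * norm u' / si" using L by (simp add: si_def)
    finally have "(1 / y) powr (1 - de) <= (L * norm u' / si + 3 * L) powr (1 - de)"
     using y de by (intro powr_mono2) auto
    also have "... <= 2 * ((L * norm u' / si) powr (1 - de) + (3 * L) powr (1 - de))"
     using L si de by (intro powr_add_le_sum) auto
    also have "... <= 2 * ((L1 * ?a) * si powr - (1 - de) + 3 * L1)"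
    proof (intro mono_l add_mono)
     have p1: "z powr (1 - de) <= y" if "0 <= z" "z <= y" "1 <= y" for z y :: real
     proof -
      have "z powr (1 - de) <= y powr (1 - de)" using that de by (intro powr_mono2) auto
      also have "... <= y powr 1" using that de by (intro powr_mono) auto
      finally show ?thesis using that by simp
     qed
     have g1: "1 <= L1 * ?a" using L1 mult_mono[of 1 L1 1 "1 + norm u'"] by simp
     have "L * norm u' <= L1 * ?a" using LL L L1 by (intro mult_mono) auto
     then have "(L * norm u') powr (1 - de) <= L1 * ?a" using L g1 by (intro p1) auto
     then have "?k <= ?j"
      by (intro mono_r) auto
     moreover have "(L * norm u' / si) powr (1 - de) = ?k"
      by (simp only: powr_divide powr_minus_divide) simp
     ultimately show "(L * norm u' / si) powr (1 - de) <= ?j" by simp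
     show "(3 * L) powr (1 - de) <= 3 * L1" using LL L L1 by (intro p1) auto
    qed auto
    also have "... <= 8 * L1 * ?a * S"
    proof -
     have "0 <= ?j" "0 <= L1 * norm u'" using L1 by auto
     moreover have "8 * L1 * ?a * S = 8 * L1 + 8 * (L1 * norm u') + 8 * (L1 * ?a * si powr - (1 - de))"
      by (simp add: S_def algebra_simps)
     ultimately show ?thesis unfolding distrib_left using L1 by linarith
    qed
    finally show "(1 / y) powr (1 - de) <= 8 * L1 * ?a * S" .
   qed (use a zeta in auto)
   also have "... = (8 * a1 * L1) * (?h * (?a * S))" by simp
   also have "... <= C * (?h * (?a * S))"
    using C(2) zeta S by (intro mono_r) auto
   finally show ?thesis by (simp add: mult.assoc)
  qed
  show "0 < rate x ?b \<and>
  norm ?b / rate x ?b <=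
   C * ?h * (1 + norm ?b) * ?m \<and>
  tau x ?b * (norm ?b / rate x ?b) <=
   C * sqrt t * (1 + norm ?b) * ?m"
   using r first second unfolding u'_def[symmetric] L_def[symmetric] si_def[symmetric] S_def[symmetric] hf(1) by blast
 qed
qed

text \<open>
 The velocities on a line in the direction \<open>x - c\<close> whose rays meet the obstacle form a half-line
 with some endpoint \<open>a\<close>; halving the distance to \<open>a\<close> reduces the bound to a turn of a hitting ray.
\<close>

lemma line_bound:
 assumes de: "0 < de" "de <= 1 / 4"
 obtains C where "1 <= C"
  "!!x m L q t. [|xi x < 0; norm m = 1; r0 <= L; xi0 <= xi (x - L *R m); 0 < t; t <= 1|] ==>
   EX a. ALL s. s ~= a --> t_b xi x (q + s *R m) <= ereal t -->
    0 < rate x (q + s *R m) \<and>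
    norm (q + s *R m) / rate x (q + s *R m) <= C * zeta de x * (1 + norm (q + s *R m)) * (1 + abs (s - a) powr - (1 - de)) \<and>
    tau x (q + s *R m) * (norm (q + s *R m) / rate x (q + s *R m)) <=
     C * sqrt t * (1 + norm (q + s *R m)) * (1 + abs (s - a) powr - (1 - de))"
proof -
 obtain C where C: "1 <= C" and step:
  "!!x c k t ta0 u. [|xi x < 0; xi0 <= xi c; r0 <= norm (c - x); 0 < k; 0 < t; t <= 1; 0 < ta0; 0 < xi (x - ta0 *R u);
   t_b xi x (u - k *R (c - x)) <= ereal t|] ==>
  0 < rate x (u - k *R (c - x)) \<and>
  norm (u - k *R (c - x)) / rate x (u - k *R (c - x)) <=
   C * zeta de x * (1 + norm (u - k *R (c - x))) * (1 + (k * norm (c - x)) powr - (1 - de)) \<and>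
  tau x (u - k *R (c - x)) * (norm (u - k *R (c - x)) / rate x (u - k *R (c - x))) <=
   C * sqrt t * (1 + norm (u - k *R (c - x))) * (1 + (k * norm (c - x)) powr - (1 - de))"
  by (rule line_step[OF de]) (rule that)
 show ?thesis
 proof (rule that[of "2 * C"])
  show "1 <= 2 * C" using C by simp
  fix x m :: "real^3" and L t :: real and q
  assume x: "xi x < 0" and m: "norm m = 1" and L: "r0 <= L" and c: "xi0 <= xi (x - L *R m)" and t: "0 < t" "t <= 1"
  have L0: "0 < L" using L r0_pos by linarith
  let ?u = "%s. q + s *R m"
  let ?c = "x - L *R m"
  have nc: "norm (?c - x) = L" using m L0 by simp
  have turn: "?u s = ?u s' - ((s - s') / L) *R (?c - x)" for s s'
  proof -
   have "((s - s') / L) *R (?c - x) = (s' - s) *R m" using L0 by (simp add: scaleR_minus_left[symmetric] del: scaleR_minus_left)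
   then show ?thesis by (simp add: algebra_simps)
  qed
  \<comment> \<open>Parameters of the rays that reach the closed obstacle. By \<open>deeper\<close>
    each larger parameter reaches its interior, which is what \<open>line_step\<close> asks of the
    ray before the turn.\<close>
  define H where "H = {s. EX ta>0. 0 <= xi (x - ta *R ?u s)}"
  have deeper: "EX ta>0. 0 < xi (x - ta *R ?u s)" if s': "s' \<in> H" "s' < s" for s s'
  proof -
   obtain ta where ta: "0 < ta" "0 <= xi (x - ta *R ?u s')" using s' by (auto simp: H_def)
   define k where "k = (s - s') / L"
   have k: "0 < k" using s' L0 by (simp add: k_def)
   have pos: "0 < 1 + ta * k" using ta k by (simp add: add_pos_pos)
   define l where "l = ta * k / (1 + ta * k)"
   have l: "0 < l" "l <= 1" "1 - l = 1 / (1 + ta * k)" using ta k pos by (simp_all add: l_def field_simps)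
   have "(1 - l) *R (x - ta *R ?u s') + l *R ?c = x - ((1 - l) * ta) *R ?u s' + l *R (?c - x)"
    by (simp add: algebra_simps)
   moreover have e: "l = ((1 - l) * ta) * k" unfolding l(3) by (simp add: l_def)
   moreover have "x - A *R p + (A * k) *R w = x - A *R (p - k *R w)" for A p w by (simp add: algebra_simps)
   ultimately have pt: "(1 - l) *R (x - ta *R ?u s') + l *R ?c = x - ((1 - l) * ta) *R ?u s"
    unfolding turn[of s s'] k_def[symmetric] by metis
   have "0 < l * xi0" using l xi0_pos by simp
   also have "... <= l * xi ?c" using l c by (intro mono_l) auto
   also have "... <= (1 - l) * xi (x - ta *R ?u s') + l * xi ?c" using l(2) ta by (simp add: mult_nonneg_nonneg del: zero_le_mult_iff)
   also have "... <= xi (x - ((1 - l) * ta) *R ?u s)" unfolding pt[symmetric] using l by (intro concave_comb) auto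
   finally show ?thesis using l(3) pos ta by (intro exI[of _ "(1 - l) * ta"]) simp
  qed
  have inH: "s \<in> H" if hit: "t_b xi x (?u s) <= ereal t" for s
  proof (cases rule: t_b_cases[OF less_imp_le[OF x], of "?u s", case_names miss hit])
   case miss
   then show ?thesis using hit by simp
  next
   case (hit ta)
   have "ta ~= 0" using hit(3) x by auto
   then show ?thesis using hit by (auto simp: H_def intro!: exI[of _ ta])
  qed
  have "EX a. ALL s. s ~= a --> s \<in> H --> (EX s'<s. (EX h:H. h < s') & (s - s' = 1 | s - s' = abs (s - a) / 2))"
  proof (cases "bdd_below H")
   case True
   show ?thesis
   proof (rule exI[of _ "Inf H"], intro allI impI)
    fix s assume s: "s ~= Inf H" "s \<in> H"
    have "Inf H < s" using cInf_lower[OF s(2) True] s by simp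
    then have "Inf H < (s + Inf H) / 2" by simp
    then obtain h where "h \<in> H" "h < (s + Inf H) / 2" using cInf_lessD s(2) by blast
    with \<open>Inf H < s\<close> show "EX s'<s. (EX h:H. h < s') & (s - s' = 1 | s - s' = abs (s - Inf H) / 2)"
     by (intro exI[of _ "(s + Inf H) / 2"]) (auto simp: field_simps abs_if)
   qed
  next
   \<comment> \<open>Now every parameter belongs to \<open>H\<close>; there is no endpoint,
     \<open>a\<close> is arbitrary, and a turn of unit size is always available.\<close>
   case False
   show ?thesis
   proof (rule exI[of _ 0], intro allI impI)
    fix s :: real
    obtain h where "h \<in> H" "h < s - 1" using False unfolding bdd_below_def by (metis not_le)
    then show "EX s'<s. (EX h:H. h < s') & (s - s' = 1 | s - s' = abs (s - 0) / 2)"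
     by (intro exI[of _ "s - 1"]) auto
   qed
  qed
  then obtain a where a: "!!s. s ~= a ==> s \<in> H ==> EX s'<s. (EX h:H. h < s') & (s - s' = 1 | s - s' = abs (s - a) / 2)" by blast
  show "EX a. ALL s. s ~= a --> t_b xi x (q + s *R m) <= ereal t -->
    0 < rate x (q + s *R m) \<and>
    norm (q + s *R m) / rate x (q + s *R m) <= 2 * C * zeta de x * (1 + norm (q + s *R m)) * (1 + abs (s - a) powr - (1 - de)) \<and>
    tau x (q + s *R m) * (norm (q + s *R m) / rate x (q + s *R m)) <=
     2 * C * sqrt t * (1 + norm (q + s *R m)) * (1 + abs (s - a) powr - (1 - de))"
  proof (intro exI[of _ a] allI impI)
   fix s assume sa: "s ~= a" and hits: "t_b xi x (?u s) <= ereal t"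
   let ?d = "rate x (?u s)"
   let ?b = "abs (s - a)"
   let ?f = "(1 / 2) powr - (1 - de) * ?b powr - (1 - de)"
   let ?e = "1 + ?b powr - (1 - de)"
   let ?a = "1 + norm (?u s)"
   obtain s' where s': "s' < s" "EX h:H. h < s'" "s - s' = 1 | s - s' = ?b / 2" using a[OF sa inH[OF hits]] by blast
   obtain ta0 where ta0: "0 < ta0" "0 < xi (x - ta0 *R ?u s')" using s'(2) deeper by blast
   have k: "0 < (s - s') / L" "(s - s') / L * norm (?c - x) = s - s'" using s' L0 nc by auto
   let ?S = "1 + (s - s') powr - (1 - de)" and ?S' = "2 * ?e"
   have k2: "(s - s') / L * L = s - s'" using L0 by simp
   have st: "0 < ?d & norm (?u s) / ?d <= C * zeta de x * ?a * ?S \<and>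
     tau x (?u s) * (norm (?u s) / ?d) <= C * sqrt t * ?a * ?S"
    using step[OF x c _ k(1) t ta0] hits L unfolding turn[of s s', symmetric] k2 nc by blast
   have "?S <= ?S'"
    using s'(3)
   proof
    assume "s - s' = 1" then show ?thesis by simp
   next
    assume e: "s - s' = ?b / 2"
    have "(1 / 2) powr - (1 - de) <= (1 / 2) powr (- 1 :: real)" using de by (intro powr_mono') auto
    then have "(1 / 2) powr - (1 - de) <= (2::real)" by (simp add: powr_minus_divide)
    then have "?f <= 2 * ?b powr - (1 - de)"
     by (intro mono_r) auto
    moreover have "(s - s') powr - (1 - de) = ?f"
     using powr_mult[of "1 / 2" "?b" "- (1 - de)"] unfolding e by simp
    ultimately show ?thesis by simp
   qed
   moreover have "0 <= C * zeta de x * ?a" "0 <= C * sqrt t * ?a"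
    using C t by (simp_all add: zeta_def)
   ultimately have le: "C * zeta de x * ?a * ?S <= C * zeta de x * ?a * ?S'"
    "C * sqrt t * ?a * ?S <= C * sqrt t * ?a * ?S'"
    by (blast intro: mono_l)+
   have e: "2 * a * b * c * d = a * b * c * (2 * d)" for a b c d :: real by simp
   show "0 < ?d \<and>
    norm (?u s) / ?d <= 2 * C * zeta de x * ?a * ?e \<and>
    tau x (?u s) * (norm (?u s) / ?d) <= 2 * C * sqrt t * ?a * ?e"
    unfolding e using st le by (intro conjI) (blast, linarith+)
  qed
 qed
qed

end

section \<open>Integrals along trajectories\<close>

lemma nn_integral_exp_interval:
 assumes "0 < c"
 shows "(NN r. ennreal (exp (- c * r)) * indicator {0..t} r) <= ennreal (1 / c)"
proof (cases "0 <= t")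
 case True
 have "(NN r. ennreal (exp (- c * r)) * indicator {0..t} r) = ennreal (- exp (- c * t) / c - - exp (- c * 0) / c)"
  using assms True by (intro nn_integral_FTC_Icc) (auto intro!: derivative_eq_intros)
 also have "... <= ennreal (1 / c)" using assms by (intro ennreal_leI) (simp add: field_simps)
 finally show ?thesis .
qed simp

text \<open>The damping comes from going back in time in the weight \<open>Theta\<close>. It absorbs
  the growth \<open>1 + r * w\<close> in \<open>flow_deviation\<close> and yields the decay
  \<open>1 / (1 + w)\<close>, at the price of the integrable singularity
  \<open>r powr - (1 / 2)\<close>.\<close>

lemma exp_growth_bound:
 fixes r w :: real
 assumes "0 < r" "r <= 1" "0 <= w"
 shows "exp (- ((1 + w)^2 / 8) * r) * (1 + r * w) <= 11 / (1 + w) * r powr - (1 / 2)"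
proof -
 define y where "y = sqrt r * (1 + w)"
 let ?a = "y^2 / 8"
 let ?b = "exp (- ?a)"
 have y: "0 < y" using assms by (simp add: y_def)
 have y2: "(1 + w)^2 / 8 * r = y^2 / 8" using assms by (simp add: y_def power_mult_distrib)
 have rw: "r * w <= y"
 proof -
  have "r = sqrt r * sqrt r" using assms by simp
  also have "... <= sqrt r * 1" using assms by (intro mono_l) auto
  finally have "r * w <= sqrt r * w" using assms by (intro mono_r) auto
  also have "... <= y" using assms by (simp add: y_def algebra_simps)
  finally show ?thesis .
 qed
 have "y * (1 + y) <= 11 * exp ?a"
 proof -
  have "1 + y^2 / 8 <= exp ?a" by (rule exp_ge_add_one_self)
  then have "11 + 11 * ?a <= 11 * exp ?a" by (simp add: field_simps)
  moreover have "y * (1 + y) <= 11 + 11 * ?a"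
  proof -
   have "0 <= (y - 1)^2 * (3/8) + 10" by simp
   have "0 <= (y - 4 / 3)^2" by simp
   then show ?thesis by (simp add: sq_eq algebra_simps)
  qed
  ultimately show ?thesis by linarith
 qed
 then have "?b * (y * (1 + y)) <= ?b * (11 * exp ?a)"
  by (intro mono_l) auto
 also have "... = 11" by (simp add: exp_minus)
 finally have "?b * (1 + y) <= 11 / y" using y by (simp add: field_simps)
 moreover have "?b * (1 + r * w) <= ?b * (1 + y)"
  using rw by (intro mono_l) auto
 moreover have "11 / y = 11 / (1 + w) * r powr - (1 / 2)"
  using assms by (simp add: y_def powr_minus_divide powr_half_sqrt)
 ultimately have "?b * (1 + r * w) <= 11 / (1 + w) * r powr - (1 / 2)" by linarith
 moreover have "- ((1 + w)^2 / 8) * r = - ?a" using y2 by simp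
 ultimately show ?thesis by (simp only:)
qed

context convex_obstacle
begin

lemma xi_measurable [measurable]: "xi \<in> bm"
 using cont by (rule borel_measurable_continuous_onI)

lemma flow_measurable [measurable]: "(%r. flow r x v) \<in> bm"
 unfolding flow_def Xc_def by measurable

lemma vel_measurable [measurable]: "(%r. vel r x v) \<in> bm"
 unfolding vel_def Vc_def by measurable

lemma zeta_measurable [measurable]: "zeta de \<in> bm"
 unfolding zeta_def[abs_def] by measurable

lemma zeta_ge_1: "1 <= zeta de x"
 by (simp add: zeta_def)

lemma flow_interior:
 assumes "xi x <= 0" "v ~= 0"
 shows "EX r1. ALL r>=0. r ~= r1 --> xi (flow r x v) < 0"
proof -
 obtain r1 where "!!r. 0 <= r ==> xi (flow r x v) <= - (th / 4 * N2 v * (r - r1)^2)"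
  by (rule flow_depth[OF assms(1)]) (rule that)
 moreover have "0 < th / 4 * N2 v * (r - r1)^2" if "r ~= r1" for r
  using that assms th_pos by simp
 ultimately show ?thesis by (intro exI[of _ r1]) (smt (verit))
qed

definition CZ :: "real => real" where "CZ de = 30 * (1 + (th / 4) powr - (de / 2))"

text \<open>By \<open>flow_depth\<close>, \<open>zeta\<close> on the trajectory is at most
  \<open>1 + k * abs (r - r1) powr - de\<close>. Its product with \<open>r powr - (1 / 2)\<close>
  splits into singularities of exponent at most \<open>3 / 4\<close>, which leaves the power
  \<open>1 / 4\<close> of \<open>t\<close>. The factor \<open>norm v powr - de\<close> reflects that
  slow particles stay near the boundary for long.\<close>

lemma zeta_integral:
 assumes x: "xi x <= 0" and v: "v ~= 0" and t: "0 < t" "t <= 1" and de: "0 < de" "de <= 1 / 4"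
 shows "(NN r. ennreal (r powr - (1 / 2) * zeta de (flow r x v)) * indicator {0..t} r)
  <= ennreal (CZ de * t powr (1 / 4) * (1 + norm v powr - de))"
proof -
 let ?e = "CZ de * t powr (1 / 4) * (1 + norm v powr - de)"
 let ?b = "1 - 1 / 2"
 obtain r1 where r1: "!!r. 0 <= r ==> xi (flow r x v) <= - (th / 4 * N2 v * (r - r1)^2)"
  by (rule flow_depth[OF x]) (rule that)
 define k where "k = (th / 4) powr - (de / 2) * norm v powr - de"
 let ?c = "ennreal k"
 have k: "0 <= k" by (simp add: k_def)
 define be where "be = 1 / 2 + de"
 let ?a = "3 * t powr (1 - be) / (1 - be)"
 have be: "0 <= be" "be < 1" "be <= 3 / 4" using de by (auto simp: be_def)
 have pt: "r powr - (1 / 2) * zeta de (flow r x v) <= abs (r - 0) powr - (1 / 2) + (k * abs (r - 0) powr - be + k * abs (r - r1) powr - be)"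
  if r: "0 < r" "r ~= r1" for r
 proof -
  let ?d = "abs (r - r1)"
  have n: "0 < th / 4 * N2 v * (r - r1)^2" using r v th_pos by simp
  have "zeta de (flow r x v) <= 1 + (th / 4 * N2 v * (r - r1)^2) powr - (de / 2)"
   unfolding zeta_def using r1[of r] r n de by (intro add_left_mono powr_mono2') auto
  also have "(th / 4 * N2 v * (r - r1)^2) powr - (de / 2) = (th / 4) powr - (de / 2) * (N2 v) powr - (de / 2) * ((r - r1)^2) powr - (de / 2)"
   by (simp only: powr_mult)
  also have "(N2 v) powr - (de / 2) = norm v powr - de"
  proof -
   have "N2 v = norm v powr 2" using v by simp
   then show ?thesis by (simp only: powr_powr) simp
  qed
  also have "((r - r1)^2) powr - (de / 2) = ?d powr - de"
  proof -
   have "(r - r1)^2 = ?d powr 2" using r by simp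
   then show ?thesis by (simp only: powr_powr) simp
  qed
  finally have "zeta de (flow r x v) <= 1 + k * ?d powr - de" by (simp add: k_def)
  then have "r powr - (1 / 2) * zeta de (flow r x v) <= r powr - (1 / 2) * (1 + k * ?d powr - de)"
   by (intro mono_l) auto
  also have "... = r powr - (1 / 2) + k * (r powr - (1 / 2) * ?d powr - de)" by (simp add: algebra_simps)
  also have "... <= r powr - (1 / 2) + k * (r powr - be + ?d powr - be)"
   unfolding be_def using k r de by (intro add_left_mono mono_l powr_mult_le_sum) auto
  finally show ?thesis using r by (simp add: algebra_simps)
 qed
 have "(NN r. ennreal (r powr - (1 / 2) * zeta de (flow r x v)) * indicator {0..t} r) <=
  (NN r. (ennreal (abs (r - 0) powr - (1 / 2)) * indicator {0..t} r + (?c * (ennreal (abs (r - 0) powr - be) * indicator {0..t} r) +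
    ?c * (ennreal (abs (r - r1) powr - be) * indicator {0..t} r))))"
 proof (rule nn_integral_mono_AE)
  have "AE r in lborel. r ~= 0 & r ~= r1"
   using AE_lborel_singleton[of "0::real"] AE_lborel_singleton[of r1] by auto
  then show "AE r in lborel. ennreal (r powr - (1 / 2) * zeta de (flow r x v)) * indicator {0..t} r <=
   ennreal (abs (r - 0) powr - (1 / 2)) * indicator {0..t} r + (?c * (ennreal (abs (r - 0) powr - be) * indicator {0..t} r) +
    ?c * (ennreal (abs (r - r1) powr - be) * indicator {0..t} r))"
  proof (rule AE_mp, intro AE_I2 impI)
   fix r assume r: "r ~= 0 & r ~= r1"
   show "ennreal (r powr - (1 / 2) * zeta de (flow r x v)) * indicator {0..t} r <=
   ennreal (abs (r - 0) powr - (1 / 2)) * indicator {0..t} r + (?c * (ennreal (abs (r - 0) powr - be) * indicator {0..t} r) +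
    ?c * (ennreal (abs (r - r1) powr - be) * indicator {0..t} r))"
   proof (cases "r \<in> {0..t}")
    case True
    then show ?thesis using ennreal_leI[OF pt[of r]] r k
     by (simp add: ennreal_mult[symmetric] ennreal_plus[symmetric] del: ennreal_plus)
   qed simp
  qed
 qed
 also have "... = (NN r. ennreal (abs (r - 0) powr - (1 / 2)) * indicator {0..t} r) +
   (?c * (NN r. ennreal (abs (r - 0) powr - be) * indicator {0..t} r) +
   ?c * (NN r. ennreal (abs (r - r1) powr - be) * indicator {0..t} r))"
  by (simp add: nn_integral_add nn_integral_cmult)
 also have "... <= ennreal (3 * t powr ?b / ?b) + (?c * ennreal ?a + ?c * ennreal ?a)"
  using be t by (intro add_mono mono_l nn_integral_abs_powr_interval) auto
 also have "... = ennreal (3 * t powr ?b / ?b + (k * ?a + k * ?a))"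
  using k be by (simp add: ennreal_mult[symmetric] ennreal_plus[symmetric] del: ennreal_plus)
 also have "... <= ennreal (CZ de * t powr (1 / 4) * (1 + norm v powr - de))"
 proof (rule ennreal_leI)
  have t1: "t powr ?b <= t powr (1 / 4)" "t powr (1 - be) <= t powr (1 / 4)"
   using t be by (intro powr_mono'; simp)+
  have "3 * t powr (1 - be) / (1 - be) <= 3 * t powr (1 / 4) / (1 / 4)"
   using t1 be by (intro frac_le) auto
  then have "k * ?a <= k * (12 * t powr (1 / 4))"
   using k by (intro mono_l) auto
  then have "3 * t powr ?b / ?b + (k * ?a + k * ?a)
   <= 6 * t powr (1 / 4) + 24 * (k * t powr (1 / 4))" using t1 by simp
  also have "... <= ?e"
  proof -
   let ?K = "(th / 4) powr - (de / 2)" and ?n = "norm v powr - de" and ?t = "t powr (1 / 4)"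
   have "CZ de * ?t * (1 + ?n) = 30 * ?t + 30 * (k * ?t) + 30 * (?K * ?t) + 30 * (?t * ?n)"
    by (simp add: CZ_def k_def algebra_simps)
   moreover have "0 <= k * ?t" "0 <= ?K * ?t" "0 <= ?t * ?n" "0 <= ?t" using k by simp_all
   ultimately show ?thesis by linarith
  qed
  finally show "3 * t powr ?b / ?b + (k * ?a + k * ?a) <= ?e" .
 qed
 finally show ?thesis .
qed

lemma CD_pos: "0 < CD"
 using CD_bounds(1) by linarith

text \<open>\<open>z\<close> and \<open>z'\<close> are left open because two different bounds are
  inserted later: a power of the speed, and the weight that distinguishes points near the
  boundary.\<close>

lemma position_integral:
 assumes x: "xi x <= 0" "xi x' <= 0" and t: "0 < t" "t <= 1"
  and D: "norm (x - x') <= 1" "norm (v - v') <= 1" and e: "dev_bound t x v x' v' e"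
  and z: "(NN r. ennreal (r powr - (1 / 2) * zeta de (flow r x v)) * indicator {0..t} r) <= ennreal z" "0 <= z"
  and z': "(NN r. ennreal (r powr - (1 / 2) * zeta de (flow r x' v')) * indicator {0..t} r) <= ennreal z'" "0 <= z'"
 defines "w == norm v + norm v'"
 shows "(NN r. ennreal (exp (- ((1 + w)^2 / 8) * r) * ((zeta de (flow r x v) + zeta de (flow r x' v')) * norm (flow r x v - flow r x' v'))) * indicator {0..t} r)
  <= ennreal (11 * CD / (1 + w) * (norm (x - x') + norm (v - v') + e) * (z + z'))"
proof -
 let ?a = "(1 + w)^2 / 8"
 have w: "0 <= w" by (simp add: w_def)
 have e0: "0 <= e" by (rule dev_bound_nonneg[OF x e])
 define K where "K = 11 * CD / (1 + w) * (norm (x - x') + norm (v - v') + e)"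
 have K: "0 <= K" using CD_pos w e0 by (simp add: K_def)
 let ?Z = "%r. zeta de (flow r x v) + zeta de (flow r x' v')"
 have Z: "0 <= zeta de y" for y using zeta_ge_1[of de y] by linarith
 have pt: "exp (- ?a * r) * (?Z r * norm (flow r x v - flow r x' v')) <= K * (r powr - (1 / 2) * zeta de (flow r x v) + r powr - (1 / 2) * zeta de (flow r x' v'))"
  if r: "0 < r" "r <= t" for r
 proof -
  let ?c = "1 + r * w"
  let ?D = "norm (x - x') + norm (v - v')"
  have rw: "0 <= r * w" using r w by simp
  have "norm (flow r x v - flow r x' v') <= CD * (?D + ?c * e)"
   using flow_deviation(1)[OF x _ r(2) t(2) D e] r by (simp add: w_def)
  also have "... <= CD * (?c * (?D + e))"
  proof (intro mono_l)
   have "0 <= r * w * ?D" using rw by simp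
   then show "?D + ?c * e <= ?c * (?D + e)" by (simp add: algebra_simps)
  qed (use CD_pos in auto)
  finally have "exp (- ?a * r) * (?Z r * norm (flow r x v - flow r x' v')) <= exp (- ?a * r) * (?Z r * (CD * (?c * (?D + e))))"
   using Z by (intro mono_l) auto
  also have "... = (exp (- ?a * r) * ?c) * (?Z r * (CD * (?D + e)))" by (simp add: mult_ac)
  also have "... <= (11 / (1 + w) * r powr - (1 / 2)) * (?Z r * (CD * (?D + e)))"
   using r t w e0 CD_pos Z by (intro mono_r exp_growth_bound mult_nonneg_nonneg add_nonneg_nonneg) auto
  also have "... = K * (r powr - (1 / 2) * zeta de (flow r x v) + r powr - (1 / 2) * zeta de (flow r x' v'))"
   unfolding K_def distrib_left[of "r powr - (1 / 2)", symmetric] by (simp only: distrib_left[symmetric] mult_ac times_divide_eq_right times_divide_eq_left)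
  finally show ?thesis .
 qed
 let ?I = "%x v r. ennreal (r powr - (1 / 2) * zeta de (flow r x v)) * indicator {0..t} r"
 have "(NN r. ennreal (exp (- ?a * r) * (?Z r * norm (flow r x v - flow r x' v'))) * indicator {0..t} r) <=
  (NN r. ennreal K * (?I x v r + ?I x' v' r))"
 proof (rule nn_integral_mono_AE, rule AE_mp[OF AE_lborel_singleton[of "0::real"]], intro AE_I2 impI)
  fix r :: real assume r: "r ~= 0"
  let ?b = "ennreal (exp (- ?a * r) * (?Z r * norm (flow r x v - flow r x' v')))"
  show "?b * indicator {0..t} r <= ennreal K * (?I x v r + ?I x' v' r)"
  proof (cases "r \<in> {0..t}")
   case True
   have "?b <= ennreal (K * (r powr - (1 / 2) * zeta de (flow r x v) + r powr - (1 / 2) * zeta de (flow r x' v')))"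
    using True r by (intro ennreal_leI pt) auto
   also have "... = ennreal K * (ennreal (r powr - (1 / 2) * zeta de (flow r x v)) + ennreal (r powr - (1 / 2) * zeta de (flow r x' v')))"
    using K Z by (simp add: ennreal_mult ennreal_plus)
   finally show ?thesis using True by simp
  qed simp
 qed
 also have "... = ennreal K * ((NN r. ?I x v r) + (NN r. ?I x' v' r))"
  by (simp add: nn_integral_add nn_integral_cmult)
 also have "... <= ennreal K * (ennreal z + ennreal z')" using z z' by (intro mono_l add_mono) auto
 also have "... = ennreal (K * (z + z'))" using K z z' by (simp add: ennreal_mult ennreal_plus)
 finally show ?thesis by (simp add: K_def)
qed

lemma jump_le:
 assumes "xi x <= 0"
 shows "jump d x v r <= La * norm v"
proof (cases "t_b xi x v <= ereal r")
 case True
 then obtain ta where "t_b xi x v = ereal ta" "xi (x - ta *R v) = 0" "grad xi (x - ta *R v) *. v <= 0"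
  by (cases rule: t_b_cases[OF assms, of v]) auto
 then have "rate x v <= La * norm v" by (rule hit_facts)
 then show ?thesis using La_ge_1 by (simp add: jump_def)
next
 case False
 then show ?thesis using La_ge_1 by (simp add: jump_def)
qed

definition CV :: real where "CV = CD * (9 + 4 * La)"

text \<open>The first bound is linear in the distances and serves the Lipschitz scale; its position
  term is not small in \<open>t\<close>, because of the jumps. The second serves the square-root
  scale: an integrated jump is at most \<open>La * w * t\<close> and also of order
  \<open>e^2\<close>, hence bounded by their geometric mean, which brings in
  \<open>sqrt t\<close>.\<close>

lemma velocity_integral:
 assumes x: "xi x <= 0" "xi x' <= 0" and t: "0 < t" "t <= 1"
  and D: "norm (x - x') <= 1" "norm (v - v') <= 1" and e: "dev_bound t x v x' v' e"
 defines "w == norm v + norm v'"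
 defines "I == (NN r. ennreal (exp (- ((1 + w)^2 / 8) * r) * norm (vel r x v - vel r x' v')) * indicator {0..t} r)"
 shows "I <= ennreal (CV * (e / (1 + w) + norm (x - x') + t * norm (v - v')))"
  and "e = sqrt (norm (x - x') + norm (v - v')) ==> I <= ennreal (CV * ((1 + w) * sqrt t * e))"
proof -
 let ?p = "ennreal CD"
 let ?n = "9 + 4 * La"
 let ?m = "e / (1 + w) + norm (x - x') + t * norm (v - v')"
 let ?j = "e / (1 + w)"
 let ?h = "ennreal (w * e)"
 let ?f = "La * w * t"
 let ?e = "1 / ((1 + w)^2 / 8)"
 let ?a = "(1 + w) * sqrt t * e"
 let ?k = "2 * La * ?a"
 define Dx Dv where "Dx = norm (x - x')" and "Dv = norm (v - v')"
 let ?q = "ennreal Dv"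
 let ?l = "e / (1 + w) + Dx + t * Dv"
 define d where "d = 2 * La * (Dx + t * Dv)"
 have w: "0 <= w" "norm v <= w" "norm v' <= w" by (simp_all add: w_def)
 have nn: "0 <= Dx" "0 <= Dv" "Dx <= 1" "Dv <= 1" using D by (simp_all add: Dx_def Dv_def)
 have e0: "0 <= e" by (rule dev_bound_nonneg[OF x e])
 have d0: "0 <= d" using nn t La_ge_1 by (simp add: d_def)
 let ?E = "%r. exp (- ((1 + w)^2 / 8) * r)" and ?J = "%r. jump d x v r" and ?J' = "%r. jump d x' v' r"
 have E: "0 <= ?E r" "0 <= r ==> ?E r <= 1" for r using w by auto
 have J: "0 <= ?J r" "0 <= ?J' r" for r using jump_nonneg x by blast+
 note [measurable] = jump_integral(1)[OF x(1) d0, of v] jump_integral(1)[OF x(2) d0, of v']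
 let ?i = "%r. indicator {0..t} r :: ennreal"
 let ?d = "NN r. ennreal (?J r) * ?i r"
 let ?c = "NN r. ennreal (?J' r) * ?i r"
 let ?b = "NN r. ennreal (?E r) * ?i r"
 have i1: "(NN r. ?i r) = ennreal t" using t by simp
 have dev: "norm (vel r x v - vel r x' v') <= CD * (Dv + w * e + (?J r + ?J' r))" if "0 <= r" "r <= t" for r
  using flow_deviation(2)[OF x that t(2) D e] by (simp add: w_def d_def Dx_def Dv_def)
 have split: "I <= ?p * (?q * (NN r. ?i r) + ?h * ?b +
  (?d + ?c))"
 proof -
  have "I <= (NN r. ?p * (?q * ?i r + ?h * (ennreal (?E r) * ?i r) + (ennreal (?J r) * ?i r + ennreal (?J' r) * ?i r)))"
   unfolding I_def
  proof (rule nn_integral_mono)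
   fix r
   show "ennreal (?E r * norm (vel r x v - vel r x' v')) * ?i r <= ?p * (?q * ?i r + ?h * (ennreal (?E r) * ?i r) + (ennreal (?J r) * ?i r + ennreal (?J' r) * ?i r))"
   proof (cases "r \<in> {0..t}")
    case True
    have "?E r * norm (vel r x v - vel r x' v') <= ?E r * (CD * (Dv + w * e + (?J r + ?J' r)))"
     using True dev E by (intro mono_l) auto
    also have "... = CD * (?E r * Dv + (w * e) * ?E r + ?E r * (?J r + ?J' r))" by (simp add: algebra_simps)
    also have "... <= CD * (1 * Dv + (w * e) * ?E r + 1 * (?J r + ?J' r))"
     using True E[of r] nn J[of r] CD_pos w e0 mult_nonneg_nonneg[OF w(1) e0] by (intro mono_l add_mono mono_r) auto
    finally have "ennreal (?E r * norm (vel r x v - vel r x' v')) <= ennreal (CD * (Dv + (w * e) * ?E r + (?J r + ?J' r)))"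
     by (intro ennreal_leI) simp
    also have "... = ?p * (?q + ?h * ennreal (?E r) + (ennreal (?J r) + ennreal (?J' r)))"
     using CD_pos nn w e0 J[of r] by (simp add: ennreal_mult ennreal_plus)
    finally show ?thesis using True by simp
   qed simp
  qed
  also have "... = ?p * (?q * (NN r. ?i r) + ?h * ?b +
  (?d + ?c))"
   by (simp add: nn_integral_add nn_integral_cmult)
  finally show ?thesis .
 qed
 have j1: "(NN r. ennreal (jump d y u r) * ?i r) <= ennreal d" if "xi y <= 0" for y u
 proof -
  have "(NN r. ennreal (jump d y u r) * ?i r) <= (NN r. ennreal (jump d y u r))"
   by (intro nn_integral_mono) (simp add: indicator_def)
  also have "... <= ennreal d" by (rule jump_integral(2)[OF that d0])
  finally show ?thesis .
 qed
 have total: "I <= ennreal (CD * (Dv * t + w * e * E0 + (j + j')))"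
  if "?b <= ennreal E0" "0 <= E0"
   "?d <= ennreal j" "?c <= ennreal j'" "0 <= j" "0 <= j'" for E0 j j'
 proof -
  have "I <= ?p * (?q * ennreal t + ?h * ennreal E0 + (ennreal j + ennreal j'))"
   using split unfolding i1 by (rule order_trans) (intro mono_l add_mono that order_refl; simp)
  also have "... = ennreal (CD * (Dv * t + w * e * E0 + (j + j')))"
   using CD_pos nn w e0 t that by (simp add: ennreal_mult ennreal_plus)
  finally show ?thesis .
 qed
 show "I <= ennreal (CV * ?m)"
 proof (rule order_trans[OF total ennreal_leI])
  show "?b <= ennreal ?e"
   using w by (intro nn_integral_exp_interval) (simp add: add_pos_nonneg)
  show "0 <= 1 / ((1 + w)^2 / 8)" by simp
  show "?d <= ennreal d" "?c <= ennreal d"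
   by (rule j1, rule x)+
  have "w * e * ?e = 8 * (w / (1 + w)) * ?j" by (simp add: sq_eq)
  also have "... <= 8 * 1 * ?j" using w e0 by (intro mono_r mono_l) auto
  finally have we: "w * e * ?e <= 8 * ?j" by simp
  have "Dv * t + w * e * ?e + (d + d) <= ?n * ?l"
  proof -
   have "d + d = 4 * (La * Dx) + 4 * (La * (t * Dv))" by (simp add: d_def algebra_simps)
   moreover have "?n * ?l = 9 * ?j + 9 * Dx + 9 * (Dv * t) + 4 * (La * ?j) + 4 * (La * Dx) + 4 * (La * (t * Dv))"
    by (simp add: algebra_simps)
   moreover have "0 <= e / (1 + w)" "0 <= La * ?j" "0 <= Dv * t" using e0 w La_ge_1 nn t by auto
   ultimately show ?thesis using we nn by linarith
  qed
  then have "CD * (Dv * t + w * e * ?e + (d + d)) <= CD * (?n * ?l)"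
   using CD_pos by (intro mono_l) auto
  then show "CD * (Dv * t + w * e * ?e + (d + d)) <= CV * ?m"
   by (simp add: CV_def Dx_def Dv_def mult.assoc)
 qed (use d0 in auto)
 assume esq: "e = sqrt (norm (x - x') + norm (v - v'))"
 have e2: "e^2 = Dx + Dv" unfolding esq by (simp add: Dx_def Dv_def)
 have j2: "(NN r. ennreal (jump d y u r) * ?i r) <= ennreal ?k" if y: "xi y <= 0" "norm u <= w" for y u
 proof -
  let ?g = "NN r. ennreal (jump d y u r) * ?i r"
  have "?g <= (NN r. ennreal (La * w) * ?i r)"
  proof (intro nn_integral_mono mono_r ennreal_leI)
   fix r
   have "jump d y u r <= La * norm u" by (rule jump_le[OF y(1)])
   also have "... <= La * w" using y La_ge_1 by (intro mono_l) auto
   finally show "jump d y u r <= La * w" .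
  qed simp
  also have "... = ennreal ?f" using t w La_ge_1 by (simp add: nn_integral_cmult i1 ennreal_mult[symmetric])
  finally have a: "?g <= ennreal ?f" .
  have "min ?f d <= 2 * La * ?a"
  proof -
   have "(min ?f d)^2 <= ?f * d"
    unfolding sq_eq using d0 w t La_ge_1 by (intro mult_mono) auto
   also have "d <= 2 * La * e^2"
    unfolding d_def e2 using La_ge_1 t nn by (intro mono_l add_left_mono) (auto simp: mult_left_le_one_le)
   also have "?f * (2 * La * e^2) = 2 * La^2 * w * (t * e^2)" by (simp add: sq_eq)
   also have "... <= 4 * La^2 * (1 + w)^2 * (t * e^2)"
   proof (intro mono_r)
    have "w <= 2 * (1 + w)^2" using w by (simp add: sq_eq algebra_simps add_increasing)
    then have "(2 * La^2) * w <= (2 * La^2) * (2 * (1 + w)^2)" by (intro mono_l) auto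
    then show "2 * La^2 * w <= 4 * La^2 * (1 + w)^2" by simp
   qed (use t in auto)
   also have "... = ?k^2" using t by (simp add: power_mult_distrib)
   finally have "(min ?f d)^2 <= ?k^2"
    using w t La_ge_1 by (simp add: mono_l)
   then show ?thesis using w t e0 La_ge_1 by (elim power2_le_imp_le) (intro mult_nonneg_nonneg, auto)
  qed
  then have "ennreal (min ?f d) <= ennreal ?k" by (rule ennreal_leI)
  moreover have "?g <= ennreal (min ?f d)"
   using a j1[OF y(1), of u] by (auto simp: min_def)
  ultimately show ?thesis by (rule order_trans[rotated])
 qed
 show "I <= ennreal (CV * ?a)"
 proof (rule order_trans[OF total ennreal_leI])
  have "?b <= (NN r. ?i r)"
  proof (rule nn_integral_mono)
   fix r show "ennreal (?E r) * ?i r <= ?i r" using ennreal_leI[OF E(2)[of r]] by (cases "r \<in> {0..t}") auto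
  qed
  then show "?b <= ennreal t" unfolding i1 .
  show "?d <= ennreal ?k"
   "?c <= ennreal ?k"
   using j2 x w by blast+
  define Y where "Y = (1 + w) * sqrt t * e"
  have tt: "t <= sqrt t" using t by (intro real_le_rsqrt) (simp add: sq_eq mult_left_le_one_le)
  have Dve: "Dv <= e"
  proof -
   have "Dv^2 <= e^2" unfolding e2 using nn by (simp add: sq_eq mult_left_le_one_le add_increasing)
   then show ?thesis using e0 by (rule power2_le_imp_le)
  qed
  have "Dv * t <= e * sqrt t" using Dve tt t nn e0 by (intro mult_mono) auto
  also have "... <= Y" unfolding Y_def using w e0 t mono_r[of 1 "1 + w" "e * sqrt t"] by (simp add: mult_ac)
  finally have a: "Dv * t <= Y" .
  have "w * e * t <= (1 + w) * e * sqrt t" using w e0 tt t by (intro mult_mono) auto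
  then have b: "w * e * t <= Y" by (simp add: Y_def mult_ac)
  have Y: "0 <= Y" using w t e0 by (simp add: Y_def)
  have "Dv * t + w * e * t + (2 * La * Y + 2 * La * Y) <= ?n * Y"
   using a b Y by (simp add: algebra_simps)
  then have "CD * (Dv * t + w * e * t + (2 * La * Y + 2 * La * Y)) <= CD * (?n * Y)"
   using CD_pos by (intro mono_l) auto
  then show "CD * (Dv * t + w * e * t + (2 * La * ?a + 2 * La * ?a)) <= CV * ?a"
   by (simp add: CV_def Y_def mult.assoc)
  show "0 <= 2 * La * ?a" "0 <= 2 * La * ?a" using w t e0 La_ge_1 by simp_all
 qed (use t in auto)
qed

end

section \<open>The collision operator\<close>

definition gain :: "(real^3 => real) => real^3 => real" where
 "gain ph v = Gamma_gain (%_ _. ph) (%_ _. ph) 0 0 v"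

definition freq :: "(real^3 => real) => real^3 => real" where
 "freq ph v = coll_freq (%_ _. ph) 0 0 v"

lemma Gamma_gain_eq: "Gamma_gain f f t x v = gain (f t x) v"
 by (simp add: gain_def Gamma_gain_def)

lemma coll_freq_eq: "coll_freq f t x v = freq (f t x) v"
 by (simp add: freq_def coll_freq_def)

text \<open>By conservation of energy the three square roots of Maxwellians in the gain term combine
  to \<open>sqrt (\<mu> u)\<close>, so that gain and loss share this kernel.\<close>

definition kern :: "real^3 => real^3 => real^3 => real" where
 "kern v u om = (if norm om = 1 & 0 <= (v - u) *. om then abs ((v - u) *. om) * exp (- N2 u / 4) else 0)"

lemma kern_measurable [measurable]:
 assumes [measurable]: "f \<in> borel_measurable M" "g \<in> borel_measurable M" "h \<in> borel_measurable M"
 shows "(%x. kern (f x) (g x) (h x)) \<in> borel_measurable M"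
 unfolding kern_def by measurable

lemma kern_nonneg: "0 <= kern v u om"
 by (simp add: kern_def)

lemma sqrt_mu: "sqrt (\<mu> v) = exp (- N2 v / 4)"
proof -
 have "\<mu> v = (exp (- N2 v / 4))^2" by (simp add: \<mu>_def exp_double[symmetric])
 then show ?thesis by simp
qed

lemma gain_eq: "gain ph v = (LINT u|lborel. LINT om|sphere_measure. kern v u om * (ph (post_u v u om) * ph (post_v v u om)))"
proof -
 have "1 / sqrt (\<mu> v) * (indicat_real (S_plus (v - u)) om *R (abs ((v - u) *. om)
    * sqrt (\<mu> (post_u v u om)) * ph (post_u v u om) * sqrt (\<mu> (post_v v u om)) * ph (post_v v u om)))
  = kern v u om * (ph (post_u v u om) * ph (post_v v u om))" for u om
 proof (cases "norm om = 1 & 0 <= (v - u) *. om")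
  let ?b = "post_v v u om"
  let ?a = "post_u v u om"
  case True
  have "exp (- N2 ?a / 4) * exp (- N2 ?b / 4) = exp (- N2 v / 4) * exp (- N2 u / 4)"
   using post_energy[of om v u] True by (simp add: exp_add[symmetric] field_simps)
  then have "1 / sqrt (\<mu> v) * (sqrt (\<mu> ?a) * sqrt (\<mu> ?b)) = exp (- N2 u / 4)"
   unfolding sqrt_mu by simp
  moreover have "1 / sqrt (\<mu> v) * (indicat_real (S_plus (v - u)) om *R (abs ((v - u) *. om)
    * sqrt (\<mu> ?a) * ph ?a * sqrt (\<mu> ?b) * ph ?b)) =
    (1 / sqrt (\<mu> v) * (sqrt (\<mu> ?a) * sqrt (\<mu> ?b))) * (abs ((v - u) *. om) * (ph ?a * ph ?b))"
   using True by (simp add: S_plus_def)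
  ultimately show ?thesis using True by (simp add: kern_def)
 next
  case False
  then have "om \<notin> S_plus (v - u)" by (auto simp: S_plus_def)
  then show ?thesis using False by (auto simp: kern_def)
 qed
 then show ?thesis
  unfolding gain_def Gamma_gain_def set_lebesgue_integral_def
  by (simp only: integral_mult_right_zero[symmetric])
qed

lemma freq_eq: "freq ph v = (LINT u|lborel. LINT om|sphere_measure. kern v u om * ph u)"
proof -
 have "indicat_real (S_plus (v - u)) om *R (abs ((v - u) *. om) * sqrt (\<mu> u) * ph u) = kern v u om * ph u" for u om
  by (auto simp: S_plus_def kern_def sqrt_mu)
 then show ?thesis unfolding freq_def coll_freq_def set_lebesgue_integral_def by (simp only:)
qed

text \<open>Without integrability the Bochner integral is \<open>0\<close> by convention, and the
  inequality remains true.\<close>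

lemma lint_le_nn_integral:
 assumes "!!x. 0 <= ps x" and [measurable]: "ps \<in> borel_measurable M"
 shows "ennreal (LINT x|M. ps x) <= (\<integral>\<^sup>+x. ennreal (ps x) \<partial>M)"
proof (cases "integrable M ps")
 case True
 then show ?thesis using assms by (simp add: nn_integral_eq_integral)
qed (simp add: not_integrable_integral_eq)

lemma double_lint_le:
 fixes ps :: "real^3 => real^3 => real"
 assumes nn: "!!u om. 0 <= ps u om" and [measurable]: "case_prod ps \<in> borel_measurable (lborel \<Otimes>\<^sub>M sphere_measure)"
 shows "ennreal (LINT u|lborel. LINT om|sphere_measure. ps u om) <= (NN u. NS om. ennreal (ps u om))"
proof -
 have "ennreal (LINT u|lborel. LINT om|sphere_measure. ps u om) <= (NN u. ennreal (LINT om|sphere_measure. ps u om))"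
  by (rule lint_le_nn_integral) (auto intro!: Bochner_Integration.integral_nonneg nn)
 also have "... <= (NN u. NS om. ennreal (ps u om))"
  by (intro nn_integral_mono lint_le_nn_integral nn) measurable
 finally show ?thesis .
qed

text \<open>For a difference the convention \<open>0\<close> would be fatal; hence finiteness of
  both nonnegative integrals, by which the iterated integrals become integrals over the
  product.\<close>

lemma double_lint_diff:
 fixes ps ps' :: "real^3 => real^3 => real"
 assumes nn: "!!u om. 0 <= ps u om" "!!u om. 0 <= ps' u om"
  and m [measurable]: "case_prod ps \<in> borel_measurable (lborel \<Otimes>\<^sub>M sphere_measure)"
   "case_prod ps' \<in> borel_measurable (lborel \<Otimes>\<^sub>M sphere_measure)"
  and fin: "(NN u. NS om. ennreal (ps u om)) < \<infinity>" "(NN u. NS om. ennreal (ps' u om)) < \<infinity>"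
 shows "ennreal \<bar>(LINT u|lborel. LINT om|sphere_measure. ps u om) - (LINT u|lborel. LINT om|sphere_measure. ps' u om)\<bar>
  <= (NN u. NS om. ennreal \<bar>ps u om - ps' u om\<bar>)"
proof -
 let ?P = "lborel \<Otimes>\<^sub>M sphere_measure :: ((real^3) \<times> (real^3)) measure"
 have int: "integrable ?P (case_prod ph)" if "!!u om. 0 <= ph u om" and [measurable]: "case_prod ph \<in> borel_measurable ?P"
  "(NN u. NS om. ennreal (ph u om)) < \<infinity>" for ph :: "real^3 => real^3 => real"
 proof (rule integrableI_nonneg)
  show "(\<integral>\<^sup>+p. ennreal (case_prod ph p) \<partial>?P) < \<infinity>"
   using that(3) sphere.nn_integral_fst[of "%p. ennreal (case_prod ph p)" lborel] by simp
 qed (use that in auto)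
 have eq: "(LINT u|lborel. LINT om|sphere_measure. ph u om) = (LINT p|?P. case_prod ph p)"
  if "integrable ?P (case_prod ph)" for ph :: "real^3 => real^3 => real"
  using lborel_sphere.integral_fst'[OF that] by simp
 have i: "integrable ?P (case_prod ps)" "integrable ?P (case_prod ps')" using int nn m fin by blast+
 have "ennreal \<bar>(LINT p|?P. case_prod ps p) - (LINT p|?P. case_prod ps' p)\<bar> = ennreal (norm (LINT p|?P. case_prod ps p - case_prod ps' p))"
  unfolding real_norm_def using i by (subst Bochner_Integration.integral_diff) simp_all
 also have "... <= (\<integral>\<^sup>+p. ennreal (norm (case_prod ps p - case_prod ps' p)) \<partial>?P)"
  by (rule integral_norm_bound_ennreal[OF Bochner_Integration.integrable_diff[OF i]])
 also have "... = (NN u. NS om. ennreal \<bar>ps u om - ps' u om\<bar>)"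
  by (subst sphere.nn_integral_fst[symmetric]) auto
 finally show ?thesis unfolding eq[OF i(1)] eq[OF i(2)] .
qed

section \<open>Total mass and pointwise size of the collision terms\<close>

definition kavg :: "real => real^3 => (real^3 => ennreal) => ennreal" where
 "kavg ka v g = (NN z. ennreal (gs ka (z - v) / norm (z - v)) * g z)"

lemma kavg_const:
 assumes "0 < ka"
 obtains C where "0 < C" "!!v. kavg ka v (%_. 1) <= ennreal C"
proof -
 obtain C where C: "0 < C"
  "!!(g :: real^3 => ennreal) m v h P. [|g \<in> bm; norm m = 1; 0 <= P;
   !!q. EX a b. ALL s. s ~= a --> s ~= b --> q + s *R m ~= 0 --> q + s *R m + h ~= 0 -->
    g (q + s *R m) <= ennreal ((1 + norm (q + s *R m) powr - 0 + norm (q + s *R m + h) powr - 0) *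
      (P * (1 + abs (s - a) powr - 0 + abs (s - b) powr - 0)))|] ==>
   (NN z. ennreal (gs ka (z - v) / norm (z - v)) * g z) <= ennreal (C * P)"
  by (rule kernel_average[OF assms, of 0 0]) (simp_all, blast)
 show ?thesis
 proof (rule that[OF C(1)])
  fix v
  have "kavg ka v (%_. 1) <= ennreal (C * 1)" unfolding kavg_def
  proof (rule C(2)[of _ "axis 1 1" _ 0])
   fix q :: "real^3"
   have "1 <= ennreal ((1 + norm (q + s *R axis 1 1) powr - 0 + norm (q + s *R axis 1 1 + 0) powr - 0) * (1 * (1 + abs (s - 0) powr - 0 + abs (s - 0) powr - 0)))" for s
   proof -
    have "1 * 1 <= (1 + norm (q + s *R axis 1 1) powr - 0 + norm (q + s *R axis 1 1 + 0) powr - 0) * (1 * (1 + abs (s - 0) powr - 0 + abs (s - 0) powr - (0::real)))"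
     by (intro mult_mono) auto
    then show ?thesis using ennreal_leI by fastforce
   qed
   then show "EX a b. ALL s. s ~= a --> s ~= b --> q + s *R axis 1 1 ~= 0 --> q + s *R axis 1 1 + 0 ~= 0 --> 1 <= ennreal ((1 + norm (q + s *R axis 1 1) powr - 0 + norm (q + s *R axis 1 1 + 0) powr - 0) * (1 * (1 + abs (s - a) powr - 0 + abs (s - b) powr - 0)))"
    by blast
  qed (auto simp: norm_axis_1)
  then show "kavg ka v (%_. 1) <= ennreal C" by simp
 qed
qed

lemma gauss_kernel_le:
 fixes y ka :: real
 assumes "0 < y" "ka <= 1 / 32"
 shows "(1 + y) * exp (- (y^2 / 16)) <= 60 * (exp (- ka * y^2) / y)"
proof -
 have "y * (1 + y) <= 60 * exp (y^2 / 32)"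
 proof -
  have "1 + y^2 / 32 <= exp (y^2 / 32)" by (rule exp_ge_add_one_self)
  moreover have "y * (1 + y) <= 60 * (1 + y^2 / 32)"
  proof -
   have "0 <= (y - 1)^2" "0 <= y^2" by simp_all
   moreover have "(y - 1)^2 = y^2 - 2 * y + 1" "y * (1 + y) = y + y^2" "60 * (1 + y^2 / 32) = 60 + 15 / 8 * y^2"
    by (simp_all add: sq_eq algebra_simps)
   ultimately show ?thesis by linarith
  qed
  ultimately show ?thesis unfolding distrib_left[of 60] by linarith
 qed
 then have "exp (- (y^2 / 16)) * (y * (1 + y)) <= exp (- (y^2 / 16)) * (60 * exp (y^2 / 32))" by (intro mono_l) auto
 also have "... = 60 * exp (- (1 / 32) * y^2)" by (simp add: exp_add[symmetric])
 also have "... <= 60 * exp (- ka * y^2)"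
  using assms by (intro mono_l) (auto intro!: mono_r)
 finally show ?thesis using assms by (simp add: field_simps)
qed

lemma sphere_mass:
 obtains S where "0 < S" "emeasure sphere_measure UNIV <= ennreal S"
proof -
 obtain r where "0 <= r" "emeasure sphere_measure UNIV = ennreal r"
  using sphere.emeasure_finite[of UNIV] by (cases "emeasure sphere_measure UNIV") auto
 then show ?thesis by (intro that[of "r + 1"]) (auto intro: ennreal_leI)
qed

lemma nn_integral_sphere_const:
 assumes "emeasure sphere_measure UNIV <= ennreal S" "!!om. norm om = 1 ==> ph om <= c"
 shows "(NS om. ph om) <= ennreal S * c"
proof -
 have "(NS om. ph om) <= (NS om. c)"
  using AE_sphere_norm assms(2) by (intro nn_integral_mono_AE) auto
 also have "... = emeasure sphere_measure UNIV * c" by (simp add: mult.commute)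
 also have "... <= ennreal S * c" using assms(1) by (rule mono_r) simp
 finally show ?thesis .
qed

lemma inner_unit_le:
 fixes v u om :: "real^3"
 assumes "norm om = 1"
 shows "abs ((v - u) *. om) <= (1 + norm v) * (1 + norm u)"
proof -
 have "abs ((v - u) *. om) <= norm (v - u)" using Cauchy_Schwarz_ineq2[of "v - u" om] assms by simp
 also have "... <= norm v + norm u" by (rule norm_triangle_ineq4)
 also have "... <= (1 + norm v) * (1 + norm u)" by (simp add: algebra_simps)
 finally show ?thesis .
qed

text \<open>Weighting with \<open>g\<close> bounds at once the total mass and the part of the loss term that does not depend on \<open>om\<close>.\<close>

lemma loss_kernel:
 fixes g :: "real^3 => ennreal"
 assumes ka: "ka <= 1 / 32" and S: "emeasure sphere_measure UNIV <= ennreal S" "0 <= S" and [measurable]: "g \<in> bm"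
 shows "(NN u. NS om. ennreal (abs ((v - u) *. om) * exp (- N2 u / 16)) * g u) <= ennreal (60 * S * (1 + norm v)) * kavg ka 0 g"
proof -
 let ?b = "1 + norm v"
 let ?d = "ennreal (60 * S * ?b)"
 have "(NN u. NS om. ennreal (abs ((v - u) *. om) * exp (- N2 u / 16)) * g u)
  <= (NN u. ennreal S * (ennreal (?b * ((1 + norm u) * exp (- (N2 u / 16)))) * g u))"
 proof (intro nn_integral_mono nn_integral_sphere_const[OF S(1)] mono_r ennreal_leI)
  fix u om :: "real^3" assume "norm om = 1"
  from inner_unit_le[OF this, of v u] have "abs ((v - u) *. om) * exp (- N2 u / 16) <= (?b * (1 + norm u)) * exp (- N2 u / 16)"
   by (intro mono_r) auto
  then show "abs ((v - u) *. om) * exp (- N2 u / 16) <= ?b * ((1 + norm u) * exp (- (N2 u / 16)))"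
   by (simp add: mult.assoc)
 qed simp
 also have "... <= (NN u. ?d * (ennreal (gs ka (u - 0) / norm (u - 0)) * g u))"
 proof (rule nn_integral_mono_AE, rule AE_mp[OF AE_lborel_singleton[of "0 :: real^3"]], intro AE_I2 impI)
  fix u :: "real^3" assume "u ~= 0"
  then have u: "0 < norm u" by simp
  let ?c = "gs ka u / norm u"
  let ?a = "?b * ((1 + norm u) * exp (- (N2 u / 16)))"
  have "(1 + norm u) * exp (- (N2 u / 16)) <= 60 * ?c"
   by (rule gauss_kernel_le[OF u ka])
  then have "S * ?a <= S * (?b * (60 * ?c))"
   using S by (intro mono_l) auto
  also have "... = 60 * S * ?b * ?c" by (simp only: mult_ac)
  finally have "ennreal (S * ?a) * g u <= ennreal (60 * S * ?b * ?c) * g u"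
   by (intro mono_r ennreal_leI) simp_all
  moreover have "ennreal (S * ?a) = ennreal S * ennreal ?a"
   using S by (intro ennreal_mult) auto
  moreover have "ennreal (60 * S * ?b * ?c) = ?d * ennreal ?c"
   using S by (intro ennreal_mult) auto
  ultimately show "ennreal S * (ennreal ?a * g u) <= ?d * (ennreal (gs ka (u - 0) / norm (u - 0)) * g u)"
   by (simp only: mult.assoc diff_zero)
 qed
 also have "... = ?d * kavg ka 0 g"
  unfolding kavg_def by (subst nn_integral_cmult) simp_all
 finally show ?thesis .
qed

lemma kern_mass:
 obtains C where "0 < C" "!!v. (NN u. NS om. ennreal (abs ((v - u) *. om) * exp (- N2 u / 16))) <= ennreal (C * (1 + norm v))"
  "!!v. (NN u. NS om. ennreal (kern v u om)) <= ennreal (C * (1 + norm v))"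
proof -
 obtain S where S: "0 < S" "emeasure sphere_measure UNIV <= ennreal S" by (rule sphere_mass)
 obtain C where C: "0 < C" "!!v. kavg (1 / 32) v (%_. 1) <= ennreal C" by (rule kavg_const[of "1 / 32"]) auto
 have a: "(NN u. NS om. ennreal (abs ((v - u) *. om) * exp (- N2 u / 16))) <= ennreal (60 * S * C * (1 + norm v))" for v
 proof -
  have "(NN u. NS om. ennreal (abs ((v - u) *. om) * exp (- N2 u / 16))) <= ennreal (60 * S * (1 + norm v)) * kavg (1 / 32) 0 (%_. 1)"
   using loss_kernel[of "1 / 32" S "%_. 1" v] S by simp
  also have "... <= ennreal (60 * S * (1 + norm v)) * ennreal C" using C by (intro mono_l) auto
  also have "... = ennreal (60 * S * C * (1 + norm v))" using S C by (simp add: ennreal_mult[symmetric] mult_ac)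
  finally show ?thesis .
 qed
 have "(NN u. NS om. ennreal (kern v u om)) <= (NN u. NS om. ennreal (abs ((v - u) *. om) * exp (- N2 u / 16)))" for v
 proof (intro nn_integral_mono ennreal_leI)
  fix u om
  have "(if P then abs ((v - u) *. om) * exp (- N2 u / 4) else 0) <= abs ((v - u) *. om) * exp (- N2 u / 16)" for P
   by (auto intro!: mono_l)
  then show "kern v u om <= abs ((v - u) *. om) * exp (- N2 u / 16)" unfolding kern_def .
 qed
 with a show ?thesis using S C by (intro that[of "60 * S * C"]) (auto intro: order_trans)
qed

text \<open>The bound for \<open>ph\<close> holds for almost all velocities, but gain evaluates
  \<open>ph\<close> at outgoing velocities, and these must avoid the exceptional null set. The
  function \<open>g\<close>, infinite on that set, has average 0 against every kernel, so by
  \<open>gain_kernel_u\<close> and \<open>gain_kernel_v\<close> its integral against the collision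
  measure is 0 as well.\<close>

lemma collision_bounds:
 obtains C where "0 < C"
  "!!ph v th K. [|ph \<in> bm; !!u. 0 <= ph u; 0 < th; 0 <= K; AE u in lborel. ph u <= K * gs th u|] ==>
   (NN u. NS om. ennreal (kern v u om * (ph (post_u v u om) * ph (post_v v u om)))) <= ennreal (C * K^2 * (1 + norm v) * gs th v) \<and>
   (NN u. NS om. ennreal (kern v u om * ph u)) <= ennreal (C * K * (1 + norm v)) \<and>
   0 <= gain ph v & gain ph v <= C * K^2 * (1 + norm v) * gs th v \<and>
   0 <= freq ph v & freq ph v <= C * K * (1 + norm v)"
proof -
 obtain C where C: "0 < C" "!!v. (NN u. NS om. ennreal (kern v u om)) <= ennreal (C * (1 + norm v))"
  by (rule kern_mass) blast
 show ?thesis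
 proof (rule that[OF C(1)], intro conjI)
  fix ph :: "real^3 => real" and v :: "real^3" and th K :: real
  assume phm [measurable]: "ph \<in> bm" and ph0: "!!u. 0 <= ph u" and th: "0 < th" and K: "0 <= K"
   and ae: "AE u in lborel. ph u <= K * gs th u"
  define g :: "real^3 => ennreal" where "g u = (if ph u <= K * gs th u then 0 else \<infinity>)" for u
  have g01: "g z = 0 | g z = \<infinity>" for z by (simp add: g_def)
  have gm [measurable]: "g \<in> bm" unfolding g_def by measurable
  have g0: "kavg ka c g = 0" for ka c
  proof -
   have "AE z in lborel. ennreal (gs ka (z - c) / norm (z - c)) * g z = 0"
    using ae by eventually_elim (simp add: g_def)
   then show ?thesis unfolding kavg_def by (subst nn_integral_0_iff_AE) auto
  qed
  let ?b = "%u om. abs ((v - u) *. om) * gs 1 u"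
  have z1: "(NN u. NS om. ennreal (?b u om * gs 1 (post_u v u om)) * g (post_v v u om)) = 0"
   using gain_kernel_v[OF gm, of 1 1 v] unfolding g0[unfolded kavg_def] by simp
  let ?g = "NN u. NS om. ennreal (kern v u om * ph u)"
  let ?c = "1 + norm v"
  let ?d = "ennreal (C * K^2 * ?c * gs th v)"
  have z2: "(NN u. NS om. ennreal (?b u om * gs 1 (post_v v u om)) * g (post_u v u om)) = 0"
   using gain_kernel_u[OF gm, of 1 1 v] unfolding g0[unfolded kavg_def] by simp
  let ?k = "K^2 * gs th v"
  let ?ps = "%u om. kern v u om * (ph (post_u v u om) * ph (post_v v u om))"
  have "(NN u. NS om. ennreal (?ps u om)) <=
   (NN u. NS om. (ennreal ?k * ennreal (kern v u om) + (ennreal (?b u om * gs 1 (post_u v u om)) * g (post_v v u om) +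
    ennreal (?b u om * gs 1 (post_v v u om)) * g (post_u v u om))))"
  proof (intro nn_integral_mono)
   fix u om
   show "ennreal (?ps u om) <= ennreal ?k * ennreal (kern v u om) + (ennreal (?b u om * gs 1 (post_u v u om)) * g (post_v v u om) +
    ennreal (?b u om * gs 1 (post_v v u om)) * g (post_u v u om))" (is "_ <= ?a + (?b1 + ?b2)")
   proof (cases "norm om = 1 & (v - u) *. om ~= 0")
    case False
    then have "kern v u om = 0" by (auto simp: kern_def)
    then show ?thesis by simp
   next
    let ?f = "post_v v u om"
    let ?e = "post_u v u om"
    case True
    \<comment> \<open>Where an outgoing velocity is exceptional the right-hand side is infinite,
      since the factor in front of \<open>g\<close> is positive.\<close>
    then have pos: "0 < ?b u om * e" if "0 < e" for e using that by simp
    have inf: "0 < c ==> ennreal c * \<infinity> = \<infinity>" for c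
     by (simp add: ennreal_mult_top)
    consider "g (post_v v u om) = \<infinity>" | "g (post_u v u om) = \<infinity>" | "g (post_v v u om) = 0" "g (post_u v u om) = 0"
     using g01 by blast
    then show ?thesis
    proof cases
     case 1
     have "?b1 = \<infinity>" unfolding 1 by (rule inf, rule pos) simp
     then show ?thesis by simp
    next
     case 2
     have "?b2 = \<infinity>" unfolding 2 by (rule inf, rule pos) simp
     then show ?thesis by simp
    next
     case 3
     then have le: "ph ?f <= K * gs th ?f" "ph ?e <= K * gs th ?e"
      by (auto simp: g_def split: if_splits)
     have "ph ?e * ph ?f <= (K * gs th ?e) * (K * gs th ?f)"
      using le ph0 K by (intro mult_mono) auto
     also have "... = K^2 * exp (- th * (N2 ?e + N2 ?f))"
      by (simp add: sq_eq exp_add[symmetric] algebra_simps)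
     also have "... <= ?k"
      unfolding post_energy[OF conjunct1[OF True]] using th by (intro mono_l) auto
     finally have "?ps u om <= kern v u om * ?k" using kern_nonneg by (intro mono_l) auto
     then have "ennreal (?ps u om) <= ennreal (?k * kern v u om)" by (intro ennreal_leI) (simp add: mult.commute)
     also have "... = ?a" using kern_nonneg by (simp add: ennreal_mult)
     finally show ?thesis using 3 by simp
    qed
   qed
  qed
  also have "... = ennreal ?k * (NN u. NS om. ennreal (kern v u om))"
   by (simp add: nn_integral_add nn_integral_cmult z1[simplified] z2[simplified])
  also have "... <= ennreal ?k * ennreal (C * ?c)" by (intro mono_l C) simp
  also have "... = ?d" using C by (simp add: ennreal_mult[symmetric] mult_ac)
  finally show g1: "(NN u. NS om. ennreal (?ps u om)) <= ?d" .
  have "?g <= (NN u. NS om. ennreal K * ennreal (kern v u om))"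
  proof (intro nn_integral_mono_AE)
   show "AE u in lborel. (NS om. ennreal (kern v u om * ph u)) <= (NS om. ennreal K * ennreal (kern v u om))"
    using ae
   proof eventually_elim
    case (elim u)
    have "gs th u <= 1" using th by simp
    then have "K * gs th u <= K" using K by (simp add: mult_left_le)
    then have "kern v u om * ph u <= K * kern v u om" for om
     using elim kern_nonneg[of v u om] by (simp add: mult.commute mono_r)
    then show ?case using K kern_nonneg by (intro nn_integral_mono) (simp add: ennreal_mult[symmetric] ennreal_leI)
   qed
  qed
  also have "... = ennreal K * (NN u. NS om. ennreal (kern v u om))"
   by (simp add: nn_integral_cmult)
  also have "... <= ennreal K * ennreal (C * ?c)" by (intro mono_l C) simp
  also have "... = ennreal (C * K * ?c)" using K C by (simp add: ennreal_mult[symmetric] mult_ac)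
  finally show f1: "?g <= ennreal (C * K * ?c)" .
  have nn: "0 <= ?ps u om" "0 <= kern v u om * ph u" for u om using ph0 kern_nonneg by simp_all
  have "ennreal (gain ph v) <= ?d"
   unfolding gain_eq by (rule order_trans[OF double_lint_le g1]) (use nn in auto)
  then show "gain ph v <= C * K^2 * ?c * gs th v" using C by (simp add: ennreal_le_iff)
  have "ennreal (freq ph v) <= ennreal (C * K * ?c)"
   unfolding freq_eq by (rule order_trans[OF double_lint_le f1]) (use nn in auto)
  then show "freq ph v <= C * K * ?c" using C K by (simp add: ennreal_le_iff)
  show "0 <= gain ph v" unfolding gain_eq by (intro integral_nonneg_AE AE_I2 nn)
  show "0 <= freq ph v" unfolding freq_eq by (intro integral_nonneg_AE AE_I2 nn)
 qed
qed

section \<open>Differences of the collision terms in a weight that grows with time\<close>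

definition Theta :: "real => real^3 => real" where
 "Theta s v = exp ((1 + N2 v) * s)"

lemma Theta_pos: "0 < Theta s v"
 by (simp add: Theta_def)

lemma Theta_ge_1: "0 <= s ==> 1 <= Theta s v"
 by (simp add: Theta_def)

lemma Theta_measurable [measurable]: "Theta s \<in> bm"
 unfolding Theta_def[abs_def] by measurable

lemma exp_minus_diff_le:
 fixes a b m :: real
 assumes "m <= a" "m <= b"
 shows "abs (exp (- a) - exp (- b)) <= abs (a - b) * exp (- m)"
proof -
 have le: "exp (- a) - exp (- b) <= (b - a) * exp (- m)" if "a <= b" "m <= a" for a b :: real
 proof -
  have "exp (- a) - exp (- b) = exp (- a) * (1 - exp (- (b - a)))" by (simp add: algebra_simps exp_add[symmetric])
  also have "... <= exp (- m) * (b - a)"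
  proof (rule mult_mono)
   show "1 - exp (- (b - a)) <= b - a" using exp_ge_add_one_self[of "- (b - a)"] by linarith
  qed (use that in auto)
  finally show ?thesis by (simp add: mult.commute)
 qed
 show ?thesis using le[of a b] le[of b a] assms by (cases "a <= b") auto
qed

lemma norm_shift_sq:
 fixes u h :: "real^3"
 assumes "norm h <= 1"
 shows "N2 u <= 2 * N2 (u + h) + 2" "N2 (u + h) <= 2 * N2 u + 2"
proof -
 have *: "N2 (a + b) <= 2 * N2 a + 2" if "norm b <= 1" for a b :: "real^3"
 proof -
  have "N2 (a + b) <= (norm a + 1)^2" using norm_triangle_ineq[of a b] that by (intro power_mono) auto
  also have "... <= 2 * N2 a + 2"
  proof -
   have "0 <= (norm a - 1)^2" by simp
   then show ?thesis by (simp add: sq_eq algebra_simps)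
  qed
  finally show ?thesis .
 qed
 show "N2 u <= 2 * N2 (u + h) + 2" using *[of "- h" "u + h"] assms by simp
 show "N2 (u + h) <= 2 * N2 u + 2" using *[of h u] assms by simp
qed

lemma exp_small: "exp (1 / 4) <= (2::real)" "exp 1 <= (3::real)"
proof -
 show "exp 1 <= (3::real)" by (rule exp_le)
 have "exp (1 / 4) <= 1 + 1 / 4 + (1 / 4 :: real)^2" by (rule exp_bound) auto
 then show "exp (1 / 4) <= (2::real)" by (simp add: sq_eq)
qed

lemma gauss_diff:
 fixes u h :: "real^3"
 assumes h: "norm h <= 1"
 shows "abs (exp (- N2 u / 4) - exp (- N2 (u + h) / 4)) <= 12 * norm h * exp (- N2 u / 16)"
proof -
 let ?d = "N2 (u + h)"
 let ?b = "norm (u + h)"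
 define y where "y = norm u"
 let ?c = "y^2 / 16"
 let ?a = "exp (- (y^2 / 8))"
 define m where "m = y^2 / 8 - 1 / 4"
 have y: "0 <= y" by (simp add: y_def)
 have sh: "y^2 <= 2 * ?d + 2" unfolding y_def by (rule norm_shift_sq[OF h])
 have "0 <= y^2" by simp
 then have "abs (exp (- (y^2 / 4)) - exp (- (?d / 4))) <= abs (y^2 / 4 - ?d / 4) * exp (- m)"
  using sh by (intro exp_minus_diff_le) (simp_all add: m_def field_simps)
 also have "... <= (norm h * ((2 * y + 1) / 4)) * (2 * ?a)"
 proof (rule mult_mono)
  have "abs (y^2 - ?d) = abs (?b - y) * (?b + y)"
  proof -
   have "y^2 - ?d = - ((?b - y) * (?b + y))" by (simp add: sq_eq algebra_simps)
   moreover have "abs (?b + y) = ?b + y" using y by simp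
   ultimately show ?thesis by (simp only: abs_minus_cancel abs_mult)
  qed
  also have "... <= norm h * (2 * y + 1)"
  proof (rule mult_mono)
   show "abs (?b - y) <= norm h" using norm_triangle_ineq3[of "u + h" u] by (simp add: y_def)
   show "?b + y <= 2 * y + 1" using norm_triangle_ineq[of u h] h by (simp add: y_def)
  qed (use y in auto)
  finally show "abs (y^2 / 4 - ?d / 4) <= norm h * ((2 * y + 1) / 4)" by (simp add: field_simps)
  have "exp (- m) = exp (1 / 4) * ?a" by (simp add: m_def exp_add[symmetric])
  also have "... <= 2 * ?a" using exp_small by (intro mono_r) auto
  finally show "exp (- m) <= 2 * ?a" .
 qed (use y in auto)
 also have "... = norm h * ((y + 1 / 2) * ?a)" by (simp add: field_simps)
 also have "... <= norm h * (12 * exp (- ?c))"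
 proof (intro mono_l)
  have "1 + y^2 / 16 <= exp ?c" by (rule exp_ge_add_one_self)
  moreover have "0 <= (y - 1)^2" "(y - 1)^2 = y^2 - 2 * y + 1" by (rule zero_le_power2, simp add: sq_eq algebra_simps)
  moreover have "0 <= y^2" by simp
  ultimately have "y + 1 / 2 <= 12 * exp ?c" by linarith
  then have "(y + 1 / 2) * ?a <= 12 * exp ?c * ?a" by (rule mono_r) simp
  also have "... = 12 * exp (- ?c)" by (simp add: exp_add[symmetric])
  finally show "(y + 1 / 2) * ?a <= 12 * exp (- ?c)" .
 qed simp
 finally show ?thesis by (simp add: y_def)
qed

text \<open>An outgoing velocity carries at most the total energy, so its weight is that of
  \<open>v\<close> or \<open>v'\<close> times a factor growing like a Gaussian in \<open>u\<close>
  with small exponent; for \<open>s <= 1 / 64\<close> half of the decay in \<open>u\<close> absorbs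
  it.\<close>

lemma Theta_weight:
 fixes v u h p q :: "real^3"
 assumes h: "norm h <= 1" and s: "0 <= s" "s <= 1 / 64"
  and p: "N2 p <= N2 u + N2 v" and q: "N2 q <= N2 (u + h) + N2 v'"
 shows "exp (- N2 u / 4) * (Theta s p + Theta s q) <= 2 * (Theta s v + Theta s v') * exp (- N2 u / 8)"
proof -
 define e where "e = exp (- N2 u / 4)"
 have one: "exp (- N2 u / 4) * Theta s p <= 2 * Theta s v * exp (- N2 u / 8)"
  if p: "N2 p <= 2 * N2 u + 2 + N2 v" for p v
 proof -
  have "(1 + N2 p) * s <= (1 + (2 * N2 u + 2 + N2 v)) * s" using p s by (intro mono_r) auto
  also have "... = (1 + N2 v) * s + (2 * N2 u + 2) * s" by (simp add: algebra_simps)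
  also have "... <= (1 + N2 v) * s + (2 * N2 u + 2) * (1 / 64)" using s by (intro add_left_mono mono_l) auto
  also have "... <= (1 + N2 v) * s + (N2 u / 8 + 1 / 4)" by simp
  finally have "- N2 u / 4 + (1 + N2 p) * s <= (1 + N2 v) * s + (- N2 u / 8 + 1 / 4)" by simp
  then have "exp (- N2 u / 4) * Theta s p <= exp (1 / 4) * (Theta s v * exp (- N2 u / 8))"
   by (simp add: Theta_def exp_add[symmetric])
  also have "... <= 2 * (Theta s v * exp (- N2 u / 8))" using exp_small Theta_pos[of s v] by (intro mono_r) auto
  finally show ?thesis by simp
 qed
 have "N2 p <= 2 * N2 u + 2 + N2 v" using p zero_le_power2[of "norm u"] by linarith
 moreover have "N2 q <= 2 * N2 u + 2 + N2 v'" using q norm_shift_sq[OF h, of u] by linarith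
 ultimately show ?thesis using one[of p v] one[of q v'] by (simp add: algebra_simps)
qed

lemma linear_gauss:
 fixes y th :: real
 assumes "0 < th" "th <= 1" "0 <= y"
 shows "(1 + y) * exp (- (th / 2) * y^2) <= 2 / th"
proof -
 have "1 + y <= 2 + y^2"
 proof -
  have "0 <= (y - 1)^2" "(y - 1)^2 = y^2 - 2 * y + 1" "0 <= y^2" by (rule zero_le_power2, simp add: sq_eq algebra_simps, simp)
  then show ?thesis by linarith
 qed
 also have "... <= 2 / th + y^2" using assms by (simp add: field_simps)
 also have "... = 2 / th * (1 + th / 2 * y^2)" using assms by (simp add: field_simps)
 also have "... <= 2 / th * exp (th / 2 * y^2)" using assms by (intro mono_l exp_ge_add_one_self) auto
 finally have "(1 + y) * exp (- (th / 2) * y^2) <= (2 / th * exp (th / 2 * y^2)) * exp (- (th / 2) * y^2)"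
  by (intro mono_r) auto
 also have "... = 2 / th" by (simp add: exp_minus)
 finally show ?thesis .
qed

lemma kern_shift: "kern (v + h) (u + h) om = (if norm om = 1 & 0 <= (v - u) *. om then abs ((v - u) *. om) * exp (- N2 (u + h) / 4) else 0)"
 by (simp add: kern_def)

lemma post_plus: "post_u (v + h) (u + h) om = post_u v u om + h" "post_v (v + h) (u + h) om = post_v v u om + h"
 by (simp_all add: post_u_def post_v_def)

text \<open>Shifting \<open>u\<close> together with \<open>v\<close> by \<open>h\<close> preserves
  the relative velocity and the half sphere; only the Gaussian in \<open>u\<close> and the factors
  \<open>a\<close>, \<open>b\<close> vary.\<close>

lemma kern_diff:
 assumes "norm h <= 1" and om: "norm om = 1" and a: "0 <= a" and b: "0 <= b"
 shows "abs (kern v u om * a - kern (v + h) (u + h) om * b) <=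
  12 * norm h * b * (abs ((v - u) *. om) * exp (- N2 u / 16)) + abs ((v - u) *. om) * exp (- N2 u / 4) * abs (a - b)"
proof (cases "0 <= (v - u) *. om")
 case True
 let ?q = "abs ((v - u) *. om)" and ?e = "exp (- N2 u / 4)" and ?e' = "exp (- N2 (u + h) / 4)"
 have "kern v u om * a - kern (v + h) (u + h) om * b = ?q * ((?e - ?e') * b + ?e * (a - b))"
  unfolding kern_shift using True om by (simp add: kern_def algebra_simps)
 then have "abs (kern v u om * a - kern (v + h) (u + h) om * b) = ?q * abs ((?e - ?e') * b + ?e * (a - b))"
  by (simp add: abs_mult)
 also have "... <= ?q * (abs (?e - ?e') * b + ?e * abs (a - b))"
  using b by (intro mono_l order_trans[OF abs_triangle_ineq]) (auto simp: abs_mult)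
 also have "... <= ?q * ((12 * norm h * exp (- N2 u / 16)) * b + ?e * abs (a - b))"
  using gauss_diff[OF assms(1), of u] b by (intro mono_l add_right_mono mono_r) auto
 finally show ?thesis by (simp add: algebra_simps)
next
 case False
 then have "kern v u om = 0" "kern (v + h) (u + h) om = 0" by (simp_all add: kern_def)
 then show ?thesis using b by simp
qed

lemma lborel_shift:
 fixes h :: "real^3"
 shows "f \<in> bm ==> (LINT u|lborel. f (u + h)) = (LINT u|lborel. (f u :: real))"
  and "g \<in> bm ==> (NN u. g (u + h)) = (NN u. g u)"
proof -
 have d: "distr lborel borel (%u. u + h) = lborel"
  using lborel_distr_plus[of h] unfolding add.commute[of h] .
 show "f \<in> bm ==> (LINT u|lborel. f (u + h)) = (LINT u|lborel. (f u :: real))"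
  using integral_distr[of "%u. u + h" lborel borel f] unfolding d by simp
 show "g \<in> bm ==> (NN u. g (u + h)) = (NN u. g u)"
  using nn_integral_distr[of "%u. u + h" lborel borel g] unfolding d by simp
qed

text \<open>In the telescoped product each difference keeps the decay of the other factor. Since
  \<open>a'\<close> decays at the shifted point \<open>p'\<close>, the last hypothesis transfers
  this decay to \<open>p\<close> at half the rate.\<close>

lemma gauss_product_diff:
 fixes a a' b b' :: real and p q p' q' :: "real^3"
 assumes "0 <= a'" "0 <= b" "b <= B * gs th q" "a' <= B * gs th p'"
  and "0 < th" "th <= 1" "0 <= B" "N2 p <= 2 * N2 p' + 2"
 shows "abs (a * b - a' * b') <= 3 * B * (gs (th / 2) q * abs (a - a') + gs (th / 2) p * abs (b - b'))"
proof -
 let ?a = "gs (th / 2) p"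
 have "a * b - a' * b' = b * (a - a') + a' * (b - b')" by (simp add: algebra_simps)
 then have "abs (a * b - a' * b') <= b * abs (a - a') + a' * abs (b - b')"
  using abs_triangle_ineq[of "b * (a - a')" "a' * (b - b')"] assms(1,2) by (simp add: abs_mult)
 moreover have "b <= 3 * B * gs (th / 2) q"
 proof -
  have "B * gs th q <= (3 * B) * gs (th / 2) q"
   using assms by (intro mult_mono) auto
  then show ?thesis using assms(3) by linarith
 qed
 moreover have "a' <= 3 * B * ?a"
 proof -
  have "th / 2 * N2 p <= th / 2 * (2 * N2 p' + 2)" using assms by (intro mono_l) auto
  also have "... = th * N2 p' + th" by (simp add: algebra_simps)
  finally have "- th * N2 p' <= 1 + - (th / 2) * N2 p" using assms by simp
  then have "gs th p' <= exp 1 * ?a" by (simp add: exp_add[symmetric])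
  also have "... <= 3 * ?a" using exp_small by (intro mono_r) auto
  finally have "B * gs th p' <= B * (3 * ?a)" using assms by (intro mono_l) auto
  then show ?thesis using assms(4) by (simp add: mult_ac)
 qed
 ultimately have "abs (a * b - a' * b') <= (3 * B * gs (th / 2) q) * abs (a - a') + (3 * B * ?a) * abs (b - b')"
  by (smt (verit) mono_r abs_ge_zero)
 then show ?thesis by (simp add: algebra_simps)
qed

text \<open>The second profile is taken at \<open>z + h\<close>, because \<open>kern_diff\<close>
  compares the two profiles after a translation. Dividing by the weights at both points keeps the
  quotient bounded where the modulus grows.\<close>

definition quot :: "real => (real^3 => real) => (real^3 => real) => real^3 => real^3 => real" where
 "quot s ph ph' h z = abs (ph z - ph' (z + h)) / (Theta s z + Theta s (z + h))"

lemma quot_measurable [measurable]: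
 assumes [measurable]: "ph \<in> bm" "ph' \<in> bm"
 shows "quot s ph ph' h \<in> bm"
 unfolding quot_def[abs_def] by measurable

lemma quot_nonneg: "0 <= quot s ph ph' h z"
 using Theta_pos[of s z] Theta_pos[of s "z + h"] by (simp add: quot_def)

lemma quot_mult: "abs (ph z - ph' (z + h)) = (Theta s z + Theta s (z + h)) * quot s ph ph' h z"
 using Theta_pos[of s z] Theta_pos[of s "z + h"] by (simp add: quot_def)

text \<open>The translation of the integration variable shifts both outgoing velocities by
  \<open>h\<close>. Their weights pass to \<open>v\<close> and \<open>v + h\<close> by
  \<open>Theta_weight\<close>, and the two remaining quotients are averaged by
  \<open>gain_kernel_u\<close> and \<open>gain_kernel_v\<close>.\<close>

lemma gain_difference:
 assumes th: "0 < th" "th <= 1"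
 obtains C where "0 < C"
  "!!ph ph' v h s B. [|ph \<in> bm; ph' \<in> bm; 0 <= B;
   !!u. 0 <= ph u & ph u <= B * gs th u; !!u. 0 <= ph' u & ph' u <= B * gs th u;
   norm h <= 1; 0 <= s; s <= 1 / 64|] ==>
   ennreal \<bar>gain ph v - gain ph' (v + h)\<bar> <= ennreal (C * (1 + B^2) * (Theta s v + Theta s (v + h))) *
    (ennreal (norm h) + kavg (min (1 / 16) (th / 2) / 2) v (%z. ennreal (quot s ph ph' h z)))"
proof -
 let ?b = "4 * pi / (1 / 8)"
 obtain M where M: "0 < M" "!!v. (NN u. NS om. ennreal (abs ((v - u) *. om) * exp (- N2 u / 16))) <= ennreal (M * (1 + norm v))"
  by (rule kern_mass) blast
 obtain CB where CB: "!!ph v th K. [|ph \<in> bm; !!u. 0 <= ph u; 0 < th; 0 <= K; AE u in lborel. ph u <= K * gs th u|] ==>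
   (NN u. NS om. ennreal (kern v u om * (ph (post_u v u om) * ph (post_v v u om)))) <= ennreal (CB * K^2 * (1 + norm v) * gs th v)"
  by (rule collision_bounds) blast
 define ka where "ka = min (1 / 16) (th / 2) / 2"
 define C where "C = 72 * M / th + 384 * pi"
 have C: "0 < C" "0 <= 72 * M / th" using M th by (simp_all add: C_def add_pos_pos)
 show ?thesis
 proof (rule that[OF C(1)], unfold ka_def[symmetric])
  fix ph ph' :: "real^3 => real" and v h :: "real^3" and s B :: real
  assume [measurable]: "ph \<in> bm" "ph' \<in> bm" and B: "0 <= B"
   and ph: "!!u. 0 <= ph u & ph u <= B * gs th u" and ph': "!!u. 0 <= ph' u & ph' u <= B * gs th u"
   and h: "norm h <= 1" and s: "0 <= s" "s <= 1 / 64"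
  let ?r = "ennreal (norm h)"
  define S where "S = Theta s v + Theta s (v + h)"
  let ?l = "M * (1 + norm v)"
  let ?k = "gs (th / 2) v"
  let ?d = "ennreal (C * (1 + B^2) * S)"
  have S: "1 <= S" using Theta_ge_1[OF s(1), of v] Theta_pos[of s "v + h"] by (simp add: S_def)
  let ?e = "quot s ph ph' h"
  let ?a = "kavg ka v (%z. ennreal (?e z))"
  let ?ps = "%u om. kern v u om * (ph (post_u v u om) * ph (post_v v u om))"
  let ?f = "%u om. kern (v + h) u om * (ph' (post_u (v + h) u om) * ph' (post_v (v + h) u om))"
  let ?ps' = "%u om. ?f (u + h) om"
  have fm [measurable]: "case_prod ?f \<in> borel_measurable (borel \<Otimes>\<^sub>M sphere_measure)" by measurable
  have g': "gain ph' (v + h) = (LINT u|lborel. LINT om|sphere_measure. ?ps' u om)"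
   unfolding gain_eq by (rule lborel_shift(1)[symmetric]) measurable
  let ?Q = "%u om. abs ((v - u) *. om)"
  let ?A = "%u om. ennreal (?Q u om * exp (- N2 u / 16))"
  let ?U = "%u om. ennreal (?Q u om * gs (1 / 8) u * gs (th / 2) (post_v v u om)) * ennreal (?e (post_u v u om))"
  let ?V = "%u om. ennreal (?Q u om * gs (1 / 8) u * gs (th / 2) (post_u v u om)) * ennreal (?e (post_v v u om))"
  define a1 where "a1 = 36 * norm h * B^2 * ?k"
  define a2 where "a2 = 6 * B * S"
  let ?s = "ennreal (2 * a2 * ?b)"
  let ?h = "ennreal a2"
  have a: "0 <= a1" "0 <= a2" using B S by (simp_all add: a1_def a2_def)
  have pt: "ennreal \<bar>?ps u om - ?ps' u om\<bar> <= ennreal a1 * ?A u om + (?h * ?U u om + ?h * ?V u om)" if om: "norm om = 1" for u om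
  proof -
   let ?c = "?Q u om * exp (- N2 u / 16)"
   let ?p = "post_u v u om" and ?q = "post_v v u om"
   let ?j = "abs (ph ?q - ph' (?q + h))"
   let ?i = "abs (ph ?p - ph' (?p + h))"
   have en: "N2 ?p + N2 ?q = N2 u + N2 v" by (rule post_energy[OF om])
   have en': "N2 (?p + h) + N2 (?q + h) = N2 (u + h) + N2 (v + h)"
    using post_energy[OF om, of "v + h" "u + h"] by (simp add: post_plus)
   have np: "0 <= N2 ?p" "0 <= N2 ?q" "0 <= N2 (?p + h)" "0 <= N2 (?q + h)" "0 <= N2 (u + h)" by simp_all
   define b where "b = ph' (?p + h) * ph' (?q + h)"
   let ?g = "abs (ph ?p * ph ?q - b)"
   have b: "0 <= b" using ph' by (simp add: b_def)
   have b_le: "b <= 3 * B^2 * ?k"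
   proof -
    have "b <= (B * gs th (?p + h)) * (B * gs th (?q + h))"
     unfolding b_def using ph' B by (intro mult_mono) auto
    also have "... = B^2 * exp (- th * (N2 (?p + h) + N2 (?q + h)))"
     by (simp add: sq_eq exp_add[symmetric] algebra_simps)
    also have "... <= B^2 * (exp 1 * ?k)"
    proof (intro mono_l)
     have "th / 2 * N2 v <= th / 2 * (2 * (N2 (u + h) + N2 (v + h)) + 2)"
      using norm_shift_sq(1)[OF h, of v] th np(5) unfolding distrib_left[of 2] by (intro mono_l) linarith+
     then have "th / 2 * N2 v <= th * (N2 (u + h) + N2 (v + h)) + th" by (simp add: algebra_simps)
     then show "exp (- th * (N2 (?p + h) + N2 (?q + h))) <= exp 1 * ?k"
      unfolding en' using th by (simp add: exp_add[symmetric])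
    qed simp
    also have "... <= B^2 * (3 * ?k)" using exp_small by (intro mono_l mono_r) auto
    finally show ?thesis by simp
   qed
   define E4 where "E4 = exp (- N2 u / 4)"
   define E8 where "E8 = gs (1 / 8) u"
   have E: "0 < E4" "0 < E8" by (simp_all add: E4_def E8_def)
   have W: "E4 * abs (ph z - ph' (z + h)) <= 2 * S * E8 * ?e z" if "N2 z <= N2 u + N2 v" "N2 (z + h) <= N2 (u + h) + N2 (v + h)" for z
   proof -
    have "E4 * (Theta s z + Theta s (z + h)) <= 2 * S * E8"
     using Theta_weight[OF h s that] by (simp add: E4_def E8_def S_def)
    then have "E4 * (Theta s z + Theta s (z + h)) * ?e z <= 2 * S * E8 * ?e z" by (rule mono_r) (rule quot_nonneg)
    then show ?thesis unfolding quot_mult[of ph z ph' h s] by (simp only: mult.assoc)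
   qed
   have Wp: "E4 * ?i <= 2 * S * E8 * ?e ?p" and Wq: "E4 * ?j <= 2 * S * E8 * ?e ?q"
    using en en' np by (intro W; linarith)+
   let ?gq = "gs (th / 2) ?q" and ?gp = "gs (th / 2) ?p"
   let ?n = "a2 * (E8 * ?gq * ?e ?p) + a2 * (E8 * ?gp * ?e ?q)"
   let ?m = "a2 * (E8 * ?gq * ?e ?p) + a2 * (E8 * ?gp * ?e ?q)"
   have "?g <= 3 * B * (?gq * ?i + ?gp * ?j)"
    unfolding b_def using ph ph' th B norm_shift_sq(1)[OF h, of ?p] by (intro gauss_product_diff[where p' = "?p + h"]) auto
   then have "E4 * ?g <= E4 * (3 * B * (?gq * ?i + ?gp * ?j))"
    using E by (intro mono_l) auto
   also have "... = 3 * B * (?gq * (E4 * ?i) + ?gp * (E4 * ?j))" by (simp add: algebra_simps)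
   also have "... <= 3 * B * (?gq * (2 * S * E8 * ?e ?p) + ?gp * (2 * S * E8 * ?e ?q))"
    using B Wp Wq by (intro mono_l add_mono) auto
   also have "... = ?n" by (simp add: a2_def algebra_simps)
   finally have main: "E4 * ?g <= ?n" .
   have "abs (?ps u om - ?ps' u om) <= 12 * norm h * b * ?c + ?Q u om * E4 * ?g"
    unfolding post_plus b_def[symmetric] E4_def using ph b by (intro kern_diff[OF h om]) auto
   also have "... <= a1 * ?c + ?Q u om * ?m"
   proof (rule add_mono)
    have "12 * norm h * b <= 12 * norm h * (3 * B^2 * ?k)" using b_le by (intro mono_l) auto
    then have "12 * norm h * b <= a1" by (simp add: a1_def mult_ac)
    then show "12 * norm h * b * ?c <= a1 * ?c"
     by (intro mono_r) auto
    show "?Q u om * E4 * ?g <= ?Q u om * ?m"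
     unfolding mult.assoc[of "?Q u om"] using main by (intro mono_l) auto
   qed
   finally have "ennreal \<bar>?ps u om - ?ps' u om\<bar> <= ennreal (a1 * ?c + (a2 * (?Q u om * E8 * ?gq * ?e ?p) + a2 * (?Q u om * E8 * ?gp * ?e ?q)))"
    by (intro ennreal_leI) (simp add: algebra_simps)
   also have "... = ennreal a1 * ?A u om + (?h * ?U u om + ?h * ?V u om)"
    using a E quot_nonneg[of s ph ph' h] by (simp add: ennreal_mult ennreal_plus E8_def)
   finally show ?thesis .
  qed
  have AEb: "AE u in lborel. ph u <= B * gs th u" "AE u in lborel. ph' u <= B * gs th u" using ph ph' by auto
  have "ennreal \<bar>gain ph v - gain ph' (v + h)\<bar> <= (NN u. NS om. ennreal \<bar>?ps u om - ?ps' u om\<bar>)"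
   unfolding g' unfolding gain_eq
  proof (rule double_lint_diff)
   show "(NN u. NS om. ennreal (?ps u om)) < \<infinity>"
    by (rule le_less_trans[OF CB[OF _ _ th(1) B AEb(1)]]) (use ph in auto)
   have "(NN u. NS om. ennreal (?ps' u om)) = (NN u. NS om. ennreal (?f u om))"
    by (rule lborel_shift(2)) measurable
   also have "... < \<infinity>" by (rule le_less_trans[OF CB[OF _ _ th(1) B AEb(2)]]) (use ph' in auto)
   finally show "(NN u. NS om. ennreal (?ps' u om)) < \<infinity>" .
  qed (use ph ph' kern_nonneg in \<open>auto intro!: mult_nonneg_nonneg\<close>)
  also have "... <= (NN u. NS om. (ennreal a1 * ?A u om + (?h * ?U u om + ?h * ?V u om)))"
   using AE_sphere_norm pt by (intro nn_integral_mono nn_integral_mono_AE) auto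
  also have "... = ennreal a1 * (NN u. NS om. ?A u om) + (?h * (NN u. NS om. ?U u om) +
    ?h * (NN u. NS om. ?V u om))"
   by (simp add: nn_integral_add nn_integral_cmult)
  also have "... <= ennreal a1 * ennreal ?l + (?h * (ennreal ?b * ?a) +
    ?h * (ennreal ?b * ?a))"
  proof (intro add_mono mono_l M)
   have k: "min (1 / 8 / 2) (th / 2) / 2 = ka" by (simp add: ka_def)
   show "(NN u. NS om. ?U u om) <= ennreal ?b * ?a"
    unfolding kavg_def using gain_kernel_u[of "%z. ennreal (?e z)" "1 / 8" "th / 2" v] th unfolding k by simp
   show "(NN u. NS om. ?V u om) <= ennreal ?b * ?a"
    unfolding kavg_def using gain_kernel_v[of "%z. ennreal (?e z)" "1 / 8" "th / 2" v] th unfolding k by simp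
  qed auto
  also have "... = ennreal (a1 * ?l) + ?s * ?a"
  proof -
   have "?s = ennreal (a2 * ?b) + ennreal (a2 * ?b)"
    using a by (simp add: ennreal_plus[symmetric] del: ennreal_plus)
   then show ?thesis using a M by (simp add: ennreal_mult distrib_right mult.assoc)
  qed
  also have "... <= ?d * ?r + ?d * ?a"
  proof (intro add_mono mono_r)
   have BB: "2 * B <= 1 + B^2" using zero_le_power2[of "B - 1"] by (simp add: sq_eq algebra_simps)
   have "a1 * ?l = 36 * norm h * B^2 * M * ((1 + norm v) * ?k)" by (simp add: a1_def)
   also have "... <= 36 * norm h * B^2 * M * (2 / th)" using M th by (intro mono_l linear_gauss) auto
   also have "... = (72 * M / th) * B^2 * 1 * norm h" by simp
   also have "... <= C * (1 + B^2) * S * norm h"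
    using S C by (intro mono_r mult_mono) (auto simp: C_def)
   finally show "ennreal (a1 * ?l) <= ?d * ?r"
    using C S by (simp add: ennreal_mult[symmetric] ennreal_leI)
   have "2 * a2 * ?b = (384 * pi) * B * S" by (simp add: a2_def)
   also have "... <= C * (1 + B^2) * S" using S C B BB by (intro mono_r mult_mono) (auto simp: C_def)
   finally show "?s <= ?d" by (rule ennreal_leI)
  qed auto
  also have "... = ?d * (?r + ?a)" by (simp add: distrib_left)
  finally show "ennreal \<bar>gain ph v - gain ph' (v + h)\<bar> <= ennreal (C * (1 + B^2) * (Theta s v + Theta s (v + h))) * (?r + ?a)"
   by (simp add: S_def)
 qed
qed

text \<open>The same translation; but the quotient stands at \<open>u\<close> itself, so the average
  is centred at \<open>0\<close> and the Gaussian absorbs its weight entirely, by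
  \<open>Theta_weight\<close> with \<open>v = v' = 0\<close>.\<close>

lemma freq_difference:
 assumes th: "0 < th" "th <= 1"
 obtains C where "0 < C"
  "!!ph ph' v h s B. [|ph \<in> bm; ph' \<in> bm; 0 <= B;
   !!u. 0 <= ph u & ph u <= B * gs th u; !!u. 0 <= ph' u & ph' u <= B * gs th u;
   norm h <= 1; 0 <= s; s <= 1 / 64|] ==>
   ennreal \<bar>freq ph v - freq ph' (v + h)\<bar> <= ennreal (C * (1 + B) * (1 + norm v)) *
    (ennreal (norm h) + kavg (min (1 / 16) (th / 2) / 2) 0 (%z. ennreal (quot s ph ph' h z)))"
proof -
 obtain M where M: "0 < M" "!!v. (NN u. NS om. ennreal (abs ((v - u) *. om) * exp (- N2 u / 16))) <= ennreal (M * (1 + norm v))"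
  by (rule kern_mass) blast
 obtain CB where CB: "!!ph v th K. [|ph \<in> bm; !!u. 0 <= ph u; 0 < th; 0 <= K; AE u in lborel. ph u <= K * gs th u|] ==>
   (NN u. NS om. ennreal (kern v u om * ph u)) <= ennreal (CB * K * (1 + norm v))"
  by (rule collision_bounds) blast
 obtain S where S: "0 < S" "emeasure sphere_measure UNIV <= ennreal S" by (rule sphere_mass)
 define ka where "ka = min (1 / 16) (th / 2) / 2"
 have ka: "ka <= 1 / 32" by (simp add: ka_def)
 define C where "C = 12 * M + 480 * S"
 have C: "0 < C" using M S by (simp add: C_def add_pos_pos)
 show ?thesis
 proof (rule that[OF C], unfold ka_def[symmetric])
  fix ph ph' :: "real^3 => real" and v h :: "real^3" and s B :: real
  assume [measurable]: "ph \<in> bm" "ph' \<in> bm" and B: "0 <= B"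
   and ph: "!!u. 0 <= ph u & ph u <= B * gs th u" and ph': "!!u. 0 <= ph' u & ph' u <= B * gs th u"
   and h: "norm h <= 1" and s: "0 <= s" "s <= 1 / 64"
  let ?h = "ennreal (norm h)"
  let ?g = "ennreal (12 * norm h * B)"
  let ?e = "quot s ph ph' h"
  let ?c = "kavg ka 0 (%z. ennreal (?e z))"
  let ?ps = "%u om. kern v u om * ph u"
  let ?f = "%u om. kern (v + h) u om * ph' u"
  let ?ps' = "%u om. ?f (u + h) om"
  have fm [measurable]: "case_prod ?f \<in> borel_measurable (borel \<Otimes>\<^sub>M sphere_measure)" by measurable
  have g': "freq ph' (v + h) = (LINT u|lborel. LINT om|sphere_measure. ?ps' u om)"
   unfolding freq_eq by (rule lborel_shift(1)[symmetric]) measurable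
  let ?a = "1 + norm v"
  let ?j = "ennreal (480 * S * ?a)"
  let ?b = "ennreal (C * (1 + B) * ?a)"
  let ?Q = "%u om. abs ((v - u) *. om)"
  let ?A = "%u om. ennreal (?Q u om * exp (- N2 u / 16))"
  have pt: "ennreal \<bar>?ps u om - ?ps' u om\<bar> <= ?g * ?A u om + ennreal 8 * (?A u om * ennreal (?e u))" if om: "norm om = 1" for u om
  proof -
   let ?i = "exp (- N2 u / 4)"
   let ?d = "exp (- N2 u / 16)"
   have "gs th (u + h) <= 1" using th by simp
   then have "B * gs th (u + h) <= B" using B by (simp add: mult_left_le)
   then have b: "0 <= ph' (u + h)" "ph' (u + h) <= B" using ph'[of "u + h"] by auto
   have W: "?i * abs (ph u - ph' (u + h)) <= 8 * ?d * ?e u"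
   proof -
    have "?i * (Theta s u + Theta s (u + h)) <= 2 * (Theta s 0 + Theta s 0) * exp (- N2 u / 8)"
     by (rule Theta_weight[OF h s]) auto
    also have "... <= 8 * ?d"
    proof (rule mult_mono)
     have "Theta s 0 <= exp (1 / 4)" using s by (simp add: Theta_def)
     then have "Theta s 0 <= 2" using exp_small(1) by linarith
     then show "2 * (Theta s 0 + Theta s 0) <= 8" by simp
    qed auto
    finally have "?i * (Theta s u + Theta s (u + h)) * ?e u <= 8 * ?d * ?e u"
     by (rule mono_r) (rule quot_nonneg)
    then show ?thesis unfolding quot_mult[of ph u ph' h s] by (simp only: mult.assoc)
   qed
   have "abs (?ps u om - ?ps' u om) <= 12 * norm h * ph' (u + h) * (?Q u om * ?d) + ?Q u om * ?i * abs (ph u - ph' (u + h))"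
    using ph b by (intro kern_diff[OF h om]) auto
   also have "... <= 12 * norm h * B * (?Q u om * ?d) + ?Q u om * (8 * ?d * ?e u)"
    unfolding mult.assoc[of "?Q u om"] using b W by (intro add_mono mono_l mono_r) auto
   finally have "ennreal \<bar>?ps u om - ?ps' u om\<bar> <= ennreal (12 * norm h * B * (?Q u om * ?d) + 8 * ((?Q u om * ?d) * ?e u))"
    by (intro ennreal_leI) (simp add: algebra_simps)
   also have "... = ?g * ?A u om + ennreal 8 * (?A u om * ennreal (?e u))"
    using B quot_nonneg[of s ph ph' h] by (simp add: ennreal_mult ennreal_plus)
   finally show ?thesis .
  qed
  have AEb: "AE u in lborel. ph u <= B * gs th u" "AE u in lborel. ph' u <= B * gs th u" using ph ph' by auto
  have "ennreal \<bar>freq ph v - freq ph' (v + h)\<bar> <= (NN u. NS om. ennreal \<bar>?ps u om - ?ps' u om\<bar>)"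
   unfolding g' unfolding freq_eq
  proof (rule double_lint_diff)
   show "(NN u. NS om. ennreal (?ps u om)) < \<infinity>"
    by (rule le_less_trans[OF CB[OF _ _ th(1) B AEb(1)]]) (use ph in auto)
   have "(NN u. NS om. ennreal (?ps' u om)) = (NN u. NS om. ennreal (?f u om))"
    by (rule lborel_shift(2)) measurable
   also have "... < \<infinity>" by (rule le_less_trans[OF CB[OF _ _ th(1) B AEb(2)]]) (use ph' in auto)
   finally show "(NN u. NS om. ennreal (?ps' u om)) < \<infinity>" .
  qed (use ph ph' kern_nonneg in \<open>auto intro!: mult_nonneg_nonneg\<close>)
  also have "... <= (NN u. NS om. (?g * ?A u om + ennreal 8 * (?A u om * ennreal (?e u))))"
   using AE_sphere_norm pt by (intro nn_integral_mono nn_integral_mono_AE) auto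
  also have "... = ?g * (NN u. NS om. ?A u om) + ennreal 8 * (NN u. NS om. ?A u om * ennreal (?e u))"
   by (simp add: nn_integral_add nn_integral_cmult)
  also have "... <= ?g * ennreal (M * ?a) + ennreal 8 * (ennreal (60 * S * ?a) * ?c)"
   using S by (intro add_mono mono_l M loss_kernel[OF ka]) auto
  also have "... = ennreal (12 * norm h * B * (M * ?a)) + ?j * ?c"
  proof -
   have "?j = ennreal (8 * (60 * S * ?a))" by (rule arg_cong[of _ _ ennreal]) simp
   also have "... = ennreal 8 * ennreal (60 * S * ?a)" using S by (intro ennreal_mult) auto
   finally show ?thesis using B M by (simp add: ennreal_mult mult.assoc)
  qed
  also have "... <= ?b * ?h + ?b * ?c"
  proof (intro add_mono mono_r)
   have "12 * norm h * B * (M * ?a) = (12 * M) * B * ?a * norm h" by simp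
   also have "... <= C * (1 + B) * ?a * norm h"
    using S C B M by (intro mono_r mult_mono) (auto simp: C_def)
   finally show "ennreal (12 * norm h * B * (M * ?a)) <= ?b * ?h"
    using C B by (simp add: ennreal_mult[symmetric] ennreal_leI)
   have "480 * S * 1 * ?a <= C * (1 + B) * ?a" using S C B M by (intro mono_r mult_mono) (auto simp: C_def)
   then show "?j <= ?b" by (intro ennreal_leI) simp
  qed auto
  also have "... = ?b * (?h + ?c)" by (simp add: distrib_left)
  finally show "ennreal \<bar>freq ph v - freq ph' (v + h)\<bar> <= ?b * (?h + ?c)" .
 qed
qed

section \<open>Pointwise bounds for the solution\<close>

text \<open>On the image the inverse is Lipschitz, and Lipschitz maps preserve null sets;
  measurability of \<open>E\<close> does not enter.\<close>

lemma negligible_expanding: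
 fixes Ph :: "'a::euclidean_space => 'a"
 assumes "Ph ` E \<subseteq> S" "negligible S" and L: "!!p q. p \<in> E ==> q \<in> E ==> norm (p - q) <= L * norm (Ph p - Ph q)"
 shows "negligible E"
proof -
 have inj: "inj_on Ph E" using L by (intro inj_onI) fastforce
 let ?g = "inv_into E Ph"
 have "negligible (?g ` (Ph ` E))"
 proof (rule negligible_locally_Lipschitz_image)
  show "negligible (Ph ` E)" using assms(1,2) negligible_subset by blast
  fix y assume y: "y \<in> Ph ` E"
  have "norm (?g z - ?g y) <= L * norm (z - y)" if "z \<in> Ph ` E" for z
   using L[of "?g z" "?g y"] that y by (simp add: inv_into_into f_inv_into_f)
  then show "EX T B. open T & y \<in> T & (ALL z:Ph ` E \<inter> T. norm (?g z - ?g y) <= B * norm (z - y))"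
   by (intro exI[of _ UNIV] exI[of _ L]) auto
 qed simp
 then show ?thesis using inj by (simp add: inv_into_image_cancel)
qed

lemma AE_lborel_negligible:
 fixes E :: "('a::euclidean_space \<times> 'b::euclidean_space) set"
 assumes "negligible E"
 shows "AE a in lborel. AE b in lborel. (a, b) \<notin> E"
proof -
 have "E \<in> null_sets lebesgue" using assms by (simp add: negligible_iff_null_sets)
 then have "AE p in lborel. p \<notin> E" using AE_not_in[of E lebesgue] by (simp only: AE_completion_iff)
 then have "AE p in lborel \<Otimes>\<^sub>M lborel. p \<notin> E" unfolding lborel_prod .
 from lborel_pair.AE_pair[OF this] show ?thesis .
qed

text \<open>The exponentials differ by at most the integral of the difference of frequencies. They
  are always paired with the first datum and the first source, so that only \<open>abs ph\<close>
  and \<open>c\<close> appear as factors.\<close>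

lemma duhamel_diff:
 fixes n n' g g' :: "real => real"
 assumes [measurable]: "n \<in> bm" "n' \<in> bm" "g \<in> bm" "g' \<in> bm"
  and n: "!!s. 0 <= n s & n s <= k" "!!s. 0 <= n' s & n' s <= k" and g: "!!s. 0 <= g s & g s <= c" "!!s. 0 <= g' s & g' s <= c'"
  and t: "0 <= t"
 shows "abs ((exp (- (LINT ta:{0..t}|lborel. n ta)) * ph + (LINT s:{0..t}|lborel. exp (- (LINT ta:{s..t}|lborel. n ta)) * g s)) -
   (exp (- (LINT ta:{0..t}|lborel. n' ta)) * ph' + (LINT s:{0..t}|lborel. exp (- (LINT ta:{s..t}|lborel. n' ta)) * g' s)))
  <= abs (ph - ph') + (LINT s:{0..t}|lborel. abs (g s - g' s) + (abs ph + t * c) * abs (n s - n' s))"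
proof -
 have bnd: "set_integrable lborel {a..t} h" if [measurable]: "h \<in> bm" and "!!s. abs (h s) <= C" for h :: "real => real" and C a
  unfolding set_integrable_def
  by (rule integrableI_bounded_set_indicator[where B = C]) (use that in \<open>auto simp: emeasure_lborel_Icc_eq\<close>)
 define d where "d = (LINT ta:{0..t}|lborel. abs (n ta - n' ta))"
 let ?a = "%m s. LINT ta:{s..t}|lborel. m ta"
 have nd: "abs (n s - n' s) <= k" for s using n[of s] by (simp add: abs_le_iff)
 have gd: "abs (g s - g' s) <= max c c'" for s using g(1)[of s] g(2)[of s] by linarith
 have in1: "set_integrable lborel {a..t} n" "set_integrable lborel {a..t} n'" for a using n by (auto intro!: bnd[where C = k])
 have ind: "set_integrable lborel {a..t} (%s. abs (n s - n' s))" for a by (rule bnd[where C = k]) (use nd in auto)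
 have ing: "set_integrable lborel {a..t} (%s. abs (g s - g' s))" for a by (rule bnd[where C = "max c c'"]) (use gd in auto)
 have incd: "set_integrable lborel {0..t} (%s. c * d)" by (rule bnd[where C = "abs (c * d)"]) auto
 have d0: "0 <= d" unfolding d_def set_lebesgue_integral_def by (intro Bochner_Integration.integral_nonneg) auto
 have ad: "abs (?a n s - ?a n' s) <= d" if "0 <= s" for s
 proof -
  have "abs (?a n s - ?a n' s) = abs (?a (%ta. n ta - n' ta) s)" using in1 by (simp add: set_integral_diff)
  also have "... <= ?a (%ta. abs (n ta - n' ta)) s"
   using in1 set_integral_norm_bound[of lborel "{s..t}" "%ta. n ta - n' ta"] by (simp add: set_integral_diff)
  also have "... <= d" unfolding d_def
   unfolding set_lebesgue_integral_def using ind[of s] ind[of 0] that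
   by (intro Bochner_Integration.integral_mono) (auto simp: set_integrable_def indicator_def)
  finally show ?thesis .
 qed
 have a0: "0 <= ?a m s" if "!!s. 0 <= m s" for m :: "real => real" and s
  unfolding set_lebesgue_integral_def by (rule Bochner_Integration.integral_nonneg) (use that in auto)
 have e: "abs (exp (- ?a n s) * p - exp (- ?a n' s) * q) <= abs p * d + abs (p - q)" if "0 <= s" for s p q
 proof -
  let ?b = "exp (- ?a n' s)"
  let ?c = "exp (- ?a n s) - ?b"
  have 1: "abs ?c <= d"
   using exp_minus_diff_le[of 0 "?a n s" "?a n' s"] a0[of n s] a0[of n' s] n ad[OF that] by simp
  have 2: "?b <= 1" using a0[of n' s] n by simp
  have "exp (- ?a n s) * p - ?b * q = p * ?c + ?b * (p - q)"
   by (simp add: algebra_simps)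
  also have "abs (...) <= abs p * abs ?c + ?b * abs (p - q)"
   by (rule order_trans[OF abs_triangle_ineq]) (simp add: abs_mult)
  also have "... <= abs p * d + 1 * abs (p - q)" using 1 2 by (intro add_mono mono_l mono_r) auto
  finally show ?thesis by simp
 qed
 have am: "(%s. ?a m s) \<in> bm" if [measurable]: "m \<in> bm" for m :: "real => real"
 proof -
  have "(%s. LINT ta|lborel. (if s <= ta & ta <= t then m ta else 0)) \<in> bm" by measurable
  moreover have "?a m s = (LINT ta|lborel. (if s <= ta & ta <= t then m ta else 0))" for s
   unfolding set_lebesgue_integral_def by (rule Bochner_Integration.integral_cong) auto
  ultimately show ?thesis by simp
 qed
 note [measurable] = am[of n] am[of n']
 have eb: "abs (exp (- ?a m s) * h s) <= C" if "!!s. 0 <= m s" "!!s. 0 <= h s & h s <= C" for m h :: "real => real" and C s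
 proof -
  have "exp (- ?a m s) * h s <= 1 * h s" using a0[of m s] that by (intro mono_r) auto
  then show ?thesis using that(2)[of s] by simp
 qed
 have ig: "set_integrable lborel {0..t} (%s. exp (- ?a n s) * g s)" "set_integrable lborel {0..t} (%s. exp (- ?a n' s) * g' s)"
  by (rule bnd[where C = c], measurable, rule eb; use n g in blast) (rule bnd[where C = c'], measurable, rule eb; use n g in blast)
 let ?D = "%s. exp (- ?a n s) * g s - exp (- ?a n' s) * g' s"
 have "abs ((LINT s:{0..t}|lborel. exp (- ?a n s) * g s) - (LINT s:{0..t}|lborel. exp (- ?a n' s) * g' s)) = abs (LINT s:{0..t}|lborel. ?D s)"
  using ig by (simp add: set_integral_diff)
 also have "... <= (LINT s:{0..t}|lborel. abs (?D s))"
  using ig set_integral_norm_bound[of lborel "{0..t}" ?D] by (simp add: set_integral_diff)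
 also have "... <= (LINT s:{0..t}|lborel. c * d + abs (g s - g' s))"
 proof (rule set_integral_mono)
  show "set_integrable lborel {0..t} (%s. abs (?D s))" using ig by (simp add: set_integrable_abs set_integral_diff)
  show "set_integrable lborel {0..t} (%s. c * d + abs (g s - g' s))"
   using ing incd by (intro set_integral_add(1))
  fix s assume s: "s \<in> {0..t}"
  have "abs (?D s) <= abs (g s) * d + abs (g s - g' s)" using s by (intro e) auto
  also have "abs (g s) * d <= c * d" using g(1)[of s] d0 by (intro mono_r) auto
  finally show "abs (?D s) <= c * d + abs (g s - g' s)" by simp
 qed
 also have "... = t * (c * d) + (LINT s:{0..t}|lborel. abs (g s - g' s))"
  using ing incd t by (subst set_integral_add(2)) (auto simp: set_lebesgue_integral_def)
 finally have 1: "abs ((LINT s:{0..t}|lborel. exp (- ?a n s) * g s) - (LINT s:{0..t}|lborel. exp (- ?a n' s) * g' s)) <= t * (c * d) + (LINT s:{0..t}|lborel. abs (g s - g' s))" .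
 have 2: "abs (exp (- ?a n 0) * ph - exp (- ?a n' 0) * ph') <= abs ph * d + abs (ph - ph')" by (rule e) simp
 have "(LINT s:{0..t}|lborel. abs (g s - g' s) + (abs ph + t * c) * abs (n s - n' s)) = (LINT s:{0..t}|lborel. abs (g s - g' s)) + (abs ph + t * c) * d"
  unfolding d_def using ing ind by (subst set_integral_add(2)) auto
 also have "(abs ph + t * c) * d = abs ph * d + t * (c * d)" by (simp add: algebra_simps)
 finally show ?thesis using 1 2 by linarith
qed

text \<open>\<open>F\<close> is the solution extended by \<open>0\<close>, so that it is Borel on
  the whole space. \<open>F_ae\<close> is what the essential supremum provides: at each time an
  exceptional null set of positions and velocities.\<close>

locale solution = convex_obstacle +
 fixes f0 :: "real^3 => real^3 => real" and F :: "real => real^3 => real^3 => real" and T M th0 :: real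
 assumes T_pos: "0 < T" and M_nonneg: "0 <= M" and th0_pos: "0 < th0"
  and F_borel: "(%(t, x, v). F t x v) \<in> bm"
  and F_nonneg: "0 <= F t x v"
  and F_outside: "~ (0 <= t & t <= T & xi x <= 0) ==> F t x v = 0"
  and f0_bound: "xi x <= 0 ==> abs (f0 x v) <= M * gs th0 v"
  and F_ae: "EX K al. 0 <= K & 0 < al & al <= th0 & al <= 1 & (ALL s. AE p in lborel. F s (fst p) (snd p) <= K * gs al (snd p))"
  and mild: "0 <= t ==> t <= T ==> xi x <= 0 ==>
   F t x v = exp (- (LINT ta:{0..t}|lborel. freq (F ta (flow (t - ta) x v)) (vel (t - ta) x v))) * f0 (flow t x v) (vel t x v) +
    (LINT s:{0..t}|lborel. exp (- (LINT ta:{s..t}|lborel. freq (F ta (flow (t - ta) x v)) (vel (t - ta) x v))) *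
     gain (F s (flow (t - s) x v)) (vel (t - s) x v))"
begin

lemma F_measurable [measurable]:
 assumes [measurable]: "f \<in> borel_measurable MM" "g \<in> borel_measurable MM" "h \<in> borel_measurable MM"
 shows "(%x. F (f x) (g x) (h x)) \<in> borel_measurable MM"
proof -
 have "(%x. (f x, g x, h x)) \<in> MM \<rightarrow>\<^sub>M borel" by measurable
 from measurable_compose[OF this F_borel] show ?thesis by simp
qed

lemma F_slice: "F s x \<in> bm"
 by (rule F_measurable[of "%_. s" borel "%_. x" "%v. v"]) simp_all

lemma gain_measurable [measurable]:
 assumes [measurable]: "f \<in> borel_measurable MM" "g \<in> borel_measurable MM" "h \<in> borel_measurable MM"
 shows "(%x. gain (F (f x) (g x)) (h x)) \<in> borel_measurable MM"
 unfolding gain_eq by measurable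

lemma freq_measurable [measurable]:
 assumes [measurable]: "f \<in> borel_measurable MM" "g \<in> borel_measurable MM" "h \<in> borel_measurable MM"
 shows "(%x. freq (F (f x) (g x)) (h x)) \<in> borel_measurable MM"
 unfolding freq_eq by measurable

lemma freq_nonneg: "0 <= freq (F s y) u"
 unfolding freq_eq using F_nonneg kern_nonneg by (intro Bochner_Integration.integral_nonneg) auto

lemma gain_nonneg: "0 <= gain (F s y) u"
 unfolding gain_eq using F_nonneg kern_nonneg by (intro Bochner_Integration.integral_nonneg) auto

section \<open>From a bound almost everywhere to a bound everywhere\<close>

definition tame :: "real => real => real => real^3 => bool" where
 "tame K al s y \<longleftrightarrow> (AE u in lborel. F s y u <= K * gs al u)"

text \<open>The gain term has to be bounded only at almost all times of one trajectory. Half of the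
  exponent is spent on the growth \<open>1 + norm v\<close>.\<close>

lemma mild_bound:
 obtains C where "0 < C"
  "!!K al t x v. [|0 <= K; 0 < al; al <= th0; al <= 1; 0 <= t; t <= T; xi x <= 0; AE s in lborel. s \<in> {0..t} --> tame K al s (flow (t - s) x v)|] ==>
   F t x v <= (M + T * (C * K^2 * (2 / al))) * gs (al / 2) v"
proof -
 obtain C where C: "0 < C" and CB: "!!ph v al K. [|ph \<in> bm; !!u. 0 <= ph u; 0 < al; 0 <= K; AE u in lborel. ph u <= K * gs al u|] ==>
   gain ph v <= C * K^2 * (1 + norm v) * gs al v"
  by (rule collision_bounds) blast
 show ?thesis
 proof (rule that[OF C])
  fix K al t :: real and x v :: "real^3"
  assume K: "0 <= K" and al: "0 < al" "al <= th0" "al <= 1" and t: "0 <= t" "t <= T" and x: "xi x <= 0"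
   and ae: "AE s in lborel. s \<in> {0..t} --> tame K al s (flow (t - s) x v)"
  let ?a = "f0 (flow t x v) (vel t x v)"
  let ?e = "gs (al / 2) v"
  let ?N = "%s. LINT ta:{s..t}|lborel. freq (F ta (flow (t - ta) x v)) (vel (t - ta) x v)"
  let ?G = "%s. gain (F s (flow (t - s) x v)) (vel (t - s) x v)"
  have N: "exp (- ?N s) <= 1" for s
   unfolding set_lebesgue_integral_def using freq_nonneg by (simp add: Bochner_Integration.integral_nonneg)
  let ?c = "C * K^2 * (2 / al) * ?e"
  have c: "0 <= ?c" using C al by simp
  have "exp (- ?N 0) * ?a <= 1 * abs (?a)"
  proof -
   have "exp (- ?N 0) * ?a <= exp (- ?N 0) * abs (?a)" by (rule mono_l) auto
   also have "... <= 1 * abs (?a)" using N[of 0] by (intro mono_r) auto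
   finally show ?thesis .
  qed
  also have "... <= M * gs th0 (vel t x v)" using f0_bound[OF flow_le_0[OF x t(1)]] by simp
  also have "... <= M * ?e"
  proof (unfold norm_vel[OF x t(1)], rule mono_l[OF _ M_nonneg])
   have "al / 2 * N2 v <= th0 * N2 v" using al by (intro mono_r) auto
   then show "gs th0 v <= ?e" by simp
  qed
  finally have 1: "exp (- ?N 0) * ?a <= M * ?e" .
  have "ennreal (LINT s:{0..t}|lborel. exp (- ?N s) * ?G s) <= (NN s. ennreal (indicator {0..t} s *R (exp (- ?N s) * ?G s)))"
   unfolding set_lebesgue_integral_def
  proof (cases "integrable lborel (%s. indicator {0..t} s *R (exp (- ?N s) * ?G s))")
   case True
   then show "ennreal (LINT s|lborel. indicator {0..t} s *R (exp (- (LINT ta|lborel. indicator {s..t} ta *R freq (F ta (flow (t - ta) x v)) (vel (t - ta) x v))) * ?G s)) <=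
    (NN s. ennreal (indicator {0..t} s *R (exp (- (LINT ta|lborel. indicator {s..t} ta *R freq (F ta (flow (t - ta) x v)) (vel (t - ta) x v))) * ?G s)))"
    using gain_nonneg by (subst nn_integral_eq_integral) (auto simp: set_lebesgue_integral_def)
  qed (simp add: not_integrable_integral_eq set_lebesgue_integral_def)
  also have "... <= (NN s. ennreal ?c * indicator {0..t} s)"
  proof (rule nn_integral_mono_AE)
   show "AE s in lborel. ennreal (indicator {0..t} s *R (exp (- ?N s) * ?G s)) <= ennreal ?c * indicator {0..t} s"
    using ae
   proof eventually_elim
    case (elim s)
    show ?case
    proof (cases "s \<in> {0..t}")
     case True
     then have "?G s <= C * K^2 * (1 + norm (vel (t - s) x v)) * gs al (vel (t - s) x v)"
      using elim K al F_nonneg by (intro CB F_slice) (auto simp: tame_def)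
     also have "... = C * K^2 * ((1 + norm v) * gs al v)" using True norm_vel[OF x] by simp
     also have "gs al v = gs (al / 2) v * ?e" by (simp add: exp_add[symmetric])
     also have "C * K^2 * ((1 + norm v) * (gs (al / 2) v * ?e)) = C * K^2 * (((1 + norm v) * gs (al / 2) v) * ?e)" by simp
     also have "... <= C * K^2 * (2 / al * ?e)" using C al by (intro mono_l mono_r linear_gauss) auto
     finally have "?G s <= ?c" by simp
     then have "exp (- ?N s) * ?G s <= 1 * ?c" using N[of s] gain_nonneg by (intro mult_mono) auto
     then show ?thesis using True by (simp add: ennreal_leI)
    qed simp
   qed
  qed
  also have "... = ennreal ?c * ennreal t" using t by (simp add: nn_integral_cmult)
  also have "... = ennreal (?c * t)" using t c by (intro ennreal_mult[symmetric])
  finally have "(LINT s:{0..t}|lborel. exp (- ?N s) * ?G s) <= ?c * t" using mult_nonneg_nonneg[OF c t(1)] by (simp only: ennreal_le_iff)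
  also have "... <= ?c * T" using t c by (intro mono_l) auto
  finally have "F t x v <= M * ?e + ?c * T" using mild[OF t x, of v] 1 by linarith
  then show "F t x v <= (M + T * (C * K^2 * (2 / al))) * ?e" by (simp add: algebra_simps)
 qed
qed

lemma flow_refl_time:
 assumes x: "xi x <= 0" and r: "0 <= r" "0 <= r'" "t_b xi x v <= ereal r" "t_b xi x v <= ereal r'"
 shows "norm (flow r x v - flow r' x v) = abs (r - r') * norm v"
proof (cases rule: flow_cases[OF x r(1), of v, case_names free refl])
 case free
 then show ?thesis using r by simp
next
 case (refl ta)
 note A = this
 show ?thesis
 proof (cases rule: flow_cases[OF x r(2), of v, case_names free refl])
  case free
  then show ?thesis using r by simp
 next
  case (refl ta')
  then have [simp]: "ta' = ta" using A by simp
  have "flow r x v - flow r' x v = (r' - r) *R refl_vel xi (x - ta *R v) v"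
   unfolding A(7) refl(7) by (simp add: algebra_simps)
  then show ?thesis using norm_refl[OF A(4), of v] by (simp add: abs_minus_commute)
 qed
qed

text \<open>The exceptional set is null in position and time, but a trajectory is a curve and may
  lie in it. For fixed \<open>x\<close> the velocity is varied: the map from \<open>(v, s)\<close>
  to \<open>(flow (t - s) x v, s)\<close> expands on the free part and, by
  \<open>reflected_flow_expands\<close>, on the reflected part, so the exceptional pairs
  \<open>(v, s)\<close> form a null set.\<close>

lemma tame_along:
 assumes K: "0 <= K" and ae: "!!s. AE p in lborel. F s (fst p) (snd p) <= K * gs al (snd p)"
  and x: "xi x <= 0" and t: "0 <= t"
 shows "AE v in lborel. AE s in lborel. s \<in> {0..t} --> tame K al s (flow (t - s) x v)"
proof -
 let ?j = "borel_measurable (borel \<Otimes>\<^sub>M borel)"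
 \<comment> \<open>The measure of the velocities that violate the bound; it turns
   \<open>tame\<close> into a measurable condition on time and position.\<close>
 define be where "be s y = (NN u. (if F s y u <= K * gs al u then 0 else 1))" for s y
 have bem [measurable]: "case_prod be \<in> ?j" unfolding be_def by measurable
 have tame: "tame K al s y" if "be s y = 0" for s y
 proof -
  have "AE u in lborel. (if F s y u <= K * gs al u then 0 else 1 :: ennreal) = 0"
   using that unfolding be_def by (subst (asm) nn_integral_0_iff_AE) auto
  then show ?thesis unfolding tame_def by eventually_elim (auto split: if_splits)
 qed
 define S where "S = {p. be (snd p) (fst p) ~= 0}"
 have "(NN y. be s y) = 0" for s
 proof -
  have "(NN y. be s y) = (NN p. (if F s (fst p) (snd p) <= K * gs al (snd p) then 0 else 1))"
   unfolding be_def by (subst nn_integral_lborel_pair) (auto simp: borel_prod[symmetric])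
  also have "... = 0"
  proof (subst nn_integral_0_iff_AE)
   show "(%p. if F s (fst p) (snd p) <= K * gs al (snd p) then 0 else 1 :: ennreal) \<in> borel_measurable lborel"
   proof -
    have "(%(y, u). if F s y u <= K * gs al u then 0 else 1 :: ennreal) \<in> ?j" by measurable
    then show ?thesis by (simp add: borel_prod case_prod_beta')
   qed
   show "AE p in lborel. (if F s (fst p) (snd p) <= K * gs al (snd p) then 0 else 1 :: ennreal) = 0"
    using ae[of s] by eventually_elim simp
  qed
  finally show ?thesis .
 qed
 then have "(NN s. NN y. be s y) = 0" by simp
 then have "(\<integral>\<^sup>+p. be (snd p) (fst p) \<partial>(lborel \<Otimes>\<^sub>M lborel)) = 0"
  by (subst lborel_pair.nn_integral_snd[symmetric]) auto
 then have "AE p in lborel \<Otimes>\<^sub>M lborel. be (snd p) (fst p) = 0"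
  by (subst (asm) nn_integral_0_iff_AE) auto
 then have "AE p in lborel. be (snd p) (fst p) = 0" unfolding lborel_prod .
 then have "AE p in lborel. p \<notin> S" by (simp add: S_def)
 moreover have "S \<in> sets lborel"
 proof -
  have "Measurable.pred borel (%p :: (real^3) \<times> real. be (snd p) (fst p) ~= 0)" unfolding borel_prod[symmetric] by measurable
  then show ?thesis by (simp add: S_def pred_def)
 qed
 ultimately have "S \<in> null_sets lborel" by (simp add: AE_iff_null_sets)
 then have negS: "negligible S" unfolding negligible_iff_null_sets by (rule null_sets_completionI)
 define Ph where "Ph = (%p :: (real^3) \<times> real. (flow (t - snd p) x (fst p), snd p))"
 \<comment> \<open>The expansion degenerates as the elapsed time tends to 0 and for large
   velocities. On \<open>D k\<close> both are controlled, and the sets \<open>D k\<close> exhaust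
   all exceptional pairs with \<open>s < t\<close>.\<close>
 define D where "D k = {p. snd p \<in> {0..t} & 1 <= (real k + 1) * (t - snd p) & norm (fst p) <= real k + 1 & Ph p \<in> S}" for k
 define free where "free p \<longleftrightarrow> ereal (t - snd p) < t_b xi x (fst p)" for p :: "(real^3) \<times> real"
 let ?d = "\<Union>k. D k \<inter> {p. free p} \<union> D k \<inter> {p. ~ free p}"
 have close: "norm (p - q) <= ((real k + 1)^2 + (real k + 1) + 1) * norm (Ph p - Ph q)"
  if p: "p \<in> D k" and le: "(t - snd p) * norm (fst p - fst q) <= norm (flow (t - snd p) x (fst p) - flow (t - snd q) x (fst q)) + abs (snd p - snd q) * (real k + 1)" for p q k
 proof -
  let ?i = "flow (t - snd q) x (fst q)"
  let ?h = "flow (t - snd p) x (fst p)"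
  let ?f = "norm (Ph p - Ph q)"
  let ?e = "norm (fst p - fst q)"
  let ?k = "real k + 1" and ?y = "norm (?h - ?i)" and ?s = "abs (snd p - snd q)"
  have y: "?y <= ?f" using norm_fst_le[of "?h - ?i" "snd p - snd q"] by (simp add: Ph_def)
  have s: "?s <= ?f" using norm_snd_le[of "snd p - snd q" "?h - ?i"] by (simp add: Ph_def)
  have "1 * ?e <= (?k * (t - snd p)) * ?e" using p by (intro mono_r) (auto simp: D_def)
  also have "... = ?k * ((t - snd p) * ?e)" by simp
  also have "... <= ?k * (?y + ?s * ?k)" using le by (intro mono_l) auto
  also have "... <= ?k * (?f + ?f * ?k)" using y s by (intro mono_l add_mono mono_r) auto
  finally have "?e <= (?k + ?k^2) * ?f" by (simp add: sq_eq algebra_simps)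
  moreover have "norm (p - q) <= ?e + ?s" using norm_Pair_le[of "fst p - fst q" "snd p - snd q"] by (cases p; cases q) simp
  ultimately show ?thesis using s by (simp add: algebra_simps)
 qed
 have sym: "norm (p - q) <= ((real k + 1)^2 + (real k + 1) + 1) * norm (Ph p - Ph q)"
  if p: "p \<in> D k" "q \<in> D k" and le: "(t - snd p) * norm (fst p - fst q) <= norm (flow (t - snd p) x (fst p) - flow (t - snd q) x (fst q)) + abs (snd p - snd q) * (real k + 1) \<or>
   (t - snd q) * norm (fst q - fst p) <= norm (flow (t - snd q) x (fst q) - flow (t - snd p) x (fst p)) + abs (snd q - snd p) * (real k + 1)" for p q k
  using le close[OF p(1), of q] close[OF p(2), of p] by (auto simp: norm_minus_commute)
 have imS: "Ph ` (D k \<inter> X) \<subseteq> S" for k X by (auto simp: D_def)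
 have 1: "negligible (D k \<inter> {p. free p})" for k
 proof (rule negligible_expanding[OF imS negS])
  fix p q assume pq: "p \<in> D k \<inter> {p. free p}" "q \<in> D k \<inter> {p. free p}"
  let ?g = "snd p - snd q"
  let ?a = "flow (t - snd p) x (fst p) - flow (t - snd q) x (fst q)"
  have fl: "flow (t - snd p) x (fst p) = x - (t - snd p) *R fst p" if "free p" for p
   using that by (simp add: free_def flow_def Xc_def)
  have "(t - snd p) *R (fst p - fst q) = - ?a + ?g *R fst q"
  proof -
   have "free p" "free q" using pq by auto
   note e = fl[OF this(1)] fl[OF this(2)]
   show ?thesis unfolding e by (simp add: algebra_simps)
  qed
  then have "norm ((t - snd p) *R (fst p - fst q)) <= norm ?a + norm (?g *R fst q)"
   using norm_triangle_ineq[of "- ?a" "?g *R fst q"] by (simp only: norm_minus_cancel)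
  also have "... <= norm ?a + abs ?g * (real k + 1)"
   using pq by (auto simp: D_def intro!: mono_l)
  finally have "(t - snd p) * norm (fst p - fst q) <= norm ?a + abs ?g * (real k + 1)"
   using pq by (auto simp: D_def)
  then show "norm (p - q) <= ((real k + 1)^2 + (real k + 1) + 1) * norm (Ph p - Ph q)" using pq by (intro close) auto
 qed
 have 2: "negligible (D k \<inter> {p. ~ free p})" for k
 proof (rule negligible_expanding[OF imS negS])
  fix p q assume pq: "p \<in> D k \<inter> {p. ~ free p}" "q \<in> D k \<inter> {p. ~ free p}"
  \<comment> \<open>Two reflected trajectories are compared after the longer of the two elapsed
    times, when both have been reflected; the correction in time is made along one of them.\<close>
  have *: "(t - snd p) * norm (fst p - fst q) <= norm (flow (t - snd p) x (fst p) - flow (t - snd q) x (fst q)) + abs (snd p - snd q) * (real k + 1)"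
   if pq: "p \<in> D k \<inter> {p. ~ free p}" "q \<in> D k \<inter> {p. ~ free p}" and le: "snd p <= snd q" for p q
  proof -
   let ?c = "t - snd p"
   let ?l = "flow ?c x (fst q)"
   let ?b = "flow (t - snd q) x (fst q)"
   have "t_b xi x (fst q) <= ereal (t - snd q)" using pq by (simp add: free_def not_less)
   also have "ereal (t - snd q) <= ereal ?c" using le by simp
   finally have q: "t_b xi x (fst q) <= ereal ?c" .
   have "?c * norm (fst p - fst q) <= norm (flow ?c x (fst p) - ?l)"
    using pq q by (intro reflected_flow_expands[OF x]) (auto simp: free_def D_def not_less)
   also have "... <= norm (flow ?c x (fst p) - ?b) + norm (?b - ?l)"
    using norm_triangle_ineq[of "flow ?c x (fst p) - ?b" "?b - ?l"] by simp
   also have "norm (?b - ?l) = abs ((t - snd q) - ?c) * norm (fst q)"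
    using pq q by (intro flow_refl_time[OF x]) (auto simp: free_def D_def not_less)
   also have "... <= abs (snd p - snd q) * (real k + 1)" using pq by (auto simp: D_def intro!: mult_mono)
   finally show ?thesis by simp
  qed
  show "norm (p - q) <= ((real k + 1)^2 + (real k + 1) + 1) * norm (Ph p - Ph q)"
   using linear[of "snd p" "snd q"] *[OF pq] *[OF pq(2,1)] pq by (intro sym) auto
 qed
 have "negligible ?d"
  using 1 2 by (intro negligible_countable_Union negligible_Un) auto
 from AE_lborel_negligible[OF this]
 have "AE v in lborel. AE s in lborel. (v, s) \<notin> ?d" .
 then show ?thesis
 proof eventually_elim
  case (elim v)
  then show ?case using AE_lborel_singleton[of t]
  proof eventually_elim
   case (elim s)
   show ?case
   proof (intro impI)
    assume s: "s \<in> {0..t}"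
    then have st: "0 < t - s" using elim by auto
    obtain k :: nat where k: "max (norm v) (1 / (t - s)) <= real k" using real_arch_simple by blast
    then have "1 / (t - s) <= real k + 1" by simp
    then have "1 <= (real k + 1) * (t - s)" using st by (simp add: pos_divide_le_eq)
    moreover have "(v, s) \<notin> D k" using elim(1) by blast
    ultimately have "Ph (v, s) \<notin> S" using s k by (auto simp: D_def)
    then show "tame K al s (flow (t - s) x v)" by (intro tame) (simp add: S_def Ph_def)
   qed
  qed
 qed
qed

text \<open>Two passes. First, at every \<open>(t, x)\<close> the bound holds for almost all
  \<open>v\<close>, so every position is tame; then \<open>mild_bound\<close> applies to every
  single trajectory. Each pass halves the exponent.\<close>

lemma pointwise_bound:
 obtains B al where "0 < al" "al <= 1" "al <= th0" "0 <= B" "M <= B" "!!t x v. F t x v <= B * gs al v"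
proof -
 obtain C where C: "0 < C" and bd: "!!K al t x v. [|0 <= K; 0 < al; al <= th0; al <= 1; 0 <= t; t <= T; xi x <= 0; AE s in lborel. s \<in> {0..t} --> tame K al s (flow (t - s) x v)|] ==>
   F t x v <= (M + T * (C * K^2 * (2 / al))) * gs (al / 2) v"
  by (rule mild_bound) blast
 obtain K al where K: "0 <= K" "0 < al" "al <= th0" "al <= 1" "!!s. AE p in lborel. F s (fst p) (snd p) <= K * gs al (snd p)"
  using F_ae by blast
 define K1 where "K1 = M + T * (C * K^2 * (2 / al))"
 have K1: "0 <= K1" using M_nonneg T_pos C K by (simp add: K1_def)
 have out: "F t x v <= k * e" if "~ (0 <= t & t <= T & xi x <= 0)" "0 <= k" "0 <= e" for t x v k e
  using F_outside[OF that(1)] that by simp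
 have tame: "tame K1 (al / 2) t x" for t x
 proof (cases "0 <= t & t <= T & xi x <= 0")
  case True
  then have "AE v in lborel. AE s in lborel. s \<in> {0..t} --> tame K al s (flow (t - s) x v)"
   using K by (intro tame_along) auto
  then show ?thesis unfolding tame_def[of K1]
  proof eventually_elim
   case (elim v)
   then show ?case unfolding K1_def using K True by (intro bd) auto
  qed
 next
  case False
  then show ?thesis unfolding tame_def by (intro AE_I2 out) (use K1 in auto)
 qed
 define B where "B = M + T * (C * K1^2 * (2 / (al / 2)))"
 have B: "M <= B" using T_pos C K by (simp add: B_def)
 show ?thesis
 proof (rule that[of "al / 4" B])
  fix t x v
  show "F t x v <= B * gs (al / 4) v"
  proof (cases "0 <= t & t <= T & xi x <= 0")
   case True
   then show ?thesis using bd[of K1 "al / 2" t x v] K K1 tame by (simp add: B_def)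
  next
   case False
   then show ?thesis by (intro out) (use B M_nonneg in auto)
  qed
 qed (use K B M_nonneg in auto)
qed

end

section \<open>Differences of the solution along trajectories\<close>

lemma nn_integral_linear3:
 assumes [measurable]: "f \<in> borel_measurable M" "g \<in> borel_measurable M" "h \<in> borel_measurable M"
 shows "(\<integral>\<^sup>+r. a * f r + (b * g r + c * h r) \<partial>M) = a * (\<integral>\<^sup>+r. f r \<partial>M) + (b * (\<integral>\<^sup>+r. g r \<partial>M) + c * (\<integral>\<^sup>+r. h r \<partial>M))"
 by (simp add: nn_integral_add nn_integral_cmult)

lemma (in convex_obstacle) flow_comp_measurable [measurable]:
 assumes [measurable]: "f \<in> borel_measurable M"
 shows "(%s. flow (f s) x v) \<in> borel_measurable M" "(%s. vel (f s) x v) \<in> borel_measurable M"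
 by (rule measurable_compose[OF assms flow_measurable], rule measurable_compose[OF assms vel_measurable])

locale tame_solution = solution +
 fixes B al :: real
 assumes al: "0 < al" "al <= 1" "al <= th0" and M_le: "M <= B"
  and F_le: "F s y u <= B * gs al u"
  and gain_le: "gain (F s y) u <= B * gs al u"
  and freq_le: "freq (F s y) u <= B * (1 + norm u)"

lemma (in solution) tame_solution_exists:
 obtains B al where "tame_solution xi th xi0 r0 R La c0 f0 F T M th0 B al"
proof -
 obtain B al where B: "0 < al" "al <= 1" "al <= th0" "0 <= B" "M <= B" "!!t x v. F t x v <= B * gs al v"
  by (rule pointwise_bound) blast
 obtain C where C: "0 < C" and CB: "!!ph v al K. [|ph \<in> bm; !!u. 0 <= ph u; 0 < al; 0 <= K; AE u in lborel. ph u <= K * gs al u|] ==>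
   gain ph v <= C * K^2 * (1 + norm v) * gs al v & freq ph v <= C * K * (1 + norm v)"
  by (rule collision_bounds) blast
 have cb: "gain (F s y) u <= C * B^2 * (1 + norm u) * gs al u & freq (F s y) u <= C * B * (1 + norm u)" for s y u
  by (rule CB) (use B F_nonneg F_slice in auto)
 define B' where "B' = B + C * B^2 * (2 / al) + C * B"
 have nn: "0 <= C * B^2 * (2 / al)" "0 <= C * B" using C B by simp_all
 show ?thesis
 proof (rule that[of B' "al / 2"], unfold_locales)
  fix s and y u :: "real^3"
  have e: "gs al u = gs (al / 2) u * gs (al / 2) u" by (simp add: exp_add[symmetric])
  let ?a = "gs (al / 2) u"
  have "F s y u <= B * gs al u" by (rule B)
  also have "... <= B' * ?a"
   using B nn by (intro mult_mono) (auto simp: B'_def)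
  finally show "F s y u <= B' * ?a" .
  have "gain (F s y) u <= C * B^2 * ((1 + norm u) * ?a) * ?a"
   using cb[of s y u] unfolding e by (simp add: mult.assoc)
  also have "... <= C * B^2 * (2 / al) * ?a"
   using B C by (intro mono_r mono_l linear_gauss) auto
  also have "... <= B' * ?a" using B nn by (intro mono_r) (auto simp: B'_def)
  finally show "gain (F s y) u <= B' * ?a" .
  have "freq (F s y) u <= C * B * (1 + norm u)" using cb by blast
  also have "... <= B' * (1 + norm u)" using B nn by (intro mono_r) (auto simp: B'_def)
  finally show "freq (F s y) u <= B' * (1 + norm u)" .
  show "M <= B'" using B nn by (simp add: B'_def)
 qed (use B in auto)
qed

context tame_solution
begin

lemma B_nonneg: "0 <= B"
 using M_le M_nonneg by simp

text \<open>The integrand left by \<open>duhamel_diff\<close>: \<open>(1 + T) * B * gs al v\<close>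
  bounds the datum plus the integrated gain on the first trajectory, which together multiply the
  difference of frequencies.\<close>

definition Q :: "real => real^3 => real^3 => real^3 => real^3 => real" where
 "Q s x x' v v' = abs (gain (F s x) v - gain (F s x') v') + (1 + T) * B * gs al v * abs (freq (F s x) v - freq (F s x') v')"

lemma duhamel:
 assumes x: "xi x <= 0" "xi x' <= 0" and t: "0 <= t" "t <= T"
 shows "ennreal \<bar>F t x v - F t x' v'\<bar> <= ennreal \<bar>f0 (flow t x v) (vel t x v) - f0 (flow t x' v') (vel t x' v')\<bar> +
  (NN r. ennreal (Q (t - r) (flow r x v) (flow r x' v') (vel r x v) (vel r x' v')) * indicator {0..t} r)"
proof -
 let ?b = "NN r. ennreal (Q (t - r) (flow r x v) (flow r x' v') (vel r x v) (vel r x' v')) * indicator {0..t} r"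
 let ?a = "NN s. ennreal (Q s (flow (t - s) x v) (flow (t - s) x' v') (vel (t - s) x v) (vel (t - s) x' v')) * indicator {0..t} s"
 define n where "n y u s = (if 0 <= s & s <= t then freq (F s (flow (t - s) y u)) (vel (t - s) y u) else 0)" for y u s
 define g where "g y u s = (if 0 <= s & s <= t then gain (F s (flow (t - s) y u)) (vel (t - s) y u) else 0)" for y u s
 have m [measurable]: "n y u \<in> bm" "g y u \<in> bm" for y u
  unfolding n_def[abs_def] g_def[abs_def] by measurable
 have b: "0 <= n y u s" "n y u s <= B * (1 + norm u)" "0 <= g y u s" "g y u s <= B * gs al u" if "xi y <= 0" for y u s
  using freq_nonneg[of s "flow (t - s) y u" "vel (t - s) y u"] gain_nonneg[of s "flow (t - s) y u" "vel (t - s) y u"]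
   freq_le[of s "flow (t - s) y u" "vel (t - s) y u"] gain_le[of s "flow (t - s) y u" "vel (t - s) y u"] norm_vel[OF that, of "t - s" u] B_nonneg
  by (auto simp: n_def g_def)
 define ph where "ph y u = f0 (flow t y u) (vel t y u)" for y u
 let ?d = "abs (ph x v)"
 have eq: "F t y u = exp (- (LINT ta:{0..t}|lborel. n y u ta)) * ph y u + (LINT s:{0..t}|lborel. exp (- (LINT ta:{s..t}|lborel. n y u ta)) * g y u s)"
  if "xi y <= 0" for y u
 proof -
  have "(LINT ta:{s..t}|lborel. n y u ta) = (LINT ta:{s..t}|lborel. freq (F ta (flow (t - ta) y u)) (vel (t - ta) y u))" if "0 <= s" for s
   using that by (intro set_lebesgue_integral_cong) (auto simp: n_def)
  moreover have "(LINT s:{0..t}|lborel. exp (- (LINT ta:{s..t}|lborel. n y u ta)) * g y u s) =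
    (LINT s:{0..t}|lborel. exp (- (LINT ta:{s..t}|lborel. freq (F ta (flow (t - ta) y u)) (vel (t - ta) y u))) * gain (F s (flow (t - s) y u)) (vel (t - s) y u))"
   using calculation by (intro set_lebesgue_integral_cong) (auto simp: g_def)
  ultimately show ?thesis using mild[OF t that, of u] by (simp add: ph_def)
 qed
 let ?c = "B * gs al v"
 let ?e = "\<bar>ph x v\<bar> + t * ?c"
 define k where "k = max (B * (1 + norm v)) (B * (1 + norm v'))"
 have "abs (F t x v - F t x' v') <= abs (ph x v - ph x' v') + (LINT s:{0..t}|lborel. abs (g x v s - g x' v' s) + (?d + t * ?c) * abs (n x v s - n x' v' s))"
  unfolding eq[OF x(1)] eq[OF x(2)]
  using b[OF x(1), of v] b[OF x(2), of v'] t by (intro duhamel_diff[where k = k and c' = "B * gs al v'"]) (auto simp: k_def intro: max.coboundedI1 max.coboundedI2)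
 moreover have "(LINT s:{0..t}|lborel. abs (g x v s - g x' v' s) + (?d + t * ?c) * abs (n x v s - n x' v' s)) = (LINT s|lborel. indicator {0..t} s *R (abs (g x v s - g x' v' s) + (?d + t * ?c) * abs (n x v s - n x' v' s)))"
  by (simp add: set_lebesgue_integral_def)
 ultimately have "ennreal \<bar>F t x v - F t x' v'\<bar> <= ennreal (\<bar>ph x v - ph x' v'\<bar> + (LINT s|lborel. indicator {0..t} s *R (\<bar>g x v s - g x' v' s\<bar> + ?e * \<bar>n x v s - n x' v' s\<bar>)))"
  by (intro ennreal_leI) simp
 also have "... = ennreal \<bar>ph x v - ph x' v'\<bar> + ennreal (LINT s|lborel. indicator {0..t} s *R (\<bar>g x v s - g x' v' s\<bar> + ?e * \<bar>n x v s - n x' v' s\<bar>))"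
  using t B_nonneg by (intro ennreal_plus Bochner_Integration.integral_nonneg) (auto intro!: mult_nonneg_nonneg add_nonneg_nonneg)
 also have "... <= ennreal \<bar>ph x v - ph x' v'\<bar> + (NN s. ennreal (indicator {0..t} s *R (\<bar>g x v s - g x' v' s\<bar> + ?e * \<bar>n x v s - n x' v' s\<bar>)))"
  using t B_nonneg by (intro add_left_mono lint_le_nn_integral) (auto intro!: mult_nonneg_nonneg add_nonneg_nonneg)
 also have "... <= ennreal \<bar>ph x v - ph x' v'\<bar> + ?a"
 proof (intro add_left_mono nn_integral_mono)
  fix s
  have "?d <= M * gs th0 (vel t x v)" unfolding ph_def by (rule f0_bound[OF flow_le_0[OF x(1) t(1)]])
  also have "... <= B * gs al v"
   unfolding norm_vel[OF x(1) t(1)] using M_le M_nonneg al B_nonneg by (intro mult_mono) (auto intro!: mono_r)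
  finally have "?d + t * ?c <= ?c + T * ?c" using t B_nonneg by (intro add_mono mono_r) auto
  then have c: "?d + t * ?c <= (1 + T) * B * gs al v" by (simp add: algebra_simps)
  show "ennreal (indicator {0..t} s *R (abs (g x v s - g x' v' s) + (?d + t * ?c) * abs (n x v s - n x' v' s))) <=
   ennreal (Q s (flow (t - s) x v) (flow (t - s) x' v') (vel (t - s) x v) (vel (t - s) x' v')) * indicator {0..t} s"
  proof (cases "s \<in> {0..t}")
   case True
   then have "norm (vel (t - s) x v) = norm v" by (intro norm_vel[OF x(1)]) auto
   then have "abs (g x v s - g x' v' s) + (?d + t * ?c) * abs (n x v s - n x' v' s) <= Q s (flow (t - s) x v) (flow (t - s) x' v') (vel (t - s) x v) (vel (t - s) x' v')"
    using True mono_r[OF c, of "abs (n x v s - n x' v' s)"] by (simp add: Q_def g_def n_def)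
   then show ?thesis using True by (simp add: ennreal_leI)
  qed simp
 qed
 also have "?a =
  ?b"
 proof -
  have "?a =
   ennreal \<bar>(- 1 :: real)\<bar> * (NN r. ennreal (Q (t + - 1 * r) (flow (t - (t + - 1 * r)) x v) (flow (t - (t + - 1 * r)) x' v') (vel (t - (t + - 1 * r)) x v) (vel (t - (t + - 1 * r)) x' v')) * indicator {0..t} (t + - 1 * r))"
   by (rule nn_integral_real_affine) (unfold Q_def, measurable)
  also have "... = ?b"
   by (simp, rule nn_integral_cong) (auto simp: indicator_def)
  finally show ?thesis .
 qed
 finally show ?thesis by (simp add: ph_def)
qed

text \<open>\<open>L\<close> and \<open>et\<close> measure the Lipschitz modulus, whereas \<open>b\<close> is an error that the iteration removes.\<close>

definition modulus :: "real => real => real => real => real => bool" where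
 "modulus de t0 L et b \<longleftrightarrow> (ALL s x x' v v'. 0 < s --> s <= t0 --> xi x < 0 --> xi x' < 0 -->
  Q s x x' v v' <= (Theta s v + Theta s v') * (L * ((zeta de x + zeta de x') * norm (x - x') + et * norm (v - v')) + b))"

text \<open>Going back by \<open>r\<close> divides the weight by
  \<open>exp ((1 + N2 v) * r)\<close>, and \<open>1 + N2 v\<close> dominates an eighth of the square
  of one plus both speeds, because these differ by at most 1.\<close>

lemma Theta_back:
 assumes v: "norm (v - v') <= 1" and r: "0 <= r"
 shows "Theta (t - r) v <= Theta t v * exp (- ((1 + (norm v + norm v'))^2 / 8) * r)"
proof -
 let ?a = "1 + (norm v + norm v')"
 have "norm v' <= norm v + 1" using norm_triangle_sub[of v' v] v by (simp add: norm_minus_commute)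
 then have "?a^2 <= (2 * norm v + 2)^2" by (intro power_mono) auto
 also have "... <= 8 * (1 + N2 v)"
 proof -
  have "0 <= (norm v - 1)^2" by (rule zero_le_power2)
  moreover have "(norm v - 1)^2 = N2 v - 2 * norm v + 1" "(2 * norm v + 2)^2 = 4 * N2 v + 8 * norm v + 4"
   by (simp_all add: sq_eq algebra_simps)
  ultimately show ?thesis unfolding distrib_left[of 8] by linarith
 qed
 finally have "?a^2 / 8 <= 1 + N2 v" by simp
 then have "?a^2 / 8 * r <= (1 + N2 v) * r" using r by (rule mono_r)
 then show ?thesis by (simp add: Theta_def exp_add[symmetric] right_diff_distrib)
qed

text \<open>The modulus is known only outside the closed obstacle, where both trajectories are at
  almost all times. Its three terms become the position integral, the velocity integral and
  \<open>b * t\<close>; the factor \<open>t\<close> in the last is what the iteration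
  exploits.\<close>

lemma modulus_step:
 assumes hyp: "modulus de t0 L et b" and L: "0 <= L" "0 <= et" "0 <= b"
  and x: "xi x <= 0" "xi x' <= 0" and t: "0 < t" "t <= t0" "t0 <= 1" "t0 <= T"
  and D: "norm (x - x') <= 1" "norm (v - v') <= 1" and e: "dev_bound t x v x' v' e"
  and inside: "AE r in lborel. r \<in> {0..t} --> xi (flow r x v) < 0" "AE r in lborel. r \<in> {0..t} --> xi (flow r x' v') < 0"
  and z: "(NN r. ennreal (r powr - (1 / 2) * zeta de (flow r x v)) * indicator {0..t} r) <= ennreal z" "0 <= z"
  and z': "(NN r. ennreal (r powr - (1 / 2) * zeta de (flow r x' v')) * indicator {0..t} r) <= ennreal z'" "0 <= z'"
 defines "w == norm v + norm v'"
 assumes J: "(NN r. ennreal (exp (- ((1 + w)^2 / 8) * r) * norm (vel r x v - vel r x' v')) * indicator {0..t} r) <= ennreal J" "0 <= J"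
 shows "abs (F t x v - F t x' v') <= abs (f0 (flow t x v) (vel t x v) - f0 (flow t x' v') (vel t x' v')) +
  (Theta t v + Theta t v') * (L * (11 * CD / (1 + w) * (norm (x - x') + norm (v - v') + e) * (z + z')) + L * et * J + b * t)"
proof -
 let ?e = "abs (f0 (flow t x v) (vel t x v) - f0 (flow t x' v') (vel t x' v'))"
 let ?S = "Theta t v + Theta t v'" and ?i = "%r. indicator {0..t} r :: ennreal"
 let ?g = "ennreal (?S * L)"
 let ?d = "ennreal (?S * b)"
 let ?c = "NN r. ennreal (Q (t - r) (flow r x v) (flow r x' v') (vel r x v) (vel r x' v')) * ?i r"
 let ?b = "?S * (L * et)"
 have S: "0 <= ?S" using Theta_pos[of t v] Theta_pos[of t v'] by simp
 let ?E = "%r. exp (- ((1 + w)^2 / 8) * r)"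
 let ?P = "%r. ?E r * ((zeta de (flow r x v) + zeta de (flow r x' v')) * norm (flow r x v - flow r x' v'))"
 let ?V = "%r. ?E r * norm (vel r x v - vel r x' v')"
 define Y where "Y = 11 * CD / (1 + w) * (norm (x - x') + norm (v - v') + e) * (z + z')"
 let ?a = "?S * L * Y + (?S * (L * et) * J + ?S * b * t)"
 have e0: "0 <= e" by (rule dev_bound_nonneg[OF x e])
 have Y: "0 <= Y" using CD_pos e0 z z' by (simp add: Y_def w_def)
 have P0: "0 <= ?P r" for r using zeta_ge_1[of de "flow r x v"] zeta_ge_1[of de "flow r x' v'"] by simp
 have E1: "?E r <= 1" if "0 <= r" for r using that by (simp add: w_def)
 have "?c <=
  (NN r. ?g * (ennreal (?P r) * ?i r) + (ennreal ?b * (ennreal (?V r) * ?i r) + ?d * ?i r))"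
 proof (rule nn_integral_mono_AE)
  show "AE r in lborel. ennreal (Q (t - r) (flow r x v) (flow r x' v') (vel r x v) (vel r x' v')) * ?i r <=
   ?g * (ennreal (?P r) * ?i r) + (ennreal ?b * (ennreal (?V r) * ?i r) + ?d * ?i r)"
   using inside AE_lborel_singleton[of t]
  proof eventually_elim
   case (elim r)
   let ?k = "flow r x' v'"
   let ?j = "vel r x v"
   let ?f = "vel r x' v'"
   let ?h = "Q (t - r) (flow r x v) (?k) (?j) (?f)"
   show ?case
   proof (cases "r \<in> {0..t}")
    case True
    let ?X = "L * ((zeta de (flow r x v) + zeta de (?k)) * norm (flow r x v - ?k) + et * norm (?j - ?f)) + b"
    have X: "0 <= ?X" using L zeta_ge_1[of de "flow r x v"] zeta_ge_1[of de "?k"] by simp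
    have nv: "norm (?j) = norm v" "norm (?f) = norm v'" using norm_vel[OF x(1)] norm_vel[OF x(2)] True by auto
    have Tv: "Theta s (?j) = Theta s v" "Theta s (?f) = Theta s v'" for s unfolding Theta_def nv by simp_all
    have "?h <= (Theta (t - r) (?j) + Theta (t - r) (?f)) * ?X"
     using hyp[unfolded modulus_def, rule_format, of "t - r" "flow r x v" "?k" "?j" "?f"] elim True t by simp
    also have "... <= (?S * ?E r) * ?X"
    proof (rule mono_r[OF _ X])
     have "Theta (t - r) v <= Theta t v * ?E r" using Theta_back[OF D(2), of r t] True by (simp add: w_def)
     moreover have "Theta (t - r) v' <= Theta t v' * ?E r"
      using Theta_back[of v' v r t] D(2) True by (simp add: w_def norm_minus_commute add.commute)
     ultimately show "Theta (t - r) (?j) + Theta (t - r) (?f) <= ?S * ?E r" unfolding Tv by (simp add: distrib_right)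
    qed
    also have "... = (?S * L) * ?P r + (?b * ?V r + (?S * b) * ?E r)" by (simp add: algebra_simps)
    also have "... <= (?S * L) * ?P r + (?b * ?V r + (?S * b) * 1)"
     using S L E1[of r] True by (intro add_left_mono mono_l) auto
    finally have "ennreal (?h) <= ennreal ((?S * L) * ?P r + (?b * ?V r + ?S * b))"
     by (intro ennreal_leI) simp
    also have "... = ennreal ((?S * L) * ?P r) + (ennreal (?b * ?V r) + ?d)"
     using S L P0[of r] by (subst ennreal_plus, simp, simp, subst ennreal_plus, simp_all)
    also have "... = ?g * ennreal (?P r) + (ennreal ?b * ennreal (?V r) + ?d)"
     using S L P0[of r] by (simp only: ennreal_mult mult_nonneg_nonneg norm_ge_zero exp_ge_zero)
    finally show ?thesis using True by simp
   qed simp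
  qed
 qed
 also have "... = ?g * (NN r. ennreal (?P r) * ?i r) + (ennreal ?b * (NN r. ennreal (?V r) * ?i r) + ?d * (NN r. ?i r))"
  by (rule nn_integral_linear3) measurable
 also have "... <= ?g * ennreal Y + (ennreal ?b * ennreal J + ?d * ennreal t)"
 proof (intro add_mono mono_l)
  show "(NN r. ennreal (?P r) * ?i r) <= ennreal Y"
   unfolding Y_def w_def using t by (intro position_integral[OF x _ _ D e z z']) auto
  show "(NN r. ennreal (?V r) * ?i r) <= ennreal J" by (rule J)
  show "(NN r. ?i r) <= ennreal t" using t by simp
 qed auto
 also have "... = ennreal ?a"
  using S L Y J t by (simp only: ennreal_mult ennreal_plus mult_nonneg_nonneg less_imp_le add_nonneg_nonneg)
 finally have "?c <= ennreal ?a" .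
 then have "ennreal \<bar>F t x v - F t x' v'\<bar> <= ennreal \<bar>f0 (flow t x v) (vel t x v) - f0 (flow t x' v') (vel t x' v')\<bar> + ennreal ?a"
  by (intro order_trans[OF duhamel[OF x, of t v v']] add_left_mono) (use t in auto)
 also have "... = ennreal (?e + ?a)"
  using S L Y J t by (intro ennreal_plus[symmetric]) auto
 finally have "abs (F t x v - F t x' v') <= ?e + ?a"
  using S L Y J t by (subst (asm) ennreal_le_iff) auto
 then show ?thesis by (simp add: Y_def algebra_simps)
qed

end

section \<open>Iteration of the Lipschitz modulus\<close>

lemma (in convex_obstacle) CF_nonneg: "0 <= CF"
proof -
 have "0 <= La * CD" using La_ge_1 CD_pos by simp
 then show ?thesis using CD_pos BD_bounds(1) unfolding CF_def distrib_left by linarith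
qed

locale regular_solution = tame_solution +
 fixes A1 :: real
 assumes A1: "0 <= A1"
  and fx: "!!x x' v. xi x <= 0 ==> xi x' <= 0 ==> abs (f0 x v - f0 x' v) <= A1 / (1 + norm v) * norm (x - x')"
  and fv: "!!x v v'. xi x <= 0 ==> abs (norm v - norm v') <= 1 ==> abs (f0 x v - f0 x v') <= A1 / (1 + norm v)^2 * norm (v - v')"
  and spec: "!!x v. xi x = 0 ==> f0 x v = f0 x (refl_vel xi x v)"
begin

text \<open>It lets the weight absorb the growth in \<open>initial_deviation\<close>.\<close>

lemma Theta_linear:
 assumes v: "norm (v - v') <= 1" and t: "0 <= t" "t <= 1"
 shows "1 + t * (norm v + norm v') <= 3 * (Theta t v + Theta t v')"
proof -
 have "norm v' <= norm v + 1" using norm_triangle_sub[of v' v] v by (simp add: norm_minus_commute)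
 then have "t * (norm v + norm v') <= t * (2 * (1 + N2 v))"
 proof (intro mono_l)
  have "0 <= (norm v - 1)^2" "(norm v - 1)^2 = N2 v - 2 * norm v + 1" "0 <= N2 v"
   by (rule zero_le_power2, simp add: sq_eq algebra_simps, simp)
  then show "norm v + norm v' <= 2 * (1 + N2 v)" if "norm v' <= norm v + 1" using that unfolding distrib_left by linarith
 qed (use t in auto)
 also have "... <= 2 * Theta t v"
  using exp_ge_add_one_self[of "(1 + N2 v) * t"] unfolding Theta_def by (simp only: mult_ac)
 finally show ?thesis using Theta_ge_1[OF t(1), of v] Theta_pos[of t v'] unfolding distrib_left by linarith
qed

lemma initial_difference:
 assumes x: "xi x <= 0" "xi x' <= 0" and t: "0 <= t" "t <= 1"
  and D: "norm (x - x') <= 1" "norm (v - v') <= 1" and e: "dev_bound t x v x' v' e"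
 shows "abs (f0 (flow t x v) (vel t x v) - f0 (flow t x' v') (vel t x' v')) <=
  (Theta t v + Theta t v') * (3 * CF * A1 / (1 + (norm v + norm v')) * (norm (x - x') + norm (v - v') + e))"
proof -
 let ?w = "norm v + norm v'" and ?D = "norm (x - x') + norm (v - v')" and ?S = "Theta t v + Theta t v'"
 have e0: "0 <= e" by (rule dev_bound_nonneg[OF x e])
 have tw: "0 <= t * ?w" using t by simp
 have "abs (f0 (flow t x v) (vel t x v) - f0 (flow t x' v') (vel t x' v')) <= CF * A1 / (1 + ?w) * (?D + (1 + t * ?w) * e)"
  using initial_deviation[OF A1 fx fv spec x t D e] by simp
 also have "... <= CF * A1 / (1 + ?w) * ((1 + t * ?w) * (?D + e))"
 proof (intro mono_l)
  have "0 <= t * ?w * ?D" using tw by simp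
  then show "?D + (1 + t * ?w) * e <= (1 + t * ?w) * (?D + e)" by (simp add: algebra_simps)
 qed (use CF_nonneg A1 in auto)
 also have "... <= CF * A1 / (1 + ?w) * ((3 * ?S) * (?D + e))"
  using Theta_linear[OF D(2) t] e0 CF_nonneg A1 by (intro mono_l mono_r) auto
 finally show ?thesis by (simp only: times_divide_eq_left times_divide_eq_right mult_ac)
qed

lemma CZ_nonneg: "0 <= CZ de"
 by (simp add: CZ_def)

lemma inside_AE:
 assumes "xi x <= 0" "v ~= 0"
 shows "AE r in lborel. r \<in> {0..t} --> xi (flow r x v) < 0"
proof -
 obtain r1 where r1: "!!r. 0 <= r ==> r ~= r1 ==> xi (flow r x v) < 0" using flow_interior[OF assms] by blast
 show ?thesis using AE_lborel_singleton[of r1] by eventually_elim (auto intro: r1)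
qed

text \<open>The contribution of the initial datum plus that of the position integral, which contains
  \<open>L\<close> but is small for short times.\<close>

definition P1 :: "real => real => real => real" where
 "P1 de L t = 3 * CF * A1 + 22 * CD * CZ de * L * t powr (1 / 4)"

lemma P1_nonneg: "0 <= L ==> 0 <= P1 de L t"
 using CF_nonneg A1 CD_pos CZ_nonneg[of de] by (simp add: P1_def)

lemma difference_bound:
 assumes hyp: "modulus de t0 L et b" and L: "0 <= L" "0 <= et" "0 <= b" and de: "0 < de" "de <= 1 / 4"
  and x: "xi x <= 0" "xi x' <= 0" and t: "0 < t" "t <= t0" "t0 <= 1" "t0 <= T"
  and D: "norm (x - x') <= 1" "norm (v - v') <= 1" and e: "dev_bound t x v x' v' e" and v: "v ~= 0" "v' ~= 0"
 defines "w == norm v + norm v'"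
 assumes J: "(NN r. ennreal (exp (- ((1 + w)^2 / 8) * r) * norm (vel r x v - vel r x' v')) * indicator {0..t} r) <= ennreal J" "0 <= J"
 shows "abs (F t x v - F t x' v') <= (Theta t v + Theta t v') *
  ((1 + norm v powr - de + norm v' powr - de) * (P1 de L t / (1 + w) * (norm (x - x') + norm (v - v') + e)) + L * et * J + b * t)"
proof -
 let ?e = "1 + norm v powr - de"
 let ?d = "1 + norm v' powr - de"
 let ?c = "abs (f0 (flow t x v) (vel t x v) - f0 (flow t x' v') (vel t x' v'))"
 let ?D = "norm (x - x') + norm (v - v')" and ?S = "Theta t v + Theta t v'" and ?p = "1 + norm v powr - de + norm v' powr - de"
 let ?a = "3 * CF * A1 / (1 + w) * (?D + e)"
 have e0: "0 <= e" by (rule dev_bound_nonneg[OF x e])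
 have S: "0 <= ?S" using Theta_pos[of t v] Theta_pos[of t v'] by simp
 define c where "c = CZ de * t powr (1 / 4)"
 let ?b = "L * (11 * CD / (1 + w) * (?D + e) * (2 * c * ?p)) + L * et * J + b * t"
 have c: "0 <= c" using CZ_nonneg by (simp add: c_def)
 have t1: "t <= 1" using t by simp
 have "abs (F t x v - F t x' v') <= ?c +
  ?S * (L * (11 * CD / (1 + w) * (?D + e) * (c * ?e + c * ?d)) + L * et * J + b * t)"
  unfolding w_def
 proof (rule modulus_step[OF hyp L x t D e inside_AE[OF x(1) v(1)] inside_AE[OF x(2) v(2)]])
  show "(NN r. ennreal (r powr - (1 / 2) * zeta de (flow r x v)) * indicator {0..t} r) <= ennreal (c * ?e)"
   unfolding c_def by (rule zeta_integral[OF x(1) v(1) t(1) t1 de])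
  show "(NN r. ennreal (r powr - (1 / 2) * zeta de (flow r x' v')) * indicator {0..t} r) <= ennreal (c * ?d)"
   unfolding c_def by (rule zeta_integral[OF x(2) v(2) t(1) t1 de])
 qed (use c J in \<open>auto simp: w_def\<close>)
 also have "... <= ?S * ?a + ?S * ?b"
 proof (intro add_mono mono_l)
  show "?c <= ?S * ?a"
   unfolding w_def using t t1 by (intro initial_difference x D e) auto
  have "0 <= c * norm v powr - de" "0 <= c * norm v' powr - de" using c by simp_all
  then show "c * ?e + c * ?d <= 2 * c * ?p" by (simp add: algebra_simps)
 qed (use S L CD_pos e0 in \<open>auto simp: w_def\<close>)
 also have "... <= ?S * (?p * ?a) + ?S * ?b"
 proof (intro add_right_mono mono_l[OF _ S])
  have "0 <= 3 * CF * A1 / (1 + w) * (?D + e)" using CF_nonneg A1 e0 by (simp add: w_def)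
  then show "3 * CF * A1 / (1 + w) * (?D + e) <= ?p * ?a"
   using mono_r[of 1 ?p "3 * CF * A1 / (1 + w) * (?D + e)"] by simp
 qed
 also have "... = ?S * (?p * (P1 de L t / (1 + w) * (?D + e)) + L * et * J + b * t)"
 proof -
  define k where "k = 1 / (1 + w)"
  have k: "y / (1 + w) = y * k" for y by (simp add: k_def)
  show ?thesis unfolding P1_def k c_def by (simp add: algebra_simps)
 qed
 finally show ?thesis .
qed

text \<open>The direction from \<open>c0\<close> to \<open>x\<close> serves both positions, because
  \<open>c0\<close> displaced by \<open>x' - x\<close> is still deep; each position contributes one
  singularity on the line. The velocity part with \<open>norm h\<close> carries
  \<open>L * et\<close> only together with \<open>sqrt t\<close>, since velocity differences enter
  through \<open>tau\<close> or with a factor \<open>t\<close>; the position part has no such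
  gain.\<close>

lemma quotient_on_line:
 assumes de: "0 < de" "de <= 1 / 4"
 obtains K where "1 <= K"
  "!!t0 L et b t x x' h m q. [|modulus de t0 L et b; 0 <= L; 0 <= et; 0 <= b; 0 < t; t <= t0; t0 <= 1; t0 <= T; xi x < 0; xi x' < 0;
   norm (x - x') <= r0; norm h <= 1; m = sgn (x - c0)|] ==>
   EX a b'. ALL s. s ~= a --> s ~= b' --> q + s *R m ~= 0 --> q + s *R m + h ~= 0 -->
    quot t (F t x) (F t x') h (q + s *R m) <= (1 + norm (q + s *R m) powr - de + norm (q + s *R m + h) powr - de) *
     ((K * (P1 de L t + L * et * CV) * ((zeta de x + zeta de x') * norm (x - x')) + K * (P1 de L t + L * et * CV * sqrt t) * norm h + b * t) *
      (1 + abs (s - a) powr - (1 - de) + abs (s - b') powr - (1 - de)))"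
proof -
 obtain K where K: "1 <= K" and line: "!!x m l q t. [|xi x < 0; norm m = 1; r0 <= l; xi0 <= xi (x - l *R m); 0 < t; t <= 1|] ==>
   EX a. ALL s. s ~= a --> t_b xi x (q + s *R m) <= ereal t -->
    0 < rate x (q + s *R m) \<and>
    norm (q + s *R m) / rate x (q + s *R m) <= K * zeta de x * (1 + norm (q + s *R m)) * (1 + abs (s - a) powr - (1 - de)) \<and>
    tau x (q + s *R m) * (norm (q + s *R m) / rate x (q + s *R m)) <=
     K * sqrt t * (1 + norm (q + s *R m)) * (1 + abs (s - a) powr - (1 - de))"
  by (rule line_bound[OF de]) blast
 show ?thesis
 proof (rule that[of "3 * K"])
  show "1 <= 3 * K" using K by simp
  fix t0 L et b t and x x' h m q :: "real^3"
  assume hyp: "modulus de t0 L et b" and L: "0 <= L" "0 <= et" "0 <= b" and t: "0 < t" "t <= t0" "t0 <= 1" "t0 <= T"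
   and x: "xi x < 0" "xi x' < 0" and D: "norm (x - x') <= r0" and h: "norm h <= 1" and m_def: "m = sgn (x - c0)"
  let ?h = "norm (x - x')"
  let ?f = "zeta de x"
  let ?e = "zeta de x'"
  let ?be = "1 - de"
  define l where "l = norm (x - c0)"
  \<comment> \<open>\<open>x\<close> is outside the ball about \<open>c0\<close> on which
    \<open>xi\<close> is positive.\<close>
  have l: "2 * r0 < l" using center[of x] x(1) xi0_pos unfolding l_def by force
  then have l0: "0 < l" "r0 <= l" using r0_pos by simp_all
  then have m: "norm m = 1" "l *R m = x - c0" unfolding m_def l_def by (auto simp: norm_sgn sgn_div_norm)
  have c1: "xi0 <= xi (x - l *R m)" unfolding m(2) using c0_ge by simp
  have c2: "xi0 <= xi (x' - l *R m)" unfolding m(2) using D r0_pos by (intro center) (simp add: norm_minus_commute)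
  have t1: "t <= 1" using t by simp
  obtain a where a: "!!s. s ~= a ==> t_b xi x (q + s *R m) <= ereal t ==>
    0 < rate x (q + s *R m) \<and>
    norm (q + s *R m) / rate x (q + s *R m) <= K * ?f * (1 + norm (q + s *R m)) * (1 + abs (s - a) powr - ?be) \<and>
    tau x (q + s *R m) * (norm (q + s *R m) / rate x (q + s *R m)) <= K * sqrt t * (1 + norm (q + s *R m)) * (1 + abs (s - a) powr - ?be)"
   using line[OF x(1) m(1) l0(2) c1 t(1) t1, of q] by blast
  obtain a' where a': "!!s. s ~= a' ==> t_b xi x' (q + h + s *R m) <= ereal t ==>
    0 < rate x' (q + h + s *R m) \<and>
    norm (q + h + s *R m) / rate x' (q + h + s *R m) <= K * ?e * (1 + norm (q + h + s *R m)) * (1 + abs (s - a') powr - ?be) \<and>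
    tau x' (q + h + s *R m) * (norm (q + h + s *R m) / rate x' (q + h + s *R m)) <= K * sqrt t * (1 + norm (q + h + s *R m)) * (1 + abs (s - a') powr - ?be)"
   using line[OF x(2) m(1) l0(2) c2 t(1) t1, of "q + h"] by blast
  let ?Z = "?f + ?e"
  define P where "P = 3 * K * (P1 de L t + L * et * CV) * (?Z * ?h) + 3 * K * (P1 de L t + L * et * CV * sqrt t) * norm h + b * t"
  have main: "quot t (F t x) (F t x') h (q + s *R m) <= (1 + norm (q + s *R m) powr - de + norm (q + s *R m + h) powr - de) *
    (P * (1 + abs (s - a) powr - ?be + abs (s - a') powr - ?be))"
   if s: "s ~= a" "s ~= a'" and z: "q + s *R m ~= 0" "q + s *R m + h ~= 0" for s
  proof -
   define v v' where "v = q + s *R m" and "v' = q + s *R m + h"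
   let ?i = "sig t x' v'"
   let ?g = "Theta t v + Theta t v'"
   have v'h: "v' = v + h" "q + h + s *R m = v'" by (simp_all add: v_def v'_def)
   note A = a[OF s(1), folded v_def] and A' = a'[OF s(2), unfolded v'h(2)]
   have v0: "v ~= 0" "v' ~= 0" using z by (simp_all add: v_def v'_def)
   define w where "w = norm v + norm v'"
   define S where "S = 1 + abs (s - a) powr - ?be + abs (s - a') powr - ?be"
   let ?b = "K * sqrt t * (1 + w) * S"
   define p where "p = 1 + norm v powr - de + norm v' powr - de"
   have S: "1 <= S" "1 + abs (s - a) powr - ?be <= S" "1 + abs (s - a') powr - ?be <= S" by (simp_all add: S_def)
   have p: "1 <= p" by (simp add: p_def)
   have w: "0 <= w" "1 + norm v <= 1 + w" "1 + norm v' <= 1 + w" by (simp_all add: w_def)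
   define Dx Dv where "Dx = ?h" and "Dv = norm h"
   let ?d = "2 * (?Z * Dx) + 3 * Dv"
   let ?a = "2 * (?Z * Dx) + 3 * (sqrt t * Dv)"
   let ?j = "K * S * ?a"
   have Dv: "norm (v - v') = Dv" by (simp add: v'h Dv_def)
   have nn: "0 <= Dx" "0 <= Dv" by (simp_all add: Dx_def Dv_def)
   have z1: "1 <= ?f" "1 <= ?e" by (rule zeta_ge_1)+
   have D1: "?h <= 1" "norm (v - v') <= 1" using D r0_le_1 h by (simp_all add: v'h)
   \<comment> \<open>Off the two exceptional parameters neither ray grazes within time
     \<open>t\<close>, which admits the Lipschitz scale.\<close>
   define e where "e = lip_dev t x v x' v'"
   let ?c = "?h + norm (v - v') + e"
   have ng: "nongrazing t x v" "nongrazing t x' v'" using A A' by (auto simp: nongrazing_def)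
   have e: "dev_bound t x v x' v' e" using ng by (simp add: dev_bound_def e_def)
   have e0: "0 <= e" by (rule dev_bound_nonneg[OF _ _ e]) (use x in auto)
   have sg: "sig t x v <= K * ?f * (1 + w) * S" "tau x v * sig t x v <= ?b"
   proof -
    have up: "c * (1 + norm v) * (1 + abs (s - a) powr - ?be) <= c * (1 + w) * S" if "0 <= c" for c
     using that S w by (intro mult_mono) auto
    have c: "0 <= K * ?f" "0 <= K * sqrt t" using K z1 t by auto
    have pos: "0 <= K * ?f * (1 + w) * S" "0 <= ?b" using c S w by auto
    show "sig t x v <= K * ?f * (1 + w) * S" "tau x v * sig t x v <= ?b"
     using A up[OF c(1)] up[OF c(2)] pos by (auto simp: sig_def)
   qed
   have sg': "?i <= K * ?e * (1 + w) * S" "tau x' v' * ?i <= ?b"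
   proof -
    have up: "c * (1 + norm v') * (1 + abs (s - a') powr - ?be) <= c * (1 + w) * S" if "0 <= c" for c
     using that S w by (intro mult_mono) auto
    have c: "0 <= K * ?e" "0 <= K * sqrt t" using K z1 t by auto
    have pos: "0 <= K * ?e * (1 + w) * S" "0 <= ?b" using c S w by auto
    show "?i <= K * ?e * (1 + w) * S" "tau x' v' * ?i <= ?b"
     using A' up[OF c(1)] up[OF c(2)] pos by (auto simp: sig_def)
   qed
   define Y where "Y = K * S * (?Z * Dx + 2 * sqrt t * Dv)"
   have eY: "e / (1 + w) <= Y"
   proof -
    have "e = Dx * sig t x v + Dv * (tau x v * sig t x v) + (Dx * ?i + Dv * (tau x' v' * ?i))"
     unfolding e_def lip_dev_def Dv Dx_def by (simp add: algebra_simps)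
    also have "... <= Dx * (K * ?f * (1 + w) * S) + Dv * (K * sqrt t * (1 + w) * S) + (Dx * (K * ?e * (1 + w) * S) + Dv * (K * sqrt t * (1 + w) * S))"
     using sg sg' nn by (intro add_mono mono_l) auto
    also have "... = Y * (1 + w)" by (simp add: Y_def algebra_simps)
    finally show ?thesis using w by (simp add: pos_divide_le_eq)
   qed
   define J where "J = CV * (e / (1 + w) + Dx + t * Dv)"
   have CV: "0 <= CV" using CD_pos La_ge_1 by (simp add: CV_def)
   have J: "0 <= J" using CV e0 w nn t by (simp add: J_def)
   have "abs (F t x v - F t x' v') <= ?g * (p * (P1 de L t / (1 + w) * ?c) + L * et * J + b * t)"
    unfolding p_def w_def
   proof (rule difference_bound[OF hyp L de _ _ t D1 e v0 _ J])
    show "(NN r. ennreal (exp (- ((1 + (norm v + norm v'))^2 / 8) * r) * norm (vel r x v - vel r x' v')) * indicator {0..t} r) <= ennreal J"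
     using velocity_integral(1)[OF _ _ t(1) t1 D1 e] x unfolding J_def w_def Dx_def Dv by simp
   qed (use x in auto)
   also have "... <= ?g * (p * (P * S))"
   proof (rule mono_l)
    let ?P = "P1 de L t" and ?M = "L * et * CV"
    have P: "0 <= ?P" by (rule P1_nonneg[OF L(1)])
    have M: "0 <= ?M" using L CV by simp
    have b: "0 <= b * t" using L t by simp
    have st: "0 <= sqrt t" "sqrt t <= 1" "t <= sqrt t"
     using t t1 by (auto intro!: real_le_rsqrt simp: sq_eq mult_left_le_one_le)
    have ZD: "0 <= ?Z * Dx" "Dx <= ?Z * Dx" using z1 nn mono_r[of 1 ?Z Dx] by auto
    have KS: "1 <= K * S" using K S mult_mono[of 1 K 1 S] by simp
    then have KS0: "0 <= K * S" by simp
    have up: "y <= (K * S) * y" if "0 <= y" for y using that KS mono_r[of 1 "K * S" y] by simp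
    have big: "(Dx + Dv) / (1 + w) + e / (1 + w) <= K * S * ?d"
    proof -
     have "(Dx + Dv) / (1 + w) <= Dx + Dv" using nn w by (simp add: pos_divide_le_eq mult_le_cancel_left1)
     also have "... <= ?Z * Dx + Dv" using ZD by simp
     also have "... <= K * S * (?Z * Dx + Dv)" using ZD nn by (intro up) auto
     finally have "(Dx + Dv) / (1 + w) <= K * S * (?Z * Dx + Dv)" .
     moreover have "Y <= K * S * (?Z * Dx + 2 * Dv)"
      unfolding Y_def using KS st nn by (intro mono_l add_left_mono mono_r) auto
     ultimately have "(Dx + Dv) / (1 + w) + e / (1 + w) <= K * S * (?Z * Dx + Dv) + K * S * (?Z * Dx + 2 * Dv)" using eY by linarith
     also have "... = K * S * ?d" by (simp add: algebra_simps)
     finally show ?thesis .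
    qed
    have small: "e / (1 + w) + Dx + t * Dv <= K * S * ?a"
    proof -
     have "Dx + t * Dv <= ?Z * Dx + sqrt t * Dv" using ZD st nn by (intro add_mono mono_r) auto
     also have "... <= K * S * (?Z * Dx + sqrt t * Dv)" using ZD nn st by (intro up) auto
     finally have "e / (1 + w) + Dx + t * Dv <= K * S * (?Z * Dx + 2 * sqrt t * Dv) + K * S * (?Z * Dx + sqrt t * Dv)" using eY unfolding Y_def by linarith
     also have "... = K * S * ?a" by (simp add: algebra_simps)
     finally show ?thesis .
    qed
    have "?P / (1 + w) * ?c = ?P * ((Dx + Dv) / (1 + w) + e / (1 + w))"
     by (simp add: Dx_def Dv add_divide_distrib[symmetric])
    also have "... <= ?P * (K * S * ?d)" by (rule mono_l[OF big P])
    finally have 1: "p * (?P / (1 + w) * ?c) <= p * (?P * (K * S * ?d))"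
     using p by (intro mono_l) auto
    have "L * et * J = ?M * (e / (1 + w) + Dx + t * Dv)" by (simp add: J_def mult_ac)
    also have "... <= ?M * ?j" by (rule mono_l[OF small M])
    also have "... <= p * (?M * ?j)"
    proof -
     have "0 <= ?M * ?j"
      by (rule mult_nonneg_nonneg[OF M mult_nonneg_nonneg[OF KS0]]) (use ZD st nn in auto)
     then show ?thesis using p by (simp add: mult_le_cancel_right1)
    qed
    finally have 2: "L * et * J <= p * (?M * ?j)" .
    have "1 * (b * t) <= (p * S) * (b * t)" using p S b mult_mono[of 1 p 1 S] by (intro mono_r) auto
    then have 3: "b * t <= p * (S * (b * t))" by (simp add: mult_ac)
    have "p * (P * S) = p * (?P * (K * S * ?d)) + p * (?M * ?j) + p * (S * (b * t)) +
      p * ((?P + ?M) * (K * S * (?Z * Dx)))"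
     by (simp add: P_def Dx_def Dv_def algebra_simps)
    moreover have "0 <= p * ((?P + ?M) * (K * S * (?Z * Dx)))"
     by (rule mult_nonneg_nonneg[OF _ mult_nonneg_nonneg[OF add_nonneg_nonneg[OF P M] mult_nonneg_nonneg[OF KS0 ZD(1)]]]) (use p in simp)
    ultimately show "p * (?P / (1 + w) * ?c) + L * et * J + b * t <= p * (P * S)"
     using 1 2 3 by linarith
   qed (use Theta_pos[of t v] Theta_pos[of t v'] in auto)
   finally have "abs (F t x v - F t x' v') <= ?g * (p * (P * S))" .
   then have "quot t (F t x) (F t x') h v <= p * (P * S)"
    using Theta_pos[of t v] Theta_pos[of t v'] unfolding quot_def v'h(1) by (simp add: pos_divide_le_eq add_pos_pos mult.commute)
   then show ?thesis by (simp add: v_def v'_def p_def S_def)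
  qed
  show "EX a b'. ALL s. s ~= a --> s ~= b' --> q + s *R m ~= 0 --> q + s *R m + h ~= 0 -->
    quot t (F t x) (F t x') h (q + s *R m) <= (1 + norm (q + s *R m) powr - de + norm (q + s *R m + h) powr - de) *
     ((3 * K * (P1 de L t + L * et * CV) * (?Z * ?h) + 3 * K * (P1 de L t + L * et * CV * sqrt t) * norm h + b * t) *
      (1 + abs (s - a) powr - (1 - de) + abs (s - b') powr - (1 - de)))"
   by (rule exI[of _ a], rule exI[of _ a'], intro allI impI, unfold P_def[symmetric]) (rule main)
 qed
qed

end

context regular_solution
begin

section \<open>Halving the error of the modulus\<close>

definition Qm :: real where "Qm = B + (1 + T) * B * (B * (2 / al))"

lemma Qm_nonneg: "0 <= Qm"
 using B_nonneg T_pos al by (simp add: Qm_def)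

lemma gauss_linear: "(1 + norm v) * gs al v <= 2 / al"
proof -
 have "(1 + norm v) * gs al v <= (1 + norm v) * gs (al / 2) v"
  using al by (intro mono_l) auto
 also have "... <= 2 / al" by (rule linear_gauss) (use al in auto)
 finally show ?thesis .
qed

text \<open>Boundedness alone: the start of the iteration, and the estimate for distant
  pairs.\<close>

lemma Q_trivial: "Q s x x' v v' <= Qm * (1 + norm (v - v'))"
proof -
 let ?b = "abs (freq (F s x) v - freq (F s x') v')"
 let ?D = "norm (v - v')" and ?e = "gs al v"
 let ?a = "1 + norm v + ?D"
 have e1: "gs al u <= 1" for u :: "real^3" using al by simp
 have g: "gain (F s y) u <= B" for y u
  using gain_le[of s y u] mono_l[OF e1[of u] B_nonneg] by linarith
 have 1: "abs (gain (F s x) v - gain (F s x') v') <= B"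
  using g[of x v] g[of x' v'] gain_nonneg[of s x v] gain_nonneg[of s x' v'] by linarith
 have "norm v' <= norm v + ?D" using norm_triangle_sub[of v' v] by (simp add: norm_minus_commute)
 then have "B * (1 + norm v') <= B * ?a" "B * (1 + norm v) <= B * ?a"
  using B_nonneg by (intro mono_l; simp)+
 then have "?b <= B * ?a"
  using freq_le[of s x v] freq_le[of s x' v'] freq_nonneg[of s x v] freq_nonneg[of s x' v'] by linarith
 then have "(1 + T) * B * ?e * ?b <= (1 + T) * B * ?e * (B * ?a)"
  using B_nonneg T_pos by (intro mono_l) auto
 also have "... = (1 + T) * B * (B * ((1 + norm v) * ?e + ?e * ?D))" by (simp add: algebra_simps)
 also have "... <= (1 + T) * B * (B * (2 / al + 2 / al * ?D))"
 proof (intro mono_l add_mono mono_r gauss_linear)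
  have "1 <= 2 / al" using al by simp
  then show "?e <= 2 / al" using e1[of v] by linarith
 qed (use B_nonneg T_pos in auto)
 also have "... = (1 + T) * B * (B * (2 / al)) * (1 + ?D)"
 proof -
  have "2 / al + 2 / al * ?D = 2 / al * (1 + ?D)" by (simp only: distrib_left mult_1_right)
  then show ?thesis by (simp only: mult.assoc)
 qed
 finally have "Q s x x' v v' <= B + (1 + T) * B * (B * (2 / al)) * (1 + ?D)" unfolding Q_def using 1 by linarith
 also have "... <= B * (1 + ?D) + (1 + T) * B * (B * (2 / al)) * (1 + ?D)" using B_nonneg by (simp add: distrib_left)
 finally show ?thesis by (simp add: Qm_def distrib_right)
qed

text \<open>On lines the approximate modulus controls \<open>quot\<close>, and the average over
  velocities returns it for \<open>gain\<close> and \<open>freq\<close> without singularity in the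
  velocity. The side conditions keep the new coefficients of position, velocity and error below
  \<open>L\<close>, \<open>L * et\<close> and \<open>b / 2\<close>; the error shrinks because it
  returns multiplied by the time. \<open>C <= L * et\<close> is for distant pairs.\<close>

lemma modulus_improve:
 assumes de: "0 < de" "de <= 1 / 4"
 obtains C where "1 <= C" "Qm <= C"
  "!!t0 L et b. [|modulus de t0 L et b; 0 <= L; 0 <= et; et <= 1; 0 <= b; t0 <= 1 / 64; t0 <= T;
   C * (P1 de L t0 + L * et * CV) <= L; C * (1 + P1 de L t0 + L * et * CV * sqrt t0) <= L * et; C * t0 <= 1 / 2; C <= L * et|] ==>
   modulus de t0 L et (b / 2)"
proof -
 let ?f = "1 + B^2"
 define ka where "ka = min (1 / 16) (al / 2) / 2"
 have ka: "0 < ka" using al by (simp add: ka_def)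
 obtain Cg where Cg: "0 < Cg" and gd: "!!ph ph' v h s B. [|ph \<in> bm; ph' \<in> bm; 0 <= B;
   !!u. 0 <= ph u & ph u <= B * gs al u; !!u. 0 <= ph' u & ph' u <= B * gs al u;
   norm h <= 1; 0 <= s; s <= 1 / 64|] ==>
   ennreal \<bar>gain ph v - gain ph' (v + h)\<bar> <= ennreal (Cg * (1 + B^2) * (Theta s v + Theta s (v + h))) *
    (ennreal (norm h) + kavg ka v (%z. ennreal (quot s ph ph' h z)))"
  by (rule gain_difference[OF al(1,2), folded ka_def]) blast
 obtain Cf where Cf: "0 < Cf" and fd: "!!ph ph' v h s B. [|ph \<in> bm; ph' \<in> bm; 0 <= B;
   !!u. 0 <= ph u & ph u <= B * gs al u; !!u. 0 <= ph' u & ph' u <= B * gs al u;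
   norm h <= 1; 0 <= s; s <= 1 / 64|] ==>
   ennreal \<bar>freq ph v - freq ph' (v + h)\<bar> <= ennreal (Cf * (1 + B) * (1 + norm v)) *
    (ennreal (norm h) + kavg ka 0 (%z. ennreal (quot s ph ph' h z)))"
  by (rule freq_difference[OF al(1,2), folded ka_def]) blast
 let ?b = "(1 + T) * B * (Cf * (1 + B) * (2 / al))"
 have be: "0 <= 1 - de" "1 - de < 1" "0 <= de" using de by auto
 obtain CK where CK: "0 < CK" and avg:
  "!!(g :: real^3 => ennreal) m v h P. [|g \<in> bm; norm m = 1; 0 <= P;
   !!q. EX a b. ALL s. s ~= a --> s ~= b --> q + s *R m ~= 0 --> q + s *R m + h ~= 0 -->
    g (q + s *R m) <= ennreal ((1 + norm (q + s *R m) powr - de + norm (q + s *R m + h) powr - de) *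
      (P * (1 + abs (s - a) powr - (1 - de) + abs (s - b) powr - (1 - de))))|] ==>
   kavg ka v g <= ennreal (CK * P)"
  unfolding kavg_def by (rule kernel_average[OF ka be(3) de(2) be(1,2)]) blast
 obtain K where K: "1 <= K" and line:
  "!!t0 L et b t x x' h m q. [|modulus de t0 L et b; 0 <= L; 0 <= et; 0 <= b; 0 < t; t <= t0; t0 <= 1; t0 <= T; xi x < 0; xi x' < 0;
   norm (x - x') <= r0; norm h <= 1; m = sgn (x - c0)|] ==>
   EX a b'. ALL s. s ~= a --> s ~= b' --> q + s *R m ~= 0 --> q + s *R m + h ~= 0 -->
    quot t (F t x) (F t x') h (q + s *R m) <= (1 + norm (q + s *R m) powr - de + norm (q + s *R m + h) powr - de) *
     ((K * (P1 de L t + L * et * CV) * ((zeta de x + zeta de x') * norm (x - x')) + K * (P1 de L t + L * et * CV * sqrt t) * norm h + b * t) *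
      (1 + abs (s - a) powr - (1 - de) + abs (s - b') powr - (1 - de)))"
  by (rule quotient_on_line[OF de]) blast
 let ?c = "1 + CK * K"
 define C1 where "C1 = Cg * ?f + (1 + T) * B * (Cf * (1 + B) * (2 / al))"
 have C1: "0 <= C1" using Cg Cf B_nonneg T_pos al by (simp add: C1_def)
 define C where "C = 1 + 2 * Qm / r0 + C1 * ?c"
 have Qr: "2 * Qm <= 2 * Qm / r0" using Qm_nonneg r0_pos r0_le_1 by (simp add: pos_le_divide_eq mult_left_le)
 have CC: "0 <= C1 * ?c" using C1 CK K by (intro mult_nonneg_nonneg) auto
 have C: "1 <= C" "2 * Qm <= C" "2 * Qm <= C * r0" "C1 * ?c <= C"
 proof -
  show "1 <= C" "2 * Qm <= C" "C1 * ?c <= C" using Qm_nonneg Qr CC unfolding C_def by linarith+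
  have "2 * Qm / r0 <= C" using CC unfolding C_def by linarith
  then show "2 * Qm <= C * r0" using r0_pos by (simp add: pos_divide_le_eq)
 qed
 have CV: "0 <= CV" using CD_pos La_ge_1 by (simp add: CV_def)
 show ?thesis
 proof (rule that[OF C(1)])
  show "Qm <= C" using C(2) Qm_nonneg by linarith
  fix t0 L et b
  assume hyp: "modulus de t0 L et b" and L: "0 <= L" "0 <= et" and et1: "et <= 1" and b: "0 <= b" and t0: "t0 <= 1 / 64" "t0 <= T"
   and c1: "C * (P1 de L t0 + L * et * CV) <= L" and c2: "C * (1 + P1 de L t0 + L * et * CV * sqrt t0) <= L * et" and c3: "C * t0 <= 1 / 2" and c4: "C <= L * et"
  show "modulus de t0 L et (b / 2)" unfolding modulus_def
  proof (intro allI impI)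
   fix s x x' v v'
   assume s: "0 < s" "s <= t0" and x: "xi x < 0" "xi x' < 0"
   let ?a = "sgn (x - c0)"
   define S where "S = Theta s v + Theta s v'"
   let ?d = "1 + norm v"
   have S: "1 <= S" using Theta_ge_1[of s v] Theta_pos[of s v'] s by (simp add: S_def)
   define Z where "Z = zeta de x + zeta de x'"
   define Dx Dv where "Dx = norm (x - x')" and "Dv = norm (v - v')"
   have nn: "0 <= Dx" "0 <= Dv" by (simp_all add: Dx_def Dv_def)
   have Z: "1 <= Z" using zeta_ge_1[of de x] zeta_ge_1[of de x'] by (simp add: Z_def)
   have ZD: "Dx <= Z * Dx" using Z nn mono_r[of 1 Z Dx] by simp
   define X where "X = L * (Z * Dx + et * Dv) + b / 2"
   have LZ: "0 <= L * (Z * Dx)" "0 <= L * et * Dv" using L Z nn by simp_all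
   have Xs: "X = L * (Z * Dx) + L * et * Dv + b / 2" by (simp add: X_def algebra_simps)
   have X0: "0 <= X" unfolding Xs using LZ b by simp
   have SX: "X <= S * X" using S X0 mono_r[of 1 S X] by simp
   \<comment> \<open>The averaged estimates presuppose \<open>norm h <= 1\<close> and a direction
     common to both positions, hence \<open>Dx <= r0\<close>. For the other pairs
     \<open>Q_trivial\<close> suffices, as \<open>L\<close> and \<open>L * et\<close> are
     large.\<close>
   consider (v) "1 < Dv" | (x) "Dv <= 1" "r0 < Dx" | (near) "Dv <= 1" "Dx <= r0" by linarith
   then have "Q s x x' v v' <= S * X"
   proof cases
    case v
    have "Q s x x' v v' <= Qm * (1 + Dv)" unfolding Dv_def by (rule Q_trivial)
    also have "... <= Qm * (2 * Dv)" using v Qm_nonneg by (intro mono_l) auto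
    also have "... <= (L * et) * Dv" using C(2) c4 nn mono_r[of "2 * Qm" "L * et" Dv] by simp
    also have "... <= X" unfolding Xs using LZ b by simp
    finally show ?thesis using SX by simp
   next
    case x
    have "Q s x x' v v' <= Qm * (1 + Dv)" unfolding Dv_def by (rule Q_trivial)
    also have "... <= Qm * 2" using x Qm_nonneg by (intro mono_l) auto
    also have "... <= C * r0" using C(3) by simp
    also have "... <= L * Dx"
    proof (rule mult_mono)
     have "L * et <= L * 1" using L et1 by (intro mono_l) auto
     then show "C <= L" using c4 by simp
    qed (use x r0_pos L in auto)
    also have "... <= L * (Z * Dx)" using ZD L by (intro mono_l) auto
    also have "... <= X" unfolding Xs using LZ b by simp
    finally show ?thesis using SX by simp
   next
    case near
    define h where "h = v' - v"
    let ?e = "ennreal (norm h)"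
    have v': "v' = v + h" and h: "norm h <= 1" "norm h = Dv" using near by (simp_all add: h_def Dv_def norm_minus_commute)
    have sT: "s <= T" "s <= 1 / 64" "0 <= s" "s <= 1" using s t0 by auto
    define A1' where "A1' = P1 de L s + L * et * CV"
    define A2' where "A2' = P1 de L s + L * et * CV * sqrt s"
    define P where "P = K * A1' * (Z * Dx) + K * A2' * Dv + b * s"
    have P1s: "0 <= P1 de L s" "P1 de L s <= P1 de L t0"
    proof -
     show "0 <= P1 de L s" by (rule P1_nonneg[OF L(1)])
     have "s powr (1 / 4) <= t0 powr (1 / 4)" using s by (intro powr_mono2) auto
     then show "P1 de L s <= P1 de L t0" unfolding P1_def
      using CD_pos CZ_nonneg[of de] L by (intro add_left_mono mono_l) auto
    qed
    have M: "0 <= L * et * CV" using L CV by simp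
    have A: "0 <= A1'" "0 <= A2'" "A1' <= P1 de L t0 + L * et * CV" "A2' <= P1 de L t0 + L * et * CV * sqrt t0"
     unfolding A1'_def A2'_def using P1s M s by (auto intro!: add_mono mono_l mult_nonneg_nonneg add_nonneg_nonneg)
    have ZD0: "0 <= Z * Dx" using ZD nn by simp
    have bs: "0 <= b * s" using b s by simp
    have P: "0 <= P" unfolding P_def
     using K A nn bs by (intro add_nonneg_nonneg mult_nonneg_nonneg[OF _ ZD0] mult_nonneg_nonneg[OF _ nn(2)] bs) auto
    let ?g = "%z. ennreal (quot s (F s x) (F s x') h z)"
    have g: "kavg ka c ?g <= ennreal (CK * P)" for c
    proof (rule avg[OF _ _ P])
     show "?g \<in> bm" using F_slice by measurable
     have "x ~= c0" using x(1) c0_ge xi0_pos by auto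
     then show "norm (?a) = 1" by (simp add: norm_sgn)
     fix q
     obtain a b' where ab: "!!si. si ~= a ==> si ~= b' ==> q + si *R ?a ~= 0 ==> q + si *R ?a + h ~= 0 ==>
      quot s (F s x) (F s x') h (q + si *R ?a) <= (1 + norm (q + si *R ?a) powr - de + norm (q + si *R ?a + h) powr - de) *
       (P * (1 + abs (si - a) powr - (1 - de) + abs (si - b') powr - (1 - de)))"
      using line[OF hyp L b s _ t0(2) x _ h(1) refl, of q] near t0 unfolding P_def A1'_def A2'_def Z_def Dx_def h(2)[symmetric] by auto
     show "EX a b. ALL si. si ~= a --> si ~= b --> q + si *R ?a ~= 0 --> q + si *R ?a + h ~= 0 -->
      ennreal (quot s (F s x) (F s x') h (q + si *R ?a)) <= ennreal ((1 + norm (q + si *R ?a) powr - de + norm (q + si *R ?a + h) powr - de) *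
       (P * (1 + abs (si - a) powr - (1 - de) + abs (si - b) powr - (1 - de))))"
      by (rule exI[of _ a], rule exI[of _ b'], intro allI impI ennreal_leI) (rule ab)
    qed
    have CKP: "0 <= CK * P" using CK P by simp
    have Fb: "0 <= F s y u & F s y u <= B * gs al u" for y u using F_nonneg F_le by blast
    have add: "?e + kavg ka c ?g <= ennreal (Dv + CK * P)" for c
    proof -
     have "?e + kavg ka c ?g <= ennreal Dv + ennreal (CK * P)" using g[of c] h by (intro add_mono) auto
     then show ?thesis using nn CKP by (simp add: ennreal_plus)
    qed
    define Y where "Y = Dv + CK * P"
    have Y: "0 <= Y" using nn CKP by (simp add: Y_def)
    have "ennreal \<bar>gain (F s x) v - gain (F s x') (v + h)\<bar> <= ennreal (Cg * ?f * (Theta s v + Theta s (v + h))) * (?e + kavg ka v ?g)"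
     by (rule gd[OF F_slice F_slice B_nonneg Fb Fb h(1) sT(3,2)])
    also have "... <= ennreal (Cg * ?f * S) * ennreal Y"
     unfolding S_def v' Y_def using add by (intro mono_l) auto
    also have "... = ennreal (Cg * ?f * S * Y)" using Cg S Y by (intro ennreal_mult[symmetric]) auto
    finally have gn: "abs (gain (F s x) v - gain (F s x') v') <= Cg * ?f * S * Y"
     using Cg S Y unfolding v' by (subst (asm) ennreal_le_iff) auto
    have "ennreal \<bar>freq (F s x) v - freq (F s x') (v + h)\<bar> <= ennreal (Cf * (1 + B) * ?d) * (?e + kavg ka 0 ?g)"
     by (rule fd[OF F_slice F_slice B_nonneg Fb Fb h(1) sT(3,2)])
    also have "... <= ennreal (Cf * (1 + B) * ?d) * ennreal Y"
     unfolding Y_def using add by (intro mono_l) auto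
    also have "... = ennreal (Cf * (1 + B) * ?d * Y)" using Cf B_nonneg Y by (intro ennreal_mult[symmetric]) auto
    finally have fr: "abs (freq (F s x) v - freq (F s x') v') <= Cf * (1 + B) * ?d * Y"
     using Cf B_nonneg Y unfolding v' by (subst (asm) ennreal_le_iff) auto
    \<comment> \<open>The linear growth of the frequency in \<open>v\<close> is compensated by the
      Gaussian factor in \<open>Q\<close>.\<close>
    have "(1 + T) * B * gs al v * abs (freq (F s x) v - freq (F s x') v') <= (1 + T) * B * gs al v * (Cf * (1 + B) * ?d * Y)"
     using fr B_nonneg T_pos by (intro mono_l) auto
    also have "... = ((1 + T) * B * (Cf * (1 + B))) * (?d * gs al v) * Y" by (simp add: mult_ac)
    also have "... <= ((1 + T) * B * (Cf * (1 + B))) * (2 / al) * Y"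
     using B_nonneg T_pos Cf Y by (intro mono_r mono_l gauss_linear) auto
    also have "... = ?b * (1 * Y)" by simp
    also have "... <= ?b * (S * Y)"
     using B_nonneg T_pos Cf Y S al by (intro mono_l mono_r) auto
    finally have "Q s x x' v v' <= Cg * ?f * S * Y + ?b * (S * Y)"
     unfolding Q_def using gn by linarith
    also have "... = S * (C1 * Y)" by (simp add: C1_def algebra_simps)
    also have "... <= S * X"
    proof (rule mono_l)
     let ?R = "A1' * (Z * Dx) + (1 + A2') * Dv + b * s"
     have R: "0 <= ?R" using A nn by (intro add_nonneg_nonneg mult_nonneg_nonneg[OF _ ZD0] mult_nonneg_nonneg[OF _ nn(2)] bs) auto
     have "Y <= ?c * ?R"
     proof -
      have "b * s <= K * (b * s)" using K bs mono_r[of 1 K "b * s"] by simp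
      then have "P <= K * (A1' * (Z * Dx) + A2' * Dv + b * s)" by (simp add: P_def algebra_simps)
      also have "... <= K * ?R" using K nn by (intro mono_l) (auto simp: distrib_right)
      finally have "CK * P <= CK * (K * ?R)" using CK by (intro mono_l) auto
      moreover have "Dv <= ?R"
      proof -
       have "0 <= A1' * (Z * Dx)" "0 <= A2' * Dv" using A ZD0 nn by auto
       then show ?thesis using bs by (simp add: distrib_right)
      qed
      ultimately show ?thesis unfolding Y_def by (simp add: distrib_right)
     qed
     then have "C1 * Y <= C1 * (?c * ?R)" using C1 by (rule mono_l)
     also have "... = (C1 * ?c) * ?R" by simp
     also have "... <= C * ?R" using C(4) R by (rule mono_r)
     also have "... = (C * A1') * (Z * Dx) + (C * (1 + A2')) * Dv + (C * s) * b" by (simp add: algebra_simps)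
     also have "... <= L * (Z * Dx) + (L * et) * Dv + (1 / 2) * b"
     proof (intro add_mono mono_r)
      have C0: "0 <= C" using C(1) by simp
      show "C * A1' <= L" using mono_l[OF A(3) C0] c1 by linarith
      have "1 + A2' <= 1 + P1 de L t0 + L * et * CV * sqrt t0" using A(4) by simp
      from mono_l[OF this C0] show "C * (1 + A2') <= L * et" using c2 by linarith
      show "C * s <= 1 / 2" using mono_l[OF s(2) C0] c3 by linarith
     qed (use ZD0 nn b in auto)
     also have "... = X" by (simp add: Xs)
     finally show "C1 * Y <= X" .
    qed (use S in auto)
    finally show ?thesis .
   qed
   then show "Q s x x' v v' <= (Theta s v + Theta s v') * (L * ((zeta de x + zeta de x') * norm (x - x') + et * norm (v - v')) + b / 2)"
    by (simp add: S_def X_def Z_def Dx_def Dv_def)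
  qed
 qed
qed

text \<open>The order of choice breaks the circle. First \<open>et\<close> makes the feedback of
  velocity differences on the position coefficient a quarter of \<open>L\<close>; then
  \<open>L\<close> is so large that the initial datum contributes a quarter of
  \<open>L * et\<close>; finally \<open>t0\<close> does the same for the remaining terms that
  contain \<open>L\<close>.\<close>

lemma modulus_exists:
 assumes de: "0 < de" "de <= 1 / 4"
 obtains L et t0 where "0 <= L" "0 <= et" "0 < t0" "t0 <= 1 / 64" "t0 <= T" "modulus de t0 L et 0"
proof -
 obtain C where C: "1 <= C" "Qm <= C" and improve:
  "!!t0 L et b. [|modulus de t0 L et b; 0 <= L; 0 <= et; et <= 1; 0 <= b; t0 <= 1 / 64; t0 <= T;
   C * (P1 de L t0 + L * et * CV) <= L; C * (1 + P1 de L t0 + L * et * CV * sqrt t0) <= L * et; C * t0 <= 1 / 2; C <= L * et|] ==>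
   modulus de t0 L et (b / 2)"
  by (rule modulus_improve[OF de]) blast
 have "1 * 1 <= CD * (9 + 4 * La)" using CD_bounds(1) La_ge_1 by (intro mult_mono) auto
 then have CV: "1 <= CV" by (simp add: CV_def)
 define et where "et = 1 / (4 * C * CV)"
 have "1 <= C * CV" using C CV mult_mono[of 1 C 1 CV] by simp
 then have et: "0 < et" "et <= 1" "C * (et * CV) = 1 / 4" using C CV by (simp_all add: et_def mult.assoc pos_divide_le_eq)
 define L where "L = 4 * C * (1 + 3 * CF * A1) / et"
 have FA: "0 <= 3 * CF * A1" using CF_nonneg A1 by simp
 have L: "0 <= L" "C * (1 + 3 * CF * A1) = L * et / 4" using C et FA by (simp_all add: L_def)
 have Leta: "C <= L * et"
 proof -
  have "C * 1 <= C * (1 + 3 * CF * A1)" using C FA by (intro mono_l) auto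
  moreover have "0 <= L * et" using L et by simp
  ultimately show ?thesis using L(2) C by linarith
 qed
 define Y where "Y = C * (22 * CD * (CZ de + 1))"
 have Y: "0 < Y" using C CD_pos CZ_nonneg[of de] by (simp add: Y_def)
 define p q where "p = et / (4 * Y)" and "q = 1 / (4 * C * CV)"
 have pq: "0 < p" "0 < q" using et Y C CV by (simp_all add: p_def q_def)
 define t0 where "t0 = min (1 / 64) (min T (min (1 / (2 * C)) (min (p ^ 4) (q^2))))"
 let ?a = "C * (22 * CD * CZ de * L * t0 powr (1 / 4))"
 have t0: "0 < t0" "t0 <= 1 / 64" "t0 <= T" "t0 <= 1 / (2 * C)" "t0 <= p ^ 4" "t0 <= q^2"
  using T_pos C pq by (auto simp: t0_def)
 have tp: "t0 powr (1 / 4) <= p"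
 proof -
  have "t0 powr (1 / 4) <= (p ^ 4) powr (1 / 4)" using t0 by (intro powr_mono2) auto
  also have "... = (p powr 4) powr (1 / 4)" using pq by simp
  also have "... = p" using pq by (simp only: powr_powr) simp
  finally show ?thesis .
 qed
 have tq: "sqrt t0 <= q" using t0 pq by (intro real_le_lsqrt) auto
 have b1: "?a <= L * et / 4"
 proof -
  have "?a = L * (C * (22 * CD * CZ de) * t0 powr (1 / 4))" by simp
  also have "... <= L * (Y * p)"
   unfolding Y_def using C CD_pos CZ_nonneg[of de] L tp by (intro mono_l mult_mono) auto
  also have "Y * p = et / 4" using Y by (simp add: p_def)
  finally show ?thesis by simp
 qed
 have b2: "C * (L * et * CV * sqrt t0) <= L * et / 4"
 proof -
  have "C * (L * et * CV * sqrt t0) = L * et * (C * CV * sqrt t0)" by simp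
  also have "... <= L * et * (C * CV * q)" using L et C CV tq by (intro mono_l) auto
  also have "C * CV * q = 1 / 4" using C CV by (simp add: q_def)
  finally show ?thesis by simp
 qed
 have b3: "C * (L * et * CV) = L / 4"
 proof -
  have "C * (L * et * CV) = L * (C * (et * CV))" by simp
  then show ?thesis unfolding et by simp
 qed
 have b4: "L * et <= L" using L et by (simp add: mult_left_le)
 have b5: "0 <= L * et" using L et by simp
 have L2: "C + C * (3 * CF * A1) = L * et / 4" using L(2) by (simp add: distrib_left)
 have c1: "C * (P1 de L t0 + L * et * CV) <= L"
  unfolding P1_def distrib_left using L2 b1 b3 b4 b5 C L(1) by linarith
 have c2: "C * (1 + P1 de L t0 + L * et * CV * sqrt t0) <= L * et"
  unfolding P1_def distrib_left mult_1_right using L2 b1 b2 b5 by linarith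
 have c3: "C * t0 <= 1 / 2" using t0(4) C by (simp add: field_simps)
 \<comment> \<open>For \<open>n = 0\<close> this is boundedness; since \<open>L\<close> and
   \<open>et\<close> do not depend on \<open>n\<close>, the limit removes the error.\<close>
 have ind: "modulus de t0 L et (Qm / 2 ^ n)" for n
 proof (induction n)
  case 0
  show ?case unfolding modulus_def
  proof (intro allI impI)
   fix s x x' v v' assume s: "0 < s" "s <= t0"
   let ?S = "Theta s v + Theta s v'"
   have S: "1 <= ?S" using Theta_ge_1[of s v] Theta_pos[of s v'] s by simp
   let ?X = "L * ((zeta de x + zeta de x') * norm (x - x') + et * norm (v - v')) + Qm"
   have "Q s x x' v v' <= Qm * (1 + norm (v - v'))" by (rule Q_trivial)
   also have "... <= ?X"
   proof -
    have "Qm * norm (v - v') <= (L * et) * norm (v - v')" using C(2) Leta by (intro mono_r) auto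
    moreover have "0 <= L * ((zeta de x + zeta de x') * norm (x - x'))" using L zeta_ge_1[of de x] zeta_ge_1[of de x'] by simp
    ultimately show ?thesis by (simp add: distrib_left mult.assoc)
   qed
   also have "... <= ?S * ?X"
   proof -
    have "0 <= ?X" using L et Qm_nonneg zeta_ge_1[of de x] zeta_ge_1[of de x'] by simp
    then show ?thesis using S mono_r[of 1 ?S ?X] by simp
   qed
   finally show "Q s x x' v v' <= ?S * (L * ((zeta de x + zeta de x') * norm (x - x') + et * norm (v - v')) + Qm / 2 ^ 0)" by simp
  qed
 next
  case (Suc n)
  have "modulus de t0 L et (Qm / 2 ^ n / 2)"
   using Suc L et Qm_nonneg t0 c1 c2 c3 Leta by (intro improve) auto
  then show ?case by (simp add: mult.commute)
 qed
 have fin: "modulus de t0 L et 0" unfolding modulus_def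
 proof (intro allI impI)
  fix s x x' v v' assume s: "0 < s" "s <= t0" "xi x < 0" "xi x' < 0"
  let ?S = "Theta s v + Theta s v'"
  let ?X = "L * ((zeta de x + zeta de x') * norm (x - x') + et * norm (v - v'))"
  have "(%n. Qm / 2 ^ n) \<longlonglongrightarrow> 0"
   by (rule LIMSEQ_divide_realpow_zero) simp
  then have "(%n. ?S * (?X + Qm / 2 ^ n)) \<longlonglongrightarrow> ?S * (?X + 0)" by (intro tendsto_intros)
  moreover have "Q s x x' v v' <= ?S * (?X + Qm / 2 ^ n)" for n using ind[of n] s unfolding modulus_def by blast
  ultimately show "Q s x x' v v' <= ?S * (?X + 0)" by (intro LIMSEQ_le_const) auto
 qed
 show ?thesis by (rule that[OF L(1) less_imp_le[OF et(1)] t0(1,2,3) fin])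
qed

end

section \<open>The Hoelder estimate\<close>

context convex_obstacle
begin

text \<open>The segment from \<open>y\<close> to \<open>c0\<close> crosses the boundary at a point
  where \<open>xi\<close> increases towards \<open>c0\<close>. Towards \<open>y\<close> the linear
  term of the concavity inequality is therefore not positive, and the quadratic term counts the
  distance.\<close>

lemma depth_dist:
 assumes y: "xi y <= 0" and d: "d <= infdist y (bd xi)" "0 <= d"
 shows "xi y <= - (th / 2 * d^2)"
proof -
 let ?f = "%l. y + l *R (c0 - y)"
 have "continuous_on {0..1} (%l. xi (?f l))"
  by (rule continuous_on_compose2[OF cont]) (auto intro!: continuous_intros)
 moreover have "0 <= xi (?f 1)" using c0_ge xi0_pos by simp
 ultimately obtain l where l: "0 <= l" "l <= 1" "xi (?f l) = 0"
  using IVT'[of "%l. xi (?f l)" 0 0 1] y by auto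
 let ?p = "?f l"
 have "xi c0 <= xi ?p + grad xi ?p *. (c0 - ?p) - th / 2 * N2 (c0 - ?p)" by (rule concave)
 moreover have "0 <= th / 2 * N2 (c0 - ?p)" using th_pos by simp
 ultimately have pos: "0 < grad xi ?p *. (c0 - ?p)" using c0_ge xi0_pos l(3) by linarith
 have cp: "c0 - ?p = (1 - l) *R (c0 - y)" by (simp add: algebra_simps)
 have "0 <= grad xi ?p *. (c0 - y)"
  using pos l unfolding cp by (cases "l = 1") (auto simp: zero_less_mult_iff)
 then have g: "grad xi ?p *. (y - ?p) <= 0" using l by (simp add: inner_simps mult_nonneg_nonneg)
 have "d <= norm (y - ?p)"
  using infdist_le[of ?p "bd xi" y] l(3) d(1) by (simp add: bd_eq dist_norm)
 then have "th / 2 * d^2 <= th / 2 * N2 (y - ?p)" using d th_pos by (intro mono_l power_mono) auto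
 moreover have "xi y <= xi ?p + grad xi ?p *. (y - ?p) - th / 2 * N2 (y - ?p)" by (rule concave)
 ultimately show ?thesis using g l(3) by linarith
qed

lemma flow_far:
 assumes x: "xi x <= 0" and far: "ep < infdist x (bd xi)" and r: "0 <= r" "r * norm v <= ep / 2" and ep: "0 < ep"
 shows "xi (flow r x v) <= - (th / 2 * (ep / 2)^2)"
proof -
 have near: "ep / 2 <= infdist (x - s *R v) (bd xi)" if "0 <= s" "s <= r" for s
 proof -
  have "infdist x (bd xi) <= infdist (x - s *R v) (bd xi) + dist x (x - s *R v)" by (rule infdist_triangle)
  also have "dist x (x - s *R v) = s * norm v" using that by (simp add: dist_norm)
  also have "... <= ep / 2" using that r mono_r[of s r "norm v"] by simp
  finally show ?thesis using far by linarith
 qed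
 have eq: "flow r x v = x - r *R v"
 proof (cases rule: flow_cases[OF x r(1), of v, case_names free refl])
  case (refl ta)
  then have "infdist (x - ta *R v) (bd xi) = 0" by (simp add: bd_eq)
  then show ?thesis using near[of ta] refl ep by simp
 qed
 show ?thesis using depth_dist[OF flow_le_0[OF x r(1), of v], of "ep / 2"] near[of r] r ep unfolding eq by simp
qed

text \<open>The part of \<open>W\<close> contributed by one of the two points.\<close>

definition weight :: "real => real => real^3 => real^3 => real" where
 "weight de ep x v = 1 + norm v powr - de * indicator {y. infdist y (bd xi) <= ep} x"

lemma weight_ge_1: "1 <= weight de ep x v"
 by (simp add: weight_def)

text \<open>The singularity in the speed occurs only near the boundary. A particle of speed below 1
  that starts further away than \<open>ep\<close> keeps the distance \<open>ep / 2\<close> up to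
  time \<open>ep / 2\<close>, where \<open>zeta\<close> is bounded; for speeds at least 1 the
  negative power is at most 1. The exponent is cut at \<open>1 / 4\<close>, as the averages over
  velocities require.\<close>

lemma zeta_integral_weight:
 assumes de: "0 < de" and ep: "0 < ep" "ep < 1"
 obtains c where "0 <= c"
  "!!x v t. [|xi x <= 0; 0 < t; t <= ep / 2; v ~= 0 | ep < infdist x (bd xi)|] ==>
   (AE r in lborel. r \<in> {0..t} --> xi (flow r x v) < 0) \<and>
   (NN r. ennreal (r powr - (1 / 2) * zeta (min de (1 / 4)) (flow r x v)) * indicator {0..t} r) <= ennreal (c * t powr (1 / 4) * weight de ep x v)"
proof -
 define de' where "de' = min de (1 / 4)"
 have de': "0 < de'" "de' <= 1 / 4" "de' <= de" using de by (auto simp: de'_def)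
 define h where "h = th / 2 * (ep / 2)^2"
 have h: "0 < h" using th_pos ep by (simp add: h_def)
 define c where "c = 2 * CZ de' + 6 * (1 + h powr - (de' / 2))"
 have CZ: "0 <= CZ de'" by (simp add: CZ_def)
 have c: "2 * CZ de' <= c" "6 * (1 + h powr - (de' / 2)) <= c" "0 <= c" using CZ by (simp_all add: c_def)
 show ?thesis
 proof (rule that[OF c(3)], unfold de'_def[symmetric])
  fix x v :: "real^3" and t :: real assume x: "xi x <= 0" and t: "0 < t" "t <= ep / 2" and ok: "v ~= 0 | ep < infdist x (bd xi)"
  let ?g = "1 + norm v powr - de'"
  let ?f = "CZ de' * t powr (1 / 4) * (1 + norm v powr - de')"
  let ?d = "3 * t powr (1 - 1 / 2) / (1 - 1 / 2)"
  let ?b = "weight de ep x v"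
  let ?e = "c * t powr (1 / 4) * ?b"
  let ?c = "ennreal (c * t powr (1 / 4) * ?b)"
  let ?a = "NN r. ennreal (r powr - (1 / 2) * zeta de' (flow r x v)) * indicator {0..t} r"
  have t1: "t <= 1" using t ep by simp
  have moving: "(AE r in lborel. r \<in> {0..t} --> xi (flow r x v) < 0)" if v: "v ~= 0"
  proof -
   obtain r1 where r1: "!!r. 0 <= r ==> r ~= r1 ==> xi (flow r x v) < 0" using flow_interior[OF x v] by blast
   show ?thesis using AE_lborel_singleton[of r1] by eventually_elim (auto intro: r1)
  qed
  have bound: "?a <= ?c"
   if v: "v ~= 0" and le: "?g <= 2 * ?b"
  proof (rule order_trans[OF zeta_integral[OF x v t(1) t1 de'(1,2)] ennreal_leI])
   have "?f <= CZ de' * t powr (1 / 4) * (2 * ?b)"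
    using le CZ by (intro mono_l) auto
   also have "... = (2 * CZ de') * t powr (1 / 4) * ?b" by simp
   also have "... <= ?e"
    using c weight_ge_1[of de ep x v] by (intro mono_r) auto
   finally show "?f <= ?e" .
  qed
  have big: "norm v powr - de' <= 1" if "1 <= norm v"
  proof -
   have "v ~= 0" using that by auto
   then show ?thesis using powr_mono[of "- de'" 0 "norm v"] that de' by simp
  qed
  consider (near) "infdist x (bd xi) <= ep" | (fast) "ep < infdist x (bd xi)" "1 <= norm v" | (slow) "ep < infdist x (bd xi)" "norm v < 1" by linarith
  then show "(AE r in lborel. r \<in> {0..t} --> xi (flow r x v) < 0) \<and>
   ?a <= ?c"
  proof cases
   case near
   then have v: "v ~= 0" using ok by simp
   have "norm v powr - de' <= 1 + norm v powr - de"
   proof (cases "1 <= norm v")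
    case True
    then show ?thesis using big by (simp add: add_increasing2)
   next
    case False
    then have "norm v powr - de' <= norm v powr - de" using v de' by (intro powr_mono') auto
    then show ?thesis by simp
   qed
   moreover have "?b = 1 + norm v powr - de" using near by (simp add: weight_def)
   moreover have "0 <= norm v powr - de" by simp
   ultimately have "?g <= 2 * ?b" by linarith
   then show ?thesis using moving bound v by blast
  next
   case fast
   then have v: "v ~= 0" by auto
   have "?g <= 2 * ?b" using big[OF fast(2)] weight_ge_1[of de ep x v] by linarith
   then show ?thesis using moving bound v by blast
  next
   case slow
   have deep: "xi (flow r x v) <= - h" if "0 <= r" "r <= t" for r
   proof -
    have "r * norm v <= t * 1" using that slow by (intro mult_mono) auto
    then show ?thesis unfolding h_def using t ep that by (intro flow_far[OF x slow(1)]) auto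
   qed
   let ?k = "1 + h powr - (de' / 2)"
   have "?a <= (NN r. ennreal ?k * (ennreal (abs (r - 0) powr - (1 / 2)) * indicator {0..t} r))"
   proof (rule nn_integral_mono)
    fix r
    show "ennreal (r powr - (1 / 2) * zeta de' (flow r x v)) * indicator {0..t} r <= ennreal ?k * (ennreal (abs (r - 0) powr - (1 / 2)) * indicator {0..t} r)"
    proof (cases "r \<in> {0..t}")
     case True
     then have "h <= - xi (flow r x v)" using deep[of r] by simp
     then have "zeta de' (flow r x v) <= ?k" unfolding zeta_def using h de' by (intro add_left_mono powr_mono2') auto
     then have "r powr - (1 / 2) * zeta de' (flow r x v) <= r powr - (1 / 2) * ?k" by (intro mono_l) auto
     then have "ennreal (r powr - (1 / 2) * zeta de' (flow r x v)) <= ennreal (?k * r powr - (1 / 2))" by (intro ennreal_leI) (simp add: mult.commute)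
     also have "... = ennreal ?k * ennreal (r powr - (1 / 2))" by (intro ennreal_mult) auto
     finally show ?thesis using True by simp
    qed simp
   qed
   also have "... = ennreal ?k * (NN r. ennreal (abs (r - 0) powr - (1 / 2)) * indicator {0..t} r)" by (rule nn_integral_cmult) measurable
   also have "... <= ennreal ?k * ennreal ?d" using t by (intro mono_l nn_integral_abs_powr_interval) auto
   also have "... = ennreal (?k * ?d)" by (intro ennreal_mult[symmetric]) auto
   also have "... <= ?c"
   proof (rule ennreal_leI)
    have "t powr (1 / 2) <= t powr (1 / 4)" using t t1 by (intro powr_mono') auto
    then have "6 * ?k * t powr (1 / 2) <= 6 * ?k * t powr (1 / 4)" by (intro mono_l) auto
    also have "... <= c * t powr (1 / 4)" using c by (intro mono_r) auto
    also have "... <= ?e" using mono_l[OF weight_ge_1[of de ep x v], of "c * t powr (1 / 4)"] c by simp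
    finally show "?k * ?d <= ?e" by (simp add: algebra_simps)
   qed
   finally have "?a <= ?c" .
   moreover have "xi (flow r x v) < 0" if "r \<in> {0..t}" for r using deep[of r] that h by simp
   ultimately show ?thesis by auto
  qed
 qed
qed

end

context regular_solution
begin

text \<open>The square-root scale, with the modulus free of error. \<open>L\<close> depends on the
  solution and must not enter the constant: its terms carry \<open>t powr (1 / 4)\<close> or
  \<open>sqrt t\<close>, and \<open>T2\<close> is so short that they contribute only the summand 2.
  The factor 9 comes from the 3 in \<open>initial_difference\<close> and from bounding the linear
  distances by \<open>2 * e\<close>.\<close>

lemma hoelder_bound:
 assumes de: "0 < de" and ep: "0 < ep" "ep < 1"
 obtains T2 where "0 < T2" "T2 <= T"
  "!!t x x' v v'. [|0 <= t; t <= T2; xi x <= 0; xi x' <= 0; norm (x - x') <= 1; norm (v - v') <= 1;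
   v ~= 0 | ep < infdist x (bd xi); v' ~= 0 | ep < infdist x' (bd xi)|] ==>
   abs (F t x v - F t x' v') <= (Theta t v + Theta t v') *
    ((9 * CF * A1 + 2) * (1 + (norm v + norm v')) * (weight de ep x v + weight de ep x' v') * sqrt (norm (x - x') + norm (v - v')))"
proof -
 let ?i = "9 * CF * A1 + 2"
 define de' where "de' = min de (1 / 4)"
 obtain L et t0 where L: "0 <= L" "0 <= et" and t0: "0 < t0" "t0 <= 1 / 64" "t0 <= T" and hyp: "modulus de' t0 L et 0"
  by (rule modulus_exists[of de']) (use de in \<open>auto simp: de'_def\<close>)
 obtain c where c: "0 <= c" and zw: "!!x v t. [|xi x <= 0; 0 < t; t <= ep / 2; v ~= 0 | ep < infdist x (bd xi)|] ==>
   (AE r in lborel. r \<in> {0..t} --> xi (flow r x v) < 0) \<and>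
   (NN r. ennreal (r powr - (1 / 2) * zeta de' (flow r x v)) * indicator {0..t} r) <= ennreal (c * t powr (1 / 4) * weight de ep x v)"
  unfolding de'_def by (rule zeta_integral_weight[OF de ep]) blast
 have CV: "0 <= CV" using CD_pos La_ge_1 by (simp add: CV_def)
 define Y where "Y = 1 + 33 * L * CD * c + L * et * CV"
 have Y: "1 <= Y" "33 * L * CD * c <= Y" "L * et * CV <= Y" using L CD_pos c CV by (simp_all add: Y_def)
 define T2 where "T2 = min t0 (min (ep / 2) ((1 / Y) ^ 4))"
 have T2: "0 < T2" "T2 <= t0" "T2 <= ep / 2" "T2 <= (1 / Y) ^ 4" using t0 ep Y by (auto simp: T2_def)
 show ?thesis
 proof (rule that[OF T2(1)])
  show "T2 <= T" using T2 t0 by simp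
  fix t :: real and x x' v v' :: "real^3"
  assume t: "0 <= t" "t <= T2" and x: "xi x <= 0" "xi x' <= 0" and D: "norm (x - x') <= 1" "norm (v - v') <= 1"
   and ok: "v ~= 0 | ep < infdist x (bd xi)" "v' ~= 0 | ep < infdist x' (bd xi)"
  let ?k = "norm (v - v')"
  let ?j = "norm (x - x')"
  let ?h = "weight de ep x v"
  let ?g = "weight de ep x' v'"
  let ?d = "abs (F t x v - F t x' v')"
  let ?c = "1 + (norm v + norm v')"
  let ?b = "abs (f0 (flow t x v) (vel t x v) - f0 (flow t x' v') (vel t x' v'))"
  have t1: "t <= 1" "t <= T" using t T2 t0 by simp_all
  define w where "w = norm v + norm v'"
  define e where "e = sqrt (?j + ?k)"
  let ?e = "?j + ?k + e"
  have e: "dev_bound t x v x' v' e" by (simp add: dev_bound_def e_def)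
  have e0: "0 <= e" by (simp add: e_def)
  have e2: "?j + ?k + e <= 3 * e"
  proof -
   have "?j + ?k = e * e" by (simp add: e_def)
   moreover have "e <= 2"
   proof -
    have "e <= sqrt 4" unfolding e_def using D by (intro real_sqrt_le_mono) simp
    then show ?thesis by simp
   qed
   then have "e * e <= 2 * e" using e0 by (intro mono_r)
   ultimately show ?thesis by simp
  qed
  define y where "y = ?h + ?g"
  let ?f = "(1 + w) * y * e"
  have y: "2 <= y" using weight_ge_1[of de ep x v] weight_ge_1[of de ep x' v'] by (simp add: y_def)
  have w: "0 <= w" by (simp add: w_def)
  let ?S = "Theta t v + Theta t v'"
  have S: "0 <= ?S" using Theta_pos[of t v] Theta_pos[of t v'] by simp
  have FA: "0 <= CF * A1" using CF_nonneg A1 by simp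
  then have FA3: "0 <= 3 * CF * A1" "0 <= A1 * CF" "0 <= CF * A1" by (simp_all only: mult.assoc mult.commute[of A1] zero_le_mult_iff) auto
  have f0: "?b <= ?S * (9 * CF * A1 * e)"
  proof -
   have "?b <= ?S * (3 * CF * A1 / ?c * ?e)"
    by (rule initial_difference[OF x t(1) t1(1) D e])
   also have "... <= ?S * ((3 * CF * A1) * (3 * e))"
   proof (intro mono_l[OF mult_mono S])
    have "3 * CF * A1 * 1 <= 3 * CF * A1 * ?c" by (intro mono_l FA3(1)) simp
    then show "3 * CF * A1 / ?c <= 3 * CF * A1" by (simp add: pos_divide_le_eq add_pos_nonneg)
   qed (use e2 FA3 e0 in simp_all)
   finally show ?thesis by simp
  qed
  have yw: "e <= ?f" "(1 + w) * e <= ?f" "e * y <= ?f"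
  proof -
   have "1 * 1 <= (1 + w) * y" using w y by (intro mult_mono) auto
   from mono_r[OF this e0] show "e <= ?f" by simp
   have "(1 + w) * 1 <= (1 + w) * y" using w y by (intro mono_l) auto
   from mono_r[OF this e0] show "(1 + w) * e <= ?f" by simp
   have "1 * y <= (1 + w) * y" using w y by (intro mono_r) auto
   from mono_r[OF this e0] show "e * y <= ?f" by (simp add: mult.commute)
  qed
  have "?d <= ?S * (?i * (1 + w) * y * e)"
  proof (cases "t = 0")
   case True
   \<comment> \<open>At time 0 the Duhamel integral is over a single point;
     \<open>modulus_step\<close> is for positive times.\<close>
   have "(NN r. ennreal (Q (t - r) (flow r x v) (flow r x' v') (vel r x v) (vel r x' v')) * indicator {0..t} r) = (NN (r::real). 0)"
    unfolding True by (rule nn_integral_cong_AE, rule AE_mp[OF AE_lborel_singleton[of "0::real"]]) (auto simp: indicator_def)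
   then have "ennreal \<bar>F t x v - F t x' v'\<bar> <= ennreal \<bar>f0 (flow t x v) (vel t x v) - f0 (flow t x' v') (vel t x' v')\<bar>"
    using duhamel[OF x t(1) t1(2), of v v'] by simp
   then have "?d <= ?S * (9 * CF * A1 * e)" using f0 by (simp add: ennreal_le_iff)
   also have "... <= ?S * (?i * ((1 + w) * y * e))" using FA e0 yw(1) S by (intro mono_l mult_mono) auto
   finally show ?thesis by (simp add: mult.assoc)
  next
   case False
   then have tp: "0 < t" using t by simp
   have tq: "t powr (1 / 4) <= 1 / Y" "sqrt t <= 1 / Y"
   proof -
    have "t powr (1 / 4) <= ((1 / Y) ^ 4) powr (1 / 4)" using t T2 by (intro powr_mono2) auto
    also have "... = ((1 / Y) powr 4) powr (1 / 4)" using Y by simp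
    also have "... = 1 / Y" using Y by (simp only: powr_powr) simp
    finally show a: "t powr (1 / 4) <= 1 / Y" .
    have "sqrt t = t powr (1 / 2)" using t by (simp add: powr_half_sqrt)
    also have "... <= t powr (1 / 4)" using tp t1 by (intro powr_mono') auto
    finally show "sqrt t <= 1 / Y" using a by linarith
   qed
   define k where "k = c * t powr (1 / 4)"
   let ?a = "11 * CD / (1 + w) * ?e * (k * ?h + k * ?g)"
   have k: "0 <= k" using c by (simp add: k_def)
   have te: "t <= ep / 2" using t T2 by simp
   note z1 = zw[OF x(1) tp te ok(1), folded k_def] and z2 = zw[OF x(2) tp te ok(2), folded k_def]
   have kw: "0 <= k * ?h" "0 <= k * ?g" using k weight_ge_1[of de ep x v] weight_ge_1[of de ep x' v'] by simp_all
   define J where "J = CV * ((1 + w) * sqrt t * e)"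
   have J: "0 <= J" using CV w t e0 by (simp add: J_def)
   have "?d <= ?b +
    ?S * (L * ?a + L * et * J + 0 * t)"
    unfolding w_def
   proof (rule modulus_step[OF hyp L _ x tp _ _ t0(3) D e conjunct1[OF z1] conjunct1[OF z2] conjunct2[OF z1] kw(1) conjunct2[OF z2] kw(2) _ J])
    show "(NN r. ennreal (exp (- (?c^2 / 8) * r) * norm (vel r x v - vel r x' v')) * indicator {0..t} r) <= ennreal J"
     unfolding J_def w_def by (rule velocity_integral(2)[OF x tp t1(1) D e e_def])
   qed (use t T2 t0 in auto)
   also have "... <= ?S * (9 * CF * A1 * e) + ?S * (e * y + (1 + w) * e)"
   proof (rule add_mono[OF f0 mono_l[OF _ S]])
    have "L * ?a <= L * (11 * CD * (3 * e) * (k * y))"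
    proof (intro mono_l[OF mult_mono] L)
     have "11 * CD / (1 + w) <= 11 * CD" using CD_pos w mono_l[of 1 "1 + w" "11 * CD"] by (simp add: pos_divide_le_eq)
     then show "11 * CD / (1 + w) * ?e <= 11 * CD * (3 * e)"
      using e2 CD_pos e0 w by (intro mult_mono) auto
     show "k * ?h + k * ?g <= k * y" by (simp add: y_def distrib_left)
    qed (use CD_pos e0 kw in auto)
    also have "... = (33 * L * CD * c) * t powr (1 / 4) * (e * y)" by (simp add: k_def)
    also have "... <= 1 * (e * y)"
    proof (rule mono_r)
     have "(33 * L * CD * c) * t powr (1 / 4) <= Y * (1 / Y)" using Y tq L CD_pos c by (intro mult_mono) auto
     then show "(33 * L * CD * c) * t powr (1 / 4) <= 1" using Y by simp
    qed (use e0 y in auto)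
    finally have 1: "L * ?a <= e * y" by simp
    have "L * et * J = (L * et * CV) * sqrt t * ((1 + w) * e)" by (simp add: J_def)
    also have "... <= 1 * ((1 + w) * e)"
    proof (rule mono_r)
     have "(L * et * CV) * sqrt t <= Y * (1 / Y)" using Y tq L CV t by (intro mult_mono) auto
     then show "(L * et * CV) * sqrt t <= 1" using Y by simp
    qed (use e0 w in auto)
    finally show "L * ?a + L * et * J + 0 * t <= e * y + (1 + w) * e"
     using 1 by simp
   qed
   also have "... = ?S * (9 * (CF * A1) * e + e * y + (1 + w) * e)" by (simp add: algebra_simps)
   also have "... <= ?S * (9 * (CF * A1) * ((1 + w) * y * e) + (1 + w) * y * e + (1 + w) * y * e)"
    using yw FA by (intro mono_l[OF _ S] add_mono mono_l) auto
   also have "... = ?S * (?i * (1 + w) * y * e)" by (simp add: algebra_simps)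
   finally show ?thesis .
  qed
  then show "?d <= ?S * (?i * ?c * (?h + ?g) * sqrt (?j + ?k))"
   by (simp add: w_def y_def e_def)
 qed
qed

end

section \<open>Passage to the norms and suprema of the theorem\<close>

lemma bracket_ge: "1 <= bracket v" "(1 + norm v) <= 2 * bracket v" "(1 + norm v)^2 <= 2 * bracket v^2" "0 < bracket v"
proof -
 let ?a = "bracket v"
 have b2: "?a^2 = 1 + N2 v" by (simp add: bracket_def)
 show b1: "1 <= ?a" by (simp add: bracket_def)
 then show "0 < ?a" by simp
 have "0 <= (norm v - 1)^2" "(norm v - 1)^2 = N2 v - 2 * norm v + 1" "(1 + norm v)^2 = 1 + 2 * norm v + N2 v"
  by (rule zero_le_power2, simp_all add: sq_eq algebra_simps)
 then show sq: "(1 + norm v)^2 <= 2 * ?a^2" unfolding b2 distrib_left by linarith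
 have "(2 * ?a)^2 = 4 * ?a^2" "0 <= ?a^2" by (simp_all add: power_mult_distrib)
 then have "(1 + norm v)^2 <= (2 * ?a)^2" using sq by linarith
 then show "1 + norm v <= 2 * ?a" by (rule power2_le_imp_le) (use b1 in simp)
qed

lemma AE_imp_negligible:
 assumes "AE p in lborel. p \<notin> N"
 shows "negligible N"
proof -
 obtain N' where N': "N' \<in> null_sets lborel" "{p \<in> space lborel. ~ p \<notin> N} \<subseteq> N'"
  using assms unfolding eventually_ae_filter by blast
 have "negligible N'" unfolding negligible_iff_null_sets by (rule null_sets_completionI[OF N'(1)])
 moreover have "N \<subseteq> N'" using N'(2) by auto
 ultimately show ?thesis by (rule negligible_subset)
qed

context convex_obstacle
begin

lemma Om_bar_nonempty: "EX x. xi x <= 0"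
proof -
 have "~ norm ((R + 1) *R axis 1 1 :: real^3) <= R" using R_ge_1 by (simp add: norm_axis_1)
 then have "~ 0 <= xi ((R + 1) *R axis 1 1)" using bounded by blast
 then show ?thesis by (intro exI[of _ "(R + 1) *R axis 1 1"]) simp
qed

lemma near_interior:
 assumes x: "xi x <= 0" and r: "0 < r"
 shows "EX y. xi y < 0 & norm (y - x) < r"
proof -
 have "x \<in> Om xi \<union> frontier (Om xi)" using x Om_bar_eq by (auto simp: Om_bar_def bd_def)
 then have "x \<in> closure (Om xi)" by (auto simp: frontier_def closure_subset[THEN subsetD])
 then obtain y where "y \<in> Om xi" "dist y x < r" using r unfolding closure_approachable by blast
 then show ?thesis by (intro exI[of _ y]) (simp add: Om_eq dist_norm)
qed

lemma wnorm_AE: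
 assumes "wnorm xi th\<^sub>0 g <= ereal K"
 shows "AE p in lborel. xi (fst p) <= 0 --> abs (g (fst p) (snd p)) <= K * exp (- th\<^sub>0 * N2 (snd p))"
proof -
 let ?S = "Om_bar xi \<times> (UNIV :: (real^3) set)"
 have "closed (Om_bar xi)" unfolding Om_bar_eq using cont by (intro closed_Collect_le) auto
 then have "?S \<in> sets lebesgue" by (intro sets_completionI_sets) (auto intro!: borel_closed closed_Times)
 then have S: "?S \<inter> space lebesgue \<in> sets lebesgue" by simp
 let ?h = "%(x, v). ereal \<bar>exp (th\<^sub>0 * N2 v) * g x v\<bar>"
 have "AE p in lebesgue_on ?S. ?h p <= wnorm xi th\<^sub>0 g"
  unfolding wnorm_def norm_inf_def by (rule esssup_AE)
 then have "AE p in lebesgue. p \<in> ?S --> ?h p <= wnorm xi th\<^sub>0 g" by (subst (asm) AE_restrict_space_iff[OF S])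
 then have "AE p in lborel. p \<in> ?S --> ?h p <= wnorm xi th\<^sub>0 g" by (simp only: AE_completion_iff)
 then show ?thesis
 proof eventually_elim
  case (elim p)
  let ?b = "abs (g (fst p) (snd p))"
  let ?a = "th\<^sub>0 * N2 (snd p)"
  show ?case
  proof
   assume "xi (fst p) <= 0"
   then have "p \<in> ?S" by (cases p) (simp add: Om_bar_eq)
   then have "?h p <= ereal K" using elim assms order_trans by blast
   then have "exp ?a * ?b <= K" by (cases p) (simp add: abs_mult)
   then have "exp (- ?a) * (exp ?a * ?b) <= exp (- ?a) * K"
    by (intro mono_l) auto
   moreover have "exp (- z) * (exp z * a) = a" for z a :: real by (simp add: mult.assoc[symmetric] exp_add[symmetric])
   ultimately show "?b <= K * exp (- th\<^sub>0 * N2 (snd p))" by (simp only: mult.commute[of K] mult_minus_left)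
  qed
 qed
qed

text \<open>Over a null domain an essential supremum would be minus infinity; here the domain
  contains a nonempty open set.\<close>

lemma wnorm_nonneg: "0 <= wnorm xi th\<^sub>0 g"
proof (rule ccontr)
 let ?a = "wnorm xi th\<^sub>0 g"
 assume "~ 0 <= ?a"
 then have "?a < ereal 0" by (simp add: not_le zero_ereal_def)
 then obtain k where k: "?a < ereal k" "ereal k < ereal 0" using ereal_dense2 by blast
 have "AE p in lborel. xi (fst p) <= 0 --> abs (g (fst p) (snd p)) <= k * exp (- th\<^sub>0 * N2 (snd p))"
  using k by (intro wnorm_AE) auto
 then have "AE p :: ((real^3) \<times> (real^3)) in lborel. ~ xi (fst p) < 0"
 proof eventually_elim
  case (elim p)
  have "k * exp (- th\<^sub>0 * N2 (snd p)) < 0" using k by (simp add: mult_neg_pos)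
  then show ?case using elim abs_ge_zero[of "g (fst p) (snd p)"] by linarith
 qed
 then have "AE p :: ((real^3) \<times> (real^3)) in lborel. p \<notin> {p. xi (fst p) < 0}" by simp
 then have "negligible {p :: (real^3) \<times> (real^3). xi (fst p) < 0}" by (rule AE_imp_negligible)
 moreover have op: "open {p :: (real^3) \<times> (real^3). xi (fst p) < 0}"
  using cont by (intro open_Collect_less continuous_on_compose2[OF cont]) (auto intro!: continuous_intros)
 moreover obtain x where "xi x < 0" using Om_bar_nonempty near_interior[of _ 1] by auto
 ultimately show False using open_not_negligible[OF op] by auto
qed

text \<open>Both suprema are nonnegative, because pairs of equal points contribute the quotient
  \<open>0\<close>; a finite sum therefore bounds each of them.\<close>

lemma A_half_bounds:
 assumes "A_half xi f0 < \<infinity>"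
 obtains A where "0 <= A" "A_half xi f0 = ereal A"
  "!!x x' v. xi x <= 0 ==> xi x' <= 0 ==> norm (x - x') <= 1 ==> bracket v * abs (f0 x v - f0 x' v) <= A * norm (x - x')"
  "!!x v v'. xi x <= 0 ==> norm (v - v') <= 1 ==> bracket v^2 * abs (f0 x v - f0 x v') <= A * norm (v - v')"
proof -
 let ?I1 = "{(x, x', v). x \<in> Om_bar xi & x' \<in> Om_bar xi & norm (x - x') <= 1} :: ((real^3) \<times> (real^3) \<times> (real^3)) set"
 let ?I2 = "{(x, v, v'). x \<in> Om_bar xi & norm (v - v') <= 1} :: ((real^3) \<times> (real^3) \<times> (real^3)) set"
 let ?h1 = "%(x, x', v). ereal (bracket v * (abs (f0 x v - f0 x' v) / norm (x - x')))"
 let ?h2 = "%(x, v, v'). ereal (bracket v^2 * (abs (f0 x v - f0 x v') / norm (v - v')))"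
 define S1 where "S1 = (SUP p\<in>?I1. ?h1 p)"
 define S2 where "S2 = (SUP p\<in>?I2. ?h2 p)"
 have A: "A_half xi f0 = S1 + S2" by (simp add: A_half_def S1_def S2_def)
 obtain y where y: "xi y <= 0" using Om_bar_nonempty by blast
 have "?h1 (y, y, 0) <= S1" unfolding S1_def by (rule SUP_upper) (use y in \<open>simp add: Om_bar_eq\<close>)
 then have S1: "0 <= S1" by (simp add: zero_ereal_def)
 have "?h2 (y, 0, 0) <= S2" unfolding S2_def by (rule SUP_upper) (use y in \<open>simp add: Om_bar_eq\<close>)
 then have S2: "0 <= S2" by (simp add: zero_ereal_def)
 have "0 <= S1 + S2" using S1 S2 by (rule add_nonneg_nonneg)
 then obtain A where A': "S1 + S2 = ereal A" "0 <= A"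
  using assms unfolding A by (cases "S1 + S2") auto
 have le: "S1 <= ereal A" "S2 <= ereal A"
  using add_left_mono[OF S2, of S1] add_right_mono[OF S1, of S2] unfolding A'(1) by simp_all
 show ?thesis
 proof (rule that[OF A'(2)])
  show "A_half xi f0 = ereal A" using A A' by simp
  fix x x' v :: "real^3" assume x: "xi x <= 0" "xi x' <= 0" "norm (x - x') <= 1"
  have "?h1 (x, x', v) <= S1" unfolding S1_def by (rule SUP_upper) (use x in \<open>simp add: Om_bar_eq\<close>)
  then have "bracket v * (abs (f0 x v - f0 x' v) / norm (x - x')) <= A" using le(1) order_trans by fastforce
  then show "bracket v * abs (f0 x v - f0 x' v) <= A * norm (x - x')"
   by (cases "x = x'") (simp_all add: pos_divide_le_eq)
 next
  fix x v v' :: "real^3" assume x: "xi x <= 0" "norm (v - v') <= 1"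
  have "?h2 (x, v, v') <= S2" unfolding S2_def by (rule SUP_upper) (use x in \<open>simp add: Om_bar_eq\<close>)
  then have "bracket v^2 * (abs (f0 x v - f0 x v') / norm (v - v')) <= A" using le(2) order_trans by fastforce
  then show "bracket v^2 * abs (f0 x v - f0 x v') <= A * norm (v - v')"
   by (cases "v = v'") (simp_all add: pos_divide_le_eq)
 qed
qed

text \<open>The essential supremum is a supremum because \<open>f0\<close> is continuous on the closure of an open set.\<close>

lemma f0_pointwise:
 assumes A: "0 <= A"
  and fx: "!!x x' v. xi x <= 0 ==> xi x' <= 0 ==> norm (x - x') <= 1 ==> bracket v * abs (f0 x v - f0 x' v) <= A * norm (x - x')"
  and fv: "!!x v v'. xi x <= 0 ==> norm (v - v') <= 1 ==> bracket v^2 * abs (f0 x v - f0 x v') <= A * norm (v - v')"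
  and w: "wnorm xi th\<^sub>0 f0 <= ereal M" and x: "xi x <= 0"
 shows "abs (f0 x v) <= M * exp (- th\<^sub>0 * N2 v)"
proof -
 let ?good = "%p. xi (fst p) <= 0 --> abs (f0 (fst p) (snd p)) <= M * exp (- th\<^sub>0 * N2 (snd p))"
 have "AE p in lborel. p \<notin> {p. ~ ?good p}" using wnorm_AE[OF w] by simp
 then have neg: "negligible {p. ~ ?good p}" by (rule AE_imp_negligible)
 have "EX p. norm (fst p - x) < r & norm (snd p - v) < r & xi (fst p) < 0 & ?good p" if r: "0 < r" for r
 proof (rule ccontr)
  assume no: "~ ?thesis"
  let ?U = "({y. xi y < 0} \<inter> ball x r) \<times> ball v r"
  have op: "open ?U" using cont by (intro open_Times open_Int open_Collect_less) auto
  have "?U \<subseteq> {p. ~ ?good p}" using no by (auto simp: dist_norm norm_minus_commute)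
  then have "negligible ?U" using neg negligible_subset by blast
  moreover obtain y where "xi y < 0" "norm (y - x) < r" using near_interior[OF x r] by blast
  then have "(y, v) \<in> ?U" using r by (simp add: dist_norm norm_minus_commute)
  ultimately show False using open_not_negligible[OF op] by blast
 qed
 then have "ALL n. EX p. norm (fst p - x) < 1 / real (Suc n) & norm (snd p - v) < 1 / real (Suc n) & xi (fst p) < 0 & ?good p" by simp
 then obtain p where p: "!!n. norm (fst (p n) - x) < 1 / real (Suc n)" "!!n. norm (snd (p n) - v) < 1 / real (Suc n)" "!!n. xi (fst (p n)) < 0" "!!n. ?good (p n)"
  by metis
 have lim: "(%n. snd (p n)) \<longlonglongrightarrow> v"
 proof (rule Lim_null[THEN iffD2], rule tendsto_norm_zero_cancel, rule tendsto_sandwich[of "%_. 0" _ _ "%n. 1 / real (Suc n)"])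
  show "(%n. 1 / real (Suc n)) \<longlonglongrightarrow> 0" by (rule LIMSEQ_Suc[OF lim_1_over_n])
  show "\<forall>\<^sub>F n in sequentially. norm (snd (p n) - v) <= 1 / real (Suc n)" using p(2) by (simp add: less_imp_le)
 qed auto
 have bd: "abs (f0 x v) <= M * exp (- th\<^sub>0 * N2 (snd (p n))) + 2 * A * (1 / real (Suc n))" for n
 proof -
  let ?d = "fst (p n)"
  let ?c = "abs (f0 x v - f0 (?d) v)"
  let ?b = "A * (1 / real (Suc n))"
  let ?a = "abs (f0 (?d) v - f0 (?d) (snd (p n)))"
  have n1: "1 / real (Suc n) <= 1" by simp
  have d: "norm (x - ?d) < 1 / real (Suc n)" "norm (v - snd (p n)) < 1 / real (Suc n)"
   using p(1,2)[of n] by (simp_all only: norm_minus_commute)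
  then have d1: "norm (x - ?d) <= 1" "norm (v - snd (p n)) <= 1" using n1 by linarith+
  have "1 * ?c <= bracket v * ?c" using bracket_ge(1) by (intro mono_r) auto
  also have "... <= A * norm (x - ?d)" using p(3)[of n] x d1 by (intro fx) auto
  also have "... <= ?b" using d A by (intro mono_l) auto
  finally have 1: "?c <= ?b" by simp
  have "1 * ?a <= bracket v^2 * ?a"
   using bracket_ge(1) by (intro mono_r) (auto simp: one_le_power)
  also have "... <= A * norm (v - snd (p n))" using p(3)[of n] d1 by (intro fv) auto
  also have "... <= ?b" using d A by (intro mono_l) auto
  finally have 2: "?a <= ?b" by simp
  have "abs (f0 (?d) (snd (p n))) <= M * exp (- th\<^sub>0 * N2 (snd (p n)))" using p(3,4)[of n] by simp
  then show ?thesis using 1 2 by linarith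
 qed
 have "(%n. M * exp (- th\<^sub>0 * N2 (snd (p n))) + 2 * A * (1 / real (Suc n))) \<longlonglongrightarrow> M * exp (- th\<^sub>0 * N2 v) + 2 * A * 0"
  by (intro tendsto_intros lim LIMSEQ_Suc[OF lim_1_over_n])
 then show ?thesis using LIMSEQ_le_const[of _ "M * exp (- th\<^sub>0 * N2 v) + 2 * A * 0" "abs (f0 x v)"] bd by auto
qed

definition CA :: "real => real" where "CA th\<^sub>0 = 2 + 20 / th\<^sub>0^2"

text \<open>\<open>A_half\<close> compares points at distance at most 1 only, whereas reflections
  produce velocities far apart at nearly equal speed. For distant arguments the Gaussian decay of
  \<open>f0\<close> alone yields the powers of \<open>1 + norm v\<close>; this brings in
  \<open>M\<close> and, with 4 for one argument and 16 for the other, the constant \<open>20\<close>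
  in \<open>CA\<close>.\<close>

lemma regular_data:
 assumes th\<^sub>0: "0 < th\<^sub>0" "th\<^sub>0 < 1 / 4" and A: "0 <= A" and M: "0 <= M"
  and fx: "!!x x' v. xi x <= 0 ==> xi x' <= 0 ==> norm (x - x') <= 1 ==> bracket v * abs (f0 x v - f0 x' v) <= A * norm (x - x')"
  and fv: "!!x v v'. xi x <= 0 ==> norm (v - v') <= 1 ==> bracket v^2 * abs (f0 x v - f0 x v') <= A * norm (v - v')"
  and f0: "!!x v. xi x <= 0 ==> abs (f0 x v) <= M * exp (- th\<^sub>0 * N2 v)"
 shows "xi x <= 0 ==> xi x' <= 0 ==> abs (f0 x v - f0 x' v) <= CA th\<^sub>0 * (A + M) / (1 + norm v) * norm (x - x')"
  and "xi x <= 0 ==> abs (norm v - norm v') <= 1 ==> abs (f0 x v - f0 x v') <= CA th\<^sub>0 * (A + M) / (1 + norm v)^2 * norm (v - v')"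
proof -
 let ?l = "norm (x - x')"
 let ?k = "norm (v - v')"
 let ?j = "1 + norm v'"
 let ?i = "exp (- th\<^sub>0 * N2 v')"
 let ?h = "CA th\<^sub>0 * (A + M) * ?k"
 let ?g = "CA th\<^sub>0 * (A + M) * ?l"
 let ?f = "20 / th\<^sub>0^2 * M"
 let ?e = "abs (f0 x v - f0 x v')"
 let ?d = "abs (f0 x v - f0 x' v)"
 let ?c = "CA th\<^sub>0 * (A + M)"
 let ?b = "exp (- th\<^sub>0 * N2 v)"
 let ?a = "1 + norm v"
 have q: "0 < 20 / th\<^sub>0^2" using th\<^sub>0 by simp
 have C2: "2 * A <= ?c" "?f <= ?c"
 proof -
  have "0 <= 20 / th\<^sub>0^2 * A" "0 <= ?f" "?c = 2 * A + 2 * M + (20 / th\<^sub>0^2 * A + 20 / th\<^sub>0^2 * M)"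
   using A M q by (simp_all only: CA_def distrib_left distrib_right mult_nonneg_nonneg less_imp_le)
  then show "2 * A <= ?c" "?f <= ?c" using A M by linarith+
 qed
 have gauss: "(1 + norm u)^2 * exp (- th\<^sub>0 * N2 u) <= 4 / th\<^sub>0^2" for u :: "real^3"
 proof -
  have "(1 + norm u)^2 * exp (- th\<^sub>0 * N2 u) = ((1 + norm u) * gs (th\<^sub>0 / 2) u)^2"
   by (simp add: power_mult_distrib exp_double[symmetric])
  also have "... <= (2 / th\<^sub>0)^2" using th\<^sub>0 by (intro power_mono linear_gauss) auto
  finally show ?thesis by (simp add: power_divide)
 qed
 have n1: "1 + norm u <= (1 + norm u)^2" for u :: "real^3" by (simp add: sq_eq algebra_simps)
 show "?d <= CA th\<^sub>0 * (A + M) / ?a * ?l" if x: "xi x <= 0" "xi x' <= 0"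
 proof -
  have p: "0 < 1 + norm v" by (simp add: add_pos_nonneg)
  have "?a * ?d <= ?g"
  proof (cases "?l <= 1")
   case True
   have "?a * ?d <= 2 * bracket v * ?d" using bracket_ge(2) by (intro mono_r) auto
   also have "... <= 2 * A * ?l" using fx[OF x True, of v] by simp
   also have "... <= ?g" using C2 by (intro mono_r) auto
   finally show ?thesis .
  next
   case False
   have "?d <= 2 * (M * ?b)" using f0[OF x(1), of v] f0[OF x(2), of v] by linarith
   then have "?a * ?d <= ?a^2 * (2 * (M * ?b))" using n1[of v] by (intro mult_mono) auto
   also have "... = 2 * M * (?a^2 * ?b)" by simp
   also have "... <= 2 * M * (4 / th\<^sub>0^2)" using M by (intro mono_l gauss) auto
   also have "... <= ?f" using M th\<^sub>0 by (simp add: field_simps)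
   also have "... <= ?c" by (rule C2)
   also have "... <= ?g" using False C2 A mono_l[of 1 "?l" "CA th\<^sub>0 * (A + M)"] by simp
   finally show ?thesis .
  qed
  then show ?thesis using p by (simp add: pos_le_divide_eq mult.commute)
 qed
 show "?e <= CA th\<^sub>0 * (A + M) / ?a^2 * ?k" if x: "xi x <= 0" and v: "abs (norm v - norm v') <= 1"
 proof -
  have p: "0 < ?a^2" by (rule zero_less_power) (simp add: add_pos_nonneg)
  have "?a^2 * ?e <= ?h"
  proof (cases "?k <= 1")
   case True
   have "?a^2 * ?e <= 2 * bracket v^2 * ?e" using bracket_ge(3) by (intro mono_r) auto
   also have "... <= 2 * A * ?k" using fv[OF x True] by simp
   also have "... <= ?h" using C2 by (intro mono_r) auto
   finally show ?thesis .
  next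
   case False
   have v4: "?a^2 <= 4 * ?j^2"
   proof -
    have "1 + norm v <= 2 * ?j" using v norm_ge_zero[of v'] unfolding distrib_left by linarith
    then have "?a^2 <= (2 * ?j)^2" by (intro power_mono) auto
    then show ?thesis by (simp only: power_mult_distrib) simp
   qed
   have "?a^2 * ?e <= ?a^2 * (M * ?b) + ?a^2 * (M * ?i)"
    unfolding distrib_left[of "?a^2", symmetric]
   proof (rule mono_l)
    show "?e <= M * ?b + M * ?i"
     using f0[OF x, of v] f0[OF x, of v'] by linarith
   qed simp
   also have "... <= ?a^2 * (M * ?b) + 4 * ?j^2 * (M * ?i)"
    using v4 M by (intro add_left_mono mono_r) auto
   also have "... = M * (?a^2 * ?b) + 4 * M * (?j^2 * ?i)" by simp
   also have "... <= M * (4 / th\<^sub>0^2) + 4 * M * (4 / th\<^sub>0^2)" using M by (intro add_mono mono_l gauss) auto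
   also have "... = ?f" by simp
   also have "... <= ?c" by (rule C2)
   also have "... <= ?h" using False C2 A mono_l[of 1 "?k" "CA th\<^sub>0 * (A + M)"] by simp
   finally show ?thesis .
  qed
  then show ?thesis using p by (simp add: pos_le_divide_eq mult.commute)
 qed
qed

lemma solution_from_mild:
 assumes th\<^sub>0: "0 < th\<^sub>0" "th\<^sub>0 < 1 / 4" and M: "0 <= M" "wnorm xi th\<^sub>0 f0 = ereal M"
  and f0: "!!x v. xi x <= 0 ==> abs (f0 x v) <= M * exp (- th\<^sub>0 * N2 v)"
  and sol: "mild_solution xi th\<^sub>0 f0 T f"
 shows "solution xi th xi0 r0 R La c0 f0 (%t x v. if 0 <= t & t <= T & xi x <= 0 then f t x v else 0) T M th\<^sub>0"
proof (unfold_locales)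
 let ?F = "%t x v. if 0 <= t & t <= T & xi x <= 0 then f t x v else 0"
 note sol = sol[unfolded mild_solution_def]
 show T: "0 < T" using sol by blast
 show "0 <= M" "0 < th\<^sub>0" by fact+
 let ?S = "{0..T} \<times> Om_bar xi \<times> (UNIV :: (real^3) set)"
 let ?a = "%p. if p \<in> ?S then (%(t, x, v). f t x v) p else 0"
 have "closed (Om_bar xi)" unfolding Om_bar_eq using cont by (intro closed_Collect_le) auto
 then have S: "?S \<inter> space borel \<in> sets borel" by (simp add: borel_closed closed_Times)
 have "?a \<in> bm"
  using sol by (subst measurable_restrict_space_iff[OF S, symmetric]) auto
 also have "?a = (%(t, x, v). ?F t x v)"
  by (auto simp: Om_bar_eq fun_eq_iff)
 finally show "(%(t, x, v). ?F t x v) \<in> bm" .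
 show "0 <= ?F t x v" for t x v using sol by (auto simp: Om_bar_eq)
 show "?F t x v = 0" if "~ (0 <= t & t <= T & xi x <= 0)" for t x v by (rule if_not_P[OF that])
 show "abs (f0 x v) <= M * exp (- th\<^sub>0 * N2 v)" if "xi x <= 0" for x v by (rule f0[OF that])
 obtain al K where K: "0 < al" "al < th\<^sub>0" "(SUP s\<in>{0..T}. wnorm xi al (f s)) <= ereal K * wnorm xi th\<^sub>0 f0" using sol by blast
 have ae: "AE p in lborel. ?F s (fst p) (snd p) <= abs (K * M) * gs al (snd p)" for s
 proof (cases "0 <= s & s <= T")
  case True
  have "wnorm xi al (f s) <= (SUP s\<in>{0..T}. wnorm xi al (f s))" using True by (intro SUP_upper) simp
  also have "... <= ereal (K * M)" using K M by simp
  finally have "AE p in lborel. xi (fst p) <= 0 --> abs (f s (fst p) (snd p)) <= K * M * gs al (snd p)" by (rule wnorm_AE)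
  then show ?thesis
  proof eventually_elim
   case (elim p)
   let ?b = "abs (K * M) * gs al (snd p)"
   have "K * M * gs al (snd p) <= ?b" by (intro mono_r) auto
   moreover have "0 <= ?b" by simp
   moreover have "f s (fst p) (snd p) <= abs (f s (fst p) (snd p))" by (rule abs_ge_self)
   ultimately have "xi (fst p) <= 0 --> f s (fst p) (snd p) <= ?b" using elim by linarith
   moreover note \<open>0 <= abs (K * M) * gs al (snd p)\<close>
   ultimately show ?case by simp
  qed
 qed (auto intro!: AE_I2)
 show "EX K al. 0 <= K & 0 < al & al <= th\<^sub>0 & al <= 1 & (ALL s. AE p in lborel. ?F s (fst p) (snd p) <= K * gs al (snd p))"
  by (rule exI[of _ "abs (K * M)"], rule exI[of _ al], intro conjI allI ae) (use K th\<^sub>0 in auto)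
 fix t x v assume t: "0 <= t" "t <= T" and x: "xi x <= 0"
 have eq: "?F s (flow (t - s) x v) = f s (flow (t - s) x v)" if "0 <= s" "s <= t" for s
  using that t flow_le_0[OF x, of "t - s" v] by (simp add: fun_eq_iff)
 have I: "(LINT ta:{s..t}|lborel. freq (?F ta (flow (t - ta) x v)) (vel (t - ta) x v)) = (LINT ta:{s..t}|lborel. freq (f ta (flow (t - ta) x v)) (vel (t - ta) x v))" if "0 <= s" for s
  by (intro set_lebesgue_integral_cong) (use that eq in auto)
 have II: "(LINT s:{0..t}|lborel. exp (- (LINT ta:{s..t}|lborel. freq (?F ta (flow (t - ta) x v)) (vel (t - ta) x v))) * gain (?F s (flow (t - s) x v)) (vel (t - s) x v)) =
   (LINT s:{0..t}|lborel. exp (- (LINT ta:{s..t}|lborel. freq (f ta (flow (t - ta) x v)) (vel (t - ta) x v))) * gain (f s (flow (t - s) x v)) (vel (t - s) x v))"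
  by (intro set_lebesgue_integral_cong) (use eq I in auto)
 have "mild_eq_at xi f0 f t x v" using sol t x by (auto simp: Om_bar_eq)
 then have "f t x v = exp (- (LINT ta:{0..t}|lborel. freq (f ta (flow (t - ta) x v)) (vel (t - ta) x v))) * f0 (flow t x v) (vel t x v) +
  (LINT s:{0..t}|lborel. exp (- (LINT ta:{s..t}|lborel. freq (f ta (flow (t - ta) x v)) (vel (t - ta) x v))) * gain (f s (flow (t - s) x v)) (vel (t - s) x v))"
  unfolding mild_eq_at_def Let_def Xc_flow Vc_vel coll_freq_eq Gamma_gain_eq by simp
 then show "?F t x v = exp (- (LINT ta:{0..t}|lborel. freq (?F ta (flow (t - ta) x v)) (vel (t - ta) x v))) * f0 (flow t x v) (vel t x v) +
  (LINT s:{0..t}|lborel. exp (- (LINT ta:{s..t}|lborel. freq (?F ta (flow (t - ta) x v)) (vel (t - ta) x v))) * gain (?F s (flow (t - s) x v)) (vel (t - s) x v))"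
  unfolding I[OF order_refl] II using t x by simp
qed

lemma W_infinite:
 assumes "v = 0 & infdist x (bd xi) <= ep | v' = 0 & infdist x' (bd xi) <= ep"
 shows "W xi (x, v) (x', v') ep de = \<infinity>"
proof -
 have nn: "0 <= 1 / ereal (norm u powr de) * indicator {y. infdist y (bd xi) <= ep} y" for u y :: "real^3"
  by (intro ereal_0_le_mult) (simp_all add: divide_ereal_def indicator_def)
 have inf: "1 / ereal (norm u powr de) * indicator {y. infdist y (bd xi) <= ep} y = \<infinity>" if "u = 0" "infdist y (bd xi) <= ep" for u y :: "real^3"
  using that by (simp add: divide_ereal_def)
 show ?thesis using assms
 proof
  assume "v = 0 & infdist x (bd xi) <= ep"
  then show ?thesis unfolding W_def using inf[of v x] by simp
 next
  assume "v' = 0 & infdist x' (bd xi) <= ep"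
  then show ?thesis unfolding W_def using inf[of v' x'] nn[of v x] by simp
 qed
qed

lemma W_finite:
 assumes "v ~= 0 | ep < infdist x (bd xi)" "v' ~= 0 | ep < infdist x' (bd xi)"
 shows "W xi (x, v) (x', v') ep de = ereal (weight de ep x v + weight de ep x' v' - 1)"
proof -
 have "1 / ereal (norm u powr de) * indicator {y. infdist y (bd xi) <= ep} y = ereal (weight de ep y u - 1)"
  if "u ~= 0 | ep < infdist y (bd xi)" for u y :: "real^3"
 proof (cases "infdist y (bd xi) <= ep")
  case True
  then show ?thesis using that by (simp add: weight_def divide_ereal_def powr_minus)
 next
  case False
  then show ?thesis by (simp add: weight_def)
 qed
 from this[OF assms(1)] this[OF assms(2)] show ?thesis unfolding W_def by (simp add: one_ereal_def)
qed

lemma poly_sum_lower: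
 assumes "0 <= M"
 shows "ereal (1 + M) <= poly_sum 3 (ereal M)"
proof -
 have "{0..3} = {0, 1, 2, 3 :: nat}" by auto
 then have "(\<Sum>i=0..3. M ^ i) = 1 + M + M ^ 2 + M ^ 3" by simp
 moreover have "poly_sum 3 (ereal M) = ereal (\<Sum>i=0..3. M ^ i)" by (simp add: poly_sum_def)
 ultimately show ?thesis using assms by simp
qed

lemma CA_nonneg: "0 <= CA th\<^sub>0"
 by (simp add: CA_def)

lemma hoelder_estimate:
 assumes th\<^sub>0: "0 < th\<^sub>0" "th\<^sub>0 < 1 / 4" and ep: "0 < ep" "ep < 1" and de: "0 < de"
  and spec: "specular xi f0" and w: "wnorm xi th\<^sub>0 f0 < \<infinity>" and Ah: "A_half xi f0 < \<infinity>" and sol: "mild_solution xi th\<^sub>0 f0 T f"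
 shows "EX T2. 0 < T2 & T2 <= T \<and>
  Hoelder_sup xi ep de 3 T2 f <= ereal (32 * (9 * CF * CA th\<^sub>0 + 2)) * poly_sum 3 (wnorm xi th\<^sub>0 f0) * (A_half xi f0 + 1)"
proof -
 let ?b = "9 * CF * CA th\<^sub>0 + 2"
 let ?f = "ereal (32 * ?b) * poly_sum 3 (wnorm xi th\<^sub>0 f0) * (A_half xi f0 + 1)"
 obtain M where M: "0 <= M" "wnorm xi th\<^sub>0 f0 = ereal M"
  using w wnorm_nonneg[of th\<^sub>0 f0] by (cases "wnorm xi th\<^sub>0 f0") auto
 obtain A where A: "0 <= A" "A_half xi f0 = ereal A"
  and fx: "!!x x' v. xi x <= 0 ==> xi x' <= 0 ==> norm (x - x') <= 1 ==> bracket v * abs (f0 x v - f0 x' v) <= A * norm (x - x')"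
  and fv: "!!x v v'. xi x <= 0 ==> norm (v - v') <= 1 ==> bracket v^2 * abs (f0 x v - f0 x v') <= A * norm (v - v')"
  by (rule A_half_bounds[OF Ah]) blast
 have f0: "abs (f0 x v) <= M * exp (- th\<^sub>0 * N2 v)" if "xi x <= 0" for x v
  by (rule f0_pointwise[OF A(1) fx fv _ that]) (use M in auto)
 let ?F = "%t x v. if 0 <= t & t <= T & xi x <= 0 then f t x v else 0"
 define A1 where "A1 = CA th\<^sub>0 * (A + M)"
 have A1: "0 <= A1" using CA_nonneg A M by (simp add: A1_def)
 interpret S: solution xi th xi0 r0 R La c0 f0 ?F T M th\<^sub>0
  by (rule solution_from_mild[OF th\<^sub>0 M f0 sol])
 obtain B al where tame: "tame_solution xi th xi0 r0 R La c0 f0 ?F T M th\<^sub>0 B al" by (rule S.tame_solution_exists)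
 interpret G: regular_solution xi th xi0 r0 R La c0 f0 ?F T M th\<^sub>0 B al A1
 proof (rule regular_solution.intro[OF tame], unfold_locales)
  show "0 <= A1" by (rule A1)
  show "abs (f0 x v - f0 x' v) <= A1 / (1 + norm v) * norm (x - x')" if "xi x <= 0" "xi x' <= 0" for x x' v
   unfolding A1_def by (rule regular_data(1)[OF th\<^sub>0 A(1) M(1) fx fv f0 that])
  show "abs (f0 x v - f0 x v') <= A1 / (1 + norm v)^2 * norm (v - v')" if "xi x <= 0" "abs (norm v - norm v') <= 1" for x v v'
   unfolding A1_def by (rule regular_data(2)[OF th\<^sub>0 A(1) M(1) fx fv f0 that])
  show "f0 x v = f0 x (refl_vel xi x v)" if "xi x = 0" for x v using spec[unfolded specular_def bd_eq] that by blast
 qed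
 obtain T2 where T2: "0 < T2" "T2 <= T" and bound: "!!t x x' v v'. [|0 <= t; t <= T2; xi x <= 0; xi x' <= 0; norm (x - x') <= 1; norm (v - v') <= 1;
   v ~= 0 | ep < infdist x (bd xi); v' ~= 0 | ep < infdist x' (bd xi)|] ==>
   abs (?F t x v - ?F t x' v') <= (Theta t v + Theta t v') *
    ((9 * CF * A1 + 2) * (1 + (norm v + norm v')) * (weight de ep x v + weight de ep x' v') * sqrt (norm (x - x') + norm (v - v')))"
  by (rule G.hoelder_bound[OF de ep]) blast
 define K where "K = 9 * CF * A1 + 2"
 let ?e = "ereal (32 * K)"
 have FA: "0 <= 9 * CF * CA th\<^sub>0" using CF_nonneg CA_nonneg[of th\<^sub>0] by simp
 have K: "0 <= K" "32 * K <= 32 * ?b * (1 + M) * (A + 1)"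
 proof -
  show "0 <= K" using CF_nonneg A1 by (simp add: K_def)
  have "K = 9 * CF * CA th\<^sub>0 * (A + M) + 2" by (simp add: K_def A1_def)
  also have "... <= 9 * CF * CA th\<^sub>0 * ((1 + M) * (A + 1)) + 2 * ((1 + M) * (A + 1))"
  proof (intro add_mono mono_l FA)
   have "0 <= M * A" using A M by simp
   then show "A + M <= (1 + M) * (A + 1)" "2 <= 2 * ((1 + M) * (A + 1))" using A M by (simp_all add: algebra_simps)
  qed
  also have "... = ?b * (1 + M) * (A + 1)" by (simp only: distrib_right mult.assoc)
  finally show "32 * K <= 32 * ?b * (1 + M) * (A + 1)" by (simp only: mult.assoc)
 qed
 have rhs: "?e <= ?f"
 proof -
  have "?e <= ereal (32 * ?b) * ereal (1 + M) * ereal (A + 1)" using K by simp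
  also have "... <= ereal (32 * ?b) * poly_sum 3 (ereal M) * ereal (A + 1)"
   using poly_sum_lower[OF M(1)] FA A by (intro ereal_mult_right_mono ereal_mult_left_mono) auto
  finally show ?thesis by (simp add: M A one_ereal_def)
 qed
 have K0: "0 <= ?e" using K by simp
 have "Hoelder_sup xi ep de 3 T2 f <= ?e"
  unfolding Hoelder_sup_def
 proof (intro SUP_least, clarify)
  fix t and x x' v v' :: "real^3"
  assume t: "t \<in> {0..T2}" and x: "x \<in> Om_bar xi" "x' \<in> Om_bar xi" and N: "0 < norm ((x, v) - (x', v'))" "norm ((x, v) - (x', v')) <= 1"
  let ?g = "sqrt (norm (x - x') + norm (v - v'))"
  let ?d = "bracket v"
  let ?c = "inverse (W xi (x, v) (x', v') ep de)"
  define n where "n = norm ((x, v) - (x', v'))"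
  define d where "d = abs (f t x v - f t x' v')"
  let ?a = "inverse (?d) * exp (- 3 * ?d^2 * t) * (d / n powr (1 / 2))"
  show "?c * ereal (inverse (?d) * exp (- 3 * ?d^2 * t) * (abs (f t x v - f t x' v') / norm ((x, v) - (x', v')) powr (1 / 2))) <= ?e"
   unfolding n_def[symmetric] d_def[symmetric]
  proof (cases "v = 0 & infdist x (bd xi) <= ep | v' = 0 & infdist x' (bd xi) <= ep")
   \<comment> \<open>\<open>W\<close> is infinite here, and its inverse \<open>0\<close> annihilates
     the quotient.\<close>
   case True
   then show "?c * ereal ?a <= ?e"
    using K0 by (simp only: W_infinite ereal_inverse) simp
  next
   case False
   then have ok: "v ~= 0 | ep < infdist x (bd xi)" "v' ~= 0 | ep < infdist x' (bd xi)" by auto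
   have xs: "xi x <= 0" "xi x' <= 0" using x by (simp_all add: Om_bar_eq)
   have n: "0 < n" "n <= 1" using N by (simp_all add: n_def)
   have D: "norm (x - x') <= n" "norm (v - v') <= n"
    using norm_fst_le[of "x - x'" "v - v'"] norm_snd_le[of "v - v'" "x - x'"] by (simp_all add: n_def)
   define y where "y = weight de ep x v + weight de ep x' v' - 1"
   have y: "1 <= y" "weight de ep x v + weight de ep x' v' <= 2 * y" using weight_ge_1[of de ep x v] weight_ge_1[of de ep x' v'] by (simp_all add: y_def)
   \<comment> \<open>This is where the value 3 of \<open>varpi\<close> comes from: for
     \<open>norm (v - v') <= 1\<close> also \<open>1 + N2 v'\<close> is at most three times the
     square of \<open>bracket v\<close>, so that one exponential in \<open>v\<close> dominates both
     weights.\<close>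
   define E where "E = exp (3 * ?d^2 * t)"
   let ?h = "y * ?d * E * sqrt n"
   have b: "0 < ?d" by (rule bracket_ge)
   have tt: "0 <= t" "t <= T2" "t <= T" using t T2 by auto
   have b2: "?d^2 = 1 + N2 v" by (simp add: bracket_def)
   have E: "0 < E" "Theta t v <= E" "Theta t v' <= E"
   proof -
    show "0 < E" by (simp add: E_def)
    have "1 + N2 v <= 3 * ?d^2" by (simp add: b2)
    then show "Theta t v <= E" unfolding Theta_def E_def using tt by (simp add: mono_r)
    have "N2 v' <= 2 * N2 v + 2"
     using norm_shift_sq(2)[of "v' - v" v] D n by (simp add: norm_minus_commute)
    then have "1 + N2 v' <= 3 * ?d^2"
     using zero_le_power2[of "norm v"] unfolding b2 distrib_left by linarith
    then show "Theta t v' <= E" unfolding Theta_def E_def using tt by (simp add: mono_r)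
   qed
   have w: "1 + (norm v + norm v') <= 4 * ?d"
   proof -
    have "norm v' <= norm v + 1" using norm_triangle_sub[of v' v] D n by (simp add: norm_minus_commute)
    then show ?thesis using bracket_ge(2)[of v] by linarith
   qed
   have sn: "?g <= 2 * sqrt n"
   proof -
    have "?g <= sqrt (4 * n)" using D n by (intro real_sqrt_le_mono) simp
    then show ?thesis by (simp add: real_sqrt_mult)
   qed
   have "d = abs (?F t x v - ?F t x' v')" using xs tt by (simp add: d_def)
   also have "... <= (Theta t v + Theta t v') * (K * (1 + (norm v + norm v')) * (weight de ep x v + weight de ep x' v') * ?g)"
    unfolding K_def using D n tt xs ok by (intro bound) auto
   \<comment> \<open>The factors 2, 4, 2 and 2 make up the constant 32.\<close>
   also have "... <= (E + E) * (K * (4 * ?d) * (2 * y) * (2 * sqrt n))"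
    using E w y sn K b Theta_pos[of t v] Theta_pos[of t v'] weight_ge_1[of de ep x v] weight_ge_1[of de ep x' v']
    by (intro mult_mono add_mono order_refl mult_nonneg_nonneg) auto
   also have "... = (32 * K) * ?h" by simp
   finally have "d / ?h <= 32 * K"
    using y b E n by (simp add: pos_divide_le_eq)
   moreover have "inverse y * ?a = d / ?h"
    using y b n by (simp add: E_def exp_minus powr_half_sqrt divide_simps)
   ultimately have "ereal (inverse y * ?a) <= ?e" by simp
   moreover have "?c = ereal (inverse y)"
    unfolding W_finite[OF ok] y_def[symmetric] using y by simp
   ultimately show "?c * ereal ?a <= ?e"
    by simp
  qed
 qed
 then have "Hoelder_sup xi ep de 3 T2 f <= ?f"
  using rhs by (rule order_trans)
 then show ?thesis using T2 by blast
qed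

end

theorem theorem1p4:
  shows "\<exists>m. \<forall>\<xi>. uniformly_convex_obstacle m \<xi> \<longrightarrow>
    (\<forall>\<theta>\<^sub>0 \<epsilon>. 0 < \<theta>\<^sub>0 \<and> \<theta>\<^sub>0 < 1 / 4 \<and> 0 < \<epsilon> \<and> \<epsilon> < 1 \<longrightarrow>
      (\<exists>C :: real \<Rightarrow> real. (\<forall>\<delta>. 0 < C \<delta>) \<and>
        (\<forall>f\<^sub>0. specular \<xi> f\<^sub>0 \<and> wnorm \<xi> \<theta>\<^sub>0 f\<^sub>0 < \<infinity> \<and> A_half \<xi> f\<^sub>0 < \<infinity> \<longrightarrow>
          (\<exists>varpi>0. \<forall>T\<^sub>s f. mild_solution \<xi> \<theta>\<^sub>0 f\<^sub>0 T\<^sub>s f \<longrightarrow>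
            (\<forall>\<delta>. 0 < \<delta> \<and> \<delta> < 1 \<longrightarrow>
              (\<exists>T. 0 < T \<and> T \<le> T\<^sub>s \<and>
                Hoelder_sup \<xi> \<epsilon> \<delta> varpi T f
                  \<le> ereal (C \<delta>) * poly_sum 3 (wnorm \<xi> \<theta>\<^sub>0 f\<^sub>0) * (A_half \<xi> f\<^sub>0 + 1)))))))"
proof (rule exI[of _ 2], intro allI impI)
 fix \<xi> :: "real^3 => real" and \<theta>\<^sub>0 \<epsilon> :: real
 assume "uniformly_convex_obstacle 2 \<xi>"
 then obtain \<theta> \<xi>0 r0 R \<Lambda> c0 where "convex_obstacle \<xi> \<theta> \<xi>0 r0 R \<Lambda> c0" by (rule convex_obstacleI)
 then interpret convex_obstacle \<xi> \<theta> \<xi>0 r0 R \<Lambda> c0 .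
 assume "0 < \<theta>\<^sub>0 & \<theta>\<^sub>0 < 1 / 4 & 0 < \<epsilon> & \<epsilon> < 1"
 then have p: "0 < \<theta>\<^sub>0" "\<theta>\<^sub>0 < 1 / 4" "0 < \<epsilon>" "\<epsilon> < 1" by auto
 define C where "C = 32 * (9 * CF * CA \<theta>\<^sub>0 + 2)"
 have "0 <= CF * CA \<theta>\<^sub>0" using CF_nonneg CA_nonneg by simp
 then have C: "0 < C" by (simp add: C_def)
 show "EX C :: real => real. (ALL \<delta>. 0 < C \<delta>) \<and>
    (ALL f\<^sub>0. specular \<xi> f\<^sub>0 & wnorm \<xi> \<theta>\<^sub>0 f\<^sub>0 < \<infinity> & A_half \<xi> f\<^sub>0 < \<infinity> -->
     (EX varpi>0. ALL T\<^sub>s f. mild_solution \<xi> \<theta>\<^sub>0 f\<^sub>0 T\<^sub>s f -->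
      (ALL \<delta>. 0 < \<delta> & \<delta> < 1 -->
       (EX T. 0 < T & T <= T\<^sub>s \<and>
        Hoelder_sup \<xi> \<epsilon> \<delta> varpi T f
         <= ereal (C \<delta>) * poly_sum 3 (wnorm \<xi> \<theta>\<^sub>0 f\<^sub>0) * (A_half \<xi> f\<^sub>0 + 1)))))"
 \<comment> \<open>The dependence on \<delta> and \<epsilon> has gone into the length of the time
   interval, so one constant serves.\<close>
 proof (rule exI[of _ "%_. C"], intro conjI allI impI C)
  fix f\<^sub>0
  assume "specular \<xi> f\<^sub>0 & wnorm \<xi> \<theta>\<^sub>0 f\<^sub>0 < \<infinity> & A_half \<xi> f\<^sub>0 < \<infinity>"
  then show "EX varpi>0. ALL T\<^sub>s f. mild_solution \<xi> \<theta>\<^sub>0 f\<^sub>0 T\<^sub>s f -->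
      (ALL \<delta>. 0 < \<delta> & \<delta> < 1 -->
       (EX T. 0 < T & T <= T\<^sub>s \<and>
        Hoelder_sup \<xi> \<epsilon> \<delta> varpi T f
         <= ereal C * poly_sum 3 (wnorm \<xi> \<theta>\<^sub>0 f\<^sub>0) * (A_half \<xi> f\<^sub>0 + 1)))"
   unfolding C_def by (intro exI[of _ 3] conjI allI impI hoelder_estimate[OF p]) auto
 qed
qed

end
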